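(* Let $k$ be a noetherian integral domain and let $d\in\mathbb N$. If $A$ is a cellular $k$-algebra, then the wreath product algebra $A\wr\mathfrak S_d$ is also cellular.
   Context: $\otimes=\otimes_k$. A $k$-algebra is a unital associative algebra, finitely generated projective as a $k$-module. The symmetric group $\mathfrak S_d$ acts on the right on $A^{\otimes d}$ by permuting tensor factors, $(x_1\otimes\cdots\otimes x_d)\sigma=x_{\sigma(1)}\otimes\cdots\otimes x_{\sigma(d)}$. The wreath product algebra $A\wr\mathfrak S_d$ is the $k$-module $A^{\otimes d}\otimes k\mathfrak S_d$ with multiplication $(x\otimes\rho)\cdot(y\otimes\sigma)=x(y\rho^{-1})\otimes\rho\sigma$ for $x,y\in A^{\otimes d}$ and $\rho,\sigma\in\mathfrak S_d$. A $k$-algebra $A$ is cellular if it has a cell datum $(I,M,C,\tau)$, that is: (C1) $(I,\trianglerighteq)$ is a finite partially ordered set; to each $\lambda\in I$ is associated a finite set $M(\lambda)$; and $A$ has a $k$-basis $\{C^\lambda_{S,T}\}$, where $(S,T)$ runs through $M(\lambda)\times M(\lambda)$ and $\lambda$ through $I$. (C2) $\tau$ is a ($k$-linear) anti-involution of $A$ with $\tau(C^\lambda_{S,T})=C^\lambda_{T,S}$. (C3) For $\lambda\in I$, $S,T\in M(\lambda)$ and $a\in A$, $aC^\lambda_{S,T}=\sum_{U\in M(\lambda)}r_a(U,S)C^\lambda_{U,T}+r'$, where $r'$ is a linear combination of basis elements with upper index $\mu\triangleright\lambda$ strictly larger than $\lambda$, and the coefficients $r_a(U,S)\in k$ do not depend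 on $T$. *)

theory Defs
  imports
    "HOL-Algebra.Module"
    "HOL-Algebra.Product_Groups"
    "HOL-Algebra.Ring_Divisibility"
    "HOL-Algebra.Sym_Groups"
begin

section \<open>Modules and algebras over a commutative ring\<close>

text \<open>
  \<open>free_module R B\<close> is the free \<open>R\<close>-module on \<open>B\<close>, realised as the finitely supported functions
  \<open>B \<Rightarrow> R\<close>. Modules are records extending rings; the ring fields \<open>mult\<close> and \<open>one\<close> carry no
  information here.
\<close>

definition free_module :: "('k, 'r) ring_scheme \<Rightarrow> 'x set \<Rightarrow> ('k, 'x \<Rightarrow> 'k) module" where
  "free_module R B =
     \<lparr>carrier = {f \<in> B \<rightarrow>\<^sub>E carrier R. finite {x \<in> B. f x \<noteq> \<zero>\<^bsub>R\<^esub>}},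
      monoid.mult = undefined, one = undefined,
      zero = (\<lambda>x\<in>B. \<zero>\<^bsub>R\<^esub>), add = (\<lambda>f g. \<lambda>x\<in>B. f x \<oplus>\<^bsub>R\<^esub> g x),
      smult = (\<lambda>r f. \<lambda>x\<in>B. r \<otimes>\<^bsub>R\<^esub> f x)\<rparr>"

definition free_gen :: "('k, 'r) ring_scheme \<Rightarrow> 'x set \<Rightarrow> 'x \<Rightarrow> 'x \<Rightarrow> 'k" where
  "free_gen R B x = (\<lambda>y\<in>B. if y = x then \<one>\<^bsub>R\<^esub> else \<zero>\<^bsub>R\<^esub>)"

definition module_hom ::
  "('k, 'r) ring_scheme \<Rightarrow> ('k, 'a, 'm) module_scheme \<Rightarrow> ('k, 'b, 'n) module_scheme \<Rightarrow> ('a \<Rightarrow> 'b) set" where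
  "module_hom R M N =
     {h \<in> carrier M \<rightarrow> carrier N.
        (\<forall>x\<in>carrier M. \<forall>y\<in>carrier M. h (x \<oplus>\<^bsub>M\<^esub> y) = h x \<oplus>\<^bsub>N\<^esub> h y) \<and>
        (\<forall>r\<in>carrier R. \<forall>x\<in>carrier M. h (r \<odot>\<^bsub>M\<^esub> x) = r \<odot>\<^bsub>N\<^esub> h x)}"

text \<open>Finitely generated projective: a direct summand (i.e. a retract) of some \<open>R\<^sup>n\<close>.\<close>

definition fg_projective :: "('k, 'r) ring_scheme \<Rightarrow> ('k, 'a, 'm) module_scheme \<Rightarrow> bool" where
  "fg_projective R M \<longleftrightarrow>
     (\<exists>n::nat. \<exists>i \<in> module_hom R M (free_module R {..<n}). \<exists>p \<in> module_hom R (free_module R {..<n}) M.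
        \<forall>x\<in>carrier M. p (i x) = x)"

text \<open>
  The library locale \<open>algebra\<close> only covers commutative algebras, hence the following one for unital
  associative algebras, finitely generated projective as modules.
\<close>

locale fgp_algebra = module R A + ring A
  for R :: "('k, 'r) ring_scheme" (structure) and A :: "('k, 'a, 'm) module_scheme" (structure) +
  assumes smult_mult_left:
      "\<lbrakk>r \<in> carrier R; x \<in> carrier A; y \<in> carrier A\<rbrakk> \<Longrightarrow>
         (r \<odot>\<^bsub>A\<^esub> x) \<otimes>\<^bsub>A\<^esub> y = r \<odot>\<^bsub>A\<^esub> (x \<otimes>\<^bsub>A\<^esub> y)"
    and smult_mult_right:
      "\<lbrakk>r \<in> carrier R; x \<in> carrier A; y \<in> carrier A\<rbrakk> \<Longrightarrow>
         x \<otimes>\<^bsub>A\<^esub> (r \<odot>\<^bsub>A\<^esub> y) = r \<odot>\<^bsub>A\<^esub> (x \<otimes>\<^bsub>A\<^esub> y)"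
    and fg_projective: "fg_projective R A"

definition finite_basis ::
  "('k, 'r) ring_scheme \<Rightarrow> ('k, 'a, 'm) module_scheme \<Rightarrow> 'x set \<Rightarrow> ('x \<Rightarrow> 'a) \<Rightarrow> bool" where
  "finite_basis R M B b \<longleftrightarrow>
     finite B \<and> b \<in> B \<rightarrow> carrier M \<and>
     (\<forall>x\<in>carrier M. \<exists>!c. c \<in> B \<rightarrow>\<^sub>E carrier R \<and> x = (\<Oplus>\<^bsub>M\<^esub>i\<in>B. c i \<odot>\<^bsub>M\<^esub> b i))"


section \<open>Cellular algebras\<close>

definition cell_indices :: "'i set \<Rightarrow> ('i \<Rightarrow> 's set) \<Rightarrow> ('i \<times> 's \<times> 's) set" where
  "cell_indices I M = (SIGMA \<kappa>:I. M \<kappa> \<times> M \<kappa>)"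

text \<open>
  \<open>(\<kappa>, \<mu>) \<in> ord\<close> stands for \<open>\<kappa> \<unlhd> \<mu>\<close>. The basis element with upper index \<open>\<kappa>\<close> and lower indices
  \<open>S, T\<close> is \<open>C \<kappa> S T\<close>. In \<open>C3\<close> the scalars \<open>r U S\<close> are chosen before \<open>T\<close>.
\<close>

locale cell_datum = fgp_algebra R A
  for R :: "('k, 'r) ring_scheme" (structure) and A :: "('k, 'a, 'm) module_scheme" (structure) +
  fixes I :: "'i set" and ord :: "'i rel" and M :: "'i \<Rightarrow> 's set"
    and C :: "'i \<Rightarrow> 's \<Rightarrow> 's \<Rightarrow> 'a" and \<tau> :: "'a \<Rightarrow> 'a"
  assumes C1_order: "finite I" "partial_order_on I ord"
    and C1_finite: "\<kappa> \<in> I \<Longrightarrow> finite (M \<kappa>)"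
    and C1_basis: "finite_basis R A (cell_indices I M) (\<lambda>(\<kappa>, S, T). C \<kappa> S T)"
    and C2_linear: "\<tau> \<in> module_hom R A A"
    and C2_anti: "\<lbrakk>x \<in> carrier A; y \<in> carrier A\<rbrakk> \<Longrightarrow> \<tau> (x \<otimes>\<^bsub>A\<^esub> y) = \<tau> y \<otimes>\<^bsub>A\<^esub> \<tau> x"
    and C2_one: "\<tau> \<one>\<^bsub>A\<^esub> = \<one>\<^bsub>A\<^esub>"
    and C2_involution: "x \<in> carrier A \<Longrightarrow> \<tau> (\<tau> x) = x"
    and C2_basis: "\<lbrakk>\<kappa> \<in> I; S \<in> M \<kappa>; T \<in> M \<kappa>\<rbrakk> \<Longrightarrow> \<tau> (C \<kappa> S T) = C \<kappa> T S"
    and C3: "\<lbrakk>\<kappa> \<in> I; a \<in> carrier A\<rbrakk> \<Longrightarrow>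
      \<exists>r \<in> M \<kappa> \<rightarrow> M \<kappa> \<rightarrow> carrier R. \<forall>S\<in>M \<kappa>. \<forall>T\<in>M \<kappa>.
        \<exists>c \<in> cell_indices {\<mu> \<in> I. (\<kappa>, \<mu>) \<in> ord \<and> \<mu> \<noteq> \<kappa>} M \<rightarrow> carrier R.
          a \<otimes>\<^bsub>A\<^esub> C \<kappa> S T =
            (\<Oplus>\<^bsub>A\<^esub>U\<in>M \<kappa>. r U S \<odot>\<^bsub>A\<^esub> C \<kappa> U T) \<oplus>\<^bsub>A\<^esub>
            finsum A (\<lambda>(\<mu>, U, V). c (\<mu>, U, V) \<odot>\<^bsub>A\<^esub> C \<mu> U V)
              (cell_indices {\<mu> \<in> I. (\<kappa>, \<mu>) \<in> ord \<and> \<mu> \<noteq> \<kappa>} M)"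

text \<open>
  An existential quantifier cannot range over types. As \<open>I\<close> and all \<open>M \<kappa>\<close> are finite, indices in
  \<open>nat\<close> suffice; \<open>cellular_algebraI\<close> below shows that cell data over any types are admissible.
\<close>

definition cellular_algebra :: "('k, 'r) ring_scheme \<Rightarrow> ('k, 'a, 'm) module_scheme \<Rightarrow> bool" where
  "cellular_algebra R A \<longleftrightarrow>
     (\<exists>(I :: nat set) ord (M :: nat \<Rightarrow> nat set) C \<tau>. cell_datum R A I ord M C \<tau>)"


lemma finite_basis_reindex:
  fixes R (structure) and M (structure)
  assumes "module R M" and B: "finite_basis R M B b" and h: "bij_betw h B' B"
    and b': "\<And>i. i \<in> B' \<Longrightarrow> b' i = b (h i)"
  shows "finite_basis R M B' b'"
proof -
  interpret module R M by fact
  have fin: "finite B" and b: "b \<in> B \<rightarrow> carrier M"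
    and ex: "\<And>x. x \<in> carrier M \<Longrightarrow>
      \<exists>!c. c \<in> B \<rightarrow>\<^sub>E carrier R \<and> x = (\<Oplus>\<^bsub>M\<^esub>i\<in>B. c i \<odot>\<^bsub>M\<^esub> b i)"
    using B unfolding finite_basis_def by blast+
  have hB: "\<And>i. i \<in> B' \<Longrightarrow> h i \<in> B" and inj: "inj_on h B'" and img: "h ` B' = B"
    using h by (auto simp: bij_betw_def)
  define k where "k = inv_into B' h"
  have kB: "k j \<in> B'" and hk: "h (k j) = j" if "j \<in> B" for j
    using that img unfolding k_def by (auto intro: inv_into_into f_inv_into_f)
  have kh: "k (h i) = i" if "i \<in> B'" for i
    using that inj unfolding k_def by auto
  have sum: "(\<Oplus>\<^bsub>M\<^esub>i\<in>B'. c (h i) \<odot>\<^bsub>M\<^esub> b' i) = (\<Oplus>\<^bsub>M\<^esub>i\<in>B. c i \<odot>\<^bsub>M\<^esub> b i)"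
    if c: "c \<in> B \<rightarrow> carrier R" for c
  proof -
    have "(\<Oplus>\<^bsub>M\<^esub>i\<in>h ` B'. c i \<odot>\<^bsub>M\<^esub> b i) = (\<Oplus>\<^bsub>M\<^esub>i\<in>B'. c (h i) \<odot>\<^bsub>M\<^esub> b (h i))"
      using c b hB inj by (intro M.finsum_reindex) (auto simp: Pi_iff)
    also have "\<dots> = (\<Oplus>\<^bsub>M\<^esub>i\<in>B'. c (h i) \<odot>\<^bsub>M\<^esub> b' i)"
      using c b hB b' by (intro M.finsum_cong') (auto simp: Pi_iff)
    finally show ?thesis by (simp add: img)
  qed
  show ?thesis
    unfolding finite_basis_def
  proof (intro conjI ballI)
    show "finite B'" using fin h bij_betw_finite by blast
    show "b' \<in> B' \<rightarrow> carrier M" using b hB b' by auto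
    fix x assume "x \<in> carrier M"
    from ex[OF this] obtain c where c: "c \<in> B \<rightarrow>\<^sub>E carrier R" "x = (\<Oplus>\<^bsub>M\<^esub>i\<in>B. c i \<odot>\<^bsub>M\<^esub> b i)"
      and uniq: "\<And>c'. c' \<in> B \<rightarrow>\<^sub>E carrier R \<Longrightarrow> x = (\<Oplus>\<^bsub>M\<^esub>i\<in>B. c' i \<odot>\<^bsub>M\<^esub> b i) \<Longrightarrow> c' = c"
      by blast
    show "\<exists>!c. c \<in> B' \<rightarrow>\<^sub>E carrier R \<and> x = (\<Oplus>\<^bsub>M\<^esub>i\<in>B'. c i \<odot>\<^bsub>M\<^esub> b' i)"
    proof (intro ex1I conjI)
      show "(\<lambda>i\<in>B'. c (h i)) \<in> B' \<rightarrow>\<^sub>E carrier R" using c hB by auto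
      have "(\<Oplus>\<^bsub>M\<^esub>i\<in>B'. (\<lambda>i\<in>B'. c (h i)) i \<odot>\<^bsub>M\<^esub> b' i) = (\<Oplus>\<^bsub>M\<^esub>i\<in>B'. c (h i) \<odot>\<^bsub>M\<^esub> b' i)"
        using c b hB b' by (intro M.finsum_cong') (auto simp: Pi_iff)
      also have "\<dots> = x" using c by (subst sum) auto
      finally show "x = (\<Oplus>\<^bsub>M\<^esub>i\<in>B'. (\<lambda>i\<in>B'. c (h i)) i \<odot>\<^bsub>M\<^esub> b' i)" by simp
    next
      fix e assume e: "e \<in> B' \<rightarrow>\<^sub>E carrier R \<and> x = (\<Oplus>\<^bsub>M\<^esub>i\<in>B'. e i \<odot>\<^bsub>M\<^esub> b' i)"
      have "(\<Oplus>\<^bsub>M\<^esub>i\<in>B. (\<lambda>j\<in>B. e (k j)) i \<odot>\<^bsub>M\<^esub> b i)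
          = (\<Oplus>\<^bsub>M\<^esub>i\<in>B'. (\<lambda>j\<in>B. e (k j)) (h i) \<odot>\<^bsub>M\<^esub> b' i)"
        using e kB by (subst sum) auto
      also have "\<dots> = (\<Oplus>\<^bsub>M\<^esub>i\<in>B'. e i \<odot>\<^bsub>M\<^esub> b' i)"
        using e b b' hB kh by (intro M.finsum_cong') (auto simp: Pi_iff)
      finally have "(\<lambda>j\<in>B. e (k j)) = c" using e kB by (intro uniq) auto
      then have "e i = c (h i)" if "i \<in> B'" for i
        using that kh hB by (metis restrict_apply')
      with e show "e = (\<lambda>i\<in>B'. c (h i))"
        by (intro ext) (auto simp: restrict_def PiE_def extensional_def)
    qed
  qed
qed

lemma cellular_algebraI:
  assumes "cell_datum R A I ord M C \<tau>"
  shows "cellular_algebra R A"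
proof -
  interpret cell_datum R A I ord M C \<tau> by fact
  obtain f :: "_ \<Rightarrow> nat" where f: "inj_on f I"
    using finite_imp_inj_to_nat_seg[OF C1_order(1)] by auto
  have fin: "finite (\<Union>\<kappa>\<in>I. M \<kappa>)" using C1_order C1_finite by auto
  obtain g :: "_ \<Rightarrow> nat" where g: "inj_on g (\<Union>\<kappa>\<in>I. M \<kappa>)"
    using finite_imp_inj_to_nat_seg[OF fin] by auto
  define f' where "f' = inv_into I f"
  define g' where "g' = inv_into (\<Union>\<kappa>\<in>I. M \<kappa>) g"
  define I' where "I' = f ` I"
  define ord' where "ord' = map_prod f f ` ord"
  define M' where "M' = (\<lambda>n. g ` M (f' n))"
  define C' where "C' = (\<lambda>n s t. C (f' n) (g' s) (g' t))"
  have f'f [simp]: "f' (f \<kappa>) = \<kappa>" if "\<kappa> \<in> I" for \<kappa>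
    using that f by (simp add: f'_def)
  have g'g [simp]: "g' (g S) = S" if "\<kappa> \<in> I" "S \<in> M \<kappa>" for \<kappa> S
    using that g unfolding g'_def by (intro inv_into_f_f) auto
  have ff': "f' n \<in> I" "f (f' n) = n" if "n \<in> I'" for n
    using that by (auto simp: I'_def)
  have M'f: "M' (f \<kappa>) = g ` M \<kappa>" if "\<kappa> \<in> I" for \<kappa> using that by (simp add: M'_def)
  have gM: "inj_on g (M \<kappa>)" if "\<kappa> \<in> I" for \<kappa>
    using g that by (auto simp: inj_on_def)
  have ord_sub: "ord \<subseteq> I \<times> I" and ord_refl: "refl_on I ord" and ord_trans: "trans ord"
    and ord_anti: "antisym ord"
    using C1_order(2) by (auto dest: partial_order_onD)
  have ord'_iff: "(f \<kappa>, f \<mu>) \<in> ord' \<longleftrightarrow> (\<kappa>, \<mu>) \<in> ord" if "\<kappa> \<in> I" "\<mu> \<in> I" for \<kappa> \<mu>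
  proof
    assume "(f \<kappa>, f \<mu>) \<in> ord'"
    then obtain a b where ab: "(a, b) \<in> ord" "f \<kappa> = f a" "f \<mu> = f b" by (auto simp: ord'_def)
    with that ord_sub have "\<kappa> = a" "\<mu> = b" by (auto intro: inj_onD[OF f])
    with ab show "(\<kappa>, \<mu>) \<in> ord" by simp
  next
    assume "(\<kappa>, \<mu>) \<in> ord"
    then show "(f \<kappa>, f \<mu>) \<in> ord'" unfolding ord'_def by force
  qed
  define h where "h = (\<lambda>(n, s, t). (f' n, g' s, g' t))"
  have bij: "bij_betw h (cell_indices (f ` J) M') (cell_indices J M)" if "J \<subseteq> I" for J
  proof (rule bij_betw_byWitness[where f' = "\<lambda>(\<kappa>, S, T). (f \<kappa>, g S, g T)"])
    have *: "\<exists>\<kappa> S T. \<kappa> \<in> J \<and> \<kappa> \<in> I \<and> S \<in> M \<kappa> \<and> T \<in> M \<kappa> \<and> p = (f \<kappa>, g S, g T) \<and> h p = (\<kappa>, S, T)"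
      if "p \<in> cell_indices (f ` J) M'" for p
    proof -
      from that obtain \<kappa> s t where p: "\<kappa> \<in> J" "p = (f \<kappa>, s, t)" "s \<in> M' (f \<kappa>)" "t \<in> M' (f \<kappa>)"
        unfolding cell_indices_def by auto
      with \<open>J \<subseteq> I\<close> have \<kappa>: "\<kappa> \<in> I" by auto
      with p obtain S T where ST: "S \<in> M \<kappa>" "T \<in> M \<kappa>" "s = g S" "t = g T" by (auto simp: M'f)
      then have "h p = (\<kappa>, S, T)" using \<kappa> p g'g[OF \<kappa>] by (simp add: h_def)
      with p \<kappa> ST show ?thesis by blast
    qed
    have **: "h (f \<kappa>, g S, g T) = (\<kappa>, S, T) \<and> (f \<kappa>, g S, g T) \<in> cell_indices (f ` J) M'"
      if "\<kappa> \<in> J" "S \<in> M \<kappa>" "T \<in> M \<kappa>" for \<kappa> S T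
    proof -
      from that \<open>J \<subseteq> I\<close> have \<kappa>: "\<kappa> \<in> I" by auto
      with that g'g[OF \<kappa>] show ?thesis by (simp add: h_def cell_indices_def M'f)
    qed
    show "\<forall>a\<in>cell_indices (f ` J) M'. (\<lambda>(\<kappa>, S, T). (f \<kappa>, g S, g T)) (h a) = a"
      by (auto dest!: *)
    show "\<forall>a\<in>cell_indices J M. h ((\<lambda>(\<kappa>, S, T). (f \<kappa>, g S, g T)) a) = a"
      by (auto simp: cell_indices_def[of J M] **)
    show "h ` cell_indices (f ` J) M' \<subseteq> cell_indices J M"
      by (auto dest!: * simp: cell_indices_def[of J M])
    show "(\<lambda>(\<kappa>, S, T). (f \<kappa>, g S, g T)) ` cell_indices J M \<subseteq> cell_indices (f ` J) M'"
      by (auto simp: cell_indices_def[of J M] **)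
  qed
  have CA: "C \<kappa> S T \<in> carrier A" if "\<kappa> \<in> I" "S \<in> M \<kappa>" "T \<in> M \<kappa>" for \<kappa> S T
  proof -
    from that have "(\<kappa>, S, T) \<in> cell_indices I M" by (simp add: cell_indices_def)
    moreover have "(\<lambda>(\<kappa>, S, T). C \<kappa> S T) \<in> cell_indices I M \<rightarrow> carrier A"
      using C1_basis by (simp add: finite_basis_def)
    ultimately show ?thesis by (auto dest: funcset_mem)
  qed
  have "cell_datum R A I' ord' M' C' \<tau>"
  proof unfold_locales
    show "finite I'" using C1_order by (simp add: I'_def)
    show "partial_order_on I' ord'"
      unfolding partial_order_on_def preorder_on_def
    proof (intro conjI)
      show "ord' \<subseteq> I' \<times> I'" using ord_sub by (auto simp: ord'_def I'_def)
      show "refl_on I' ord'" using ord_refl ord'_iff by (auto simp: refl_on_def I'_def)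
      show "trans ord'"
      proof (rule transI)
        fix x y z assume "(x, y) \<in> ord'" "(y, z) \<in> ord'"
        then obtain a b b' c where "(a, b) \<in> ord" "(b', c) \<in> ord" "x = f a" "y = f b" "y = f b'" "z = f c"
          by (auto simp: ord'_def)
        moreover from this have "b = b'" using ord_sub by (auto intro: inj_onD[OF f])
        ultimately have "(a, c) \<in> ord" "x = f a" "z = f c" using transD[OF ord_trans] by auto
        then show "(x, z) \<in> ord'" unfolding ord'_def by force
      qed
      show "antisym ord'"
      proof (rule antisymI)
        fix x y assume xy: "(x, y) \<in> ord'" "(y, x) \<in> ord'"
        then obtain a b where ab: "a \<in> I" "b \<in> I" "x = f a" "y = f b"
          using ord_sub by (auto simp: ord'_def)
        with xy have "(a, b) \<in> ord" "(b, a) \<in> ord" by (simp_all add: ord'_iff)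
        with ord_anti ab show "x = y" by (auto dest: antisymD)
      qed
    qed
    show "finite (M' n)" if "n \<in> I'" for n
      using that ff' C1_finite by (simp add: M'_def)
    show "finite_basis R A (cell_indices I' M') (\<lambda>(n, s, t). C' n s t)"
      using bij[of I] unfolding I'_def
      by (rule finite_basis_reindex[OF module_axioms C1_basis]) (auto simp: h_def C'_def)
    show "\<tau> \<in> module_hom R A A" by (rule C2_linear)
    show "\<tau> (x \<otimes>\<^bsub>A\<^esub> y) = \<tau> y \<otimes>\<^bsub>A\<^esub> \<tau> x" if "x \<in> carrier A" "y \<in> carrier A" for x y
      using that by (rule C2_anti)
    show "\<tau> \<one>\<^bsub>A\<^esub> = \<one>\<^bsub>A\<^esub>" by (rule C2_one)
    show "\<tau> (\<tau> x) = x" if "x \<in> carrier A" for x using that by (rule C2_involution)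
    show "\<tau> (C' n s t) = C' n t s" if "n \<in> I'" "s \<in> M' n" "t \<in> M' n" for n s t
      using that by (auto simp: I'_def C'_def M'f C2_basis)
  next
    fix n a assume "n \<in> I'" and a: "a \<in> carrier A"
    then obtain \<kappa> where \<kappa>: "\<kappa> \<in> I" "n = f \<kappa>" by (auto simp: I'_def)
    let ?J = "{\<mu> \<in> I. (\<kappa>, \<mu>) \<in> ord \<and> \<mu> \<noteq> \<kappa>}"
    have J: "{m \<in> I'. (n, m) \<in> ord' \<and> m \<noteq> n} = f ` ?J"
      using \<kappa> f by (auto simp: I'_def ord'_iff inj_on_def)
    from C3[OF \<kappa>(1) a] obtain r where r: "r \<in> M \<kappa> \<rightarrow> M \<kappa> \<rightarrow> carrier R"
      and C3': "\<And>S T. \<lbrakk>S \<in> M \<kappa>; T \<in> M \<kappa>\<rbrakk> \<Longrightarrow> \<exists>c \<in> cell_indices ?J M \<rightarrow> carrier R.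
          a \<otimes>\<^bsub>A\<^esub> C \<kappa> S T = (\<Oplus>\<^bsub>A\<^esub>U\<in>M \<kappa>. r U S \<odot>\<^bsub>A\<^esub> C \<kappa> U T) \<oplus>\<^bsub>A\<^esub>
            finsum A (\<lambda>(\<mu>, U, V). c (\<mu>, U, V) \<odot>\<^bsub>A\<^esub> C \<mu> U V) (cell_indices ?J M)"
      by blast
    show "\<exists>r \<in> M' n \<rightarrow> M' n \<rightarrow> carrier R. \<forall>S\<in>M' n. \<forall>T\<in>M' n.
        \<exists>c \<in> cell_indices {m \<in> I'. (n, m) \<in> ord' \<and> m \<noteq> n} M' \<rightarrow> carrier R.
          a \<otimes>\<^bsub>A\<^esub> C' n S T = (\<Oplus>\<^bsub>A\<^esub>U\<in>M' n. r U S \<odot>\<^bsub>A\<^esub> C' n U T) \<oplus>\<^bsub>A\<^esub>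
            finsum A (\<lambda>(m, U, V). c (m, U, V) \<odot>\<^bsub>A\<^esub> C' m U V)
              (cell_indices {m \<in> I'. (n, m) \<in> ord' \<and> m \<noteq> n} M')"
      unfolding J
    proof (intro bexI[where x = "\<lambda>u s. r (g' u) (g' s)"] ballI)
      show "(\<lambda>u s. r (g' u) (g' s)) \<in> M' n \<rightarrow> M' n \<rightarrow> carrier R"
        using r \<kappa> by (auto simp: M'f Pi_iff)
      fix s t assume "s \<in> M' n" "t \<in> M' n"
      then obtain S T where ST: "S \<in> M \<kappa>" "T \<in> M \<kappa>" "s = g S" "t = g T"
        using \<kappa> by (auto simp: M'f)
      from C3'[OF ST(1,2)] obtain c where c: "c \<in> cell_indices ?J M \<rightarrow> carrier R"
        and eq: "a \<otimes>\<^bsub>A\<^esub> C \<kappa> S T = (\<Oplus>\<^bsub>A\<^esub>U\<in>M \<kappa>. r U S \<odot>\<^bsub>A\<^esub> C \<kappa> U T) \<oplus>\<^bsub>A\<^esub>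
            finsum A (\<lambda>(\<mu>, U, V). c (\<mu>, U, V) \<odot>\<^bsub>A\<^esub> C \<mu> U V) (cell_indices ?J M)"
        by blast
      have hJ: "bij_betw h (cell_indices (f ` ?J) M') (cell_indices ?J M)" by (rule bij) auto
      have sum1: "(\<Oplus>\<^bsub>A\<^esub>u\<in>M' n. r (g' u) (g' s) \<odot>\<^bsub>A\<^esub> C' n u t) = (\<Oplus>\<^bsub>A\<^esub>U\<in>M \<kappa>. r U S \<odot>\<^bsub>A\<^esub> C \<kappa> U T)"
      proof -
        have "(\<Oplus>\<^bsub>A\<^esub>u\<in>g ` M \<kappa>. r (g' u) (g' s) \<odot>\<^bsub>A\<^esub> C' n u t)
            = (\<Oplus>\<^bsub>A\<^esub>U\<in>M \<kappa>. r (g' (g U)) (g' s) \<odot>\<^bsub>A\<^esub> C' n (g U) t)"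
          using r ST \<kappa> CA gM by (intro M.finsum_reindex) (auto simp: C'_def Pi_iff)
        also have "\<dots> = (\<Oplus>\<^bsub>A\<^esub>U\<in>M \<kappa>. r U S \<odot>\<^bsub>A\<^esub> C \<kappa> U T)"
          using r ST \<kappa> CA by (intro M.finsum_cong') (auto simp: C'_def Pi_iff)
        finally show ?thesis using \<kappa> by (simp add: M'f)
      qed
      have sum2: "finsum A (\<lambda>(m, U, V). (c \<circ> h) (m, U, V) \<odot>\<^bsub>A\<^esub> C' m U V) (cell_indices (f ` ?J) M')
          = finsum A (\<lambda>(\<mu>, U, V). c (\<mu>, U, V) \<odot>\<^bsub>A\<^esub> C \<mu> U V) (cell_indices ?J M)"
      proof -
        let ?F = "\<lambda>(\<mu>, U, V). c (\<mu>, U, V) \<odot>\<^bsub>A\<^esub> C \<mu> U V"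
        have F: "?F \<in> cell_indices ?J M \<rightarrow> carrier A"
          using c CA by (auto simp: cell_indices_def)
        have "finsum A ?F (h ` cell_indices (f ` ?J) M') = finsum A (\<lambda>p. ?F (h p)) (cell_indices (f ` ?J) M')"
          using F hJ by (intro M.finsum_reindex) (auto simp: bij_betw_def)
        also have "(\<lambda>p. ?F (h p)) = (\<lambda>(m, U, V). (c \<circ> h) (m, U, V) \<odot>\<^bsub>A\<^esub> C' m U V)"
          by (auto simp: h_def C'_def)
        finally show ?thesis using hJ by (simp add: bij_betw_def)
      qed
      show "\<exists>c \<in> cell_indices (f ` ?J) M' \<rightarrow> carrier R.
          a \<otimes>\<^bsub>A\<^esub> C' n s t = (\<Oplus>\<^bsub>A\<^esub>u\<in>M' n. r (g' u) (g' s) \<odot>\<^bsub>A\<^esub> C' n u t) \<oplus>\<^bsub>A\<^esub>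
            finsum A (\<lambda>(m, U, V). c (m, U, V) \<odot>\<^bsub>A\<^esub> C' m U V) (cell_indices (f ` ?J) M')"
      proof (rule bexI[where x = "c \<circ> h"])
        show "c \<circ> h \<in> cell_indices (f ` ?J) M' \<rightarrow> carrier R"
          using c bij_betwE[OF hJ] by (simp add: Pi_iff)
        have "C' n s t = C \<kappa> S T" using \<kappa> ST by (simp add: C'_def)
        then show "a \<otimes>\<^bsub>A\<^esub> C' n s t = (\<Oplus>\<^bsub>A\<^esub>u\<in>M' n. r (g' u) (g' s) \<odot>\<^bsub>A\<^esub> C' n u t) \<oplus>\<^bsub>A\<^esub>
            finsum A (\<lambda>(m, U, V). (c \<circ> h) (m, U, V) \<odot>\<^bsub>A\<^esub> C' m U V) (cell_indices (f ` ?J) M')"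
          unfolding sum1 sum2 using eq by simp
      qed
    qed
  qed
  then show ?thesis unfolding cellular_algebra_def by blast
qed




section \<open>Tensor powers\<close>

definition submodule_span ::
  "('k, 'r) ring_scheme \<Rightarrow> ('k, 'a, 'm) module_scheme \<Rightarrow> 'a set \<Rightarrow> 'a set" where
  "submodule_span R M S = \<Inter>{H. submodule H R M \<and> S \<subseteq> H}"

text \<open>The monoid algebra \<open>R[G]\<close>: the free module on \<open>G\<close> with the convolution product.\<close>

definition monoid_algebra ::
  "('k, 'r) ring_scheme \<Rightarrow> ('x, 'g) monoid_scheme \<Rightarrow> ('k, 'x \<Rightarrow> 'k) module" where
  "monoid_algebra R G = (free_module R (carrier G))
     \<lparr>monoid.mult := (\<lambda>f g. \<lambda>z\<in>carrier G.
        finsum R (\<lambda>(x, y). f x \<otimes>\<^bsub>R\<^esub> g y)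
          {(x, y) \<in> carrier G \<times> carrier G. x \<otimes>\<^bsub>G\<^esub> y = z \<and> f x \<noteq> \<zero>\<^bsub>R\<^esub> \<and> g y \<noteq> \<zero>\<^bsub>R\<^esub>}),
      one := free_gen R (carrier G) \<one>\<^bsub>G\<^esub>\<rparr>"

text \<open>
  \<open>tuples A d\<close> is \<open>A\<^sup>d\<close> with componentwise multiplication. The tensor power is the quotient of the
  free module on \<open>A\<^sup>d\<close> by the submodule generated by the multilinearity relations. This submodule is
  an ideal of the monoid algebra of \<open>A\<^sup>d\<close>, and the quotient ring has the usual factorwise product
  \<open>(x\<^sub>1 \<otimes> \<dots> \<otimes> x\<^sub>d) (y\<^sub>1 \<otimes> \<dots> \<otimes> y\<^sub>d) = x\<^sub>1y\<^sub>1 \<otimes> \<dots> \<otimes> x\<^sub>dy\<^sub>d\<close>.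
\<close>

definition tuples :: "('a, 'm) monoid_scheme \<Rightarrow> nat \<Rightarrow> (nat \<Rightarrow> 'a) monoid" where
  "tuples A d = product_group {1..d} (\<lambda>_. A)"

definition tensor_rels ::
  "('k, 'r) ring_scheme \<Rightarrow> ('k, 'a, 'm) module_scheme \<Rightarrow> nat \<Rightarrow> ((nat \<Rightarrow> 'a) \<Rightarrow> 'k) set" where
  "tensor_rels R A d =
     (let P = monoid_algebra R (tuples A d); \<delta> = free_gen R (carrier (tuples A d)) in
        {\<delta> (x(i := a \<oplus>\<^bsub>A\<^esub> b)) \<ominus>\<^bsub>P\<^esub> (\<delta> (x(i := a)) \<oplus>\<^bsub>P\<^esub> \<delta> (x(i := b))) | x i a b.
           x \<in> carrier (tuples A d) \<and> i \<in> {1..d} \<and> a \<in> carrier A \<and> b \<in> carrier A} \<union>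
        {\<delta> (x(i := r \<odot>\<^bsub>A\<^esub> a)) \<ominus>\<^bsub>P\<^esub> r \<odot>\<^bsub>P\<^esub> \<delta> (x(i := a)) | x i r a.
           x \<in> carrier (tuples A d) \<and> i \<in> {1..d} \<and> r \<in> carrier R \<and> a \<in> carrier A})"

definition tensor_ideal ::
  "('k, 'r) ring_scheme \<Rightarrow> ('k, 'a, 'm) module_scheme \<Rightarrow> nat \<Rightarrow> ((nat \<Rightarrow> 'a) \<Rightarrow> 'k) set" where
  "tensor_ideal R A d = submodule_span R (monoid_algebra R (tuples A d)) (tensor_rels R A d)"

definition tensor_power ::
  "('k, 'r) ring_scheme \<Rightarrow> ('k, 'a, 'm) module_scheme \<Rightarrow> nat \<Rightarrow>
     ('k, ((nat \<Rightarrow> 'a) \<Rightarrow> 'k) set) module" where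
  "tensor_power R A d =
     (let P = monoid_algebra R (tuples A d); N = tensor_ideal R A d in
        ring.extend (P Quot N) \<lparr>smult = (\<lambda>r Z. \<Union>f\<in>Z. N +>\<^bsub>P\<^esub> (r \<odot>\<^bsub>P\<^esub> f))\<rparr>)"

text \<open>\<open>pure_tensor R A d x\<close> is \<open>x\<^sub>1 \<otimes> \<dots> \<otimes> x\<^sub>d\<close>.\<close>

definition pure_tensor ::
  "('k, 'r) ring_scheme \<Rightarrow> ('k, 'a, 'm) module_scheme \<Rightarrow> nat \<Rightarrow> (nat \<Rightarrow> 'a) \<Rightarrow> ((nat \<Rightarrow> 'a) \<Rightarrow> 'k) set" where
  "pure_tensor R A d x =
     tensor_ideal R A d +>\<^bsub>monoid_algebra R (tuples A d)\<^esub> free_gen R (carrier (tuples A d)) x"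


section \<open>Wreath product algebras\<close>

definition tuple_act :: "nat \<Rightarrow> (nat \<Rightarrow> 'a) \<Rightarrow> (nat \<Rightarrow> nat) \<Rightarrow> nat \<Rightarrow> 'a" where
  "tuple_act d x \<sigma> = (\<lambda>i\<in>{1..d}. x (\<sigma> i))"

text \<open>
  The right action of the symmetric group on the tensor power is induced by \<open>tuple_act\<close>: the linear
  extension of \<open>x \<mapsto> x \<sigma>\<close> to the free module sends \<open>f\<close> to \<open>y \<mapsto> f (y \<sigma>\<^sup>-\<^sup>1)\<close>, and this is applied to all
  members of a coset.
\<close>

definition tensor_act ::
  "('a, 'm) monoid_scheme \<Rightarrow> nat \<Rightarrow> ((nat \<Rightarrow> 'a) \<Rightarrow> 'k) set \<Rightarrow> (nat \<Rightarrow> nat) \<Rightarrow> ((nat \<Rightarrow> 'a) \<Rightarrow> 'k) set" where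
  "tensor_act A d Z \<sigma> =
     (\<lambda>f. \<lambda>y\<in>carrier (tuples A d). f (tuple_act d y (inv\<^bsub>sym_group d\<^esub> \<sigma>))) ` Z"

text \<open>
  The group algebra of the symmetric group is free on the permutations, so an element of its tensor
  product with \<open>V = tensor_power R A d\<close> is uniquely \<open>\<Sum>\<rho>. F \<rho> \<otimes> \<rho>\<close> with \<open>F \<rho> \<in> V\<close>, and is
  represented by the function \<open>F\<close>; \<open>x \<otimes> \<rho>\<close> is the function with value \<open>x\<close> at \<open>\<rho>\<close> and \<open>0\<close> elsewhere
  (\<open>wreath_tensor\<close>). The product is the biadditive extension of
  \<open>(x \<otimes> \<rho>) (y \<otimes> \<sigma>) = x (y \<rho>\<^sup>-\<^sup>1) \<otimes> \<rho>\<sigma>\<close>.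
\<close>

definition wreath_tensor ::
  "('k, 'r) ring_scheme \<Rightarrow> ('k, 'a, 'm) module_scheme \<Rightarrow> nat \<Rightarrow> ((nat \<Rightarrow> 'a) \<Rightarrow> 'k) set \<Rightarrow> (nat \<Rightarrow> nat)
     \<Rightarrow> (nat \<Rightarrow> nat) \<Rightarrow> ((nat \<Rightarrow> 'a) \<Rightarrow> 'k) set" where
  "wreath_tensor R A d x \<rho> =
     (\<lambda>\<pi>\<in>carrier (sym_group d). if \<pi> = \<rho> then x else \<zero>\<^bsub>tensor_power R A d\<^esub>)"

definition wreath_algebra ::
  "('k, 'r) ring_scheme \<Rightarrow> ('k, 'a, 'm) module_scheme \<Rightarrow> nat \<Rightarrow>
     ('k, (nat \<Rightarrow> nat) \<Rightarrow> ((nat \<Rightarrow> 'a) \<Rightarrow> 'k) set) module" where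
  "wreath_algebra R A d =
     (let S = sym_group d; V = tensor_power R A d in
       \<lparr>carrier = carrier S \<rightarrow>\<^sub>E carrier V,
        monoid.mult = (\<lambda>F G. \<lambda>\<pi>\<in>carrier S.
          finsum V (\<lambda>(\<rho>, \<sigma>). F \<rho> \<otimes>\<^bsub>V\<^esub> tensor_act A d (G \<sigma>) (inv\<^bsub>S\<^esub> \<rho>))
            {(\<rho>, \<sigma>) \<in> carrier S \<times> carrier S. \<rho> \<otimes>\<^bsub>S\<^esub> \<sigma> = \<pi>}),
        one = wreath_tensor R A d \<one>\<^bsub>V\<^esub> \<one>\<^bsub>S\<^esub>,
        zero = (\<lambda>\<pi>\<in>carrier S. \<zero>\<^bsub>V\<^esub>),
        add = (\<lambda>F G. \<lambda>\<pi>\<in>carrier S. F \<pi> \<oplus>\<^bsub>V\<^esub> G \<pi>),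
        smult = (\<lambda>r F. \<lambda>\<pi>\<in>carrier S. r \<odot>\<^bsub>V\<^esub> F \<pi>)\<rparr>)"

end

theory Submission
  imports Defs "Jordan_Normal_Form.Determinant"
begin

text \<open>
  Let \<open>A\<close> have the cell datum \<open>(I, M, C, \<tau>)\<close>. The proof writes down a cell datum of \<open>A \<wr> S_d\<close>
  that combines Murphy's cellular basis of the group ring of the symmetric group with the
  basis of \<open>A\<close>. It treats all elements \<open>\<kappa>\<close> of \<open>I\<close>, called colours below, at the same time.

  The tensor products of basis elements of \<open>A\<close> together with permutations are a basis of
  \<open>A \<wr> S_d\<close> (\<open>wreath_basis\<close>). Such an element is a diagram of \<open>d\<close> strands: a permutation \<open>\<rho>\<close>,
  a colour \<open>\<kappa>\<close> for each strand, and labels \<open>u\<close>, \<open>v\<close> from \<open>M \<kappa>\<close> at its two ends. A word assigns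
  to each position a colour and a row of a Young diagram of that colour. Two words \<open>r\<close>, \<open>s\<close> of
  equal content \<open>\<Lambda>\<close> and labels \<open>u\<close>, \<open>v\<close> define the sum of the diagrams with these labels and
  colours whose permutation satisfies \<open>r \<circ> \<rho> = s\<close>. The cells are the multipartitions \<open>\<Lambda>\<close> of
  \<open>d\<close> with components indexed by \<open>I\<close>, and the cell basis consists of the sums for standard
  words \<open>r\<close>, \<open>s\<close> of content \<open>\<Lambda>\<close>, that is, for standard multitableaux. Turning diagrams upside
  down exchanges \<open>(r, u)\<close> and \<open>(s, v)\<close>, which gives (C2).

  That this is a basis is a statement about integral matrices and does not involve \<open>A\<close>. An
  exchange relation (\<open>garnir\<close>) expresses every sum by those for standard words of the same
  colours and of equal or larger weight (\<open>straighten\<close>). A single coloured permutation is such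
  a sum, for words without repeated letters, so the sums for standard pairs span. Their number
  is \<open>d! |I|^d\<close>, the number of coloured permutations (\<open>card_yword_pairs\<close>); this follows from
  the commutation relation between adding and removing boxes. A square integral matrix with a
  one-sided integral inverse is invertible over the integers (\<open>std_pairs_invertible\<close>), hence
  over \<open>R\<close> (\<open>cell_basis\<close>).

  For (C3), cells are compared first by the total height of their colours in \<open>I\<close> and then by a
  weight which grows under the exchange relation. Left multiplication by \<open>a \<otimes> \<sigma>\<close> permutes the
  left word and acts on each strand as in \<open>A\<close>: by (C3) for \<open>A\<close>, a strand keeps its colour and
  its right label, or its colour and hence the total height rises (\<open>elt_expand\<close>). The left
  word is then straightened again, with coefficients that do not depend on the right word, up
  to heavier terms (\<open>straighten_left\<close>). So the right index of a cell element never enters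
  (\<open>left_expands_elt\<close>).

  The algebraic structure of the wreath product itself comes from the universal property of
  the tensor power (\<open>tensor_universal\<close>), which is defined as a quotient of the monoid algebra
  of all tuples; identities are checked on elements \<open>x \<otimes> \<rho>\<close> with \<open>x\<close> a pure tensor.
\<close>

section \<open>Diagrams and standard words\<close>

definition wcont :: "nat \<Rightarrow> (nat \<Rightarrow> 'b) \<Rightarrow> 'b \<Rightarrow> nat" where
  "wcont n r p = card {i \<in> {1..n}. r i = p}"

text \<open>
  A function on pairs \<open>(\<kappa>, j)\<close> is read as a family of Young diagrams, one for each colour \<open>\<kappa>\<close>:
  its value is the length of row \<open>j\<close>.
\<close>

definition part :: "('i \<times> nat \<Rightarrow> nat) \<Rightarrow> bool" where
  "part c \<longleftrightarrow> (\<forall>\<kappa> j. c (\<kappa>, Suc j) \<le> c (\<kappa>, j))"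

lemma wcont_zero_iff: "wcont n r p = 0 \<longleftrightarrow> (\<forall>i\<in>{1..n}. r i \<noteq> p)"
  unfolding wcont_def by auto

lemma part_antimono: "part c \<Longrightarrow> i \<le> j \<Longrightarrow> c (\<kappa>, j) \<le> c (\<kappa>, i)"
  by (rule lift_Suc_antimono_le[of "\<lambda>j. c (\<kappa>, j)"]) (auto simp: part_def)

text \<open>
  A diagram with a box in row \<open>j\<close> has boxes in the \<open>j\<close> rows above it, so a word of length \<open>n\<close>
  cannot reach row \<open>n\<close>. This bounds the rows that standard words use, and it leaves row \<open>n\<close>
  free for the exchange below.
\<close>

lemma part_row_less:
  assumes "part (wcont n r)" "0 < wcont n r (\<kappa>, j)" shows "j < n"
proof -
  have "(\<lambda>i. (\<kappa>, i)) ` {..j} \<subseteq> r ` {1..n}"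
  proof
    fix p assume "p \<in> (\<lambda>i. (\<kappa>, i)) ` {..j}"
    then obtain i where i: "i \<le> j" "p = (\<kappa>, i)" by auto
    then have "0 < wcont n r p" using part_antimono[OF assms(1) i(1), of \<kappa>] assms(2) by auto
    then show "p \<in> r ` {1..n}" by (auto simp: wcont_def card_gt_0_iff)
  qed
  then have "card ((\<lambda>i. (\<kappa>, i)) ` {..j}) \<le> card {1..n}"
    by (meson card_mono card_image_le finite_atLeastAtMost finite_imageI le_trans)
  moreover have "card ((\<lambda>i. (\<kappa>, i)) ` {..j}) = Suc j" by (subst card_image) (auto simp: inj_on_def)
  ultimately show ?thesis by simp
qed

definition add_box :: "('b \<Rightarrow> nat) \<Rightarrow> 'b \<Rightarrow> 'b \<Rightarrow> nat" where "add_box c p = c(p := Suc (c p))"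
definition remove_box :: "('b \<Rightarrow> nat) \<Rightarrow> 'b \<Rightarrow> 'b \<Rightarrow> nat" where "remove_box c p = c(p := c p - 1)"

lemma remove_add_box: "remove_box (add_box c p) p = c" by (simp add: add_box_def remove_box_def)
lemma add_remove_box: "0 < c p \<Longrightarrow> add_box (remove_box c p) p = c" by (simp add: add_box_def remove_box_def)
lemma remove_add_box_commute: "p \<noteq> q \<Longrightarrow> remove_box (add_box c p) q = add_box (remove_box c q) p" by (auto simp: add_box_def remove_box_def fun_upd_twist)
lemma add_box_eq_iff: "add_box c p = e \<longleftrightarrow> 0 < e p \<and> c = remove_box e p"
  using remove_add_box add_remove_box by (metis fun_upd_same add_box_def zero_less_Suc)

definition addable :: "'i set \<Rightarrow> ('i \<times> nat \<Rightarrow> nat) \<Rightarrow> ('i \<times> nat) set" where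
  "addable I c = {p \<in> I \<times> UNIV. part (add_box c p)}"
definition removable :: "('i \<times> nat \<Rightarrow> nat) \<Rightarrow> ('i \<times> nat) set" where
  "removable c = {p. 0 < c p \<and> part (remove_box c p)}"

lemma part_add_box_iff:
  assumes "part c" shows "part (add_box c (\<kappa>, j)) \<longleftrightarrow> (case j of 0 \<Rightarrow> True | Suc i \<Rightarrow> c (\<kappa>, j) < c (\<kappa>, i))"
  using assms unfolding part_def add_box_def
  by (auto split: nat.splits simp: less_eq_Suc_le le_SucI)

lemma part_remove_box_iff:
  assumes "part c" "0 < c (\<kappa>, j)" shows "part (remove_box c (\<kappa>, j)) \<longleftrightarrow> c (\<kappa>, Suc j) < c (\<kappa>, j)"
proof
  assume "part (remove_box c (\<kappa>, j))"
  then have "remove_box c (\<kappa>, j) (\<kappa>, Suc j) \<le> remove_box c (\<kappa>, j) (\<kappa>, j)" unfolding part_def by blast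
  then show "c (\<kappa>, Suc j) < c (\<kappa>, j)" using assms(2) by (simp add: remove_box_def)
next
  assume lt: "c (\<kappa>, Suc j) < c (\<kappa>, j)"
  show "part (remove_box c (\<kappa>, j))" unfolding part_def
  proof (intro allI)
    fix \<mu> i
    have "c (\<mu>, Suc i) \<le> c (\<mu>, i)" using assms(1) by (simp add: part_def)
    then show "remove_box c (\<kappa>, j) (\<mu>, Suc i) \<le> remove_box c (\<kappa>, j) (\<mu>, i)" using lt by (auto simp: remove_box_def)
  qed
qed

text \<open>
  Young's lattice is closed under componentwise maxima and minima, and the two conclusions are
  the join and the meet of \<open>c\<close> and \<open>c + p - q\<close>. Hence a box can be moved from \<open>q\<close> to \<open>p\<close> by
  adding first or by removing first, which cancels the off-diagonal terms in the commutation
  relation below.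
\<close>

lemma exchange_part:
  assumes c: "part c" and "p \<noteq> q" "0 < c q" and e: "part (remove_box (add_box c p) q)"
  shows "part (add_box c p)" "part (remove_box c q)"
proof -
  obtain \<kappa> j where p: "p = (\<kappa>, j)" by (cases p)
  obtain \<mu> i where q: "q = (\<mu>, i)" by (cases q)
  have ch: "remove_box (add_box c p) q (\<nu>, Suc k) \<le> remove_box (add_box c p) q (\<nu>, k)" for \<nu> k using e by (simp add: part_def)
  show "part (add_box c p)"
  proof (cases j)
    case 0 then show ?thesis using part_add_box_iff[OF c, of \<kappa> j] p by simp
  next
    case (Suc l)
    have "c (\<kappa>, j) < c (\<kappa>, l)"
      using ch[of \<kappa> l] \<open>p \<noteq> q\<close> \<open>0 < c q\<close> Suc by (auto simp: p q add_box_def remove_box_def split: if_splits)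
    then show ?thesis using part_add_box_iff[OF c, of \<kappa> j] p Suc by simp
  qed
  have "c (\<mu>, Suc i) < c (\<mu>, i)"
    using ch[of \<mu> i] \<open>p \<noteq> q\<close> \<open>0 < c q\<close> by (auto simp: p q add_box_def remove_box_def split: if_splits)
  then show "part (remove_box c q)" using part_remove_box_iff[OF c, of \<mu> i] \<open>0 < c q\<close> q by simp
qed

text \<open>
  Removing the last box of row \<open>j\<close> and adding a box to row \<open>Suc j\<close> are possible under the same
  condition. Only the addable boxes in row 0, one for each colour, have no removable partner.
\<close>

lemma addable_eq:
  assumes c: "part c" and supp: "{p. 0 < c p} \<subseteq> I \<times> UNIV"
  shows "addable I c = (\<lambda>\<kappa>. (\<kappa>, 0)) ` I \<union> (\<lambda>(\<kappa>, j). (\<kappa>, Suc j)) ` removable c"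
proof (intro equalityI subsetI)
  fix p assume p: "p \<in> addable I c"
  obtain \<kappa> j where e: "p = (\<kappa>, j)" by (cases p)
  show "p \<in> (\<lambda>\<kappa>. (\<kappa>, 0)) ` I \<union> (\<lambda>(\<kappa>, j). (\<kappa>, Suc j)) ` removable c"
  proof (cases j)
    case 0 then show ?thesis using p e by (auto simp: addable_def)
  next
    case (Suc i)
    then have "c (\<kappa>, Suc i) < c (\<kappa>, i)" using p e part_add_box_iff[OF c, of \<kappa> j] by (simp add: addable_def)
    then have "(\<kappa>, i) \<in> removable c" using part_remove_box_iff[OF c, of \<kappa> i] by (simp add: removable_def)
    then show ?thesis using e Suc by force
  qed
next
  fix p assume "p \<in> (\<lambda>\<kappa>. (\<kappa>, 0)) ` I \<union> (\<lambda>(\<kappa>, j). (\<kappa>, Suc j)) ` removable c"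
  then consider \<kappa> where "p = (\<kappa>, 0)" "\<kappa> \<in> I" | \<kappa> j where "p = (\<kappa>, Suc j)" "(\<kappa>, j) \<in> removable c" by auto
  then show "p \<in> addable I c"
  proof cases
    case 1 then show ?thesis using part_add_box_iff[OF c, of _ 0] by (simp add: addable_def)
  next
    case 2
    then have "0 < c (\<kappa>, j)" "c (\<kappa>, Suc j) < c (\<kappa>, j)" using part_remove_box_iff[OF c, of \<kappa> j] by (auto simp: removable_def)
    then show ?thesis using 2 subsetD[OF supp, of "(\<kappa>, j)"] part_add_box_iff[OF c, of \<kappa> "Suc j"] by (simp add: addable_def)
  qed
qed

lemma card_addable:
  assumes "part c" "{p. 0 < c p} \<subseteq> I \<times> UNIV" "finite I" "finite {p. 0 < c p}"
  shows "finite (addable I c)" "finite (removable c)" "card (addable I c) = card I + card (removable c)"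
proof -
  show fr: "finite (removable c)" by (rule finite_subset[OF _ assms(4)]) (auto simp: removable_def)
  then show "finite (addable I c)" unfolding addable_eq[OF assms(1,2)] using assms(3) by auto
  have "card (addable I c) = card ((\<lambda>\<kappa>. (\<kappa>, 0::nat)) ` I) + card ((\<lambda>(\<kappa>, j). (\<kappa>, Suc j)) ` removable c)"
    unfolding addable_eq[OF assms(1,2)] using assms(3) fr by (intro card_Un_disjoint) auto
  also have "\<dots> = card I + card (removable c)" by (simp add: card_image inj_on_def split_def prod_eq_iff)
  finally show "card (addable I c) = card I + card (removable c)" .
qed

text \<open>
  Reading letter \<open>i\<close> of a word as the instruction to add a box to row \<open>r i\<close>, these words are
  the paths of length \<open>n\<close> in the lattice of coloured diagrams, i.e. the standard tableaux of
  all multipartitions of \<open>n\<close>.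
\<close>

definition ywords :: "'i set \<Rightarrow> nat \<Rightarrow> (nat \<Rightarrow> 'i \<times> nat) set" where
  "ywords I n = {r \<in> {1..n} \<rightarrow>\<^sub>E I \<times> UNIV. \<forall>m\<le>n. part (wcont m r)}"

definition num_ywords :: "'i set \<Rightarrow> nat \<Rightarrow> ('i \<times> nat \<Rightarrow> nat) \<Rightarrow> nat" where
  "num_ywords I n c = card {r \<in> ywords I n. wcont n r = c}"

lemma wcont_cong: "(\<And>i. i \<in> {1..n} \<Longrightarrow> r i = s i) \<Longrightarrow> wcont n r = wcont n s"
  unfolding wcont_def by (intro ext arg_cong[of _ _ card]) auto

lemma wcont_Suc_upd: "wcont (Suc n) (r(Suc n := p)) = add_box (wcont n r) p"
proof
  fix q
  show "wcont (Suc n) (r(Suc n := p)) q = add_box (wcont n r) p q"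
  proof (cases "q = p")
    case True
    have "{i \<in> {1..Suc n}. (r(Suc n := p)) i = p} = insert (Suc n) {i \<in> {1..n}. r i = p}"
      by (auto simp: le_Suc_eq)
    then show ?thesis using True by (simp add: wcont_def add_box_def)
  next
    case False
    then have "{i \<in> {1..Suc n}. (r(Suc n := p)) i = q} = {i \<in> {1..n}. r i = q}"
      by (auto simp: le_Suc_eq)
    then show ?thesis using False by (simp add: wcont_def add_box_def)
  qed
qed

lemma part_wcont_0: "part (wcont 0 r)" by (simp add: part_def wcont_def)

lemma ywords_0: "ywords I 0 = {\<lambda>_. undefined}"
  by (auto simp: ywords_def part_wcont_0)

lemma ywords_Suc:
  "bij_betw (\<lambda>(r, p). r(Suc n := p)) (SIGMA r:ywords I n. addable I (wcont n r)) (ywords I (Suc n))"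
proof (rule bij_betw_byWitness[where f' = "\<lambda>r. (restrict r {1..n}, r (Suc n))"])
  show "\<forall>a\<in>SIGMA r:ywords I n. addable I (wcont n r).
      (\<lambda>r. (restrict r {1..n}, r (Suc n))) ((\<lambda>(r, p). r(Suc n := p)) a) = a"
  proof
    fix a assume "a \<in> (SIGMA r:ywords I n. addable I (wcont n r))"
    then obtain r p where a: "a = (r, p)" "r \<in> {1..n} \<rightarrow>\<^sub>E I \<times> UNIV" by (auto simp: ywords_def)
    have "restrict (r(Suc n := p)) {1..n} = r" using PiE_arb[OF a(2)] by (auto simp: fun_eq_iff)
    then show "(\<lambda>r. (restrict r {1..n}, r (Suc n))) ((\<lambda>(r, p). r(Suc n := p)) a) = a" by (simp add: a)
  qed
  show "\<forall>a'\<in>ywords I (Suc n). (\<lambda>(r, p). r(Suc n := p)) (restrict a' {1..n}, a' (Suc n)) = a'"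
  proof
    fix s assume "s \<in> ywords I (Suc n)"
    then have s: "s \<in> {1..Suc n} \<rightarrow>\<^sub>E I \<times> UNIV" by (auto simp: ywords_def)
    have "(restrict s {1..n})(Suc n := s (Suc n)) = s" using PiE_arb[OF s] by (auto simp: fun_eq_iff le_Suc_eq)
    then show "(\<lambda>(r, p). r(Suc n := p)) (restrict s {1..n}, s (Suc n)) = s" by simp
  qed
  show "(\<lambda>(r, p). r(Suc n := p)) ` (SIGMA r:ywords I n. addable I (wcont n r)) \<subseteq> ywords I (Suc n)"
  proof (clarify)
    fix r p1 p2 assume r: "r \<in> ywords I n" and p: "(p1, p2) \<in> addable I (wcont n r)"
    let ?s = "r(Suc n := (p1, p2))"
    have "?s \<in> {1..Suc n} \<rightarrow>\<^sub>E I \<times> UNIV"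
      using r p PiE_fun_upd[of "(p1, p2)" "\<lambda>_. I \<times> UNIV" "Suc n" r "{1..n}"]
      by (auto simp: ywords_def addable_def atLeastAtMostSuc_conv)
    moreover have "part (wcont m ?s)" if m: "m \<le> Suc n" for m
    proof (cases "m = Suc n")
      case True then show ?thesis using p by (simp add: wcont_Suc_upd addable_def)
    next
      case False
      then have "wcont m ?s = wcont m r" using m by (intro wcont_cong) auto
      then show ?thesis using r False m by (auto simp: ywords_def)
    qed
    ultimately show "?s \<in> ywords I (Suc n)" by (simp add: ywords_def)
  qed
  show "(\<lambda>r. (restrict r {1..n}, r (Suc n))) ` ywords I (Suc n) \<subseteq> (SIGMA r:ywords I n. addable I (wcont n r))"
  proof (intro image_subsetI SigmaI)
    fix s assume s: "s \<in> ywords I (Suc n)"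
    let ?r = "restrict s {1..n}"
    have sE: "s \<in> {1..Suc n} \<rightarrow>\<^sub>E I \<times> UNIV" and pt: "\<And>m. m \<le> Suc n \<Longrightarrow> part (wcont m s)"
      using s by (auto simp: ywords_def)
    have w: "wcont m ?r = wcont m s" if "m \<le> n" for m using that by (intro wcont_cong) auto
    have mem: "s i \<in> I \<times> UNIV" if "i \<in> {1..Suc n}" for i using PiE_mem[OF sE that] .
    show "?r \<in> ywords I n" using mem pt w by (auto simp: ywords_def)
    have "wcont (Suc n) s = wcont (Suc n) (s(Suc n := s (Suc n)))" by simp
    also have "\<dots> = add_box (wcont n s) (s (Suc n))" by (rule wcont_Suc_upd)
    also have "\<dots> = add_box (wcont n ?r) (s (Suc n))" using w[of n] by simp
    finally have "part (add_box (wcont n ?r) (s (Suc n)))" using pt[of "Suc n"] by simp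
    then show "s (Suc n) \<in> addable I (wcont n ?r)" using mem[of "Suc n"] by (auto simp: addable_def)
  qed
qed

lemma ywords_wcont:
  assumes "r \<in> ywords I n"
  shows "part (wcont n r)" "{p. 0 < wcont n r p} \<subseteq> I \<times> UNIV" "finite {p. 0 < wcont n r p}"
proof -
  show "part (wcont n r)" using assms by (auto simp: ywords_def)
  have r: "r \<in> {1..n} \<rightarrow>\<^sub>E I \<times> UNIV" using assms by (auto simp: ywords_def)
  have sub: "{p. 0 < wcont n r p} \<subseteq> r ` {1..n}"
    by (auto simp: wcont_def card_gt_0_iff simp del: split_paired_Ex intro: rev_image_eqI)
  then show "finite {p. 0 < wcont n r p}" by (rule finite_subset) auto
  have "r ` {1..n} \<subseteq> I \<times> UNIV" using PiE_mem[OF r] by blast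
  with sub show "{p. 0 < wcont n r p} \<subseteq> I \<times> UNIV" by (rule subset_trans)
qed

lemma finite_ywords: "finite I \<Longrightarrow> finite (ywords I n)"
proof (induction n)
  case 0 then show ?case by (simp add: ywords_0)
next
  case (Suc n)
  have "finite (SIGMA r:ywords I n. addable I (wcont n r))"
    by (intro finite_SigmaI Suc card_addable(1) ywords_wcont)
  then show ?case using bij_betw_finite[OF ywords_Suc] by blast
qed

text \<open>
  The last letter of a word of content \<open>c\<close> is a removable box of \<open>c\<close>.
\<close>

lemma num_ywords_Suc:
  assumes c: "part c" and supp: "{p. 0 < c p} \<subseteq> I \<times> UNIV" and fin: "finite I" "finite {p. 0 < c p}"
  shows "num_ywords I (Suc n) c = (\<Sum>q\<in>removable c. num_ywords I n (remove_box c q))"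
proof -
  have "{r \<in> ywords I (Suc n). wcont (Suc n) r = c}
      = (\<lambda>(r, p). r(Suc n := p)) ` (SIGMA r:ywords I n. {p \<in> addable I (wcont n r). add_box (wcont n r) p = c})"
  proof -
    have "ywords I (Suc n) = (\<lambda>(r, p). r(Suc n := p)) ` (SIGMA r:ywords I n. addable I (wcont n r))"
      using ywords_Suc[of n I] by (simp add: bij_betw_def)
    then have "{r \<in> ywords I (Suc n). wcont (Suc n) r = c}
      = {s \<in> (\<lambda>(r, p). r(Suc n := p)) ` (SIGMA r:ywords I n. addable I (wcont n r)). wcont (Suc n) s = c}" by (simp only:)
    also have "\<dots> = (\<lambda>(r, p). r(Suc n := p)) ` {a \<in> (SIGMA r:ywords I n. addable I (wcont n r)). wcont (Suc n) ((\<lambda>(r, p). r(Suc n := p)) a) = c}"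
      by blast
    also have "{a \<in> (SIGMA r:ywords I n. addable I (wcont n r)). wcont (Suc n) ((\<lambda>(r, p). r(Suc n := p)) a) = c}
      = (SIGMA r:ywords I n. {p \<in> addable I (wcont n r). add_box (wcont n r) p = c})" by (auto simp: wcont_Suc_upd)
    finally show ?thesis .
  qed
  moreover have "inj_on (\<lambda>(r, p). r(Suc n := p)) (SIGMA r:ywords I n. {p \<in> addable I (wcont n r). add_box (wcont n r) p = c})"
    using ywords_Suc[of n I] unfolding bij_betw_def by (rule inj_on_subset[OF conjunct1]) auto
  ultimately have "num_ywords I (Suc n) c = card (SIGMA r:ywords I n. {p \<in> addable I (wcont n r). add_box (wcont n r) p = c})"
    unfolding num_ywords_def by (simp add: card_image)
  also have "(SIGMA r:ywords I n. {p \<in> addable I (wcont n r). add_box (wcont n r) p = c})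
      = prod.swap ` (SIGMA q:removable c. {r \<in> ywords I n. wcont n r = remove_box c q})"
  proof -
    have "p \<in> addable I (wcont n r) \<and> add_box (wcont n r) p = c \<longleftrightarrow> p \<in> removable c \<and> wcont n r = remove_box c p"
      if r: "r \<in> ywords I n" for r p
    proof -
      have "p \<in> I \<times> UNIV" if "0 < c p" using supp that by blast
      then show ?thesis using c ywords_wcont(1)[OF r] by (auto simp: add_box_eq_iff add_remove_box removable_def addable_def)
    qed
    then have "(r, p) \<in> (SIGMA r:ywords I n. {p \<in> addable I (wcont n r). add_box (wcont n r) p = c})
        \<longleftrightarrow> (p, r) \<in> (SIGMA q:removable c. {r \<in> ywords I n. wcont n r = remove_box c q})" for r p
      by blast
    then show ?thesis by (auto simp only: set_eq_iff image_iff split_paired_All split_paired_Bex_Sigma swap_simp)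
  qed
  also have "card \<dots> = card (SIGMA q:removable c. {r \<in> ywords I n. wcont n r = remove_box c q})"
    by (rule card_image) (auto simp: inj_on_def)
  also have "\<dots> = (\<Sum>q\<in>removable c. num_ywords I n (remove_box c q))"
    unfolding num_ywords_def using card_addable(2)[OF c supp fin] finite_ywords[OF fin(1)] by (intro card_SigmaI) auto
  finally show ?thesis .
qed

lemma removable_remove_box:
  assumes "{p. 0 < c p} \<subseteq> I \<times> UNIV" "finite {p. 0 < c p}" "p \<in> removable c"
  shows "part (remove_box c p)" "{q. 0 < remove_box c p q} \<subseteq> I \<times> UNIV" "finite {q. 0 < remove_box c p q}"
proof -
  show "part (remove_box c p)" using assms(3) by (simp add: removable_def)
  have sub: "{q. 0 < remove_box c p q} \<subseteq> {q. 0 < c q}" by (auto simp: remove_box_def split: if_splits)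
  then show "finite {q. 0 < remove_box c p q}" using assms(2) finite_subset by blast
  show "{q. 0 < remove_box c p q} \<subseteq> I \<times> UNIV" using sub assms(1) by blast
qed

text \<open>
  This is the relation \<open>D U - U D = |I|\<close> of the differential poset of coloured diagrams, with
  \<open>U\<close> and \<open>D\<close> summing over all ways to add and to remove a box, applied to the numbers of
  paths. Adding \<open>p\<close> and removing \<open>q \<noteq> p\<close> commute; for \<open>p = q\<close> the left side counts addable
  boxes, the right side removable ones, and there are \<open>|I|\<close> more of the former.
\<close>

lemma num_ywords_commutation:
  assumes c: "part c" "{p. 0 < c p} \<subseteq> I \<times> UNIV" "finite I" "finite {p. 0 < c p}"
  shows "(\<Sum>p\<in>addable I c. num_ywords I (Suc n) (add_box c p))
    = card I * num_ywords I n c + (\<Sum>q\<in>removable c. \<Sum>p\<in>addable I (remove_box c q). num_ywords I n (add_box (remove_box c q) p))"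
proof -
  note ca = card_addable[OF c]
  have upc: "part (add_box c p)" "{q. 0 < add_box c p q} \<subseteq> I \<times> UNIV" "finite {q. 0 < add_box c p q}" if "p \<in> addable I c" for p
  proof -
    show "part (add_box c p)" using that by (simp add: addable_def)
    show "{q. 0 < add_box c p q} \<subseteq> I \<times> UNIV"
      proof
      fix q assume "q \<in> {q. 0 < add_box c p q}"
      then have "q = p \<or> q \<in> {q. 0 < c q}" by (auto simp: add_box_def split: if_splits)
      then show "q \<in> I \<times> UNIV" using c(2) that unfolding addable_def by blast
    qed
    have "{q. 0 < add_box c p q} \<subseteq> insert p {q. 0 < c q}" by (auto simp: add_box_def split: if_splits)
    then show "finite {q. 0 < add_box c p q}" using c(4) finite_subset by blast
  qed
  note dnc = removable_remove_box[OF c(2,4)]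
  let ?off = "\<Sum>q\<in>removable c. \<Sum>p\<in>addable I (remove_box c q) - {q}. num_ywords I n (add_box (remove_box c q) p)"
  have "(\<Sum>p\<in>addable I c. num_ywords I (Suc n) (add_box c p)) = (\<Sum>p\<in>addable I c. \<Sum>q\<in>removable (add_box c p). num_ywords I n (remove_box (add_box c p) q))"
    by (rule sum.cong[OF refl]) (rule num_ywords_Suc, use upc c(3) in auto)
  also have "\<dots> = (\<Sum>p\<in>addable I c. num_ywords I n c + (\<Sum>q\<in>removable (add_box c p) - {p}. num_ywords I n (remove_box (add_box c p) q)))"
  proof (rule sum.cong[OF refl])
    fix p assume p: "p \<in> addable I c"
    have "p \<in> removable (add_box c p)" using c(1) by (simp add: removable_def remove_add_box) (simp add: add_box_def)
    moreover have "finite (removable (add_box c p))" using card_addable(2)[OF upc(1,2)[OF p] c(3) upc(3)[OF p]] .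
    ultimately show "(\<Sum>q\<in>removable (add_box c p). num_ywords I n (remove_box (add_box c p) q)) = num_ywords I n c + (\<Sum>q\<in>removable (add_box c p) - {p}. num_ywords I n (remove_box (add_box c p) q))"
      by (subst sum.remove) (auto simp: remove_add_box)
  qed
  also have "\<dots> = card (addable I c) * num_ywords I n c + (\<Sum>p\<in>addable I c. \<Sum>q\<in>removable (add_box c p) - {p}. num_ywords I n (remove_box (add_box c p) q))"
    by (simp add: sum.distrib)
  also have "(\<Sum>p\<in>addable I c. \<Sum>q\<in>removable (add_box c p) - {p}. num_ywords I n (remove_box (add_box c p) q)) = ?off"
  proof -
    have "(\<Sum>p\<in>addable I c. \<Sum>q\<in>removable (add_box c p) - {p}. num_ywords I n (remove_box (add_box c p) q))
        = (\<Sum>(p, q)\<in>(SIGMA p:addable I c. removable (add_box c p) - {p}). num_ywords I n (remove_box (add_box c p) q))"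
      using ca upc c(3) card_addable(2)[OF upc(1,2) c(3) upc(3)] by (intro sum.Sigma) auto
    also have "\<dots> = (\<Sum>(q, p)\<in>(SIGMA q:removable c. addable I (remove_box c q) - {q}). num_ywords I n (add_box (remove_box c q) p))"
    proof (rule sum.reindex_bij_witness[of _ prod.swap prod.swap])
      fix b assume "b \<in> (SIGMA q:removable c. addable I (remove_box c q) - {q})"
      then obtain q p where b: "b = (q, p)" "q \<in> removable c" "p \<in> addable I (remove_box c q)" "p \<noteq> q" by auto
      then have "0 < c q" "p \<in> I \<times> UNIV" "part (remove_box (add_box c p) q)" by (auto simp: removable_def addable_def remove_add_box_commute)
      moreover from exchange_part(1)[OF c(1) b(4) this(1,3)] have "part (add_box c p)" .
      ultimately show "prod.swap b \<in> (SIGMA p:addable I c. removable (add_box c p) - {p})"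
        using b by (auto simp: removable_def addable_def add_box_def)
    next
      fix a assume "a \<in> (SIGMA p:addable I c. removable (add_box c p) - {p})"
      then obtain p q where a: "a = (p, q)" "p \<in> addable I c" "q \<in> removable (add_box c p)" "q \<noteq> p" by auto
      then have 1: "0 < c q" "p \<in> I \<times> UNIV" "part (remove_box (add_box c p) q)" by (auto simp: removable_def addable_def add_box_def)
      have "part (remove_box c q)" using exchange_part[OF c(1) _ 1(1,3)] a(4) by blast
      then show "prod.swap a \<in> (SIGMA q:removable c. addable I (remove_box c q) - {q})"
        using a 1 remove_add_box_commute[of p q c] by (auto simp: removable_def addable_def)
      show "(case prod.swap a of (q, p) \<Rightarrow> num_ywords I n (add_box (remove_box c q) p)) = (case a of (p, q) \<Rightarrow> num_ywords I n (remove_box (add_box c p) q))"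
        using a remove_add_box_commute[of p q c] by simp
    qed auto
    also have "\<dots> = ?off"
      using ca card_addable(1)[OF dnc(1,2) c(3) dnc(3)] by (intro sum.Sigma[symmetric]) auto
    finally show ?thesis .
  qed
  finally have A: "(\<Sum>p\<in>addable I c. num_ywords I (Suc n) (add_box c p)) = card (addable I c) * num_ywords I n c + ?off" .
  have B: "(\<Sum>q\<in>removable c. \<Sum>p\<in>addable I (remove_box c q). num_ywords I n (add_box (remove_box c q) p)) = card (removable c) * num_ywords I n c + ?off"
  proof -
    have "(\<Sum>q\<in>removable c. \<Sum>p\<in>addable I (remove_box c q). num_ywords I n (add_box (remove_box c q) p))
        = (\<Sum>q\<in>removable c. num_ywords I n c + (\<Sum>p\<in>addable I (remove_box c q) - {q}. num_ywords I n (add_box (remove_box c q) p)))"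
    proof (rule sum.cong[OF refl])
      fix q assume q: "q \<in> removable c"
      then have "0 < c q" by (simp add: removable_def)
      then have "q \<in> addable I (remove_box c q)" using c(1) subsetD[OF c(2), of q] by (simp add: addable_def add_remove_box)
      moreover have "finite (addable I (remove_box c q))" using card_addable(1)[OF dnc(1,2)[OF q] c(3) dnc(3)[OF q]] .
      ultimately show "(\<Sum>p\<in>addable I (remove_box c q). num_ywords I n (add_box (remove_box c q) p)) = num_ywords I n c + (\<Sum>p\<in>addable I (remove_box c q) - {q}. num_ywords I n (add_box (remove_box c q) p))"
        using \<open>0 < c q\<close> by (subst sum.remove) (auto simp: add_remove_box)
    qed
    also have "\<dots> = card (removable c) * num_ywords I n c + ?off" by (simp add: sum.distrib)
    finally show ?thesis .
  qed
  from A B ca(3) show ?thesis by (simp add: add_mult_distrib)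
qed

text \<open>
  Moving \<open>D\<close> past \<open>U ^ Suc n\<close> with the commutation relation produces \<open>Suc n\<close> terms
  \<open>|I| U ^ n\<close>.
\<close>

lemma sum_num_ywords_addable:
  assumes "part c" "{p. 0 < c p} \<subseteq> I \<times> UNIV" "finite I" "finite {p. 0 < c p}"
  shows "(\<Sum>p\<in>addable I c. num_ywords I (Suc n) (add_box c p)) = Suc n * card I * num_ywords I n c"
  using assms
proof (induction n arbitrary: c)
  case 0
  have "num_ywords I 0 (add_box (remove_box c q) p) = 0" for p q
  proof -
    have "wcont 0 r p \<noteq> add_box (remove_box c q) p p" for r by (simp add: wcont_def add_box_def)
    then have "{r \<in> ywords I 0. wcont 0 r = add_box (remove_box c q) p} = {}" by (auto dest: fun_cong[of _ _ p])
    then show ?thesis unfolding num_ywords_def by (simp only: card.empty)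
  qed
  then show ?case using num_ywords_commutation[OF 0, of 0] by simp
next
  case (Suc n)
  note dnc = removable_remove_box[OF Suc.prems(2,4)]
  have "(\<Sum>q\<in>removable c. \<Sum>p\<in>addable I (remove_box c q). num_ywords I (Suc n) (add_box (remove_box c q) p))
     = (\<Sum>q\<in>removable c. Suc n * card I * num_ywords I n (remove_box c q))"
    by (rule sum.cong[OF refl]) (intro Suc.IH dnc Suc.prems(3))
  also have "\<dots> = Suc n * card I * num_ywords I (Suc n) c"
    using num_ywords_Suc[OF Suc.prems] by (simp only: sum_distrib_left[symmetric])
  finally show ?case using num_ywords_commutation[OF Suc.prems, of "Suc n"] by (simp add: add_mult_distrib)
qed

text \<open>
  The Robinson-Schensted count of pairs of standard tableaux of equal shape. Instead of a
  bijection, the proof is by induction on \<open>n\<close> from the commutation relation: the pairs whose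
  first word extends a fixed word by one letter are counted by \<open>sum_num_ywords_addable\<close>.
\<close>

theorem card_yword_pairs:
  assumes "finite I"
  shows "card {(r, s). r \<in> ywords I n \<and> s \<in> ywords I n \<and> wcont n r = wcont n s} = fact n * card I ^ n"
proof -
  have "card {(r, s). r \<in> ywords I n \<and> s \<in> ywords I n \<and> wcont n r = wcont n s}
      = card (SIGMA r:ywords I n. {s \<in> ywords I n. wcont n s = wcont n r})"
    by (rule arg_cong[of _ _ card]) auto
  also have "\<dots> = (\<Sum>r\<in>ywords I n. num_ywords I n (wcont n r))"
    unfolding num_ywords_def using finite_ywords[OF assms] by (intro card_SigmaI) auto
  also have "\<dots> = fact n * card I ^ n"
  proof (induction n)
    case 0
    have "{r \<in> ywords I 0. wcont 0 r = wcont 0 (\<lambda>_. undefined)} = {\<lambda>_. undefined}" by (auto simp: ywords_0)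
    then have "num_ywords I 0 (wcont 0 (\<lambda>_. undefined)) = 1" unfolding num_ywords_def by simp
    then show ?case by (simp add: ywords_0)
  next
    case (Suc n)
    have "(\<Sum>r\<in>ywords I (Suc n). num_ywords I (Suc n) (wcont (Suc n) r))
        = (\<Sum>x\<in>(SIGMA r:ywords I n. addable I (wcont n r)). num_ywords I (Suc n) (wcont (Suc n) ((\<lambda>(r, p). r(Suc n := p)) x)))"
      by (rule sum.reindex_bij_betw[OF ywords_Suc, symmetric])
    also have "\<dots> = (\<Sum>(r, p)\<in>(SIGMA r:ywords I n. addable I (wcont n r)). num_ywords I (Suc n) (add_box (wcont n r) p))"
      by (rule sum.cong) (auto simp: wcont_Suc_upd)
    also have "\<dots> = (\<Sum>r\<in>ywords I n. \<Sum>p\<in>addable I (wcont n r). num_ywords I (Suc n) (add_box (wcont n r) p))"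
      by (intro sum.Sigma[symmetric] finite_ywords ballI card_addable(1) ywords_wcont assms)
    also have "\<dots> = (\<Sum>r\<in>ywords I n. Suc n * card I * num_ywords I n (wcont n r))"
      by (rule sum.cong[OF refl]) (intro sum_num_ywords_addable ywords_wcont assms)
    also have "\<dots> = Suc n * card I * (fact n * card I ^ n)"
      using Suc by (simp only: sum_distrib_left[symmetric])
    finally show ?case by (simp add: algebra_simps)
  qed
  finally show ?thesis .
qed

section \<open>One-sided inverses of integral matrices\<close>

text \<open>
  A one-sided inverse of a square matrix over the field of rationals is two-sided. The
  integers embed into that field, so the same holds for integral entries.
\<close>

lemma integer_inverse_commute:
  fixes a :: "'x \<Rightarrow> 'y \<Rightarrow> int" and b :: "'y \<Rightarrow> 'x \<Rightarrow> int"
  assumes fin: "finite X" "finite Y" and card: "card X = card Y"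
    and ab: "\<And>x x'. x \<in> X \<Longrightarrow> x' \<in> X \<Longrightarrow> (\<Sum>y\<in>Y. a x y * b y x') = (if x = x' then 1 else 0)"
    and y: "y \<in> Y" "y' \<in> Y"
  shows "(\<Sum>x\<in>X. b y x * a x y') = (if y = y' then 1 else 0)"
proof -
  define n where "n = card X"
  obtain f where f: "bij_betw f {0..<n} X" using ex_bij_betw_nat_finite[OF fin(1)] n_def by auto
  obtain g where g: "bij_betw g {0..<n} Y" using ex_bij_betw_nat_finite[OF fin(2)] n_def card by auto
  define U :: "rat mat" where "U = mat n n (\<lambda>(i, j). of_int (a (f i) (g j)))"
  define W :: "rat mat" where "W = mat n n (\<lambda>(i, j). of_int (b (g i) (f j)))"
  have fm: "f i \<in> X" and gm: "g i \<in> Y" if "i < n" for i using that f g by (auto simp: bij_betw_def)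
  have fe: "f i = f j \<longleftrightarrow> i = j" and ge: "g i = g j \<longleftrightarrow> i = j" if "i < n" "j < n" for i j
    using that inj_on_eq_iff[OF bij_betw_imp_inj_on[OF f]] inj_on_eq_iff[OF bij_betw_imp_inj_on[OF g]] by simp_all
  have "U * W = 1\<^sub>m n"
  proof (rule eq_matI)
    fix i j assume ij: "i < dim_row (1\<^sub>m n :: rat mat)" "j < dim_col (1\<^sub>m n :: rat mat)"
    then have "(U * W) $$ (i, j) = (\<Sum>k\<in>{0..<n}. of_int (a (f i) (g k) * b (g k) (f j)))"
      by (simp add: U_def W_def scalar_prod_def)
    also have "\<dots> = of_int (\<Sum>k\<in>{0..<n}. a (f i) (g k) * b (g k) (f j))" by simp
    also have "(\<Sum>k\<in>{0..<n}. a (f i) (g k) * b (g k) (f j)) = (\<Sum>y\<in>Y. a (f i) y * b y (f j))"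
      by (rule sum.reindex_bij_betw[OF g])
    also have "\<dots> = (if f i = f j then 1 else 0)" using ij fm by (intro ab) auto
    finally show "(U * W) $$ (i, j) = 1\<^sub>m n $$ (i, j)" using ij fe by simp
  qed (auto simp: U_def W_def)
  then have WU: "W * U = 1\<^sub>m n" by (intro mat_mult_left_right_inverse[of U n W]) (auto simp: U_def W_def)
  obtain i j where ij: "i < n" "y = g i" "j < n" "y' = g j"
    using y g by (auto simp: bij_betw_def)
  have "(of_int (\<Sum>x\<in>X. b y x * a x y') :: rat) = of_int (\<Sum>k\<in>{0..<n}. b y (f k) * a (f k) y')"
    by (subst sum.reindex_bij_betw[OF f]) simp
  also have "\<dots> = (\<Sum>k\<in>{0..<n}. of_int (b (g i) (f k) * a (f k) (g j)))" using ij by simp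
  also have "\<dots> = (W * U) $$ (i, j)" using ij by (simp add: U_def W_def scalar_prod_def)
  also have "\<dots> = of_int (if y = y' then 1 else 0)" unfolding WU using ij ge by simp
  finally show ?thesis unfolding of_int_eq_iff .
qed

section \<open>Row words and matching functions\<close>

text \<open>
  A word assigns to each position a colour and a row of the diagram of that colour, and so is
  the row reading of a multitabloid.
\<close>

locale row_words =
  fixes I :: "'i set" and d :: nat
  assumes finite_I: "finite I"
begin

text \<open>
  There are \<open>d + 1\<close> rows for each colour, although diagrams with \<open>d\<close> boxes have at most \<open>d\<close> of
  them. The last row is free in every word whose content is a family of diagrams, and the
  exchange relation needs such a row.
\<close>

definition rows :: "('i \<times> nat) set" where "rows = I \<times> {..d}"

definition words :: "(nat \<Rightarrow> 'i \<times> nat) set" where "words = {1..d} \<rightarrow>\<^sub>E rows"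

abbreviation cont :: "(nat \<Rightarrow> 'i \<times> nat) \<Rightarrow> 'i \<times> nat \<Rightarrow> nat" where "cont \<equiv> wcont d"

definition kword :: "(nat \<Rightarrow> 'i \<times> nat) \<Rightarrow> nat \<Rightarrow> 'i" where
  "kword r = (\<lambda>i\<in>{1..d}. fst (r i))"

text \<open>
  Permutations together with a colour for each strand: the shapes of the basis elements of the
  wreath product. The colour is recorded at the position \<open>\<rho> i\<close> at which the strand from \<open>i\<close>
  ends.
\<close>

definition lperms :: "((nat \<Rightarrow> nat) \<times> (nat \<Rightarrow> 'i)) set" where
  "lperms = {\<rho>. \<rho> permutes {1..d}} \<times> ({1..d} \<rightarrow>\<^sub>E I)"

text \<open>
  The indicator function of the coloured permutations that carry the positions of each row of
  \<open>s\<close> to those of the same row of \<open>r\<close> and have the colours of \<open>r\<close>. For a single colour and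
  \<open>r = s\<close> this is the sum over a Young subgroup, and in general it is Murphy's element of the
  group ring for the row tabloids \<open>r\<close> and \<open>s\<close>.
\<close>

definition match :: "(nat \<Rightarrow> 'i \<times> nat) \<Rightarrow> (nat \<Rightarrow> 'i \<times> nat) \<Rightarrow> (nat \<Rightarrow> nat) \<times> (nat \<Rightarrow> 'i) \<Rightarrow> int" where
  "match r s x = (if kword r = snd x \<and> (\<forall>i\<in>{1..d}. r (fst x i) = s i) then 1 else 0)"

definition std :: "(nat \<Rightarrow> 'i \<times> nat) \<Rightarrow> bool" where "std r \<longleftrightarrow> (\<forall>m\<le>d. part (wcont m r))"

text \<open>
  Base 3 makes one row longer than two given ones heavier than both together:
  \<open>3 ^ Suc a > 3 ^ a + 3 ^ b\<close> for \<open>b \<le> a\<close>. Merging boxes of two rows therefore increases the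
  weight as soon as the merged row is longer than each of them.
\<close>

definition weight :: "(nat \<Rightarrow> 'i \<times> nat) \<Rightarrow> nat" where
  "weight r = (\<Sum>p\<in>rows. 3 ^ cont r p)"

definition spairs :: "((nat \<Rightarrow> 'i \<times> nat) \<times> (nat \<Rightarrow> 'i \<times> nat)) set" where
  "spairs = {(r, s). r \<in> words \<and> s \<in> words \<and> std r \<and> std s \<and> cont r = cont s}"

definition spairs_ge ::
  "nat \<Rightarrow> (nat \<Rightarrow> 'i) \<Rightarrow> (nat \<Rightarrow> 'i) \<Rightarrow> ((nat \<Rightarrow> 'i \<times> nat) \<times> (nat \<Rightarrow> 'i \<times> nat)) set" where
  "spairs_ge w k l = {(r, s) \<in> spairs. kword r = k \<and> kword s = l \<and> w \<le> weight r}"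

definition std_like :: "(nat \<Rightarrow> 'i \<times> nat) \<Rightarrow> (nat \<Rightarrow> 'i \<times> nat) set" where
  "std_like r = {t \<in> words. std t \<and> cont t = cont r \<and> kword t = kword r}"

text \<open>
  Integral linear combinations of matching functions, compared on coloured permutations only.
\<close>

definition inspan ::
  "((nat \<Rightarrow> 'i \<times> nat) \<times> (nat \<Rightarrow> 'i \<times> nat)) set \<Rightarrow> ((nat \<Rightarrow> nat) \<times> (nat \<Rightarrow> 'i) \<Rightarrow> int) \<Rightarrow> bool" where
  "inspan Y g \<longleftrightarrow> (\<exists>c. \<forall>x\<in>lperms. g x = (\<Sum>y\<in>Y. c y * match (fst y) (snd y) x))"

lemma finite_rows: "finite rows" unfolding rows_def using finite_I by auto
lemma finite_words: "finite words" unfolding words_def using finite_rows by (intro finite_PiE) auto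
lemma finite_spairs: "finite spairs"
  by (rule finite_subset[of _ "words \<times> words"]) (auto simp: spairs_def finite_words)
lemma finite_spairs_ge: "finite (spairs_ge w k l)"
  by (rule finite_subset[OF _ finite_spairs]) (auto simp: spairs_ge_def)
lemma finite_std_like: "finite (std_like r)"
  by (rule finite_subset[OF _ finite_words]) (auto simp: std_like_def)

lemma inspan_add: "inspan Y g \<Longrightarrow> inspan Y h \<Longrightarrow> inspan Y (\<lambda>x. g x + h x)"
  unfolding inspan_def
  apply (elim exE)
  subgoal for c e by (rule exI[of _ "\<lambda>y. c y + e y"]) (simp add: distrib_right sum.distrib)
  done

lemma inspan_scale: "inspan Y g \<Longrightarrow> inspan Y (\<lambda>x. a * g x)"
  unfolding inspan_def
  apply (elim exE)
  subgoal for c by (rule exI[of _ "\<lambda>y. a * c y"]) (simp add: mult.assoc sum_distrib_left)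
  done

lemma inspan_0: "inspan Y (\<lambda>x. 0)"
  unfolding inspan_def by (rule exI[of _ "\<lambda>y. 0"]) simp

lemma inspan_sum: "(\<And>t. t \<in> T \<Longrightarrow> inspan Y (g t)) \<Longrightarrow> inspan Y (\<lambda>x. \<Sum>t\<in>T. g t x)"
  by (induction T rule: infinite_finite_induct) (auto intro: inspan_0 inspan_add)

lemma inspan_cong: "inspan Y g \<Longrightarrow> (\<And>x. x \<in> lperms \<Longrightarrow> g x = h x) \<Longrightarrow> inspan Y h"
  unfolding inspan_def by auto

lemma inspan_mono:
  assumes "inspan Y g" "Y \<subseteq> Z" "finite Z" shows "inspan Z g"
proof -
  from assms(1) obtain c where c: "\<forall>x\<in>lperms. g x = (\<Sum>y\<in>Y. c y * match (fst y) (snd y) x)"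
    unfolding inspan_def by blast
  have "(\<Sum>y\<in>Y. c y * match (fst y) (snd y) x)
      = (\<Sum>y\<in>Z. (if y \<in> Y then c y else 0) * match (fst y) (snd y) x)" for x
    by (rule sum.mono_neutral_cong_left) (use assms in auto)
  with c show ?thesis unfolding inspan_def by auto
qed

lemma inspan_base:
  assumes "(r, s) \<in> Y" "finite Y" shows "inspan Y (match r s)"
proof -
  have "match r s x = (\<Sum>y\<in>Y. (if y = (r, s) then 1 else 0) * match (fst y) (snd y) x)" for x
  proof -
    have "(\<Sum>y\<in>Y. (if y = (r, s) then 1 else 0) * match (fst y) (snd y) x)
        = (\<Sum>y\<in>Y. if y = (r, s) then match r s x else 0)"
      by (rule sum.cong) auto
    also have "\<dots> = match r s x" using assms by (simp add: sum.delta)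
    finally show ?thesis by simp
  qed
  then show ?thesis unfolding inspan_def
    by (intro exI[of _ "\<lambda>y. if y = (r, s) then 1 else 0"]) simp
qed

lemma lpermsD:
  assumes "x \<in> lperms"
  shows "fst x permutes {1..d}" "snd x \<in> {1..d} \<rightarrow>\<^sub>E I"
  using assms by (auto simp: lperms_def)

lemma words_mem: "r \<in> words \<Longrightarrow> i \<in> {1..d} \<Longrightarrow> r i \<in> rows"
  unfolding words_def by (rule PiE_mem)

lemma words_fst: "r \<in> words \<Longrightarrow> i \<in> {1..d} \<Longrightarrow> fst (r i) \<in> I"
  and words_snd: "r \<in> words \<Longrightarrow> i \<in> {1..d} \<Longrightarrow> snd (r i) \<le> d"
  by (drule (1) words_mem, simp add: rows_def mem_Times_iff)+

lemma words_ext: "r \<in> words \<Longrightarrow> i \<notin> {1..d} \<Longrightarrow> r i = undefined"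
  unfolding words_def by (rule PiE_arb)

lemma words_restrict: "(\<And>i. i \<in> {1..d} \<Longrightarrow> f i \<in> rows) \<Longrightarrow> (\<lambda>i\<in>{1..d}. f i) \<in> words"
  unfolding words_def by (simp add: restrict_PiE_iff)

lemma words_eq_restrict: "r \<in> words \<Longrightarrow> r = (\<lambda>i\<in>{1..d}. f i) \<longleftrightarrow> (\<forall>i\<in>{1..d}. r i = f i)"
  using words_ext[of r] by (auto simp: fun_eq_iff)

lemma perm_mem: "\<rho> permutes {1..d} \<Longrightarrow> i \<in> {1..d} \<Longrightarrow> \<rho> i \<in> {1..d}"
  using permutes_in_image[of \<rho> "{1..d}" i] by blast

lemma words_perm: "\<rho> permutes {1..d} \<Longrightarrow> r \<in> words \<Longrightarrow> (\<lambda>i\<in>{1..d}. r (\<rho> i)) \<in> words"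
  by (rule words_restrict, erule words_mem, erule (1) perm_mem)

lemma ball_perm:
  assumes "\<rho> permutes {1..d}" shows "(\<forall>i\<in>{1..d}. P (\<rho> i)) \<longleftrightarrow> (\<forall>i\<in>{1..d}. P i)"
proof -
  have "(\<forall>i\<in>\<rho> ` {1..d}. P i) \<longleftrightarrow> (\<forall>i\<in>{1..d}. P i)" using permutes_image[OF assms] by simp
  then show ?thesis by simp
qed

lemma cont_perm:
  assumes "\<rho> permutes {1..d}" shows "cont (\<lambda>i\<in>{1..d}. r (\<rho> i)) = cont r"
proof
  fix p
  have "{i \<in> {1..d}. r i = p} \<subseteq> \<rho> ` {i \<in> {1..d}. r (\<rho> i) = p}"
  proof
    fix i assume i: "i \<in> {i \<in> {1..d}. r i = p}"
    then have "i \<in> \<rho> ` {1..d}" using permutes_image[OF assms] by simp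
    with i show "i \<in> \<rho> ` {i \<in> {1..d}. r (\<rho> i) = p}" by auto
  qed
  moreover have "\<rho> ` {i \<in> {1..d}. r (\<rho> i) = p} \<subseteq> {i \<in> {1..d}. r i = p}"
    using perm_mem[OF assms] by auto
  ultimately have "\<rho> ` {i \<in> {1..d}. r (\<rho> i) = p} = {i \<in> {1..d}. r i = p}" by blast
  moreover have "inj_on \<rho> {i \<in> {1..d}. r (\<rho> i) = p}" using assms by (rule permutes_inj_on)
  ultimately have "card {i \<in> {1..d}. r (\<rho> i) = p} = card {i \<in> {1..d}. r i = p}"
    using card_image[of \<rho> "{i \<in> {1..d}. r (\<rho> i) = p}"] by simp
  moreover have "{i \<in> {1..d}. (\<lambda>i\<in>{1..d}. r (\<rho> i)) i = p} = {i \<in> {1..d}. r (\<rho> i) = p}" by auto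
  ultimately show "cont (\<lambda>i\<in>{1..d}. r (\<rho> i)) p = cont r p" unfolding wcont_def by simp
qed

text \<open>
  Given a coloured permutation \<open>x\<close>, each word \<open>r\<close> with the colours of \<open>x\<close> matches exactly one
  word \<open>s\<close>, and by the next lemma each \<open>s\<close> is matched by at most one \<open>r\<close>. Sums of matching
  functions over a set of words thus become membership tests.
\<close>

lemma match_right:
  assumes "r \<in> words" "s \<in> words" "x \<in> lperms"
  shows "match r s x = (if s = (\<lambda>i\<in>{1..d}. r (fst x i)) \<and> kword r = snd x then 1 else 0)"
proof -
  have "(\<forall>i\<in>{1..d}. r (fst x i) = s i) \<longleftrightarrow> s = (\<lambda>i\<in>{1..d}. r (fst x i))"
    using words_eq_restrict[OF assms(2)] by auto
  then show ?thesis unfolding match_def by auto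
qed

lemma match_left:
  assumes "r \<in> words" "s \<in> words" "x \<in> lperms"
  shows "match r s x = (if r = (\<lambda>i\<in>{1..d}. s (inv' (fst x) i)) \<and> kword r = snd x then 1 else 0)"
proof -
  have p: "fst x permutes {1..d}" using assms lpermsD by blast
  then have q: "inv' (fst x) permutes {1..d}" by (rule permutes_inv)
  have "(\<forall>i\<in>{1..d}. r (fst x i) = s i) \<longleftrightarrow> (\<forall>i\<in>{1..d}. r i = s (inv' (fst x) i))"
    using ball_perm[OF p, of "\<lambda>i. r i = s (inv' (fst x) i)"] permutes_inverses(2)[OF p] by simp
  also have "\<dots> \<longleftrightarrow> r = (\<lambda>i\<in>{1..d}. s (inv' (fst x) i))"
    using words_eq_restrict[OF assms(1)] by auto
  finally show ?thesis unfolding match_def by auto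
qed

lemma cont_pos_mem: assumes "r \<in> words" "0 < cont r p" shows "p \<in> rows"
proof -
  from assms(2) obtain i where "i \<in> {1..d}" "r i = p" unfolding wcont_def by (auto simp: card_gt_0_iff)
  with words_mem[OF assms(1)] show ?thesis by auto
qed

lemma cont_le: "cont r p \<le> d"
proof -
  have "cont r p \<le> card {1..d}" unfolding wcont_def by (rule card_mono) auto
  then show ?thesis by simp
qed

lemma sum_cont:
  fixes f :: "'i \<times> nat \<Rightarrow> int"
  assumes "r \<in> words" shows "(\<Sum>i\<in>{1..d}. f (r i)) = (\<Sum>p\<in>rows. f p * int (cont r p))"
proof -
  have "(\<Sum>i\<in>{1..d}. f (r i)) = (\<Sum>p\<in>rows. \<Sum>i\<in>{i \<in> {1..d}. r i = p}. f (r i))"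
    by (rule sum.group[symmetric]) (use words_mem[OF assms] finite_rows in auto)
  also have "\<dots> = (\<Sum>p\<in>rows. f p * int (cont r p))"
    by (rule sum.cong) (auto simp: wcont_def)
  finally show ?thesis .
qed

lemma std_part: "std r \<Longrightarrow> part (cont r)" unfolding std_def by auto

section \<open>Straightening\<close>

text \<open>
  The monovariant of the exchange relation: it grows when large row indices move to later
  positions.
\<close>

definition pot :: "(nat \<Rightarrow> 'i \<times> nat) \<Rightarrow> nat" where "pot r = (\<Sum>i\<in>{1..d}. i * snd (r i))"

lemma pot_le: "r \<in> words \<Longrightarrow> pot r \<le> d * (d * d)"
proof -
  assume r: "r \<in> words"
  have "pot r \<le> (\<Sum>i\<in>{1..d}. d * d)" unfolding pot_def
    by (rule sum_mono) (use words_snd[OF r] in \<open>auto intro!: mult_mono\<close>)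
  then show ?thesis by simp
qed

lemma weight_le: "weight r \<le> card rows * 3 ^ d"
proof -
  have "weight r \<le> (\<Sum>p\<in>rows. 3 ^ d)" unfolding weight_def
    by (rule sum_mono) (use cont_le in \<open>auto intro: power_increasing\<close>)
  then show ?thesis by simp
qed

lemma weight_cong: "cont r = cont s \<Longrightarrow> weight r = weight s" unfolding weight_def by simp

text \<open>
  Let \<open>D i\<close> be the change of the row index at \<open>i\<close>. As the content is fixed, the sum of all
  \<open>D i\<close> vanishes, so \<open>i * D i\<close> and \<open>(i - m) * D i\<close> have the same sum; all terms of the latter
  are non-negative.
\<close>

lemma pot_less:
  assumes r: "r \<in> words" and t: "t \<in> words" and "cont t = cont r" and ne: "t \<noteq> r"
    and same: "\<And>i. i \<in> {1..d} \<Longrightarrow> fst (t i) = fst (r i)"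
    and later: "\<And>i. i \<in> {1..d} \<Longrightarrow> m < i \<Longrightarrow> snd (r i) \<le> snd (t i)"
    and earlier: "\<And>i. i \<in> {1..d} \<Longrightarrow> i \<le> m \<Longrightarrow> snd (t i) \<le> snd (r i)"
  shows "pot r < pot t"
proof -
  define D where "D i = int (snd (t i)) - int (snd (r i))" for i
  have sD: "(\<Sum>i\<in>{1..d}. D i) = 0"
    using sum_cont[OF r, of "\<lambda>p. int (snd p)"] sum_cont[OF t, of "\<lambda>p. int (snd p)"] assms(3)
    by (simp add: D_def sum_subtractf)
  have nn: "0 \<le> (int i - int m) * D i" if "i \<in> {1..d}" for i
  proof (cases "m < i")
    case True then show ?thesis using later[OF that] by (simp add: D_def)
  next
    case False then show ?thesis using earlier[OF that] by (simp add: D_def mult_nonpos_nonpos)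
  qed
  have eq: "int (pot t) - int (pot r) = (\<Sum>i\<in>{1..d}. (int i - int m) * D i)"
  proof -
    have "(\<Sum>i\<in>{1..d}. (int i - int m) * D i) = (\<Sum>i\<in>{1..d}. int i * D i) - int m * (\<Sum>i\<in>{1..d}. D i)"
      by (simp add: left_diff_distrib sum_subtractf sum_distrib_left)
    also have "\<dots> = int (pot t) - int (pot r)"
      using sD by (simp add: pot_def D_def right_diff_distrib sum_subtractf)
    finally show ?thesis by simp
  qed
  have "(\<Sum>i\<in>{1..d}. (int i - int m) * D i) \<noteq> 0"
  proof
    assume "(\<Sum>i\<in>{1..d}. (int i - int m) * D i) = 0"
    then have z: "(int i - int m) * D i = 0" if "i \<in> {1..d}" for i
      using nn that by (subst (asm) sum_nonneg_eq_0_iff) auto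
    have np: "D i \<le> 0" if "i \<in> {1..d}" for i
      using z[OF that] earlier[OF that] by (cases "i \<le> m") (auto simp: D_def)
    from sD have "(\<Sum>i\<in>{1..d}. - D i) = 0" by (simp add: sum_negf)
    then have "D i = 0" if "i \<in> {1..d}" for i
      using np that by (subst (asm) sum_nonneg_eq_0_iff) auto
    then have "t i = r i" if "i \<in> {1..d}" for i using same that by (simp add: D_def prod_eq_iff)
    then have "t = r" using r t unfolding words_def by (intro PiE_ext)
    with ne show False by simp
  qed
  moreover have "0 \<le> (\<Sum>i\<in>{1..d}. (int i - int m) * D i)" by (rule sum_nonneg) (use nn in auto)
  ultimately show ?thesis using eq by linarith
qed

text \<open>
  The exchange relation. If \<open>r\<close> is not standard, some prefix \<open>{1..m}\<close> has more letters
  \<open>J1 = (\<kappa>, Suc j)\<close> than \<open>J = (\<kappa>, j)\<close>. Let \<open>A\<close> be the later positions of \<open>J\<close> and \<open>B\<close> the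
  earlier positions of \<open>J1\<close>. Let \<open>r1\<close> be \<open>r\<close> with all of \<open>A \<union> B\<close> moved to a new row \<open>S\<close>. A
  coloured permutation matches \<open>r1\<close> with some word obtained from \<open>s\<close> by renaming letters \<open>J\<close>
  and \<open>J1\<close> to \<open>S\<close> if and only if it matches \<open>s\<close> with some word obtained from \<open>r\<close> by
  redistributing \<open>J\<close> and \<open>J1\<close> over \<open>A \<union> B\<close>: both say that, apart from \<open>A \<union> B\<close>, the letters of
  \<open>s\<close> and \<open>r\<close> correspond, while \<open>A \<union> B\<close> corresponds to letters \<open>J\<close> or \<open>J1\<close> of \<open>s\<close>.

  Among the redistributions, \<open>r\<close> has the letters \<open>J\<close> as late as possible, so all others have a
  larger \<open>pot\<close>. Row \<open>S\<close> of \<open>r1\<close> is longer than rows \<open>J\<close> and \<open>J1\<close> of \<open>r\<close>, because \<open>B\<close>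
  outnumbers the letters \<open>J\<close> of the prefix; so \<open>r1\<close> is heavier. Neither \<open>T\<close> nor \<open>r1\<close> depends
  on \<open>s\<close>, and this is what makes the coefficients of the straightened form independent of \<open>s\<close>.
\<close>

lemma garnir:
  assumes r: "r \<in> words" and pr: "part (cont r)" and ns: "\<not> std r"
  obtains T r1 where "finite T" "\<And>t. t \<in> T \<Longrightarrow> t \<in> words \<and> cont t = cont r \<and> kword t = kword r \<and> pot r < pot t"
    "r1 \<in> words" "kword r1 = kword r" "weight r < weight r1"
    "\<And>s. s \<in> words \<Longrightarrow> cont s = cont r \<Longrightarrow>
       \<exists>U. (\<forall>u\<in>U. u \<in> words \<and> cont u = cont r1 \<and> kword u = kword s) \<and>
         (\<forall>x\<in>lperms. match r s x = (\<Sum>u\<in>U. match r1 u x) - (\<Sum>t\<in>T. match t s x))"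
proof -
  from ns obtain \<kappa> j m where m: "m \<le> d"
    and viol: "card {i \<in> {1..m}. r i = (\<kappa>, j)} < card {i \<in> {1..m}. r i = (\<kappa>, Suc j)}"
    unfolding std_def part_def wcont_def by (meson not_le_imp_less)
  define J where "J = (\<kappa>, j)"
  define J1 where "J1 = (\<kappa>, Suc j)"
  define S where "S = (\<kappa>, d)"
  define A where "A = {i \<in> {1..d}. m < i \<and> r i = J}"
  define B where "B = {i \<in> {1..d}. i \<le> m \<and> r i = J1}"
  have B': "B = {i \<in> {1..m}. r i = J1}" using m by (auto simp: B_def)
  have "0 < card B" using viol B' by (simp add: J1_def)
  then obtain b where b: "b \<in> B" by (metis card_gt_0_iff ex_in_conv)
  have J1pos: "0 < cont r J1" using b unfolding wcont_def by (auto simp: card_gt_0_iff B_def)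
  then have jd: "Suc j < d" using part_row_less[OF pr] by (simp add: J1_def)
  have kI: "\<kappa> \<in> I" using cont_pos_mem[OF r J1pos] by (auto simp: J1_def rows_def)
  have SJ: "S \<noteq> J" "S \<noteq> J1" "J \<noteq> J1" using jd by (auto simp: S_def J_def J1_def)
  have rows: "S \<in> rows" "J \<in> rows" "J1 \<in> rows" using kI jd by (auto simp: rows_def S_def J_def J1_def)
  (* Row d is empty, because the content of r is a family of diagrams with d boxes. *)
  have S0: "cont r S = 0" using part_row_less[OF pr, of \<kappa> d] by (auto simp: S_def)
  then have rS: "r i \<noteq> S" if "i \<in> {1..d}" for i using that wcont_zero_iff[of d r S] by blast
  define r1 where "r1 = (\<lambda>i\<in>{1..d}. if i \<in> A \<union> B then S else r i)"
  have rmem: "r i \<in> rows" if "i \<in> {1..d}" for i using words_mem[OF r that] .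
  have r1: "r1 \<in> words" unfolding r1_def using rows rmem by (intro words_restrict) auto
  have AB: "r i \<in> {J, J1}" "i \<in> {1..d}" if "i \<in> A \<union> B" for i using that by (auto simp: A_def B_def)
  have kr1: "kword r1 = kword r"
    using AB by (fastforce simp: kword_def r1_def S_def J_def J1_def)
  have c1S: "Suc (cont r J) \<le> cont r1 S"
  proof -
    have "{i \<in> {1..d}. r1 i = S} = A \<union> B" using AB rS by (auto simp: r1_def)
    then have "cont r1 S = card (A \<union> B)" by (simp add: wcont_def)
    also have "\<dots> = card A + card B" by (rule card_Un_disjoint) (auto simp: A_def B_def)
    finally have 1: "cont r1 S = card A + card B" .
    have "{i \<in> {1..d}. r i = J} = A \<union> {i \<in> {1..m}. r i = J}" using m by (auto simp: A_def)
    then have "cont r J = card (A \<union> {i \<in> {1..m}. r i = J})" by (simp add: wcont_def)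
    also have "\<dots> = card A + card {i \<in> {1..m}. r i = J}" by (rule card_Un_disjoint) (auto simp: A_def)
    finally show ?thesis using 1 viol B' by (simp add: J_def J1_def)
  qed
  have c1o: "cont r1 p = cont r p" if "p \<notin> {S, J, J1}" for p
  proof -
    have "{i \<in> {1..d}. r1 i = p} = {i \<in> {1..d}. r i = p}" using that AB by (auto simp: r1_def split: if_splits)
    then show ?thesis by (simp add: wcont_def)
  qed
  have wt: "weight r < weight r1"
  proof -
    define R' where "R' = rows - {S, J, J1}"
    have split: "(\<Sum>p\<in>rows. f p) = f S + f J + f J1 + (\<Sum>p\<in>R'. f p)" for f :: "_ \<Rightarrow> nat"
    proof -
      have e: "rows = insert S (insert J (insert J1 R'))" using rows by (auto simp: R'_def)
      have "finite R'" "S \<notin> R'" "J \<notin> R'" "J1 \<notin> R'" using finite_rows by (auto simp: R'_def)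
      then show ?thesis using SJ by (subst e) simp
    qed
    have "(\<Sum>p\<in>R'. 3 ^ cont r1 p) = (\<Sum>p\<in>R'. (3::nat) ^ cont r p)"
      by (rule sum.cong) (auto simp: R'_def c1o)
    moreover have "3 * 3 ^ cont r J \<le> (3::nat) ^ cont r1 S"
      using power_increasing[OF c1S, of "3::nat"] by simp
    moreover have "(3::nat) ^ cont r J1 \<le> 3 ^ cont r J"
      using pr by (intro power_increasing) (auto simp: part_def J_def J1_def)
    moreover have "(1::nat) \<le> 3 ^ cont r J" "(1::nat) \<le> 3 ^ cont r1 J" "(1::nat) \<le> 3 ^ cont r1 J1" by auto
    moreover have "(3::nat) ^ cont r S = 1" using S0 by simp
    ultimately show ?thesis unfolding weight_def split by linarith
  qed
  (* The redistributions of J and J1 over A and B that keep the content; r is one of them. *)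
  define T where "T = {t \<in> words. cont t = cont r \<and> (\<forall>i\<in>{1..d}. if i \<in> A \<union> B then t i \<in> {J, J1} else t i = r i)}"
  have finT: "finite T" unfolding T_def using finite_words by auto
  have rT: "r \<in> T" using r AB by (auto simp: T_def)
  have Tfst: "fst (t i) = fst (r i)" if "t \<in> T" "i \<in> {1..d}" for t i
  proof (cases "i \<in> A \<union> B")
    case True
    have "\<forall>i\<in>{1..d}. if i \<in> A \<union> B then t i \<in> {J, J1} else t i = r i"
      using that unfolding T_def by blast
    then have "t i \<in> {J, J1}" using True that(2) by metis
    moreover have "r i \<in> {J, J1}" using AB(1)[OF True] .
    ultimately show ?thesis by (auto simp: J_def J1_def)
  next
    case False then show ?thesis using that by (auto simp: T_def)
  qed
  have kT: "kword t = kword r" if "t \<in> T" for t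
    using Tfst[OF that] by (auto simp: kword_def)
  have T: "t \<in> words \<and> cont t = cont r \<and> kword t = kword r \<and> pot r < pot t" if "t \<in> T - {r}" for t
  proof -
    have t: "t \<in> T" "t \<in> words" "cont t = cont r" "t \<noteq> r" using that by (auto simp: T_def)
    have cases: "t i = r i \<or> (t i \<in> {J, J1} \<and> i \<in> A \<union> B)" if "i \<in> {1..d}" for i
      using bspec[OF conjunct2[OF conjunct2[OF CollectD[OF t(1)[unfolded T_def]]]] that] by (auto split: if_splits)
    have "pot r < pot t"
    proof (rule pot_less[OF r t(2,3,4)])
      show "fst (t i) = fst (r i)" if "i \<in> {1..d}" for i using Tfst t(1) that by blast
      show "snd (r i) \<le> snd (t i)" if "i \<in> {1..d}" "m < i" for i
        using cases[OF that(1)] that by (auto simp: A_def B_def J_def J1_def)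
      show "snd (t i) \<le> snd (r i)" if "i \<in> {1..d}" "i \<le> m" for i
        using cases[OF that(1)] that by (auto simp: A_def B_def J_def J1_def)
    qed
    with t kT show ?thesis by blast
  qed
  have rel: "\<exists>U. (\<forall>u\<in>U. u \<in> words \<and> cont u = cont r1 \<and> kword u = kword s) \<and>
         (\<forall>x\<in>lperms. match r s x = (\<Sum>u\<in>U. match r1 u x) - (\<Sum>t\<in>T - {r}. match t s x))"
    if s: "s \<in> words" and cs: "cont s = cont r" for s
  proof -
    (* The renamings of letters J and J1 of s to S that have the content of r1. *)
    define U where "U = {u \<in> words. cont u = cont r1 \<and> (\<forall>i\<in>{1..d}. u i = s i \<or> (u i = S \<and> s i \<in> {J, J1}))}"
    have U: "u \<in> words \<and> cont u = cont r1 \<and> kword u = kword s" if "u \<in> U" for u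
    proof -
      have "fst (u i) = fst (s i)" if i: "i \<in> {1..d}" for i
      proof -
        have "u i = s i \<or> (u i = S \<and> s i \<in> {J, J1})" using \<open>u \<in> U\<close> i unfolding U_def by blast
        then show ?thesis by (auto simp: S_def J_def J1_def)
      qed
      then show ?thesis using that by (auto simp: U_def kword_def)
    qed
    have finU: "finite U" unfolding U_def using finite_words by auto
    have sS: "s i \<noteq> S" if "i \<in> {1..d}" for i using that cs S0 wcont_zero_iff[of d s S] by simp
    have "(\<Sum>t\<in>T. match t s x) = (\<Sum>u\<in>U. match r1 u x)" if x: "x \<in> lperms" for x
    proof -
      define \<rho> where "\<rho> = fst x"
      have p: "\<rho> permutes {1..d}" using lpermsD[OF x] by (simp add: \<rho>_def)
      then have q: "inv' \<rho> permutes {1..d}" by (rule permutes_inv)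
      define t0 where "t0 = (\<lambda>i\<in>{1..d}. s (inv' \<rho> i))"
      define u0 where "u0 = (\<lambda>i\<in>{1..d}. r1 (\<rho> i))"
      have t0: "t0 \<in> words" "cont t0 = cont r"
        unfolding t0_def using words_perm[OF q s] cont_perm[OF q] cs by auto
      have u0: "u0 \<in> words" "cont u0 = cont r1"
        unfolding u0_def using words_perm[OF p r1] cont_perm[OF p] by auto
      have "(\<Sum>t\<in>T. match t s x) = (\<Sum>t\<in>T. if t = t0 then (if kword r = snd x then 1 else 0) else 0)"
        by (rule sum.cong) (use match_left[OF _ s x] kT in \<open>auto simp: T_def t0_def \<rho>_def\<close>)
      also have "\<dots> = (if t0 \<in> T \<and> kword r = snd x then 1 else 0)" using finT by (simp add: sum.delta)
      finally have 1: "(\<Sum>t\<in>T. match t s x) = (if t0 \<in> T \<and> kword r = snd x then 1 else 0)" .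
      have "(\<Sum>u\<in>U. match r1 u x) = (\<Sum>u\<in>U. if u = u0 then (if kword r = snd x then 1 else 0) else 0)"
        by (rule sum.cong) (use match_right[OF r1 _ x] kr1 in \<open>auto simp: U_def u0_def \<rho>_def\<close>)
      also have "\<dots> = (if u0 \<in> U \<and> kword r = snd x then 1 else 0)" using finU by (simp add: sum.delta)
      finally have 2: "(\<Sum>u\<in>U. match r1 u x) = (if u0 \<in> U \<and> kword r = snd x then 1 else 0)" .
      (* Each sum has at most one non-zero term: the word t0 that matches s, and the word u0 that r1
         matches. It remains to compare the two membership conditions position by position. *)
      have "t0 \<in> T \<longleftrightarrow> (\<forall>i\<in>{1..d}. if i \<in> A \<union> B then t0 i \<in> {J, J1} else t0 i = r i)"
        using t0 by (simp add: T_def)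
      also have "\<dots> \<longleftrightarrow> (\<forall>i\<in>{1..d}. r1 i = t0 i \<or> (r1 i = S \<and> t0 i \<in> {J, J1}))"
      proof (rule ball_cong[OF refl])
        fix i assume i: "i \<in> {1..d}"
        have "t0 i \<noteq> S" using sS i perm_mem[OF q] by (simp add: t0_def)
        then show "(if i \<in> A \<union> B then t0 i \<in> {J, J1} else t0 i = r i) \<longleftrightarrow> (r1 i = t0 i \<or> (r1 i = S \<and> t0 i \<in> {J, J1}))"
          using i rS[OF i] by (auto simp: r1_def)
      qed
      also have "\<dots> \<longleftrightarrow> (\<forall>i\<in>{1..d}. r1 (\<rho> i) = t0 (\<rho> i) \<or> (r1 (\<rho> i) = S \<and> t0 (\<rho> i) \<in> {J, J1}))"
        by (rule ball_perm[OF p, symmetric])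
      also have "\<dots> \<longleftrightarrow> (\<forall>i\<in>{1..d}. u0 i = s i \<or> (u0 i = S \<and> s i \<in> {J, J1}))"
      proof (rule ball_cong[OF refl])
        fix i assume i: "i \<in> {1..d}"
        have "t0 (\<rho> i) = s i" using perm_mem[OF p i] p by (simp add: t0_def permutes_inverses)
        then show "(r1 (\<rho> i) = t0 (\<rho> i) \<or> (r1 (\<rho> i) = S \<and> t0 (\<rho> i) \<in> {J, J1})) = (u0 i = s i \<or> (u0 i = S \<and> s i \<in> {J, J1}))"
          using i by (simp add: u0_def)
      qed
      also have "\<dots> \<longleftrightarrow> u0 \<in> U" using u0 by (simp add: U_def)
      finally show ?thesis using 1 2 by simp
    qed
    moreover have "(\<Sum>t\<in>T. match t s x) = match r s x + (\<Sum>t\<in>T - {r}. match t s x)" for x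
      using finT rT by (rule sum.remove)
    ultimately have "\<forall>x\<in>lperms. match r s x = (\<Sum>u\<in>U. match r1 u x) - (\<Sum>t\<in>T - {r}. match t s x)"
      by (simp add: eq_diff_eq)
    with U show ?thesis by blast
  qed
  show thesis
    by (rule that[of "T - {r}" r1]) (use finT T r1 kr1 wt rel in \<open>simp_all\<close>)
qed

text \<open>
  Turning a coloured permutation upside down. It exchanges the two words of a matching
  function, so that results about the left word carry over to the right word.
\<close>

definition flip :: "(nat \<Rightarrow> nat) \<times> (nat \<Rightarrow> 'i) \<Rightarrow> (nat \<Rightarrow> nat) \<times> (nat \<Rightarrow> 'i)" where
  "flip x = (inv' (fst x), \<lambda>i\<in>{1..d}. snd x (fst x i))"

lemma flip_lperms: assumes "x \<in> lperms" shows "flip x \<in> lperms"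
proof -
  note x = lpermsD[OF assms]
  have "snd x (fst x i) \<in> I" if "i \<in> {1..d}" for i
    using PiE_mem[OF x(2)] perm_mem[OF x(1) that] by blast
  then show ?thesis using permutes_inv[OF x(1)] unfolding flip_def lperms_def by auto
qed

lemma match_flip:
  assumes "r \<in> words" "s \<in> words" "x \<in> lperms"
  shows "match r s (flip x) = match s r x"
proof -
  note x = lpermsD[OF assms(3)]
  have 1: "(\<forall>i\<in>{1..d}. r (inv' (fst x) i) = s i) \<longleftrightarrow> (\<forall>i\<in>{1..d}. s (fst x i) = r i)"
    using ball_perm[OF x(1), of "\<lambda>i. r (inv' (fst x) i) = s i"]
    unfolding permutes_inverses(2)[OF x(1)] by (auto simp: eq_commute[of "r _" "s _"])
  have 2: "kword r = (\<lambda>i\<in>{1..d}. snd x (fst x i)) \<longleftrightarrow> kword s = snd x"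
    if h: "\<forall>i\<in>{1..d}. s (fst x i) = r i"
  proof -
    have "kword r = (\<lambda>i\<in>{1..d}. snd x (fst x i)) \<longleftrightarrow> (\<forall>i\<in>{1..d}. fst (s (fst x i)) = snd x (fst x i))"
      using h by (auto simp: kword_def fun_eq_iff restrict_def)
    also have "\<dots> \<longleftrightarrow> (\<forall>i\<in>{1..d}. fst (s i) = snd x i)" by (rule ball_perm[OF x(1)])
    also have "\<dots> \<longleftrightarrow> kword s = snd x"
    proof
      assume "\<forall>i\<in>{1..d}. fst (s i) = snd x i"
      then show "kword s = snd x" using PiE_arb[OF x(2)] unfolding kword_def by (intro ext) auto
    next
      assume k: "kword s = snd x"
      show "\<forall>i\<in>{1..d}. fst (s i) = snd x i" using k[symmetric] by (simp add: kword_def)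
    qed
    finally show ?thesis .
  qed
  show ?thesis unfolding match_def flip_def using 1 2 by auto
qed

lemma inspan_flip:
  assumes "inspan Y g" "Y \<subseteq> words \<times> words"
  shows "inspan (prod.swap ` Y) (\<lambda>x. g (flip x))"
proof -
  from assms(1) obtain c where c: "\<And>x. x \<in> lperms \<Longrightarrow> g x = (\<Sum>y\<in>Y. c y * match (fst y) (snd y) x)"
    unfolding inspan_def by blast
  have "g (flip x) = (\<Sum>y\<in>prod.swap ` Y. c (prod.swap y) * match (fst y) (snd y) x)" if x: "x \<in> lperms" for x
  proof -
    have "g (flip x) = (\<Sum>y\<in>Y. c y * match (fst y) (snd y) (flip x))" using c[OF flip_lperms[OF x]] .
    also have "\<dots> = (\<Sum>y\<in>Y. c y * match (snd y) (fst y) x)"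
    proof (rule sum.cong[OF refl])
      fix y assume "y \<in> Y"
      then have "fst y \<in> words" "snd y \<in> words" using assms(2) by auto
      then show "c y * match (fst y) (snd y) (flip x) = c y * match (snd y) (fst y) x"
        using match_flip x by simp
    qed
    also have "\<dots> = (\<Sum>y\<in>prod.swap ` Y. c (prod.swap y) * match (fst y) (snd y) x)"
      by (subst sum.reindex) (auto simp: inj_on_def)
    finally show ?thesis .
  qed
  then show ?thesis unfolding inspan_def by (intro exI[of _ "\<lambda>y. c (prod.swap y)"]) blast
qed

lemma spairs_ge_words: "spairs_ge w k l \<subseteq> words \<times> words"
  by (auto simp: spairs_ge_def spairs_def)

lemma spairs_ge_swap: "prod.swap ` spairs_ge w k l \<subseteq> spairs_ge w l k"
proof
  fix y assume "y \<in> prod.swap ` spairs_ge w k l"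
  then obtain r s where y: "y = (s, r)" "(r, s) \<in> spairs_ge w k l" by auto
  then have "cont r = cont s" by (auto simp: spairs_ge_def spairs_def)
  then have "weight r = weight s" by (rule weight_cong)
  with y show "y \<in> spairs_ge w l k" by (auto simp: spairs_ge_def spairs_def)
qed

text \<open>
  Induction on \<open>pot\<close>, which is bounded by \<open>pot_le\<close>. The exchange relation replaces \<open>r\<close> by
  words of larger \<open>pot\<close>, up to terms of larger weight, which the hypothesis \<open>IH\<close> makes
  standard.
\<close>

lemma straighten_left_step:
  assumes IH: "\<And>r s. r \<in> words \<Longrightarrow> s \<in> words \<Longrightarrow> cont r = cont s \<Longrightarrow> w < weight r \<Longrightarrow>
      inspan (spairs_ge (weight r) (kword r) (kword s)) (match r s)"
    and "r \<in> words" "part (cont r)" "weight r = w"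
  shows "\<exists>q. \<forall>s\<in>words. cont s = cont r \<longrightarrow>
      inspan (spairs_ge (Suc w) (kword r) (kword s)) (\<lambda>x. match r s x - (\<Sum>t\<in>std_like r. q t * match t s x))"
  using assms(2-)
proof (induction "d * (d * d) - pot r" arbitrary: r rule: less_induct)
  case less
  note r = less.prems
  show ?case
  proof (cases "std r")
    case True
    then have "r \<in> std_like r" using r by (auto simp: std_like_def)
    have "(\<Sum>t\<in>std_like r. (if t = r then 1 else 0) * match t s x) = match r s x" for s x
    proof -
      have "(\<Sum>t\<in>std_like r. (if t = r then 1 else 0) * match t s x) = (\<Sum>t\<in>std_like r. if t = r then match r s x else 0)"
        by (rule sum.cong) auto
      also have "\<dots> = match r s x" using \<open>r \<in> std_like r\<close> finite_std_like by (simp add: sum.delta)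
      finally show ?thesis .
    qed
    then show ?thesis
      by (intro exI[of _ "\<lambda>t. if t = r then 1 else 0"]) (simp add: inspan_0)
  next
    case False
    obtain T r1 where T: "finite T"
      "\<And>t. t \<in> T \<Longrightarrow> t \<in> words \<and> cont t = cont r \<and> kword t = kword r \<and> pot r < pot t"
      and r1: "r1 \<in> words" "kword r1 = kword r" "weight r < weight r1"
      and rel: "\<And>s. s \<in> words \<Longrightarrow> cont s = cont r \<Longrightarrow>
       \<exists>U. (\<forall>u\<in>U. u \<in> words \<and> cont u = cont r1 \<and> kword u = kword s) \<and>
         (\<forall>x\<in>lperms. match r s x = (\<Sum>u\<in>U. match r1 u x) - (\<Sum>t\<in>T. match t s x))"
      by (rule garnir[OF r(1,2) False]) (rule that)
    have "\<exists>q. \<forall>s\<in>words. cont s = cont r \<longrightarrow>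
      inspan (spairs_ge (Suc w) (kword r) (kword s)) (\<lambda>x. match t s x - (\<Sum>t'\<in>std_like r. q t' * match t' s x))"
      if t: "t \<in> T" for t
    proof -
      note tt = T(2)[OF t]
      have sl: "std_like t = std_like r" using tt by (simp add: std_like_def)
      have "pot t \<le> d * (d * d)" using tt pot_le by blast
      then have "d * (d * d) - pot t < d * (d * d) - pot r" using tt by linarith
      moreover have "part (cont t)" "weight t = w" using tt r weight_cong[of t r] by auto
      ultimately have "\<exists>q. \<forall>s\<in>words. cont s = cont t \<longrightarrow>
          inspan (spairs_ge (Suc w) (kword t) (kword s)) (\<lambda>x. match t s x - (\<Sum>t'\<in>std_like t. q t' * match t' s x))"
        using less.hyps tt by blast
      then show ?thesis using tt unfolding sl by simp
    qed
    then have "\<forall>t\<in>T. \<exists>q. \<forall>s\<in>words. cont s = cont r \<longrightarrow>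
      inspan (spairs_ge (Suc w) (kword r) (kword s)) (\<lambda>x. match t s x - (\<Sum>t'\<in>std_like r. q t' * match t' s x))"
      by blast
    from bchoice[OF this] obtain q where q: "\<forall>t\<in>T. \<forall>s\<in>words. cont s = cont r \<longrightarrow>
      inspan (spairs_ge (Suc w) (kword r) (kword s)) (\<lambda>x. match t s x - (\<Sum>t'\<in>std_like r. q t t' * match t' s x))"
      by blast
    show ?thesis
    proof (intro exI ballI impI)
      fix s assume s: "s \<in> words" "cont s = cont r"
      let ?Y = "spairs_ge (Suc w) (kword r) (kword s)"
      from rel[OF s] obtain U where U: "\<And>u. u \<in> U \<Longrightarrow> u \<in> words \<and> cont u = cont r1 \<and> kword u = kword s"
        and eq: "\<And>x. x \<in> lperms \<Longrightarrow> match r s x = (\<Sum>u\<in>U. match r1 u x) - (\<Sum>t\<in>T. match t s x)" by blast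
      have "inspan ?Y (match r1 u)" if "u \<in> U" for u
      proof (rule inspan_mono)
        have "inspan (spairs_ge (weight r1) (kword r1) (kword u)) (match r1 u)"
          using IH[OF r1(1), of u] U[OF that] r1 r by simp
        then show "inspan (spairs_ge (weight r1) (kword r) (kword s)) (match r1 u)" using U[OF that] r1 by simp
        show "spairs_ge (weight r1) (kword r) (kword s) \<subseteq> ?Y" using r1 r by (auto simp: spairs_ge_def)
      qed (rule finite_spairs_ge)
      then have 1: "inspan ?Y (\<lambda>x. \<Sum>u\<in>U. match r1 u x)" by (rule inspan_sum)
      have 2: "inspan ?Y (\<lambda>x. (-1) * (\<Sum>t\<in>T. match t s x - (\<Sum>t'\<in>std_like r. q t t' * match t' s x)))"
        by (intro inspan_scale inspan_sum) (use q s in blast)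
      show "inspan ?Y (\<lambda>x. match r s x - (\<Sum>t\<in>std_like r. (- (\<Sum>t'\<in>T. q t' t)) * match t s x))"
      proof (rule inspan_cong[OF inspan_add[OF 1 2]])
        fix x assume x: "x \<in> lperms"
        have "(\<Sum>t\<in>std_like r. (- (\<Sum>t'\<in>T. q t' t)) * match t s x) = - (\<Sum>t\<in>std_like r. \<Sum>t'\<in>T. q t' t * match t s x)"
          by (simp add: sum_distrib_right sum_negf)
        also have "\<dots> = - (\<Sum>t'\<in>T. \<Sum>t\<in>std_like r. q t' t * match t s x)" by (subst sum.swap) simp
        finally show "(\<Sum>u\<in>U. match r1 u x) + (-1) * (\<Sum>t\<in>T. match t s x - (\<Sum>t'\<in>std_like r. q t t' * match t' s x))
           = match r s x - (\<Sum>t\<in>std_like r. (- (\<Sum>t'\<in>T. q t' t)) * match t s x)"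
          using eq[OF x] by (simp add: sum_subtractf)
      qed
    qed
  qed
qed

text \<open>
  The left word is straightened first, then the right word by flipping; words of larger weight
  are again left to \<open>IH\<close>.
\<close>

lemma straighten_partition:
  assumes IH: "\<And>r s. r \<in> words \<Longrightarrow> s \<in> words \<Longrightarrow> cont r = cont s \<Longrightarrow> w < weight r \<Longrightarrow>
      inspan (spairs_ge (weight r) (kword r) (kword s)) (match r s)"
    and r: "r \<in> words" "part (cont r)" "weight r = w" and s: "s \<in> words" "cont s = cont r"
  shows "inspan (spairs_ge w (kword r) (kword s)) (match r s)"
proof -
  let ?Y = "spairs_ge w (kword r) (kword s)"
  have sub: "spairs_ge (Suc w) k l \<subseteq> spairs_ge w k l" for k l by (auto simp: spairs_ge_def)
  from straighten_left_step[OF IH r] obtain q where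
    q: "inspan (spairs_ge (Suc w) (kword r) (kword s)) (\<lambda>x. match r s x - (\<Sum>t\<in>std_like r. q t * match t s x))"
    using s by blast
  have ws: "weight s = w" using weight_cong[OF s(2)] r by simp
  have "part (cont s)" using r s by simp
  from straighten_left_step[OF IH s(1) this ws] obtain q' where
    q': "\<And>t. t \<in> words \<Longrightarrow> cont t = cont s \<Longrightarrow>
      inspan (spairs_ge (Suc w) (kword s) (kword t)) (\<lambda>x. match s t x - (\<Sum>t'\<in>std_like s. q' t' * match t' t x))"
    by blast
  have A: "inspan ?Y (match t s)" if t: "t \<in> std_like r" for t
  proof -
    have tw: "t \<in> words" "cont t = cont s" "kword t = kword r" "std t" using t s by (auto simp: std_like_def)
    have 1: "inspan ?Y (\<lambda>x. match s t (flip x) - (\<Sum>t'\<in>std_like s. q' t' * match t' t (flip x)))"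
    proof (rule inspan_mono[OF inspan_flip[OF q'[OF tw(1,2)] spairs_ge_words]])
      show "prod.swap ` spairs_ge (Suc w) (kword s) (kword t) \<subseteq> ?Y"
        using spairs_ge_swap[of "Suc w" "kword s" "kword t"] sub tw(3) by auto
    qed (rule finite_spairs_ge)
    have 2: "inspan ?Y (\<lambda>x. \<Sum>t'\<in>std_like s. q' t' * match t t' x)"
    proof (intro inspan_sum inspan_scale inspan_base finite_spairs_ge)
      fix t' assume "t' \<in> std_like s"
      then show "(t, t') \<in> ?Y" using tw s r weight_cong[of t r]
        by (auto simp: std_like_def spairs_ge_def spairs_def)
    qed
    show ?thesis
    proof (rule inspan_cong[OF inspan_add[OF 1 2]])
      fix x assume x: "x \<in> lperms"
      have "(\<Sum>t'\<in>std_like s. q' t' * match t' t (flip x)) = (\<Sum>t'\<in>std_like s. q' t' * match t t' x)"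
        by (rule sum.cong) (use match_flip[OF _ tw(1) x] in \<open>auto simp: std_like_def\<close>)
      then show "match s t (flip x) - (\<Sum>t'\<in>std_like s. q' t' * match t' t (flip x)) +
          (\<Sum>t'\<in>std_like s. q' t' * match t t' x) = match t s x"
        using match_flip[OF s(1) tw(1) x] by simp
    qed
  qed
  have 3: "inspan ?Y (\<lambda>x. \<Sum>t\<in>std_like r. q t * match t s x)" by (intro inspan_sum inspan_scale A)
  show ?thesis
    by (rule inspan_cong[OF inspan_add[OF inspan_mono[OF q sub finite_spairs_ge] 3]]) simp
qed

text \<open>
  If the row lengths of \<open>r\<close> are not weakly decreasing, two adjacent rows of a colour can be
  renamed in both words at once. This does not affect the matching function and the weight,
  and the sum of all row indices drops.
\<close>

lemma swap_rows:
  assumes r: "r \<in> words" and lt: "cont r (\<kappa>, j) < cont r (\<kappa>, Suc j)"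
  defines "h \<equiv> transpose (\<kappa>, j) (\<kappa>, Suc j)"
  defines "f \<equiv> \<lambda>r. \<lambda>i\<in>{1..d}. h (r i)"
  shows "\<And>s. s \<in> words \<Longrightarrow> f s \<in> words" "\<And>s. kword (f s) = kword s"
    "\<And>s p. cont (f s) p = cont s (h p)" "\<And>s. weight (f s) = weight s"
    "(\<Sum>i\<in>{1..d}. snd (f r i)) < (\<Sum>i\<in>{1..d}. snd (r i))"
    "\<And>s x. x \<in> lperms \<Longrightarrow> match (f r) (f s) x = match r s x"
proof -
  have pos: "0 < cont r (\<kappa>, Suc j)" using lt by simp
  from cont_pos_mem[OF r pos] have rows: "(\<kappa>, j) \<in> rows" "(\<kappa>, Suc j) \<in> rows" by (auto simp: rows_def)
  have hrows: "h p \<in> rows" if "p \<in> rows" for p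
    using that rows by (auto simp: h_def transpose_def)
  have hh: "h (h p) = p" for p by (simp add: h_def)
  have hfst: "fst (h p) = fst p" for p by (auto simp: h_def transpose_def)
  show "f s \<in> words" if s: "s \<in> words" for s
    unfolding f_def by (intro words_restrict hrows words_mem[OF s])
  show kf: "kword (f s) = kword s" for s by (auto simp: kword_def f_def hfst)
  show cf: "cont (f s) p = cont s (h p)" for s p
  proof -
    have "h q = p \<longleftrightarrow> q = h p" for q using hh by metis
    then have "{i \<in> {1..d}. f s i = p} = {i \<in> {1..d}. s i = h p}" by (auto simp: f_def)
    then show ?thesis by (simp add: wcont_def)
  qed
  show "weight (f s) = weight s" for s
  proof -
    have "bij_betw h rows rows" by (rule bij_betw_byWitness[where f' = h]) (use hh hrows in auto)
    from sum.reindex_bij_betw[OF this, of "\<lambda>p. (3::nat) ^ cont s p"] show ?thesis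
      unfolding weight_def cf by simp
  qed
  show "(\<Sum>i\<in>{1..d}. snd (f r i)) < (\<Sum>i\<in>{1..d}. snd (r i))"
  proof -
    have "int (snd (f r i)) = int (snd (r i)) + (if r i = (\<kappa>, j) then 1 else 0) - (if r i = (\<kappa>, Suc j) then 1 else 0)"
      if "i \<in> {1..d}" for i
      using that by (auto simp: f_def h_def transpose_def)
    then have "(\<Sum>i\<in>{1..d}. int (snd (f r i))) = (\<Sum>i\<in>{1..d}. int (snd (r i)) + (if r i = (\<kappa>, j) then 1 else 0) - (if r i = (\<kappa>, Suc j) then 1 else 0))"
      by (rule sum.cong[OF refl])
    also have "\<dots> = (\<Sum>i\<in>{1..d}. int (snd (r i))) + int (cont r (\<kappa>, j)) - int (cont r (\<kappa>, Suc j))"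
      by (simp add: sum.distrib sum_subtractf wcont_def sum.If_cases Int_def)
    finally have "int (\<Sum>i\<in>{1..d}. snd (f r i)) < int (\<Sum>i\<in>{1..d}. snd (r i))"
      using lt by (simp only: of_nat_sum)
    then show ?thesis by (simp only: of_nat_less_iff)
  qed
  show "match (f r) (f s) x = match r s x" if x: "x \<in> lperms" for s x
  proof -
    have "(\<forall>i\<in>{1..d}. f r (fst x i) = f s i) \<longleftrightarrow> (\<forall>i\<in>{1..d}. r (fst x i) = s i)"
    proof (rule ball_cong[OF refl])
      fix i assume i: "i \<in> {1..d}"
      have "h (r (fst x i)) = h (s i) \<longleftrightarrow> r (fst x i) = s i" using hh by metis
      then show "f r (fst x i) = f s i \<longleftrightarrow> r (fst x i) = s i"
        using i perm_mem[OF lpermsD(1)[OF x] i] by (simp add: f_def)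
    qed
    then show ?thesis unfolding match_def kf by simp
  qed
qed

text \<open>
  The outer induction is on the weight, which is bounded by \<open>weight_le\<close>; the inner one sorts
  the rows by length with \<open>swap_rows\<close>, until the content is a family of diagrams.
\<close>

theorem straighten:
  assumes "r \<in> words" "s \<in> words" "cont r = cont s"
  shows "inspan (spairs_ge (weight r) (kword r) (kword s)) (match r s)"
  using assms
proof (induction "card rows * 3 ^ d - weight r" arbitrary: r s rule: less_induct)
  case less
  define w where "w = weight r"
  have IH: "inspan (spairs_ge (weight r') (kword r') (kword s')) (match r' s')"
    if "r' \<in> words" "s' \<in> words" "cont r' = cont s'" "w < weight r'" for r' s'
  proof (rule less.hyps[OF _ that(1-3)])
    show "card rows * 3 ^ d - weight r' < card rows * 3 ^ d - weight r"
      using weight_le[of r'] that by (auto simp: w_def)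
  qed
  have "inspan (spairs_ge w (kword r) (kword s)) (match r s)"
    if "r \<in> words" "s \<in> words" "cont r = cont s" "weight r = w" for r s
    using that
  proof (induction "\<Sum>i\<in>{1..d}. snd (r i)" arbitrary: r s rule: less_induct)
    case less
    show ?case
    proof (cases "part (cont r)")
      case True
      show ?thesis
        by (rule straighten_partition[OF IH]) (use less.prems True in simp_all)
    next
      case False
      then obtain \<kappa> j where lt: "cont r (\<kappa>, j) < cont r (\<kappa>, Suc j)" unfolding part_def by (meson not_le_imp_less)
      note sw = swap_rows[OF less.prems(1) lt]
      let ?f = "\<lambda>r. \<lambda>i\<in>{1..d}. transpose (\<kappa>, j) (\<kappa>, Suc j) (r i)"
      have "cont (?f r) = cont (?f s)" using sw(3)[of r] sw(3)[of s] less.prems(3) by (intro ext) simp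
      moreover have "weight (?f r) = w" using sw(4)[of r] less.prems(4) by simp
      ultimately have "inspan (spairs_ge w (kword (?f r)) (kword (?f s))) (match (?f r) (?f s))"
        using sw(5) sw(1) less.prems(1,2) less.hyps by blast
      then show ?thesis unfolding sw(2) by (rule inspan_cong) (rule sw(6))
    qed
  qed
  from this[OF less.prems] show ?case by (simp add: w_def)
qed

text \<open>
  The form of straightening that axiom (C3) needs: the coefficients \<open>q\<close> do not depend on the
  right word.
\<close>

theorem straighten_left:
  assumes "r \<in> words" "part (cont r)"
  shows "\<exists>q. \<forall>s\<in>words. cont s = cont r \<longrightarrow>
      inspan (spairs_ge (Suc (weight r)) (kword r) (kword s))
        (\<lambda>x. match r s x - (\<Sum>t\<in>std_like r. q t * match t s x))"
  using straighten_left_step[OF straighten assms refl] by blast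

section \<open>Matching functions of standard pairs as an integral basis\<close>

lemma spairs_eq: "spairs = {(r, s). r \<in> ywords I d \<and> s \<in> ywords I d \<and> cont r = cont s}"
proof -
  have "r \<in> words \<and> std r \<longleftrightarrow> r \<in> ywords I d" for r
  proof
    assume "r \<in> words \<and> std r"
    then show "r \<in> ywords I d"
      using words_fst[of r] words_ext[of r] by (auto simp: ywords_def std_def PiE_iff extensional_def mem_Times_iff)
  next
    assume r: "r \<in> ywords I d"
    then have E: "r \<in> {1..d} \<rightarrow>\<^sub>E I \<times> UNIV" and "std r" by (auto simp: ywords_def std_def)
    have "r i \<in> rows" if i: "i \<in> {1..d}" for i
    proof -
      obtain \<kappa> j where e: "r i = (\<kappa>, j)" by (cases "r i")
      then have "0 < cont r (\<kappa>, j)" using i by (auto simp: wcont_def card_gt_0_iff)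
      then have "j < d" using part_row_less[OF ywords_wcont(1)[OF r]] by blast
      then show ?thesis using e PiE_mem[OF E i] by (simp add: rows_def)
    qed
    then show "r \<in> words \<and> std r" using E \<open>std r\<close> by (auto simp: words_def PiE_iff)
  qed
  then show ?thesis unfolding spairs_def by blast
qed

lemma finite_lperms: "finite lperms"
  unfolding lperms_def using finite_I by (intro finite_cartesian_product finite_permutations finite_PiE) auto

lemma card_lperms: "card lperms = card spairs"
proof -
  have "card lperms = fact d * card I ^ d"
    unfolding lperms_def by (simp add: card_cartesian_product card_permutations card_PiE)
  also have "\<dots> = card spairs" unfolding spairs_eq using card_yword_pairs[OF finite_I] by simp
  finally show ?thesis .
qed

text \<open>
  The functions on coloured permutations have two families of equal size: the indicators of
  points, and the matching functions of standard pairs (\<open>card_lperms\<close>). Straightening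
  expresses each indicator by the second family with integral coefficients \<open>Q\<close>, and a
  one-sided inverse of a square matrix is two-sided. The last conclusion records that
  straightening preserves the colours at both ends.
\<close>

theorem std_pairs_invertible:
  obtains Q where
    "\<And>x x'. x \<in> lperms \<Longrightarrow> x' \<in> lperms \<Longrightarrow>
      (\<Sum>y\<in>spairs. Q x y * match (fst y) (snd y) x') = (if x = x' then 1 else 0)"
    "\<And>y y'. y \<in> spairs \<Longrightarrow> y' \<in> spairs \<Longrightarrow>
      (\<Sum>x\<in>lperms. match (fst y) (snd y) x * Q x y') = (if y = y' then 1 else 0)"
    "\<And>x y. Q x y \<noteq> 0 \<Longrightarrow> kword (fst y) = snd x \<and> kword (snd y) = (\<lambda>i\<in>{1..d}. snd x (fst x i))"
proof -
  have "\<exists>c. (\<forall>x'\<in>lperms. (\<Sum>y\<in>spairs. c y * match (fst y) (snd y) x') = (if x = x' then 1 else 0)) \<and>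
     (\<forall>y. c y \<noteq> 0 \<longrightarrow> kword (fst y) = snd x \<and> kword (snd y) = (\<lambda>i\<in>{1..d}. snd x (fst x i)))"
    if x: "x \<in> lperms" for x
  proof -
    note xx = lpermsD[OF x]
    (* The indicator of x is the matching function of two words whose letters are all distinct. *)
    define r where "r = (\<lambda>i\<in>{1..d}. (snd x i, i))"
    define s where "s = (\<lambda>i\<in>{1..d}. r (fst x i))"
    have r: "r \<in> words" unfolding r_def using PiE_mem[OF xx(2)] by (intro words_restrict) (auto simp: rows_def)
    have s: "s \<in> words" unfolding s_def by (rule words_perm[OF xx(1) r])
    have c: "cont r = cont s" unfolding s_def using cont_perm[OF xx(1)] by simp
    have kr: "kword r = snd x" using PiE_arb[OF xx(2)] by (auto simp: kword_def r_def fun_eq_iff)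
    have ks: "kword s = (\<lambda>i\<in>{1..d}. snd x (fst x i))"
      using perm_mem[OF xx(1)] by (auto simp: kword_def s_def r_def fun_eq_iff)
    have m: "match r s x' = (if x = x' then 1 else 0)" if x': "x' \<in> lperms" for x'
    proof -
      note xx' = lpermsD[OF x']
      have "x = x'" if h: "snd x = snd x'" "\<forall>i\<in>{1..d}. r (fst x' i) = s i"
      proof -
        have "fst x' i = fst x i" for i
        proof (cases "i \<in> {1..d}")
          case True
          then have "r (fst x' i) = r (fst x i)" using h(2) by (simp add: s_def)
          then show ?thesis using perm_mem[OF xx(1) True] perm_mem[OF xx'(1) True] by (simp add: r_def)
        next
          case False then show ?thesis using xx(1) xx'(1) by (simp add: permutes_def)
        qed
        then show ?thesis using h(1) by (auto simp: prod_eq_iff)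
      qed
      moreover have "\<forall>i\<in>{1..d}. r (fst x i) = s i" by (simp add: s_def)
      ultimately show ?thesis unfolding match_def kr by auto
    qed
    let ?Z = "spairs_ge (weight r) (kword r) (kword s)"
    from straighten[OF r s c] obtain e where
      e: "\<And>x'. x' \<in> lperms \<Longrightarrow> match r s x' = (\<Sum>y\<in>?Z. e y * match (fst y) (snd y) x')"
      unfolding inspan_def by blast
    define c where "c y = (if y \<in> ?Z then e y else 0)" for y
    have "(\<Sum>y\<in>spairs. c y * match (fst y) (snd y) x') = (\<Sum>y\<in>?Z. e y * match (fst y) (snd y) x')" for x'
      by (rule sum.mono_neutral_cong_right) (auto simp: c_def finite_spairs spairs_ge_def)
    then have "\<forall>x'\<in>lperms. (\<Sum>y\<in>spairs. c y * match (fst y) (snd y) x') = (if x = x' then 1 else 0)"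
      using e m by simp
    moreover have "kword (fst y) = snd x \<and> kword (snd y) = (\<lambda>i\<in>{1..d}. snd x (fst x i))" if "c y \<noteq> 0" for y
      using that kr ks by (cases y) (auto simp: c_def spairs_ge_def split: if_splits)
    ultimately show ?thesis by blast
  qed
  then have "\<forall>x\<in>lperms. \<exists>c. (\<forall>x'\<in>lperms. (\<Sum>y\<in>spairs. c y * match (fst y) (snd y) x') = (if x = x' then 1 else 0)) \<and>
     (\<forall>y. c y \<noteq> 0 \<longrightarrow> kword (fst y) = snd x \<and> kword (snd y) = (\<lambda>i\<in>{1..d}. snd x (fst x i)))" by blast
  from bchoice[OF this] obtain q where
    q: "\<forall>x\<in>lperms. (\<forall>x'\<in>lperms. (\<Sum>y\<in>spairs. q x y * match (fst y) (snd y) x') = (if x = x' then 1 else 0)) \<and>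
     (\<forall>y. q x y \<noteq> 0 \<longrightarrow> kword (fst y) = snd x \<and> kword (snd y) = (\<lambda>i\<in>{1..d}. snd x (fst x i)))" by blast
  define Q where "Q x y = (if x \<in> lperms then q x y else 0)" for x y
  have Q1: "(\<Sum>y\<in>spairs. Q x y * match (fst y) (snd y) x') = (if x = x' then 1 else 0)"
    if "x \<in> lperms" "x' \<in> lperms" for x x' using q that by (simp add: Q_def)
  have Q2: "(\<Sum>x\<in>lperms. match (fst y) (snd y) x * Q x y') = (if y = y' then 1 else 0)"
    if "y \<in> spairs" "y' \<in> spairs" for y y'
    by (rule integer_inverse_commute[OF finite_lperms finite_spairs card_lperms Q1 that])
  have Q3: "kword (fst y) = snd x \<and> kword (snd y) = (\<lambda>i\<in>{1..d}. snd x (fst x i))" if "Q x y \<noteq> 0" for x y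
    using q that unfolding Q_def by meson
  from that[OF Q1 Q2 Q3] show thesis .
qed

end

section \<open>Linear maps and spanning sets\<close>

lemma module_homI:
  assumes "\<And>x. x \<in> carrier M \<Longrightarrow> h x \<in> carrier N"
    and "\<And>x y. x \<in> carrier M \<Longrightarrow> y \<in> carrier M \<Longrightarrow> h (x \<oplus>\<^bsub>M\<^esub> y) = h x \<oplus>\<^bsub>N\<^esub> h y"
    and "\<And>r x. r \<in> carrier R \<Longrightarrow> x \<in> carrier M \<Longrightarrow> h (r \<odot>\<^bsub>M\<^esub> x) = r \<odot>\<^bsub>N\<^esub> h x"
  shows "h \<in> module_hom R M N"
  using assms by (auto simp: module_hom_def)

lemma module_homD:
  assumes "h \<in> module_hom R M N"
  shows "\<And>x. x \<in> carrier M \<Longrightarrow> h x \<in> carrier N"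
    and "\<And>x y. x \<in> carrier M \<Longrightarrow> y \<in> carrier M \<Longrightarrow> h (x \<oplus>\<^bsub>M\<^esub> y) = h x \<oplus>\<^bsub>N\<^esub> h y"
    and "\<And>r x. r \<in> carrier R \<Longrightarrow> x \<in> carrier M \<Longrightarrow> h (r \<odot>\<^bsub>M\<^esub> x) = r \<odot>\<^bsub>N\<^esub> h x"
  using assms by (auto simp: module_hom_def)

lemma module_hom_zero:
  assumes "module R M" "module R N" "h \<in> module_hom R M N" shows "h \<zero>\<^bsub>M\<^esub> = \<zero>\<^bsub>N\<^esub>"
proof -
  interpret M: module R M by fact
  interpret N: module R N by fact
  note h = module_homD[OF assms(3)]
  have "h (\<zero>\<^bsub>R\<^esub> \<odot>\<^bsub>M\<^esub> \<zero>\<^bsub>M\<^esub>) = \<zero>\<^bsub>R\<^esub> \<odot>\<^bsub>N\<^esub> h \<zero>\<^bsub>M\<^esub>" by (rule h(3)) auto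
  then show ?thesis using h(1)[of "\<zero>\<^bsub>M\<^esub>"] by simp
qed

lemma module_hom_finsum:
  assumes "module R M" "module R N" "h \<in> module_hom R M N" "f \<in> B \<rightarrow> carrier M"
  shows "h (\<Oplus>\<^bsub>M\<^esub>i\<in>B. f i) = (\<Oplus>\<^bsub>N\<^esub>i\<in>B. h (f i))"
proof -
  interpret M: module R M by fact
  interpret N: module R N by fact
  note h = module_homD[OF assms(3)]
  show ?thesis
    using assms(4)
  proof (induction B rule: infinite_finite_induct)
    case (infinite B)
    then show ?case using module_hom_zero[OF assms(1-3)] by simp
  next
    case empty
    then show ?case using module_hom_zero[OF assms(1-3)] by simp
  next
    case (insert x B)
    have f: "f x \<in> carrier M" "f \<in> B \<rightarrow> carrier M" using insert by auto
    then have hf: "h (f x) \<in> carrier N" "(\<lambda>i. h (f i)) \<in> B \<rightarrow> carrier N" using h(1) by auto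
    show ?case using insert f hf by (simp add: h(2))
  qed
qed

lemma module_hom_compose:
  "g \<in> module_hom R M N \<Longrightarrow> h \<in> module_hom R N L \<Longrightarrow> (\<lambda>x. h (g x)) \<in> module_hom R M L"
  by (auto simp: module_hom_def Pi_iff)

lemma (in module) submodule_if_closed:
  assumes "H \<subseteq> carrier M" "\<zero>\<^bsub>M\<^esub> \<in> H"
    and add: "\<And>a b. \<lbrakk>a \<in> H; b \<in> H\<rbrakk> \<Longrightarrow> a \<oplus>\<^bsub>M\<^esub> b \<in> H"
    and smult: "\<And>a x. \<lbrakk>a \<in> carrier R; x \<in> H\<rbrakk> \<Longrightarrow> a \<odot>\<^bsub>M\<^esub> x \<in> H"
  shows "submodule H R M"
proof (rule submoduleI)
  fix a assume a: "a \<in> H"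
  then have "a \<in> carrier M" using assms(1) by blast
  then have "\<ominus>\<^bsub>M\<^esub> a = (\<ominus> \<one>) \<odot>\<^bsub>M\<^esub> a" by (simp add: smult_l_minus)
  then show "\<ominus>\<^bsub>M\<^esub> a \<in> H" using smult a by simp
qed (use assms in auto)

lemma (in module) submodule_zero: "submodule H R M \<Longrightarrow> \<zero>\<^bsub>M\<^esub> \<in> H"
  by (drule submodule.axioms(1), drule subgroup.one_closed) simp

lemma (in module) submodule_finsum:
  assumes "submodule H R M" "\<And>i. i \<in> B \<Longrightarrow> f i \<in> H" shows "(\<Oplus>\<^bsub>M\<^esub>i\<in>B. f i) \<in> H"
proof -
  note HE = submoduleE[OF assms(1)]
  show ?thesis
    using assms(2)
  proof (induction B rule: infinite_finite_induct)
    case (insert x B)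
    then have "f x \<in> carrier M" "f \<in> B \<rightarrow> carrier M" using HE(1) by auto
    then show ?case using insert HE(5) by simp
  qed (use submodule_zero[OF assms(1)] in auto)
qed

definition spans :: "('k, 'r) ring_scheme \<Rightarrow> ('k, 'a, 'm) module_scheme \<Rightarrow> 'a set \<Rightarrow> bool" where
  "spans R M S \<longleftrightarrow> S \<subseteq> carrier M \<and> (\<forall>H. submodule H R M \<and> S \<subseteq> H \<longrightarrow> carrier M \<subseteq> H)"

lemma spans_induct:
  assumes "module R M" "spans R M S" "x \<in> carrier M"
    and "\<And>s. s \<in> S \<Longrightarrow> P s" and "P \<zero>\<^bsub>M\<^esub>"
    and "\<And>x y. \<lbrakk>x \<in> carrier M; y \<in> carrier M; P x; P y\<rbrakk> \<Longrightarrow> P (x \<oplus>\<^bsub>M\<^esub> y)"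
    and "\<And>r x. \<lbrakk>r \<in> carrier R; x \<in> carrier M; P x\<rbrakk> \<Longrightarrow> P (r \<odot>\<^bsub>M\<^esub> x)"
  shows "P x"
proof -
  interpret module R M by fact
  have "submodule {x \<in> carrier M. P x} R M" by (rule submodule_if_closed) (use assms in auto)
  moreover have "S \<subseteq> {x \<in> carrier M. P x}" using assms(2,4) by (auto simp: spans_def)
  ultimately have "carrier M \<subseteq> {x \<in> carrier M. P x}" using assms(2) unfolding spans_def by blast
  then show ?thesis using assms(3) by blast
qed

text \<open>
  Most identities below hold between expressions that are linear in each argument, and are
  checked on spanning sets with this lemma.
\<close>

lemma module_hom_eq_on_span:
  assumes "module R M" "module R N" "spans R M S" "g \<in> module_hom R M N" "h \<in> module_hom R M N"
    and "\<And>s. s \<in> S \<Longrightarrow> g s = h s" and "x \<in> carrier M"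
  shows "g x = h x"
  using assms(1,3,7)
proof (rule spans_induct)
  show "g \<zero>\<^bsub>M\<^esub> = h \<zero>\<^bsub>M\<^esub>" using module_hom_zero assms(1,2,4,5) by metis
qed (use assms(6) module_homD[OF assms(4)] module_homD[OF assms(5)] in simp_all)

section \<open>Associative algebras\<close>

text \<open>
  Algebras without the finiteness condition, so that the monoid algebra of all tuples, of
  which the tensor power is a quotient, is included.
\<close>

locale assoc_algebra = module R A + ring A
  for R :: "('k, 'r) ring_scheme" (structure) and A :: "('k, 'a, 'm) module_scheme" (structure) +
  assumes smult_mult_left:
      "\<lbrakk>r \<in> carrier R; x \<in> carrier A; y \<in> carrier A\<rbrakk> \<Longrightarrow>
         (r \<odot>\<^bsub>A\<^esub> x) \<otimes>\<^bsub>A\<^esub> y = r \<odot>\<^bsub>A\<^esub> (x \<otimes>\<^bsub>A\<^esub> y)"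
    and smult_mult_right:
      "\<lbrakk>r \<in> carrier R; x \<in> carrier A; y \<in> carrier A\<rbrakk> \<Longrightarrow>
         x \<otimes>\<^bsub>A\<^esub> (r \<odot>\<^bsub>A\<^esub> y) = r \<odot>\<^bsub>A\<^esub> (x \<otimes>\<^bsub>A\<^esub> y)"

lemma fgp_algebra_iff: "fgp_algebra R A \<longleftrightarrow> assoc_algebra R A \<and> fg_projective R A"
  unfolding fgp_algebra_def assoc_algebra_def fgp_algebra_axioms_def assoc_algebra_axioms_def by blast

context assoc_algebra begin

end

text \<open>
  Both sides of the associative law are linear in each of the three arguments, so it suffices
  to check it on a spanning set.
\<close>

lemma assoc_algebraI_span:
  fixes R (structure) and M (structure)
  assumes mod: "module R M" and S: "spans R M S"
    and closed: "\<And>x y. \<lbrakk>x \<in> carrier M; y \<in> carrier M\<rbrakk> \<Longrightarrow> x \<otimes>\<^bsub>M\<^esub> y \<in> carrier M"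
    and lhom: "\<And>y. y \<in> carrier M \<Longrightarrow> (\<lambda>x. x \<otimes>\<^bsub>M\<^esub> y) \<in> module_hom R M M"
    and rhom: "\<And>x. x \<in> carrier M \<Longrightarrow> (\<lambda>y. x \<otimes>\<^bsub>M\<^esub> y) \<in> module_hom R M M"
    and one: "\<one>\<^bsub>M\<^esub> \<in> carrier M" "\<And>x. x \<in> S \<Longrightarrow> \<one>\<^bsub>M\<^esub> \<otimes>\<^bsub>M\<^esub> x = x" "\<And>x. x \<in> S \<Longrightarrow> x \<otimes>\<^bsub>M\<^esub> \<one>\<^bsub>M\<^esub> = x"
    and assoc: "\<And>x y z. \<lbrakk>x \<in> S; y \<in> S; z \<in> S\<rbrakk> \<Longrightarrow> (x \<otimes>\<^bsub>M\<^esub> y) \<otimes>\<^bsub>M\<^esub> z = x \<otimes>\<^bsub>M\<^esub> (y \<otimes>\<^bsub>M\<^esub> z)"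
  shows "assoc_algebra R M"
proof -
  interpret M: module R M by fact
  note eqI = module_hom_eq_on_span[OF mod mod S]
  have SM: "x \<in> carrier M" if "x \<in> S" for x using S that by (auto simp: spans_def)
  have idh: "(\<lambda>x. x) \<in> module_hom R M M" by (simp add: module_hom_def)
  have l1: "\<one>\<^bsub>M\<^esub> \<otimes>\<^bsub>M\<^esub> x = x" if "x \<in> carrier M" for x
    by (rule eqI[OF rhom[OF one(1)] idh one(2) that])
  have r1: "x \<otimes>\<^bsub>M\<^esub> \<one>\<^bsub>M\<^esub> = x" if "x \<in> carrier M" for x
    by (rule eqI[OF lhom[OF one(1)] idh one(3) that])
  have a1: "(x \<otimes>\<^bsub>M\<^esub> y) \<otimes>\<^bsub>M\<^esub> z = x \<otimes>\<^bsub>M\<^esub> (y \<otimes>\<^bsub>M\<^esub> z)" if "x \<in> S" "y \<in> S" "z \<in> carrier M" for x y z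
    by (rule eqI[OF rhom[OF closed] module_hom_compose[OF rhom rhom] assoc])
      (use that SM in auto)
  have a2: "(x \<otimes>\<^bsub>M\<^esub> y) \<otimes>\<^bsub>M\<^esub> z = x \<otimes>\<^bsub>M\<^esub> (y \<otimes>\<^bsub>M\<^esub> z)" if "x \<in> S" "y \<in> carrier M" "z \<in> carrier M" for x y z
    by (rule eqI[OF module_hom_compose[OF rhom lhom] module_hom_compose[OF lhom rhom] a1])
      (use that SM in auto)
  have a3: "(x \<otimes>\<^bsub>M\<^esub> y) \<otimes>\<^bsub>M\<^esub> z = x \<otimes>\<^bsub>M\<^esub> (y \<otimes>\<^bsub>M\<^esub> z)" if "x \<in> carrier M" "y \<in> carrier M" "z \<in> carrier M" for x y z
    by (rule eqI[OF module_hom_compose[OF lhom lhom] lhom[OF closed] a2])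
      (use that SM in auto)
  note l = module_homD[OF lhom] and r = module_homD[OF rhom]
  have "ring M"
  proof (rule ringI)
    show "abelian_group M" by (rule M.M.abelian_group_axioms)
    show "monoid M" by (rule monoidI) (use closed one(1) a3 l1 r1 in auto)
  qed (use l(2) r(2) in auto)
  moreover have "assoc_algebra_axioms R M" by (rule assoc_algebra_axioms.intro) (use l(3) r(3) in auto)
  ultimately show ?thesis using mod by (intro assoc_algebra.intro)
qed

lemma assoc_algebra_surj:
  fixes R (structure) and P (structure) and V (structure)
  assumes "assoc_algebra R P" and surj: "\<pi> ` carrier P = carrier V"
    and add: "\<And>x y. \<lbrakk>x \<in> carrier P; y \<in> carrier P\<rbrakk> \<Longrightarrow> \<pi> (x \<oplus>\<^bsub>P\<^esub> y) = \<pi> x \<oplus>\<^bsub>V\<^esub> \<pi> y"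
    and mult: "\<And>x y. \<lbrakk>x \<in> carrier P; y \<in> carrier P\<rbrakk> \<Longrightarrow> \<pi> (x \<otimes>\<^bsub>P\<^esub> y) = \<pi> x \<otimes>\<^bsub>V\<^esub> \<pi> y"
    and smult: "\<And>r x. \<lbrakk>r \<in> carrier R; x \<in> carrier P\<rbrakk> \<Longrightarrow> \<pi> (r \<odot>\<^bsub>P\<^esub> x) = r \<odot>\<^bsub>V\<^esub> \<pi> x"
    and zero: "\<pi> \<zero>\<^bsub>P\<^esub> = \<zero>\<^bsub>V\<^esub>" and one: "\<pi> \<one>\<^bsub>P\<^esub> = \<one>\<^bsub>V\<^esub>"
  shows "assoc_algebra R V"
proof -
  interpret P: assoc_algebra R P by fact
  have pre: "\<exists>x\<in>carrier P. v = \<pi> x" if "v \<in> carrier V" for v using surj that by blast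
  have cl: "\<pi> x \<in> carrier V" if "x \<in> carrier P" for x using surj that by blast
  note hom = add[symmetric] mult[symmetric] smult[symmetric] zero[symmetric] one[symmetric]
  have ab: "abelian_group V"
  proof (rule abelian_groupI)
    show "\<zero>\<^bsub>V\<^esub> \<in> carrier V" using cl[OF P.zero_closed] zero by simp
    show "\<exists>y\<in>carrier V. y \<oplus>\<^bsub>V\<^esub> x = \<zero>\<^bsub>V\<^esub>" if "x \<in> carrier V" for x
    proof -
      obtain p where p: "p \<in> carrier P" "x = \<pi> p" using pre \<open>x \<in> carrier V\<close> by blast
      have "\<pi> (\<ominus>\<^bsub>P\<^esub> p) \<oplus>\<^bsub>V\<^esub> x = \<zero>\<^bsub>V\<^esub>"
        using p by (simp add: hom P.l_neg)
      then show ?thesis using cl[of "\<ominus>\<^bsub>P\<^esub> p"] p by blast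
    qed
  qed (auto dest!: pre simp: hom cl P.a_ac)
  have mon: "monoid V"
    by (rule monoidI) (auto dest!: pre simp: hom cl P.m_assoc)
  have ring: "ring V"
    by (rule ringI[OF ab mon]) (auto dest!: pre simp: hom cl P.l_distr P.r_distr)
  have mod: "module R V"
    by (rule moduleI[OF P.R.is_cring ab]) (auto dest!: pre simp: hom cl P.smult_l_distr P.smult_r_distr P.smult_assoc1)
  show ?thesis
    by (rule assoc_algebra.intro[OF mod ring], rule assoc_algebra_axioms.intro)
      (auto dest!: pre simp: hom cl P.smult_mult_left P.smult_mult_right)
qed

section \<open>Free modules\<close>

definition supp :: "('k, 'r) ring_scheme \<Rightarrow> 'x set \<Rightarrow> ('x \<Rightarrow> 'k) \<Rightarrow> 'x set" where
  "supp R B f = {x \<in> B. f x \<noteq> \<zero>\<^bsub>R\<^esub>}"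

definition lin_ext :: "('k, 'r) ring_scheme \<Rightarrow> 'x set \<Rightarrow> ('k, 'a, 'm) module_scheme \<Rightarrow> ('x \<Rightarrow> 'a) \<Rightarrow> ('x \<Rightarrow> 'k) \<Rightarrow> 'a" where
  "lin_ext R B M m f = (\<Oplus>\<^bsub>M\<^esub>x\<in>supp R B f. f x \<odot>\<^bsub>M\<^esub> m x)"

text \<open>
  Finitely supported functions with pointwise operations: the common part of free modules and
  monoid algebras. Only the module structure is prescribed, so that \<open>F\<close> may carry a
  multiplication.
\<close>

locale fun_module = cring R for R :: "('k, 'r) ring_scheme" (structure) +
  fixes B :: "'x set" and F :: "('k, 'x \<Rightarrow> 'k, 'm) module_scheme"
  assumes carrier_F: "carrier F = {f \<in> B \<rightarrow>\<^sub>E carrier R. finite (supp R B f)}"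
    and zero_F: "\<zero>\<^bsub>F\<^esub> = (\<lambda>x\<in>B. \<zero>)"
    and add_F: "f \<oplus>\<^bsub>F\<^esub> g = (\<lambda>x\<in>B. f x \<oplus> g x)"
    and smult_F: "r \<odot>\<^bsub>F\<^esub> f = (\<lambda>x\<in>B. r \<otimes> f x)"
begin

lemma F_mem: "f \<in> carrier F \<Longrightarrow> x \<in> B \<Longrightarrow> f x \<in> carrier R"
  by (auto simp: carrier_F dest: PiE_mem)

lemma F_fin: "f \<in> carrier F \<Longrightarrow> finite (supp R B f)"
  by (simp add: carrier_F)

lemmas F_fin' = F_fin[unfolded supp_def]

lemma add_F_app: "x \<in> B \<Longrightarrow> (f \<oplus>\<^bsub>F\<^esub> g) x = f x \<oplus> g x"
  and smult_F_app: "x \<in> B \<Longrightarrow> (r \<odot>\<^bsub>F\<^esub> f) x = r \<otimes> f x"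
  and zero_F_app: "x \<in> B \<Longrightarrow> \<zero>\<^bsub>F\<^esub> x = \<zero>"
  by (simp_all add: add_F smult_F zero_F)

lemma F_eqI:
  assumes "f \<in> carrier F" "g \<in> carrier F" "\<And>x. x \<in> B \<Longrightarrow> f x = g x" shows "f = g"
proof -
  have "f \<in> B \<rightarrow>\<^sub>E carrier R" "g \<in> B \<rightarrow>\<^sub>E carrier R" using assms(1,2) by (auto simp: carrier_F)
  then show ?thesis using assms(3) by (rule PiE_ext)
qed

lemma F_I: "(\<And>x. x \<in> B \<Longrightarrow> f x \<in> carrier R) \<Longrightarrow> finite X \<Longrightarrow> (\<And>x. x \<in> B \<Longrightarrow> x \<notin> X \<Longrightarrow> f x = \<zero>) \<Longrightarrow>
    (\<lambda>x\<in>B. f x) \<in> carrier F"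
  unfolding carrier_F by (auto simp: supp_def intro: finite_subset[of _ X])

lemma add_F_closed: "f \<in> carrier F \<Longrightarrow> g \<in> carrier F \<Longrightarrow> f \<oplus>\<^bsub>F\<^esub> g \<in> carrier F"
  unfolding add_F by (rule F_I[of _ "supp R B f \<union> supp R B g"]) (auto simp: F_mem F_fin' supp_def)

lemma smult_F_closed: "r \<in> carrier R \<Longrightarrow> f \<in> carrier F \<Longrightarrow> r \<odot>\<^bsub>F\<^esub> f \<in> carrier F"
  unfolding smult_F by (rule F_I[of _ "supp R B f"]) (auto simp: F_mem F_fin' supp_def)

lemma zero_F_closed: "\<zero>\<^bsub>F\<^esub> \<in> carrier F"
  unfolding zero_F by (rule F_I[of _ "{}"]) auto

lemma module_F: "module R F"
proof (rule moduleI)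
  show "abelian_group F"
  proof (rule abelian_groupI)
    show "\<exists>g\<in>carrier F. g \<oplus>\<^bsub>F\<^esub> f = \<zero>\<^bsub>F\<^esub>" if f: "f \<in> carrier F" for f
    proof
      show "(\<ominus> \<one>) \<odot>\<^bsub>F\<^esub> f \<in> carrier F" using f by (simp add: smult_F_closed)
      show "(\<ominus> \<one>) \<odot>\<^bsub>F\<^esub> f \<oplus>\<^bsub>F\<^esub> f = \<zero>\<^bsub>F\<^esub>"
        using f by (intro F_eqI add_F_closed smult_F_closed zero_F_closed)
          (auto simp: add_F smult_F zero_F F_mem l_minus l_neg)
    qed
  next
    fix f g h assume "f \<in> carrier F" "g \<in> carrier F" "h \<in> carrier F"
    then show "f \<oplus>\<^bsub>F\<^esub> g \<oplus>\<^bsub>F\<^esub> h = f \<oplus>\<^bsub>F\<^esub> (g \<oplus>\<^bsub>F\<^esub> h)"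
      by (intro F_eqI add_F_closed) (auto simp: add_F F_mem a_assoc)
  next
    fix f g assume "f \<in> carrier F" "g \<in> carrier F"
    then show "f \<oplus>\<^bsub>F\<^esub> g = g \<oplus>\<^bsub>F\<^esub> f"
      by (intro F_eqI add_F_closed) (auto simp: add_F F_mem a_comm)
  next
    fix f assume "f \<in> carrier F"
    then show "\<zero>\<^bsub>F\<^esub> \<oplus>\<^bsub>F\<^esub> f = f"
      by (intro F_eqI add_F_closed zero_F_closed) (auto simp: add_F zero_F F_mem)
  qed (auto intro: add_F_closed zero_F_closed)
next
  show "cring R" by (rule is_cring)
next
  fix a b f assume "a \<in> carrier R" "b \<in> carrier R" "f \<in> carrier F"
  then show "(a \<oplus> b) \<odot>\<^bsub>F\<^esub> f = a \<odot>\<^bsub>F\<^esub> f \<oplus>\<^bsub>F\<^esub> b \<odot>\<^bsub>F\<^esub> f" "(a \<otimes> b) \<odot>\<^bsub>F\<^esub> f = a \<odot>\<^bsub>F\<^esub> (b \<odot>\<^bsub>F\<^esub> f)"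
    by (intro F_eqI, simp_all add: add_F_closed smult_F_closed add_F_app smult_F_app F_mem l_distr m_assoc)+
next
  fix a f g assume "a \<in> carrier R" "f \<in> carrier F" "g \<in> carrier F"
  then show "a \<odot>\<^bsub>F\<^esub> (f \<oplus>\<^bsub>F\<^esub> g) = a \<odot>\<^bsub>F\<^esub> f \<oplus>\<^bsub>F\<^esub> a \<odot>\<^bsub>F\<^esub> g"
    by (intro F_eqI) (simp_all add: add_F_closed smult_F_closed add_F_app smult_F_app F_mem r_distr)
next
  fix f assume "f \<in> carrier F"
  then show "\<one> \<odot>\<^bsub>F\<^esub> f = f"
    by (intro F_eqI) (simp_all add: smult_F_closed smult_F_app F_mem)
qed (auto intro: smult_F_closed)

lemma gen_closed: "x \<in> B \<Longrightarrow> free_gen R B x \<in> carrier F"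
  unfolding free_gen_def by (rule F_I[of _ "{x}"]) auto

lemma F_spans: "spans R F (free_gen R B ` B)"
  unfolding spans_def
proof (intro conjI allI impI subsetI)
  show "f \<in> carrier F" if "f \<in> free_gen R B ` B" for f using that gen_closed by auto
  fix H f assume H: "submodule H R F \<and> free_gen R B ` B \<subseteq> H" and "f \<in> carrier F"
  interpret M: module R F by (rule module_F)
  note HE = M.submoduleE[OF conjunct1[OF H]]
  have zH: "\<zero>\<^bsub>F\<^esub> \<in> H" by (rule M.submodule_zero[OF conjunct1[OF H]])
  have "finite X \<Longrightarrow> X \<subseteq> B \<Longrightarrow> f \<in> carrier F \<Longrightarrow> supp R B f \<subseteq> X \<Longrightarrow> f \<in> H" for X f
  proof (induction X arbitrary: f rule: finite_induct)
    case empty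
    then have "f = \<zero>\<^bsub>F\<^esub>" by (intro F_eqI zero_F_closed) (auto simp: zero_F supp_def)
    then show ?case using zH by simp
  next
    case (insert x X)
    define g where "g = (\<lambda>y\<in>B. if y = x then \<zero> else f y)"
    have xB: "x \<in> B" using insert by auto
    have g: "g \<in> carrier F" unfolding g_def
      by (rule F_I[of _ "supp R B f"]) (use insert.prems in \<open>auto simp: F_mem F_fin' supp_def\<close>)
    have "supp R B g \<subseteq> X" using insert.prems by (auto simp: supp_def g_def)
    then have gH: "g \<in> H" using insert.IH insert.prems g by auto
    have "f = g \<oplus>\<^bsub>F\<^esub> f x \<odot>\<^bsub>F\<^esub> free_gen R B x"
      using insert.prems g xB by (intro F_eqI add_F_closed smult_F_closed gen_closed)
        (auto simp: F_mem add_F smult_F free_gen_def g_def)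
    also have "\<dots> \<in> H" using gH HE H xB insert.prems by (auto simp: F_mem)
    finally show ?case .
  qed
  from this[of "supp R B f" f] show "f \<in> H" using \<open>f \<in> carrier F\<close> F_fin by (auto simp: supp_def)
qed

lemma lin_ext_eq:
  assumes "module R M" "m \<in> B \<rightarrow> carrier M" "f \<in> carrier F" "finite X" "X \<subseteq> B" "supp R B f \<subseteq> X"
  shows "lin_ext R B M m f = (\<Oplus>\<^bsub>M\<^esub>x\<in>X. f x \<odot>\<^bsub>M\<^esub> m x)"
proof -
  interpret M: module R M by fact
  show ?thesis unfolding lin_ext_def
    by (rule M.M.add.finprod_mono_neutral_cong_left)
      (use assms in \<open>auto simp: F_mem supp_def Pi_iff subset_iff\<close>)
qed

lemma lin_ext_hom:
  assumes "module R M" "m \<in> B \<rightarrow> carrier M"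
  shows "lin_ext R B M m \<in> module_hom R F M"
proof -
  interpret M: module R M by fact
  have cl: "(\<lambda>x. f x \<odot>\<^bsub>M\<^esub> m x) \<in> X \<rightarrow> carrier M" if "f \<in> carrier F" "X \<subseteq> B" for f X
    using that assms(2) by (auto simp: F_mem Pi_iff subset_iff)
  have sB: "supp R B f \<subseteq> B" for f by (auto simp: supp_def)
  show ?thesis
  proof (rule module_homI)
    show "lin_ext R B M m f \<in> carrier M" if "f \<in> carrier F" for f
      unfolding lin_ext_def using cl[OF that sB] by (rule M.M.finsum_closed)
  next
    fix f g assume fg: "f \<in> carrier F" "g \<in> carrier F"
    let ?X = "supp R B f \<union> supp R B g"
    have X: "finite ?X" "?X \<subseteq> B" using fg by (auto simp: F_fin sB)
    have s: "supp R B (f \<oplus>\<^bsub>F\<^esub> g) \<subseteq> ?X" using fg by (auto simp: supp_def add_F)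
    have "lin_ext R B M m (f \<oplus>\<^bsub>F\<^esub> g) = (\<Oplus>\<^bsub>M\<^esub>x\<in>?X. (f \<oplus>\<^bsub>F\<^esub> g) x \<odot>\<^bsub>M\<^esub> m x)"
      by (rule lin_ext_eq[OF assms add_F_closed[OF fg] X s])
    also have "\<dots> = (\<Oplus>\<^bsub>M\<^esub>x\<in>?X. f x \<odot>\<^bsub>M\<^esub> m x \<oplus>\<^bsub>M\<^esub> g x \<odot>\<^bsub>M\<^esub> m x)"
      by (rule M.M.finsum_cong') (use X fg assms(2) in \<open>auto simp: add_F F_mem M.smult_l_distr Pi_iff subset_iff\<close>)
    also have "\<dots> = (\<Oplus>\<^bsub>M\<^esub>x\<in>?X. f x \<odot>\<^bsub>M\<^esub> m x) \<oplus>\<^bsub>M\<^esub> (\<Oplus>\<^bsub>M\<^esub>x\<in>?X. g x \<odot>\<^bsub>M\<^esub> m x)"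
      using cl fg X by (intro M.M.finsum_addf) auto
    also have "\<dots> = lin_ext R B M m f \<oplus>\<^bsub>M\<^esub> lin_ext R B M m g"
      using lin_ext_eq[OF assms fg(1) X] lin_ext_eq[OF assms fg(2) X] by simp
    finally show "lin_ext R B M m (f \<oplus>\<^bsub>F\<^esub> g) = lin_ext R B M m f \<oplus>\<^bsub>M\<^esub> lin_ext R B M m g" .
  next
    fix r f assume rf: "r \<in> carrier R" "f \<in> carrier F"
    let ?X = "supp R B f"
    have X: "finite ?X" "?X \<subseteq> B" using rf by (auto simp: F_fin sB)
    have s: "supp R B (r \<odot>\<^bsub>F\<^esub> f) \<subseteq> ?X" using rf by (auto simp: supp_def smult_F)
    have "lin_ext R B M m (r \<odot>\<^bsub>F\<^esub> f) = (\<Oplus>\<^bsub>M\<^esub>x\<in>?X. (r \<odot>\<^bsub>F\<^esub> f) x \<odot>\<^bsub>M\<^esub> m x)"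
      by (rule lin_ext_eq[OF assms smult_F_closed[OF rf] X s])
    also have "\<dots> = (\<Oplus>\<^bsub>M\<^esub>x\<in>?X. r \<odot>\<^bsub>M\<^esub> (f x \<odot>\<^bsub>M\<^esub> m x))"
      by (rule M.M.finsum_cong') (use X rf assms(2) in \<open>auto simp: smult_F F_mem M.smult_assoc1 Pi_iff subset_iff\<close>)
    also have "\<dots> = r \<odot>\<^bsub>M\<^esub> lin_ext R B M m f"
      unfolding lin_ext_def using cl rf X by (intro M.finsum_smult_ldistr[symmetric]) auto
    finally show "lin_ext R B M m (r \<odot>\<^bsub>F\<^esub> f) = r \<odot>\<^bsub>M\<^esub> lin_ext R B M m f" .
  qed
qed

lemma lin_ext_gen:
  assumes "module R M" "m \<in> B \<rightarrow> carrier M" "x \<in> B"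
  shows "lin_ext R B M m (free_gen R B x) = m x"
proof -
  interpret M: module R M by fact
  have "lin_ext R B M m (free_gen R B x) = (\<Oplus>\<^bsub>M\<^esub>y\<in>{x}. free_gen R B x y \<odot>\<^bsub>M\<^esub> m y)"
    by (rule lin_ext_eq[OF assms(1,2) gen_closed]) (use assms(3) in \<open>auto simp: supp_def free_gen_def\<close>)
  also have "\<dots> = m x" using assms by (simp add: free_gen_def Pi_iff)
  finally show ?thesis .
qed

end

lemma fun_module_free: "cring R \<Longrightarrow> fun_module R B (free_module R B)"
  by (intro fun_module.intro fun_module_axioms.intro) (auto simp: free_module_def supp_def)

lemma fun_module_monoid_algebra: "cring R \<Longrightarrow> fun_module R (carrier G) (monoid_algebra R G)"
  by (intro fun_module.intro fun_module_axioms.intro) (auto simp: free_module_def monoid_algebra_def supp_def)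

section \<open>Monoid algebras\<close>

locale monoid_alg = cring R + G: monoid G
  for R :: "('k, 'r) ring_scheme" (structure) and G :: "('x, 'g) monoid_scheme"
begin

abbreviation P where "P \<equiv> monoid_algebra R G"

sublocale F: fun_module R "carrier G" P
  by (rule fun_module_monoid_algebra[OF is_cring])

lemma mult_P:
  "f \<otimes>\<^bsub>P\<^esub> g = (\<lambda>z\<in>carrier G. finsum R (\<lambda>(x, y). f x \<otimes> g y)
     {(x, y) \<in> carrier G \<times> carrier G. x \<otimes>\<^bsub>G\<^esub> y = z \<and> f x \<noteq> \<zero> \<and> g y \<noteq> \<zero>})"
  by (simp add: monoid_algebra_def)

text \<open>
  Any finite sets that contain the supports can serve as index sets. In bilinearity proofs,
  two products with different supports can thus be written as sums over the same set.
\<close>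

lemma mult_P_app:
  assumes f: "f \<in> carrier P" "finite X" "X \<subseteq> carrier G" "supp R (carrier G) f \<subseteq> X"
    and g: "g \<in> carrier P" "finite Y" "Y \<subseteq> carrier G" "supp R (carrier G) g \<subseteq> Y"
    and z: "z \<in> carrier G"
  shows "(f \<otimes>\<^bsub>P\<^esub> g) z = (\<Oplus>p\<in>X \<times> Y. if fst p \<otimes>\<^bsub>G\<^esub> snd p = z then f (fst p) \<otimes> g (snd p) else \<zero>)"
proof -
  have "(f \<otimes>\<^bsub>P\<^esub> g) z = finsum R (\<lambda>(x, y). f x \<otimes> g y)
     {(x, y) \<in> carrier G \<times> carrier G. x \<otimes>\<^bsub>G\<^esub> y = z \<and> f x \<noteq> \<zero> \<and> g y \<noteq> \<zero>}"
    using z by (simp add: mult_P)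
  also have "\<dots> = (\<Oplus>p\<in>X \<times> Y. if fst p \<otimes>\<^bsub>G\<^esub> snd p = z then f (fst p) \<otimes> g (snd p) else \<zero>)"
  proof (rule add.finprod_mono_neutral_cong_left)
    show "finite (X \<times> Y)" using f g by simp
    show "{(x, y) \<in> carrier G \<times> carrier G. x \<otimes>\<^bsub>G\<^esub> y = z \<and> f x \<noteq> \<zero> \<and> g y \<noteq> \<zero>} \<subseteq> X \<times> Y"
      using f(4) g(4) by (auto simp: supp_def)
    show "(\<lambda>p. if fst p \<otimes>\<^bsub>G\<^esub> snd p = z then f (fst p) \<otimes> g (snd p) else \<zero>) \<in> X \<times> Y \<rightarrow> carrier R"
      using f(1,3) g(1,3) by (auto simp: F.F_mem subset_iff)
    fix i
    assume i: "i \<in> X \<times> Y - {(x, y) \<in> carrier G \<times> carrier G. x \<otimes>\<^bsub>G\<^esub> y = z \<and> f x \<noteq> \<zero> \<and> g y \<noteq> \<zero>}"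
    then have "fst i \<in> carrier G" "snd i \<in> carrier G" using f(3) g(3) by auto
    then show "(if fst i \<otimes>\<^bsub>G\<^esub> snd i = z then f (fst i) \<otimes> g (snd i) else \<zero>) = \<zero>"
      using i f(1) g(1) by (cases i) (auto simp: F.F_mem)
  qed auto
  finally show ?thesis .
qed

lemma supp_sub: "supp R (carrier G) f \<subseteq> carrier G" by (auto simp: supp_def)

lemma mult_P_closed:
  assumes f: "f \<in> carrier P" and g: "g \<in> carrier P" shows "f \<otimes>\<^bsub>P\<^esub> g \<in> carrier P"
proof -
  let ?X = "supp R (carrier G) f" and ?Y = "supp R (carrier G) g"
  note app = mult_P_app[OF f F.F_fin[OF f] supp_sub subset_refl g F.F_fin[OF g] supp_sub subset_refl]
  have cl: "(\<lambda>p. if fst p \<otimes>\<^bsub>G\<^esub> snd p = z then f (fst p) \<otimes> g (snd p) else \<zero>) \<in> ?X \<times> ?Y \<rightarrow> carrier R" for z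
    using f g by (auto simp: F.F_mem supp_def)
  have "(\<lambda>z\<in>carrier G. (f \<otimes>\<^bsub>P\<^esub> g) z) \<in> carrier P"
  proof (rule F.F_I[of _ "(\<lambda>p. fst p \<otimes>\<^bsub>G\<^esub> snd p) ` (?X \<times> ?Y)"])
    show "(f \<otimes>\<^bsub>P\<^esub> g) z \<in> carrier R" if "z \<in> carrier G" for z
      unfolding app[OF that] using cl by (rule finsum_closed)
    show "finite ((\<lambda>p. fst p \<otimes>\<^bsub>G\<^esub> snd p) ` (?X \<times> ?Y))" using F.F_fin f g by auto
    show "(f \<otimes>\<^bsub>P\<^esub> g) z = \<zero>" if "z \<in> carrier G" "z \<notin> (\<lambda>p. fst p \<otimes>\<^bsub>G\<^esub> snd p) ` (?X \<times> ?Y)" for z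
      unfolding app[OF that(1)] using that(2) by (intro add.finprod_one_eqI) auto
  qed
  moreover have "(\<lambda>z\<in>carrier G. (f \<otimes>\<^bsub>P\<^esub> g) z) = f \<otimes>\<^bsub>P\<^esub> g" by (auto simp: mult_P)
  ultimately show ?thesis by simp
qed

lemma mult_P_bilinear:
  assumes f: "f \<in> carrier P" and g: "g \<in> carrier P" and h: "h \<in> carrier P" and r: "r \<in> carrier R"
  shows "(f \<oplus>\<^bsub>P\<^esub> g) \<otimes>\<^bsub>P\<^esub> h = f \<otimes>\<^bsub>P\<^esub> h \<oplus>\<^bsub>P\<^esub> g \<otimes>\<^bsub>P\<^esub> h"
    and "h \<otimes>\<^bsub>P\<^esub> (f \<oplus>\<^bsub>P\<^esub> g) = h \<otimes>\<^bsub>P\<^esub> f \<oplus>\<^bsub>P\<^esub> h \<otimes>\<^bsub>P\<^esub> g"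
    and "(r \<odot>\<^bsub>P\<^esub> f) \<otimes>\<^bsub>P\<^esub> h = r \<odot>\<^bsub>P\<^esub> (f \<otimes>\<^bsub>P\<^esub> h)"
    and "h \<otimes>\<^bsub>P\<^esub> (r \<odot>\<^bsub>P\<^esub> f) = r \<odot>\<^bsub>P\<^esub> (h \<otimes>\<^bsub>P\<^esub> f)"
proof -
  let ?X = "supp R (carrier G) f \<union> supp R (carrier G) g" and ?Y = "supp R (carrier G) h"
  have X: "finite ?X" "?X \<subseteq> carrier G" using F.F_fin f g by (auto simp: supp_def)
  have Y: "finite ?Y" "?Y \<subseteq> carrier G" using F.F_fin h by (auto simp: supp_def)
  have X': "supp R (carrier G) f \<subseteq> ?X" "supp R (carrier G) g \<subseteq> ?X"
    "supp R (carrier G) (f \<oplus>\<^bsub>P\<^esub> g) \<subseteq> ?X" "supp R (carrier G) (r \<odot>\<^bsub>P\<^esub> f) \<subseteq> ?X"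
    using r by (auto simp: supp_def F.add_F F.smult_F)
  have mem: "x \<in> carrier G" "f x \<in> carrier R" "g x \<in> carrier R" if "x \<in> ?X" for x
    using that X(2) F.F_mem f g by auto
  have mem': "x \<in> carrier G" "h x \<in> carrier R" if "x \<in> ?Y" for x
    using that Y(2) F.F_mem h by auto
  note mem = mem mem[OF UnI1] mem[OF UnI2]
  note cl = mult_P_closed F.add_F_closed F.smult_F_closed f g h r
  note left = mult_P_app[OF _ X(1,2) _ h Y subset_refl] and right = mult_P_app[OF h Y subset_refl _ X]
  show "(f \<oplus>\<^bsub>P\<^esub> g) \<otimes>\<^bsub>P\<^esub> h = f \<otimes>\<^bsub>P\<^esub> h \<oplus>\<^bsub>P\<^esub> g \<otimes>\<^bsub>P\<^esub> h"
  proof (rule F.F_eqI)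
    fix z assume z: "z \<in> carrier G"
    have "((f \<oplus>\<^bsub>P\<^esub> g) \<otimes>\<^bsub>P\<^esub> h) z
       = (\<Oplus>p\<in>?X \<times> ?Y. (if fst p \<otimes>\<^bsub>G\<^esub> snd p = z then f (fst p) \<otimes> h (snd p) else \<zero>) \<oplus>
            (if fst p \<otimes>\<^bsub>G\<^esub> snd p = z then g (fst p) \<otimes> h (snd p) else \<zero>))"
      by (subst left, use z cl X' in \<open>(simp; fail)+\<close>, rule finsum_cong') (use r in \<open>auto simp: F.add_F_app l_distr mem mem' Pi_iff simp del: Un_iff\<close>)
    also have "\<dots> = (f \<otimes>\<^bsub>P\<^esub> h \<oplus>\<^bsub>P\<^esub> g \<otimes>\<^bsub>P\<^esub> h) z"
      using z cl X' by (simp add: F.add_F_app left, intro finsum_addf) (auto simp: mem mem' simp del: Un_iff)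
    finally show "((f \<oplus>\<^bsub>P\<^esub> g) \<otimes>\<^bsub>P\<^esub> h) z = (f \<otimes>\<^bsub>P\<^esub> h \<oplus>\<^bsub>P\<^esub> g \<otimes>\<^bsub>P\<^esub> h) z" .
  qed (use cl in auto)
  show "h \<otimes>\<^bsub>P\<^esub> (f \<oplus>\<^bsub>P\<^esub> g) = h \<otimes>\<^bsub>P\<^esub> f \<oplus>\<^bsub>P\<^esub> h \<otimes>\<^bsub>P\<^esub> g"
  proof (rule F.F_eqI)
    fix z assume z: "z \<in> carrier G"
    have "(h \<otimes>\<^bsub>P\<^esub> (f \<oplus>\<^bsub>P\<^esub> g)) z
       = (\<Oplus>p\<in>?Y \<times> ?X. (if fst p \<otimes>\<^bsub>G\<^esub> snd p = z then h (fst p) \<otimes> f (snd p) else \<zero>) \<oplus>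
            (if fst p \<otimes>\<^bsub>G\<^esub> snd p = z then h (fst p) \<otimes> g (snd p) else \<zero>))"
      by (subst right, use z cl X' in \<open>(simp; fail)+\<close>, rule finsum_cong') (use r in \<open>auto simp: F.add_F_app r_distr mem mem' Pi_iff simp del: Un_iff\<close>)
    also have "\<dots> = (h \<otimes>\<^bsub>P\<^esub> f \<oplus>\<^bsub>P\<^esub> h \<otimes>\<^bsub>P\<^esub> g) z"
      using z cl X' by (simp add: F.add_F_app right, intro finsum_addf) (auto simp: mem mem' simp del: Un_iff)
    finally show "(h \<otimes>\<^bsub>P\<^esub> (f \<oplus>\<^bsub>P\<^esub> g)) z = (h \<otimes>\<^bsub>P\<^esub> f \<oplus>\<^bsub>P\<^esub> h \<otimes>\<^bsub>P\<^esub> g) z" .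
  qed (use cl in auto)
  show "(r \<odot>\<^bsub>P\<^esub> f) \<otimes>\<^bsub>P\<^esub> h = r \<odot>\<^bsub>P\<^esub> (f \<otimes>\<^bsub>P\<^esub> h)"
  proof (rule F.F_eqI)
    fix z assume z: "z \<in> carrier G"
    have "((r \<odot>\<^bsub>P\<^esub> f) \<otimes>\<^bsub>P\<^esub> h) z
       = (\<Oplus>p\<in>?X \<times> ?Y. r \<otimes> (if fst p \<otimes>\<^bsub>G\<^esub> snd p = z then f (fst p) \<otimes> h (snd p) else \<zero>))"
      by (subst left, use z cl X' in \<open>(simp; fail)+\<close>, rule finsum_cong') (use r in \<open>auto simp: F.smult_F_app m_assoc mem mem' Pi_iff simp del: Un_iff\<close>)
    also have "\<dots> = (r \<odot>\<^bsub>P\<^esub> (f \<otimes>\<^bsub>P\<^esub> h)) z"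
      using z cl X' X Y by (simp add: F.smult_F_app left, intro finsum_rdistr[symmetric]) (auto simp: mem mem' simp del: Un_iff)
    finally show "((r \<odot>\<^bsub>P\<^esub> f) \<otimes>\<^bsub>P\<^esub> h) z = (r \<odot>\<^bsub>P\<^esub> (f \<otimes>\<^bsub>P\<^esub> h)) z" .
  qed (use cl in auto)
  show "h \<otimes>\<^bsub>P\<^esub> (r \<odot>\<^bsub>P\<^esub> f) = r \<odot>\<^bsub>P\<^esub> (h \<otimes>\<^bsub>P\<^esub> f)"
  proof (rule F.F_eqI)
    fix z assume z: "z \<in> carrier G"
    have "(h \<otimes>\<^bsub>P\<^esub> (r \<odot>\<^bsub>P\<^esub> f)) z
       = (\<Oplus>p\<in>?Y \<times> ?X. r \<otimes> (if fst p \<otimes>\<^bsub>G\<^esub> snd p = z then h (fst p) \<otimes> f (snd p) else \<zero>))"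
      by (subst right, use z cl X' in \<open>(simp; fail)+\<close>, rule finsum_cong') (use r in \<open>auto simp: F.smult_F_app m_lcomm mem mem' Pi_iff simp del: Un_iff\<close>)
    also have "\<dots> = (r \<odot>\<^bsub>P\<^esub> (h \<otimes>\<^bsub>P\<^esub> f)) z"
      using z cl X' X Y by (simp add: F.smult_F_app right, intro finsum_rdistr[symmetric]) (auto simp: mem mem' simp del: Un_iff)
    finally show "(h \<otimes>\<^bsub>P\<^esub> (r \<odot>\<^bsub>P\<^esub> f)) z = (r \<odot>\<^bsub>P\<^esub> (h \<otimes>\<^bsub>P\<^esub> f)) z" .
  qed (use cl in auto)
qed

lemma mult_P_gen:
  assumes x: "x \<in> carrier G" and y: "y \<in> carrier G"
  shows "free_gen R (carrier G) x \<otimes>\<^bsub>P\<^esub> free_gen R (carrier G) y = free_gen R (carrier G) (x \<otimes>\<^bsub>G\<^esub> y)"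
proof (rule F.F_eqI)
  fix z assume z: "z \<in> carrier G"
  have "(free_gen R (carrier G) x \<otimes>\<^bsub>P\<^esub> free_gen R (carrier G) y) z
     = (\<Oplus>p\<in>{x} \<times> {y}. if fst p \<otimes>\<^bsub>G\<^esub> snd p = z then free_gen R (carrier G) x (fst p) \<otimes> free_gen R (carrier G) y (snd p) else \<zero>)"
    using x y z by (intro mult_P_app F.gen_closed) (auto simp: supp_def free_gen_def)
  also have "\<dots> = free_gen R (carrier G) (x \<otimes>\<^bsub>G\<^esub> y) z"
    using x y z by (simp add: free_gen_def)
  finally show "(free_gen R (carrier G) x \<otimes>\<^bsub>P\<^esub> free_gen R (carrier G) y) z = free_gen R (carrier G) (x \<otimes>\<^bsub>G\<^esub> y) z" .
qed (use x y in \<open>auto intro!: mult_P_closed F.gen_closed\<close>)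

lemma assoc_algebra_P: "assoc_algebra R P"
proof (rule assoc_algebraI_span[OF F.module_F F.F_spans])
  have one: "\<one>\<^bsub>P\<^esub> = free_gen R (carrier G) \<one>\<^bsub>G\<^esub>" by (simp add: monoid_algebra_def)
  show "\<one>\<^bsub>P\<^esub> \<in> carrier P" unfolding one by (rule F.gen_closed) simp
  show "\<one>\<^bsub>P\<^esub> \<otimes>\<^bsub>P\<^esub> x = x" "x \<otimes>\<^bsub>P\<^esub> \<one>\<^bsub>P\<^esub> = x" if "x \<in> free_gen R (carrier G) ` carrier G" for x
    using that unfolding one by (auto simp: mult_P_gen)
  show "(x \<otimes>\<^bsub>P\<^esub> y) \<otimes>\<^bsub>P\<^esub> z = x \<otimes>\<^bsub>P\<^esub> (y \<otimes>\<^bsub>P\<^esub> z)"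
    if "x \<in> free_gen R (carrier G) ` carrier G" "y \<in> free_gen R (carrier G) ` carrier G"
      "z \<in> free_gen R (carrier G) ` carrier G" for x y z
    using that by (auto simp: mult_P_gen G.m_assoc)
qed (auto intro!: mult_P_closed module_homI simp: mult_P_bilinear(1,2)[OF _ _ _ zero_closed] mult_P_bilinear(3,4))

end

section \<open>Tensor powers\<close>

lemma (in module) submodule_span_properties:
  assumes "S \<subseteq> carrier M"
  shows "submodule (submodule_span R M S) R M" and "S \<subseteq> submodule_span R M S"
    and "\<And>H. submodule H R M \<Longrightarrow> S \<subseteq> H \<Longrightarrow> submodule_span R M S \<subseteq> H"
proof -
  let ?F = "{H. submodule H R M \<and> S \<subseteq> H}"
  have c: "carrier M \<in> ?F" using carrier_is_submodule assms by blast
  show "submodule (submodule_span R M S) R M"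
    unfolding submodule_span_def
    by (rule submodule_if_closed) (use c submodule_zero submoduleE in auto)
  show "S \<subseteq> submodule_span R M S" by (auto simp: submodule_span_def)
  show "submodule_span R M S \<subseteq> H" if "submodule H R M" "S \<subseteq> H" for H
    using that by (auto simp: submodule_span_def)
qed

definition multilinear ::
  "('k, 'r) ring_scheme \<Rightarrow> ('k, 'a, 'm) module_scheme \<Rightarrow> nat \<Rightarrow> ('k, 'b, 'n) module_scheme \<Rightarrow> ((nat \<Rightarrow> 'a) \<Rightarrow> 'b) \<Rightarrow> bool" where
  "multilinear R A d M f \<longleftrightarrow>
     f \<in> ({1..d} \<rightarrow>\<^sub>E carrier A) \<rightarrow> carrier M \<and>
     (\<forall>x\<in>{1..d} \<rightarrow>\<^sub>E carrier A. \<forall>i\<in>{1..d}. (\<lambda>a. f (x(i := a))) \<in> module_hom R A M)"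

locale tensor_algebra = A: assoc_algebra R A
  for R :: "('k, 'r) ring_scheme" (structure) and A :: "('k, 'a, 'm) module_scheme" (structure) +
  fixes d :: nat
begin

abbreviation T where "T \<equiv> tuples A d"

lemma carrier_T: "carrier T = {1..d} \<rightarrow>\<^sub>E carrier A" by (simp add: tuples_def)
lemma mult_T: "x \<otimes>\<^bsub>T\<^esub> y = (\<lambda>i\<in>{1..d}. x i \<otimes>\<^bsub>A\<^esub> y i)" by (simp add: tuples_def)
lemma one_T: "\<one>\<^bsub>T\<^esub> = (\<lambda>i\<in>{1..d}. \<one>\<^bsub>A\<^esub>)" by (simp add: tuples_def)

lemma T_mem: "x \<in> carrier T \<Longrightarrow> i \<in> {1..d} \<Longrightarrow> x i \<in> carrier A"
  unfolding carrier_T by (rule PiE_mem)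

lemma T_restrict: "(\<And>i. i \<in> {1..d} \<Longrightarrow> f i \<in> carrier A) \<Longrightarrow> (\<lambda>i\<in>{1..d}. f i) \<in> carrier T"
  unfolding carrier_T by (simp add: restrict_PiE_iff)

lemma T_eqI: "x \<in> carrier T \<Longrightarrow> y \<in> carrier T \<Longrightarrow> (\<And>i. i \<in> {1..d} \<Longrightarrow> x i = y i) \<Longrightarrow> x = y"
  unfolding carrier_T by (rule PiE_ext)

lemma T_upd: "x \<in> carrier T \<Longrightarrow> i \<in> {1..d} \<Longrightarrow> a \<in> carrier A \<Longrightarrow> x(i := a) \<in> carrier T"
  unfolding carrier_T by (auto simp: PiE_iff extensional_def)

lemma mult_T_closed: "x \<in> carrier T \<Longrightarrow> y \<in> carrier T \<Longrightarrow> x \<otimes>\<^bsub>T\<^esub> y \<in> carrier T"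
  unfolding mult_T by (intro T_restrict A.m_closed T_mem)

lemma one_T_closed: "\<one>\<^bsub>T\<^esub> \<in> carrier T" unfolding one_T by (intro T_restrict) simp

lemma monoid_T: "monoid T"
proof (rule monoidI)
  fix x y z assume xyz: "x \<in> carrier T" "y \<in> carrier T" "z \<in> carrier T"
  show "x \<otimes>\<^bsub>T\<^esub> y \<otimes>\<^bsub>T\<^esub> z = x \<otimes>\<^bsub>T\<^esub> (y \<otimes>\<^bsub>T\<^esub> z)"
    using xyz T_mem by (intro T_eqI mult_T_closed) (auto simp: mult_T A.m_assoc)
next
  fix x assume x: "x \<in> carrier T"
  show "\<one>\<^bsub>T\<^esub> \<otimes>\<^bsub>T\<^esub> x = x" "x \<otimes>\<^bsub>T\<^esub> \<one>\<^bsub>T\<^esub> = x"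
    using T_mem[OF x] by (auto intro!: T_eqI[OF _ x] mult_T_closed[OF one_T_closed x] mult_T_closed[OF x one_T_closed])
      (simp_all add: mult_T one_T)
qed (auto intro: mult_T_closed one_T_closed)

sublocale MA: monoid_alg R T
  by (rule monoid_alg.intro[OF A.R.is_cring monoid_T])

abbreviation P where "P \<equiv> monoid_algebra R T"
abbreviation \<delta> where "\<delta> \<equiv> free_gen R (carrier T)"
abbreviation N where "N \<equiv> tensor_ideal R A d"
abbreviation V where "V \<equiv> tensor_power R A d"
abbreviation pure where "pure \<equiv> pure_tensor R A d"

sublocale P: assoc_algebra R P by (rule MA.assoc_algebra_P)

lemma \<delta>_closed: "x \<in> carrier T \<Longrightarrow> \<delta> x \<in> carrier P" by (rule MA.F.gen_closed)

definition addrel where "addrel x i a b = \<delta> (x(i := a \<oplus>\<^bsub>A\<^esub> b)) \<ominus>\<^bsub>P\<^esub> (\<delta> (x(i := a)) \<oplus>\<^bsub>P\<^esub> \<delta> (x(i := b)))"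
definition smultrel where "smultrel x i r a = \<delta> (x(i := r \<odot>\<^bsub>A\<^esub> a)) \<ominus>\<^bsub>P\<^esub> r \<odot>\<^bsub>P\<^esub> \<delta> (x(i := a))"

lemma rels_eq: "tensor_rels R A d =
   {addrel x i a b | x i a b. x \<in> carrier T \<and> i \<in> {1..d} \<and> a \<in> carrier A \<and> b \<in> carrier A} \<union>
   {smultrel x i r a | x i r a. x \<in> carrier T \<and> i \<in> {1..d} \<and> r \<in> carrier R \<and> a \<in> carrier A}"
  unfolding tensor_rels_def Let_def addrel_def smultrel_def ..

lemma rels_cases:
  assumes "n \<in> tensor_rels R A d"
  obtains x i a b where "n = addrel x i a b" "x \<in> carrier T" "i \<in> {1..d}" "a \<in> carrier A" "b \<in> carrier A"
  | x i r a where "n = smultrel x i r a" "x \<in> carrier T" "i \<in> {1..d}" "r \<in> carrier R" "a \<in> carrier A"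
  using assms unfolding rels_eq by blast

lemma rel_closed:
  "\<lbrakk>x \<in> carrier T; i \<in> {1..d}; a \<in> carrier A; b \<in> carrier A\<rbrakk> \<Longrightarrow> addrel x i a b \<in> carrier P"
  "\<lbrakk>x \<in> carrier T; i \<in> {1..d}; r \<in> carrier R; a \<in> carrier A\<rbrakk> \<Longrightarrow> smultrel x i r a \<in> carrier P"
  unfolding addrel_def smultrel_def
  by (intro P.minus_closed P.a_closed P.smult_closed \<delta>_closed T_upd A.a_closed A.smult_closed; assumption)+

lemma rels_sub: "tensor_rels R A d \<subseteq> carrier P"
  by (auto elim!: rels_cases intro!: rel_closed simp del: atLeastAtMost_iff)

lemma N_sub: "submodule N R P" and rels_N: "tensor_rels R A d \<subseteq> N"
  and N_least: "\<And>H. submodule H R P \<Longrightarrow> tensor_rels R A d \<subseteq> H \<Longrightarrow> N \<subseteq> H"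
  unfolding tensor_ideal_def using P.submodule_span_properties[OF rels_sub] by auto

lemmas N_E = P.submoduleE[OF N_sub]

lemma zero_N: "\<zero>\<^bsub>P\<^esub> \<in> N"
  by (rule P.submodule_zero[OF N_sub])

lemma addrel_N: "\<lbrakk>x \<in> carrier T; i \<in> {1..d}; a \<in> carrier A; b \<in> carrier A\<rbrakk> \<Longrightarrow> addrel x i a b \<in> N"
  and smultrel_N: "\<lbrakk>x \<in> carrier T; i \<in> {1..d}; r \<in> carrier R; a \<in> carrier A\<rbrakk> \<Longrightarrow> smultrel x i r a \<in> N"
  using rels_N unfolding rels_eq by blast+

lemma mult_T_upd:
  assumes "x \<in> carrier T" "y \<in> carrier T" "i \<in> {1..d}" "a \<in> carrier A"
  shows "y \<otimes>\<^bsub>T\<^esub> x(i := a) = (y \<otimes>\<^bsub>T\<^esub> x)(i := y i \<otimes>\<^bsub>A\<^esub> a)" "x(i := a) \<otimes>\<^bsub>T\<^esub> y = (x \<otimes>\<^bsub>T\<^esub> y)(i := a \<otimes>\<^bsub>A\<^esub> y i)"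
  using assms(3) by (auto simp: mult_T fun_eq_iff)

text \<open>
  Multiplying a relation in position \<open>i\<close> by a tuple \<open>y\<close> is a relation in position \<open>i\<close> again,
  because multiplication by \<open>y i\<close> is linear. So the submodule that the relations span is an
  ideal.
\<close>

lemma rel_mult:
  assumes n: "n \<in> tensor_rels R A d" and y: "y \<in> carrier T"
  shows "\<delta> y \<otimes>\<^bsub>P\<^esub> n \<in> N" "n \<otimes>\<^bsub>P\<^esub> \<delta> y \<in> N"
proof -
  have "\<delta> y \<otimes>\<^bsub>P\<^esub> n \<in> N \<and> n \<otimes>\<^bsub>P\<^esub> \<delta> y \<in> N"
    using n
  proof (cases rule: rels_cases)
    case (1 x i a b)
    note c = 1(2-5) y T_upd T_mem[OF y 1(3)] \<delta>_closed mult_T_closed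
    have "\<delta> y \<otimes>\<^bsub>P\<^esub> n = addrel (y \<otimes>\<^bsub>T\<^esub> x) i (y i \<otimes>\<^bsub>A\<^esub> a) (y i \<otimes>\<^bsub>A\<^esub> b)"
      unfolding 1(1) addrel_def using c
      by (simp add: P.minus_eq P.r_distr P.r_minus MA.mult_P_gen mult_T_upd A.r_distr del: atLeastAtMost_iff)
    moreover have "n \<otimes>\<^bsub>P\<^esub> \<delta> y = addrel (x \<otimes>\<^bsub>T\<^esub> y) i (a \<otimes>\<^bsub>A\<^esub> y i) (b \<otimes>\<^bsub>A\<^esub> y i)"
      unfolding 1(1) addrel_def using c
      by (simp add: P.minus_eq P.l_distr P.l_minus MA.mult_P_gen mult_T_upd A.l_distr del: atLeastAtMost_iff)
    ultimately show ?thesis using c by (simp add: addrel_N del: atLeastAtMost_iff)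
  next
    case (2 x i r a)
    note c = 2(2-5) y T_upd T_mem[OF y 2(3)] \<delta>_closed mult_T_closed
    have "\<delta> y \<otimes>\<^bsub>P\<^esub> n = smultrel (y \<otimes>\<^bsub>T\<^esub> x) i r (y i \<otimes>\<^bsub>A\<^esub> a)"
      unfolding 2(1) smultrel_def using c
      by (simp add: P.minus_eq P.r_distr P.r_minus MA.mult_P_gen mult_T_upd A.smult_mult_right P.smult_mult_right del: atLeastAtMost_iff)
    moreover have "n \<otimes>\<^bsub>P\<^esub> \<delta> y = smultrel (x \<otimes>\<^bsub>T\<^esub> y) i r (a \<otimes>\<^bsub>A\<^esub> y i)"
      unfolding 2(1) smultrel_def using c
      by (simp add: P.minus_eq P.l_distr P.l_minus MA.mult_P_gen mult_T_upd A.smult_mult_left P.smult_mult_left del: atLeastAtMost_iff)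
    ultimately show ?thesis using c by (simp add: smultrel_N del: atLeastAtMost_iff)
  qed
  then show "\<delta> y \<otimes>\<^bsub>P\<^esub> n \<in> N" "n \<otimes>\<^bsub>P\<^esub> \<delta> y \<in> N" by auto
qed

lemma N_carrier: "n \<in> N \<Longrightarrow> n \<in> carrier P" using N_E(1) by blast

lemma ideal_N: "ideal N P"
proof -
  have 1: "f \<otimes>\<^bsub>P\<^esub> n \<in> N \<and> n \<otimes>\<^bsub>P\<^esub> f \<in> N" if n: "n \<in> tensor_rels R A d" and f: "f \<in> carrier P" for f n
  proof -
    have nP: "n \<in> carrier P" using n rels_sub by blast
    show ?thesis using MA.F.module_F MA.F.F_spans f
    proof (rule spans_induct)
      show "s \<otimes>\<^bsub>P\<^esub> n \<in> N \<and> n \<otimes>\<^bsub>P\<^esub> s \<in> N" if "s \<in> \<delta> ` carrier T" for s using that rel_mult[OF n] by auto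
    qed (use nP zero_N N_E(4,5) in \<open>simp_all add: P.l_distr P.r_distr P.smult_mult_left P.smult_mult_right\<close>)
  qed
  have "submodule {n \<in> carrier P. \<forall>f\<in>carrier P. f \<otimes>\<^bsub>P\<^esub> n \<in> N \<and> n \<otimes>\<^bsub>P\<^esub> f \<in> N} R P"
    by (rule P.submodule_if_closed)
      (use zero_N N_E(4,5) in \<open>simp_all add: subset_iff P.l_distr P.r_distr P.smult_mult_left P.smult_mult_right\<close>)
  then have "N \<subseteq> {n \<in> carrier P. \<forall>f\<in>carrier P. f \<otimes>\<^bsub>P\<^esub> n \<in> N \<and> n \<otimes>\<^bsub>P\<^esub> f \<in> N}"
    by (rule N_least) (use 1 rels_sub in auto)
  then show ?thesis
    using submodule.axioms(1)[OF N_sub] by (intro idealI P.ring_axioms) auto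
qed

sublocale N: ideal N P by (rule ideal_N)

abbreviation \<pi> where "\<pi> f \<equiv> N +>\<^bsub>P\<^esub> f"

lemma carrier_V: "carrier V = (\<lambda>f. \<pi> f) ` carrier P"
  by (auto simp: tensor_power_def Let_def ring.defs FactRing_def A_RCOSETS_def' image_iff)

lemma add_V: "x \<oplus>\<^bsub>V\<^esub> y = x <+>\<^bsub>P\<^esub> y"
  and mult_V: "x \<otimes>\<^bsub>V\<^esub> y = rcoset_mult P N x y"
  and zero_V: "\<zero>\<^bsub>V\<^esub> = N"
  and one_V: "\<one>\<^bsub>V\<^esub> = \<pi> \<one>\<^bsub>P\<^esub>"
  and smult_V: "r \<odot>\<^bsub>V\<^esub> x = (\<Union>f\<in>x. \<pi> (r \<odot>\<^bsub>P\<^esub> f))"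
  by (simp_all add: tensor_power_def Let_def ring.defs FactRing_def)

lemma \<pi>_eq_iff:
  assumes "f \<in> carrier P" "g \<in> carrier P" shows "\<pi> f = \<pi> g \<longleftrightarrow> f \<ominus>\<^bsub>P\<^esub> g \<in> N"
proof
  assume "\<pi> f = \<pi> g"
  then have "f \<in> \<pi> g" using N.a_rcos_self[OF assms(1)] by simp
  then obtain n where n: "n \<in> N" "f = n \<oplus>\<^bsub>P\<^esub> g" by (auto simp: a_r_coset_def')
  then have "f \<ominus>\<^bsub>P\<^esub> g = n" using assms N_carrier by (simp add: P.minus_eq P.a_assoc P.r_neg)
  then show "f \<ominus>\<^bsub>P\<^esub> g \<in> N" using n by simp
next
  assume n: "f \<ominus>\<^bsub>P\<^esub> g \<in> N"
  have "f = (f \<ominus>\<^bsub>P\<^esub> g) \<oplus>\<^bsub>P\<^esub> g" using assms by (simp add: P.minus_eq P.a_assoc P.l_neg)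
  then have "f \<in> \<pi> g" using n by (auto simp: a_r_coset_def')
  then show "\<pi> f = \<pi> g" using N.a_repr_independence'[OF _ assms(2)] by simp
qed

lemma \<pi>_add: "f \<in> carrier P \<Longrightarrow> g \<in> carrier P \<Longrightarrow> \<pi> (f \<oplus>\<^bsub>P\<^esub> g) = \<pi> f \<oplus>\<^bsub>V\<^esub> \<pi> g"
  unfolding add_V by (rule N.a_rcos_sum[symmetric])

lemma \<pi>_mult: "f \<in> carrier P \<Longrightarrow> g \<in> carrier P \<Longrightarrow> \<pi> (f \<otimes>\<^bsub>P\<^esub> g) = \<pi> f \<otimes>\<^bsub>V\<^esub> \<pi> g"
  unfolding mult_V by (rule N.rcoset_mult_add[symmetric])

lemma \<pi>_smult:
  assumes r: "r \<in> carrier R" and f: "f \<in> carrier P" shows "\<pi> (r \<odot>\<^bsub>P\<^esub> f) = r \<odot>\<^bsub>V\<^esub> \<pi> f"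
proof -
  have "\<pi> (r \<odot>\<^bsub>P\<^esub> g) = \<pi> (r \<odot>\<^bsub>P\<^esub> f)" if g: "g \<in> \<pi> f" for g
  proof -
    from g obtain n where n: "n \<in> N" "g = n \<oplus>\<^bsub>P\<^esub> f" by (auto simp: a_r_coset_def')
    have "r \<odot>\<^bsub>P\<^esub> g = r \<odot>\<^bsub>P\<^esub> n \<oplus>\<^bsub>P\<^esub> r \<odot>\<^bsub>P\<^esub> f" using n r f N_carrier by (simp add: P.smult_r_distr)
    then have "r \<odot>\<^bsub>P\<^esub> g \<in> \<pi> (r \<odot>\<^bsub>P\<^esub> f)" using N_E(4)[OF r n(1)] by (auto simp: a_r_coset_def')
    then show ?thesis using N.a_repr_independence'[of _ "r \<odot>\<^bsub>P\<^esub> f"] r f by simp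
  qed
  then have "(\<Union>g\<in>\<pi> f. \<pi> (r \<odot>\<^bsub>P\<^esub> g)) = (\<Union>g\<in>\<pi> f. \<pi> (r \<odot>\<^bsub>P\<^esub> f))" by (intro SUP_cong) auto
  also have "\<dots> = \<pi> (r \<odot>\<^bsub>P\<^esub> f)" using N.a_rcos_self[OF f] by auto
  finally show ?thesis unfolding smult_V by simp
qed

lemma \<pi>_zero: "\<pi> \<zero>\<^bsub>P\<^esub> = \<zero>\<^bsub>V\<^esub>"
  unfolding zero_V using P.a_rcos_zero[OF ideal_N zero_N] .

lemma assoc_algebra_V: "assoc_algebra R V"
  by (rule assoc_algebra_surj[where P = P and \<pi> = "\<lambda>f. \<pi> f"])
    (fact P.assoc_algebra_axioms carrier_V[symmetric] \<pi>_add \<pi>_mult \<pi>_smult \<pi>_zero one_V[symmetric])+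

sublocale V: assoc_algebra R V by (rule assoc_algebra_V)

lemma \<pi>_closed: "f \<in> carrier P \<Longrightarrow> \<pi> f \<in> carrier V" unfolding carrier_V by blast

lemma \<pi>_hom: "(\<lambda>f. \<pi> f) \<in> module_hom R P V"
  by (intro module_homI \<pi>_closed \<pi>_add \<pi>_smult)

lemma pure_eq: "pure x = \<pi> (\<delta> x)" by (simp add: pure_tensor_def)

lemma pure_closed: "x \<in> carrier T \<Longrightarrow> pure x \<in> carrier V"
  unfolding pure_eq by (intro \<pi>_closed \<delta>_closed)

lemma pure_mult: "x \<in> carrier T \<Longrightarrow> y \<in> carrier T \<Longrightarrow> pure x \<otimes>\<^bsub>V\<^esub> pure y = pure (x \<otimes>\<^bsub>T\<^esub> y)"
  unfolding pure_eq by (simp add: \<pi>_mult[symmetric] \<delta>_closed MA.mult_P_gen)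

lemma pure_one: "\<one>\<^bsub>V\<^esub> = pure \<one>\<^bsub>T\<^esub>"
  unfolding pure_eq one_V by (simp add: monoid_algebra_def)

lemma pure_multilinear: "multilinear R A d V pure"
  unfolding multilinear_def
proof (intro conjI ballI funcsetI)
  show "pure x \<in> carrier V" if "x \<in> {1..d} \<rightarrow>\<^sub>E carrier A" for x using that pure_closed by (simp add: carrier_T)
  fix x i assume "x \<in> {1..d} \<rightarrow>\<^sub>E carrier A" and i: "i \<in> {1..d}"
  then have x: "x \<in> carrier T" by (simp add: carrier_T)
  show "(\<lambda>a. pure (x(i := a))) \<in> module_hom R A V"
  proof (rule module_homI)
    show "pure (x(i := a)) \<in> carrier V" if "a \<in> carrier A" for a using pure_closed T_upd[OF x i that] .
  next
    fix a b assume ab: "a \<in> carrier A" "b \<in> carrier A"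
    have "\<pi> (\<delta> (x(i := a \<oplus>\<^bsub>A\<^esub> b))) = \<pi> (\<delta> (x(i := a)) \<oplus>\<^bsub>P\<^esub> \<delta> (x(i := b)))"
      using addrel_N[OF x i ab] ab T_upd[OF x i] by (subst \<pi>_eq_iff) (auto simp: addrel_def \<delta>_closed)
    then show "pure (x(i := a \<oplus>\<^bsub>A\<^esub> b)) = pure (x(i := a)) \<oplus>\<^bsub>V\<^esub> pure (x(i := b))"
      unfolding pure_eq using ab T_upd[OF x i] by (simp add: \<pi>_add \<delta>_closed)
  next
    fix r a assume ra: "r \<in> carrier R" "a \<in> carrier A"
    have "\<pi> (\<delta> (x(i := r \<odot>\<^bsub>A\<^esub> a))) = \<pi> (r \<odot>\<^bsub>P\<^esub> \<delta> (x(i := a)))"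
      using smultrel_N[OF x i ra] ra T_upd[OF x i] by (subst \<pi>_eq_iff) (auto simp: smultrel_def \<delta>_closed)
    then show "pure (x(i := r \<odot>\<^bsub>A\<^esub> a)) = r \<odot>\<^bsub>V\<^esub> pure (x(i := a))"
      unfolding pure_eq using ra T_upd[OF x i] by (simp add: \<pi>_smult \<delta>_closed)
  qed
qed

lemma spans_image:
  assumes "module R M" "module R L" "h \<in> module_hom R M L" "h ` carrier M = carrier L" "spans R M S"
  shows "spans R L (h ` S)"
  unfolding spans_def
proof (intro conjI allI impI subsetI)
  interpret M: module R M by fact
  interpret L: module R L by fact
  show "y \<in> carrier L" if "y \<in> h ` S" for y using that assms(4,5) by (auto simp: spans_def)
  fix H y assume H: "submodule H R L \<and> h ` S \<subseteq> H" and "y \<in> carrier L"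
  then obtain x where x: "x \<in> carrier M" "y = h x" using assms(4) by blast
  note HE = L.submoduleE[OF conjunct1[OF H]]
  have zH: "\<zero>\<^bsub>L\<^esub> \<in> H" by (rule L.submodule_zero[OF conjunct1[OF H]])
  have "h x \<in> H" using assms(1,5) x(1)
    by (rule spans_induct)
      (use H HE zH module_hom_zero[OF assms(1-3)] module_homD[OF assms(3)] in auto)
  then show "y \<in> H" using x by simp
qed

lemma V_spans: "spans R V (pure ` carrier T)"
  using spans_image[OF MA.F.module_F V.module_axioms \<pi>_hom carrier_V[symmetric] MA.F.F_spans]
  by (simp add: image_image pure_eq)

text \<open>
  The linear extension of \<open>m\<close> to the monoid algebra kills the relations, since they express
  multilinearity, and hence is constant on cosets.
\<close>

theorem tensor_universal:
  assumes "module R M" and m: "multilinear R A d M m"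
  obtains h where "h \<in> module_hom R V M" "\<And>x. x \<in> carrier T \<Longrightarrow> h (pure x) = m x"
proof -
  interpret M: module R M by fact
  have mT: "m \<in> carrier T \<rightarrow> carrier M" using m by (auto simp: multilinear_def carrier_T)
  have mh: "(\<lambda>a. m (x(i := a))) \<in> module_hom R A M" if "x \<in> carrier T" "i \<in> {1..d}" for x i
    using m that by (auto simp: multilinear_def carrier_T)
  define e where "e = lin_ext R (carrier T) M m"
  have e: "e \<in> module_hom R P M" unfolding e_def by (rule MA.F.lin_ext_hom[OF assms(1) mT])
  have eg: "e (\<delta> x) = m x" if "x \<in> carrier T" for x
    unfolding e_def by (rule MA.F.lin_ext_gen[OF assms(1) mT that])
  note eh = module_homD[OF e] module_hom_zero[OF MA.F.module_F assms(1) e]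
  have en: "e (\<ominus>\<^bsub>P\<^esub> f) = \<ominus>\<^bsub>M\<^esub> (e f)" if "f \<in> carrier P" for f
  proof -
    have "\<ominus>\<^bsub>P\<^esub> f = (\<ominus> \<one>) \<odot>\<^bsub>P\<^esub> f" using that by (simp add: P.smult_l_minus)
    then show ?thesis using that eh by (simp add: M.smult_l_minus)
  qed
  have "submodule {n \<in> carrier P. e n = \<zero>\<^bsub>M\<^esub>} R P"
    by (rule P.submodule_if_closed) (use eh in auto)
  moreover have "tensor_rels R A d \<subseteq> {n \<in> carrier P. e n = \<zero>\<^bsub>M\<^esub>}"
  proof
    fix n assume n: "n \<in> tensor_rels R A d"
    then have "e n = \<zero>\<^bsub>M\<^esub>"
    proof (cases rule: rels_cases)
      case (1 x i a b)
      note c = T_upd[OF 1(2,3)]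
      show ?thesis
        unfolding 1(1) addrel_def using 1(2-5) c module_homD[OF mh[OF 1(2,3)]]
        by (simp add: P.minus_eq eh en eg \<delta>_closed M.M.r_neg del: atLeastAtMost_iff)
    next
      case (2 x i r a)
      note c = T_upd[OF 2(2,3)]
      show ?thesis
        unfolding 2(1) smultrel_def using 2(2-5) c module_homD[OF mh[OF 2(2,3)]]
        by (simp add: P.minus_eq eh en eg \<delta>_closed M.M.r_neg del: atLeastAtMost_iff)
    qed
    then show "n \<in> {n \<in> carrier P. e n = \<zero>\<^bsub>M\<^esub>}" using n rels_sub by blast
  qed
  ultimately have ker: "N \<subseteq> {n \<in> carrier P. e n = \<zero>\<^bsub>M\<^esub>}" by (rule N_least)
  (* Elements of the tensor power are cosets; any representative gives the same value. *)
  define h where "h Z = e (SOME f. f \<in> Z)" for Z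
  have h\<pi>: "h (\<pi> f) = e f" if f: "f \<in> carrier P" for f
  proof -
    have "(SOME g. g \<in> \<pi> f) \<in> \<pi> f" using N.a_rcos_self[OF f] by (rule someI[of "\<lambda>g. g \<in> \<pi> f"])
    then obtain n where n: "n \<in> N" "(SOME g. g \<in> \<pi> f) = n \<oplus>\<^bsub>P\<^esub> f" by (auto simp: a_r_coset_def')
    then have "h (\<pi> f) = e n \<oplus>\<^bsub>M\<^esub> e f" using f N_carrier eh by (simp add: h_def)
    then show ?thesis using ker n(1) f eh by auto
  qed
  have "h \<in> module_hom R V M"
  proof (rule module_homI)
    show "h x \<in> carrier M" if "x \<in> carrier V" for x using that eh by (auto simp: carrier_V h\<pi>)
    show "h (x \<oplus>\<^bsub>V\<^esub> y) = h x \<oplus>\<^bsub>M\<^esub> h y" if "x \<in> carrier V" "y \<in> carrier V" for x y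
      using that eh by (auto simp: carrier_V h\<pi> \<pi>_add[symmetric])
    show "h (r \<odot>\<^bsub>V\<^esub> x) = r \<odot>\<^bsub>M\<^esub> h x" if "r \<in> carrier R" "x \<in> carrier V" for r x
      using that eh by (auto simp: carrier_V h\<pi> \<pi>_smult[symmetric])
  qed
  moreover have "h (pure x) = m x" if "x \<in> carrier T" for x
    using that by (simp add: pure_eq h\<pi> \<delta>_closed eg)
  ultimately show thesis by (rule that)
qed

end

section \<open>Finite bases\<close>

lemma finite_basis_coord:
  assumes mod: "module R M" and basis: "finite_basis R M B b"
  obtains h where "h \<in> module_hom R M (free_module R B)"
    "\<And>\<beta>. \<beta> \<in> B \<Longrightarrow> h (b \<beta>) = free_gen R B \<beta>"
    "\<And>x. x \<in> carrier M \<Longrightarrow> x = (\<Oplus>\<^bsub>M\<^esub>\<beta>\<in>B. h x \<beta> \<odot>\<^bsub>M\<^esub> b \<beta>)"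
    "\<And>x c. c \<in> carrier (free_module R B) \<Longrightarrow> x = (\<Oplus>\<^bsub>M\<^esub>\<beta>\<in>B. c \<beta> \<odot>\<^bsub>M\<^esub> b \<beta>) \<Longrightarrow> h x = c"
proof -
  interpret M: module R M by fact
  interpret F: fun_module R B "free_module R B" by (rule fun_module_free[OF M.R.is_cring])
  let ?F = "free_module R B"
  have fin: "finite B" and b: "b \<in> B \<rightarrow> carrier M"
    and ex: "\<And>x. x \<in> carrier M \<Longrightarrow> \<exists>!c. c \<in> B \<rightarrow>\<^sub>E carrier R \<and> x = (\<Oplus>\<^bsub>M\<^esub>i\<in>B. c i \<odot>\<^bsub>M\<^esub> b i)"
    using basis unfolding finite_basis_def by blast+
  have cF: "carrier ?F = B \<rightarrow>\<^sub>E carrier R" unfolding F.carrier_F using fin by (auto simp: supp_def)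
  define e where "e = lin_ext R B M b"
  have e: "e c = (\<Oplus>\<^bsub>M\<^esub>\<beta>\<in>B. c \<beta> \<odot>\<^bsub>M\<^esub> b \<beta>)" if "c \<in> carrier ?F" for c
    unfolding e_def using that by (intro F.lin_ext_eq[OF mod b _ fin]) (auto simp: supp_def)
  have eh: "e \<in> module_hom R ?F M" unfolding e_def by (rule F.lin_ext_hom[OF mod b])
  define h where "h x = (THE c. c \<in> B \<rightarrow>\<^sub>E carrier R \<and> x = (\<Oplus>\<^bsub>M\<^esub>i\<in>B. c i \<odot>\<^bsub>M\<^esub> b i))" for x
  have h: "h x \<in> carrier ?F" "x = e (h x)" if "x \<in> carrier M" for x
    using theI'[OF ex[OF that], folded h_def] e cF by auto
  have uniq: "h (e c) = c" if c: "c \<in> carrier ?F" for c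
  proof -
    have "e c \<in> carrier M" using module_homD(1)[OF eh c] .
    from the1_equality[OF ex[OF this], of c, folded h_def] show ?thesis using c e[OF c] cF by simp
  qed
  show thesis
  proof (rule that)
    show "h \<in> module_hom R M ?F"
    proof (rule module_homI)
      show "h x \<in> carrier ?F" if "x \<in> carrier M" for x using h that by blast
      show "h (x \<oplus>\<^bsub>M\<^esub> y) = h x \<oplus>\<^bsub>?F\<^esub> h y" if "x \<in> carrier M" "y \<in> carrier M" for x y
        using uniq[OF F.add_F_closed[OF h(1)[OF that(1)] h(1)[OF that(2)]]] h that module_homD(2)[OF eh] by simp
      show "h (r \<odot>\<^bsub>M\<^esub> x) = r \<odot>\<^bsub>?F\<^esub> h x" if "r \<in> carrier R" "x \<in> carrier M" for r x
        using uniq[OF F.smult_F_closed[OF that(1) h(1)[OF that(2)]]] h that module_homD(3)[OF eh] by simp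
    qed
    show "h (b \<beta>) = free_gen R B \<beta>" if "\<beta> \<in> B" for \<beta>
      using uniq[OF F.gen_closed[OF that]] F.lin_ext_gen[OF mod b that] by (simp add: e_def)
    show "x = (\<Oplus>\<^bsub>M\<^esub>\<beta>\<in>B. h x \<beta> \<odot>\<^bsub>M\<^esub> b \<beta>)" if "x \<in> carrier M" for x
      using h[OF that] e by simp
    show "h x = c" if "c \<in> carrier ?F" "x = (\<Oplus>\<^bsub>M\<^esub>\<beta>\<in>B. c \<beta> \<odot>\<^bsub>M\<^esub> b \<beta>)" for x c
      using uniq[OF that(1)] e[OF that(1)] that(2) by simp
  qed
qed

lemma finite_basis_spans:
  assumes "module R M" "finite_basis R M B b" shows "spans R M (b ` B)"
  unfolding spans_def
proof (intro conjI allI impI subsetI)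
  interpret M: module R M by fact
  have b: "b \<in> B \<rightarrow> carrier M" using assms(2) by (simp add: finite_basis_def)
  then show "y \<in> carrier M" if "y \<in> b ` B" for y using that by auto
  fix H x assume H: "submodule H R M \<and> b ` B \<subseteq> H" and x: "x \<in> carrier M"
  obtain h where h: "h \<in> module_hom R M (free_module R B)" "x = (\<Oplus>\<^bsub>M\<^esub>\<beta>\<in>B. h x \<beta> \<odot>\<^bsub>M\<^esub> b \<beta>)"
    using finite_basis_coord[OF assms] x by metis
  interpret F: fun_module R B "free_module R B" by (rule fun_module_free[OF M.R.is_cring])
  note HE = M.submoduleE[OF conjunct1[OF H]]
  have c: "h x \<beta> \<odot>\<^bsub>M\<^esub> b \<beta> \<in> H" if "\<beta> \<in> B" for \<beta>
    using HE(4) F.F_mem[OF module_homD(1)[OF h(1) x] that] H that by blast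
  show "x \<in> H" by (subst h(2)) (rule M.submodule_finsum[OF conjunct1[OF H] c])
qed

text \<open>
  Instead of proving unique existence of coordinates, it suffices to have a spanning family
  and a linear map that sends it to the standard generators: such a map is inverse to the
  linear extension of the family.
\<close>

lemma finite_basisI:
  assumes mod: "module R M" and fin: "finite B" and b: "b \<in> B \<rightarrow> carrier M" and sp: "spans R M (b ` B)"
    and h: "h \<in> module_hom R M (free_module R B)" and hb: "\<And>\<beta>. \<beta> \<in> B \<Longrightarrow> h (b \<beta>) = free_gen R B \<beta>"
  shows "finite_basis R M B b" "\<And>x. x \<in> carrier M \<Longrightarrow> x = (\<Oplus>\<^bsub>M\<^esub>\<beta>\<in>B. h x \<beta> \<odot>\<^bsub>M\<^esub> b \<beta>)"
proof -
  interpret M: module R M by fact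
  interpret F: fun_module R B "free_module R B" by (rule fun_module_free[OF M.R.is_cring])
  let ?F = "free_module R B"
  have cF: "carrier ?F = B \<rightarrow>\<^sub>E carrier R" unfolding F.carrier_F using fin by (auto simp: supp_def)
  define e where "e = lin_ext R B M b"
  have e: "e c = (\<Oplus>\<^bsub>M\<^esub>\<beta>\<in>B. c \<beta> \<odot>\<^bsub>M\<^esub> b \<beta>)" if "c \<in> carrier ?F" for c
    unfolding e_def using that by (intro F.lin_ext_eq[OF mod b _ fin]) (auto simp: supp_def)
  have eh: "e \<in> module_hom R ?F M" unfolding e_def by (rule F.lin_ext_hom[OF mod b])
  have eg: "e (free_gen R B \<beta>) = b \<beta>" if "\<beta> \<in> B" for \<beta>
    unfolding e_def by (rule F.lin_ext_gen[OF mod b that])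
  have id: "(\<lambda>x. x) \<in> module_hom R L L" for L :: "('a, 'x, 'y) module_scheme" by (simp add: module_hom_def)
  have 1: "e (h x) = x" if "x \<in> carrier M" for x
    by (rule module_hom_eq_on_span[OF mod mod sp module_hom_compose[OF h eh] _ _ that])
      (use hb eg in \<open>auto simp: module_hom_def\<close>)
  have 2: "h (e c) = c" if "c \<in> carrier ?F" for c
    by (rule module_hom_eq_on_span[OF F.module_F F.module_F F.F_spans module_hom_compose[OF eh h] _ _ that])
      (use hb eg in \<open>auto simp: module_hom_def\<close>)
  show *: "x = (\<Oplus>\<^bsub>M\<^esub>\<beta>\<in>B. h x \<beta> \<odot>\<^bsub>M\<^esub> b \<beta>)" if "x \<in> carrier M" for x
    using 1[OF that] e[OF module_homD(1)[OF h that]] by simp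
  show "finite_basis R M B b"
    unfolding finite_basis_def
  proof (intro conjI ballI fin b)
    fix x assume x: "x \<in> carrier M"
    show "\<exists>!c. c \<in> B \<rightarrow>\<^sub>E carrier R \<and> x = (\<Oplus>\<^bsub>M\<^esub>\<beta>\<in>B. c \<beta> \<odot>\<^bsub>M\<^esub> b \<beta>)"
    proof (rule ex1I[of _ "h x"])
      show "h x \<in> B \<rightarrow>\<^sub>E carrier R \<and> x = (\<Oplus>\<^bsub>M\<^esub>\<beta>\<in>B. h x \<beta> \<odot>\<^bsub>M\<^esub> b \<beta>)"
        using *[OF x] module_homD(1)[OF h x] cF by simp
      show "c = h x" if "c \<in> B \<rightarrow>\<^sub>E carrier R \<and> x = (\<Oplus>\<^bsub>M\<^esub>\<beta>\<in>B. c \<beta> \<odot>\<^bsub>M\<^esub> b \<beta>)" for c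
        using that e[of c] 2[of c] cF by simp
    qed
  qed
qed

text \<open>
  The coordinate map and the linear extension of the basis exhibit \<open>M\<close> as a retract, even an
  isomorphic copy, of a free module of finite rank.
\<close>

lemma finite_basis_fg_projective:
  assumes "module R M" "finite_basis R M B b" shows "fg_projective R M"
proof -
  interpret M: module R M by fact
  have "finite B" using assms(2) by (simp add: finite_basis_def)
  then obtain f where f: "bij_betw f {0..<card B} B" using ex_bij_betw_nat_finite by blast
  let ?n = "card B"
  have bas: "finite_basis R M {..<?n} (\<lambda>i. b (f i))"
    by (rule finite_basis_reindex[OF assms, of f]) (use f in \<open>simp_all add: atLeast0LessThan\<close>)
  interpret F: fun_module R "{..<?n}" "free_module R {..<?n}" by (rule fun_module_free[OF M.R.is_cring])
  obtain h where h: "h \<in> module_hom R M (free_module R {..<?n})"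
    "\<And>x. x \<in> carrier M \<Longrightarrow> x = (\<Oplus>\<^bsub>M\<^esub>i\<in>{..<?n}. h x i \<odot>\<^bsub>M\<^esub> b (f i))"
    using finite_basis_coord[OF assms(1) bas] by metis
  have b: "(\<lambda>i. b (f i)) \<in> {..<?n} \<rightarrow> carrier M" using bas unfolding finite_basis_def by blast
  have "lin_ext R {..<?n} M (\<lambda>i. b (f i)) (h x) = x" if x: "x \<in> carrier M" for x
  proof -
    have "supp R {..<?n} (h x) \<subseteq> {..<?n}" by (auto simp: supp_def)
    then show ?thesis
      using F.lin_ext_eq[OF assms(1) b module_homD(1)[OF h(1) x] finite_lessThan subset_refl] h(2)[OF x] by simp
  qed
  then show ?thesis
    unfolding fg_projective_def using h(1) F.lin_ext_hom[OF assms(1) b] by blast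
qed

section \<open>The action of the symmetric group on the tensor power\<close>

definition sym :: "nat \<Rightarrow> (nat \<Rightarrow> nat) set" where "sym d = {\<rho>. \<rho> permutes {1..d}}"

lemma mem_sym: "\<rho> \<in> sym d \<longleftrightarrow> \<rho> permutes {1..d}" by (simp add: sym_def)

lemma carrier_sym_group: "carrier (sym_group d) = sym d" by (simp add: sym_group_def sym_def)

lemma inv_sym: "\<rho> \<in> sym d \<Longrightarrow> inv' \<rho> \<in> sym d"
  and comp_sym: "\<rho> \<in> sym d \<Longrightarrow> \<sigma> \<in> sym d \<Longrightarrow> \<rho> \<circ> \<sigma> \<in> sym d"
  and id_sym: "id \<in> sym d"
  and inv_inv_sym: "\<rho> \<in> sym d \<Longrightarrow> inv' (inv' \<rho>) = \<rho>"
  unfolding mem_sym by (rule permutes_inv permutes_compose permutes_id permutes_inv_inv; assumption)+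

lemma inv_sym_group: "\<sigma> permutes {1..d} \<Longrightarrow> inv\<^bsub>sym_group d\<^esub> \<sigma> = inv' \<sigma>"
  by (rule group.inv_equality[OF sym_group_is_group])
    (auto simp: sym_group_def permutes_inv permutes_inv_o)

lemma permutes_mem: "\<sigma> permutes {1..d} \<Longrightarrow> i \<in> {1..d} \<Longrightarrow> \<sigma> i \<in> {1..d}" for d i :: nat
  using permutes_in_image[of \<sigma> "{1..d}" i] by blast

context tensor_algebra begin

lemma tuple_act_closed: "\<sigma> permutes {1..d} \<Longrightarrow> x \<in> carrier T \<Longrightarrow> tuple_act d x \<sigma> \<in> carrier T"
  unfolding tuple_act_def by (rule T_restrict, erule T_mem, erule (1) permutes_mem)

lemma tuple_act_compose:
  assumes "\<tau> permutes {1..d}" shows "tuple_act d (tuple_act d x \<sigma>) \<tau> = tuple_act d x (\<sigma> \<circ> \<tau>)"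
  using permutes_mem[OF assms] by (auto simp: tuple_act_def fun_eq_iff)

lemma tuple_act_id: "x \<in> carrier T \<Longrightarrow> tuple_act d x id = x"
  using PiE_arb[of x "{1..d}"] by (auto simp: tuple_act_def carrier_T fun_eq_iff)

lemma tuple_act_mult:
  assumes "\<sigma> permutes {1..d}"
  shows "tuple_act d (x \<otimes>\<^bsub>T\<^esub> y) \<sigma> = tuple_act d x \<sigma> \<otimes>\<^bsub>T\<^esub> tuple_act d y \<sigma>"
  using permutes_mem[OF assms] by (auto simp: tuple_act_def mult_T fun_eq_iff)

lemma tuple_act_upd:
  assumes \<sigma>: "\<sigma> permutes {1..d}" and i: "i \<in> {1..d}"
  shows "tuple_act d (x(i := a)) \<sigma> = (tuple_act d x \<sigma>)(inv' \<sigma> i := a)"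
proof
  fix j
  have "\<sigma> j = i \<longleftrightarrow> j = inv' \<sigma> i" using \<sigma> by (auto simp: permutes_inverses)
  moreover have "inv' \<sigma> i \<in> {1..d}" by (rule permutes_mem[OF permutes_inv[OF \<sigma>] i])
  ultimately show "tuple_act d (x(i := a)) \<sigma> j = ((tuple_act d x \<sigma>)(inv' \<sigma> i := a)) j"
    by (auto simp: tuple_act_def)
qed

text \<open>
  The action on the tensor power is defined as the image of a coset under this map, so all its
  properties are first shown for functions on tuples.
\<close>

definition relabel :: "(nat \<Rightarrow> nat) \<Rightarrow> ((nat \<Rightarrow> 'a) \<Rightarrow> 'k) \<Rightarrow> (nat \<Rightarrow> 'a) \<Rightarrow> 'k" where
  "relabel \<sigma> f = (\<lambda>y\<in>carrier T. f (tuple_act d y (inv' \<sigma>)))"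

abbreviation act where "act Z \<sigma> \<equiv> tensor_act A d Z \<sigma>"

lemma act_eq: "\<sigma> permutes {1..d} \<Longrightarrow> act Z \<sigma> = relabel \<sigma> ` Z"
  by (simp add: tensor_act_def relabel_def[abs_def] inv_sym_group)

lemma relabel_hom:
  assumes \<sigma>: "\<sigma> permutes {1..d}" shows "relabel \<sigma> \<in> module_hom R P P"
proof (rule module_homI)
  have \<sigma>': "inv' \<sigma> permutes {1..d}" by (rule permutes_inv[OF \<sigma>])
  note cl = tuple_act_closed[OF \<sigma>']
  show "relabel \<sigma> f \<in> carrier P" if f: "f \<in> carrier P" for f
    unfolding relabel_def
  proof (rule MA.F.F_I[of _ "(\<lambda>x. tuple_act d x \<sigma>) ` supp R (carrier T) f"])
    show "f (tuple_act d y (inv' \<sigma>)) \<in> carrier R" if "y \<in> carrier T" for y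
      by (rule MA.F.F_mem[OF f cl[OF that]])
    show "finite ((\<lambda>x. tuple_act d x \<sigma>) ` supp R (carrier T) f)" using MA.F.F_fin[OF f] by simp
    fix y assume y: "y \<in> carrier T" "y \<notin> (\<lambda>x. tuple_act d x \<sigma>) ` supp R (carrier T) f"
    have "tuple_act d (tuple_act d y (inv' \<sigma>)) \<sigma> = y"
      using tuple_act_compose[OF \<sigma>, of y "inv' \<sigma>"] permutes_inv_o(2)[OF \<sigma>] tuple_act_id[OF y(1)] by simp
    then have "tuple_act d y (inv' \<sigma>) \<notin> supp R (carrier T) f" using y(2) by (metis imageI)
    then show "f (tuple_act d y (inv' \<sigma>)) = \<zero>" using cl[OF y(1)] by (simp add: supp_def)
  qed
  show "relabel \<sigma> (f \<oplus>\<^bsub>P\<^esub> g) = relabel \<sigma> f \<oplus>\<^bsub>P\<^esub> relabel \<sigma> g" for f g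
    using cl by (auto simp: relabel_def MA.F.add_F fun_eq_iff)
  show "relabel \<sigma> (r \<odot>\<^bsub>P\<^esub> f) = r \<odot>\<^bsub>P\<^esub> relabel \<sigma> f" for r f
    using cl by (auto simp: relabel_def MA.F.smult_F fun_eq_iff)
qed

lemma relabel_gen:
  assumes \<sigma>: "\<sigma> permutes {1..d}" and x: "x \<in> carrier T"
  shows "relabel \<sigma> (\<delta> x) = \<delta> (tuple_act d x \<sigma>)"
proof -
  have \<sigma>': "inv' \<sigma> permutes {1..d}" by (rule permutes_inv[OF \<sigma>])
  have "tuple_act d y (inv' \<sigma>) = x \<longleftrightarrow> y = tuple_act d x \<sigma>" if y: "y \<in> carrier T" for y
    using tuple_act_compose[OF \<sigma>, of y "inv' \<sigma>"] tuple_act_compose[OF \<sigma>', of x \<sigma>]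
      permutes_inv_o[OF \<sigma>] tuple_act_id[OF y] tuple_act_id[OF x] by auto
  then show ?thesis using tuple_act_closed[OF \<sigma>'] by (auto simp: relabel_def free_gen_def fun_eq_iff)
qed

text \<open>
  A relation in position \<open>i\<close> becomes a relation in position \<open>inv \<sigma> i\<close>; so the action is well
  defined on cosets.
\<close>

lemma relabel_N:
  assumes \<sigma>: "\<sigma> permutes {1..d}" and n: "n \<in> N" shows "relabel \<sigma> n \<in> N"
proof -
  note h = module_homD[OF relabel_hom[OF \<sigma>]]
  have z: "relabel \<sigma> \<zero>\<^bsub>P\<^esub> = \<zero>\<^bsub>P\<^esub>" by (rule module_hom_zero[OF MA.F.module_F MA.F.module_F relabel_hom[OF \<sigma>]])
  have neg: "relabel \<sigma> (\<ominus>\<^bsub>P\<^esub> f) = \<ominus>\<^bsub>P\<^esub> (relabel \<sigma> f)" if "f \<in> carrier P" for f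
  proof -
    have "\<ominus>\<^bsub>P\<^esub> f = (\<ominus> \<one>) \<odot>\<^bsub>P\<^esub> f" using that by (simp add: P.smult_l_minus)
    then have "relabel \<sigma> (\<ominus>\<^bsub>P\<^esub> f) = (\<ominus> \<one>) \<odot>\<^bsub>P\<^esub> relabel \<sigma> f"
      using h(3)[OF _ that, of "\<ominus> \<one>"] by simp
    then show ?thesis using h(1)[OF that] by (simp add: P.smult_l_minus)
  qed
  have "submodule {n \<in> carrier P. relabel \<sigma> n \<in> N} R P"
    by (rule P.submodule_if_closed) (use h z zero_N N_E(4,5) in auto)
  moreover have "tensor_rels R A d \<subseteq> {n \<in> carrier P. relabel \<sigma> n \<in> N}"
  proof
    fix n assume n: "n \<in> tensor_rels R A d"
    then have "relabel \<sigma> n \<in> N"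
    proof (cases rule: rels_cases)
      case (1 x i a b)
      have "relabel \<sigma> n = addrel (tuple_act d x \<sigma>) (inv' \<sigma> i) a b"
        unfolding 1(1) addrel_def using 1(2-5) T_upd[OF 1(2,3)]
        by (simp add: P.minus_eq h neg relabel_gen[OF \<sigma>] \<delta>_closed tuple_act_upd[OF \<sigma>] del: atLeastAtMost_iff)
      then show ?thesis using 1 tuple_act_closed[OF \<sigma>] permutes_mem[OF permutes_inv[OF \<sigma>]] addrel_N by simp
    next
      case (2 x i r a)
      have "relabel \<sigma> n = smultrel (tuple_act d x \<sigma>) (inv' \<sigma> i) r a"
        unfolding 2(1) smultrel_def using 2(2-5) T_upd[OF 2(2,3)]
        by (simp add: P.minus_eq h neg relabel_gen[OF \<sigma>] \<delta>_closed tuple_act_upd[OF \<sigma>] del: atLeastAtMost_iff)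
      then show ?thesis using 2 tuple_act_closed[OF \<sigma>] permutes_mem[OF permutes_inv[OF \<sigma>]] smultrel_N by simp
    qed
    then show "n \<in> {n \<in> carrier P. relabel \<sigma> n \<in> N}" using n rels_sub by blast
  qed
  ultimately have "N \<subseteq> {n \<in> carrier P. relabel \<sigma> n \<in> N}" by (rule N_least)
  then show ?thesis using n by blast
qed

lemma relabel_inverse:
  assumes \<sigma>: "\<sigma> permutes {1..d}" and f: "f \<in> carrier P" shows "relabel \<sigma> (relabel (inv' \<sigma>) f) = f"
proof -
  have \<sigma>': "inv' \<sigma> permutes {1..d}" by (rule permutes_inv[OF \<sigma>])
  show ?thesis
  proof (rule module_hom_eq_on_span[OF MA.F.module_F MA.F.module_F MA.F.F_spans
        module_hom_compose[OF relabel_hom[OF \<sigma>'] relabel_hom[OF \<sigma>]] _ _ f])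
    show "(\<lambda>f. f) \<in> module_hom R P P" by (simp add: module_hom_def)
    show "relabel \<sigma> (relabel (inv' \<sigma>) s) = s" if "s \<in> \<delta> ` carrier T" for s
    proof -
      from that obtain x where x: "s = \<delta> x" "x \<in> carrier T" by blast
      then show ?thesis
        using relabel_gen[OF \<sigma>' x(2)] relabel_gen[OF \<sigma> tuple_act_closed[OF \<sigma>' x(2)]]
          tuple_act_compose[OF \<sigma>, of x "inv' \<sigma>"] permutes_inv_o(2)[OF \<sigma>] tuple_act_id[OF x(2)] by simp
    qed
  qed
qed

lemma act_\<pi>:
  assumes \<sigma>: "\<sigma> permutes {1..d}" and f: "f \<in> carrier P" shows "act (\<pi> f) \<sigma> = \<pi> (relabel \<sigma> f)"
proof -
  have \<sigma>': "inv' \<sigma> permutes {1..d}" by (rule permutes_inv[OF \<sigma>])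
  note h = module_homD[OF relabel_hom[OF \<sigma>]]
  have "relabel \<sigma> ` \<pi> f = \<pi> (relabel \<sigma> f)"
  proof (intro equalityI subsetI)
    fix g assume "g \<in> relabel \<sigma> ` \<pi> f"
    then obtain n where "n \<in> N" "g = relabel \<sigma> (n \<oplus>\<^bsub>P\<^esub> f)" by (auto simp: a_r_coset_def')
    then show "g \<in> \<pi> (relabel \<sigma> f)" using h f N_carrier relabel_N[OF \<sigma>] by (auto simp: a_r_coset_def')
  next
    fix g assume "g \<in> \<pi> (relabel \<sigma> f)"
    then obtain n where n: "n \<in> N" "g = n \<oplus>\<^bsub>P\<^esub> relabel \<sigma> f" by (auto simp: a_r_coset_def')
    let ?n = "relabel (inv' \<sigma>) n"
    have "?n \<in> N" using relabel_N[OF \<sigma>' n(1)] .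
    then have "g = relabel \<sigma> (?n \<oplus>\<^bsub>P\<^esub> f)" "?n \<oplus>\<^bsub>P\<^esub> f \<in> \<pi> f"
      using n h f N_carrier relabel_inverse[OF \<sigma>] by (auto simp: a_r_coset_def')
    then show "g \<in> relabel \<sigma> ` \<pi> f" by blast
  qed
  then show ?thesis by (simp add: act_eq[OF \<sigma>])
qed

lemma act_hom:
  assumes \<sigma>: "\<sigma> permutes {1..d}" shows "(\<lambda>v. act v \<sigma>) \<in> module_hom R V V"
proof (rule module_homI)
  note h = module_homD[OF relabel_hom[OF \<sigma>]]
  show "act v \<sigma> \<in> carrier V" if "v \<in> carrier V" for v
    using that h by (auto simp: carrier_V act_\<pi>[OF \<sigma>])
  show "act (v \<oplus>\<^bsub>V\<^esub> w) \<sigma> = act v \<sigma> \<oplus>\<^bsub>V\<^esub> act w \<sigma>" if "v \<in> carrier V" "w \<in> carrier V" for v w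
    using that h by (auto simp: carrier_V \<pi>_add[symmetric] act_\<pi>[OF \<sigma>])
  show "act (r \<odot>\<^bsub>V\<^esub> v) \<sigma> = r \<odot>\<^bsub>V\<^esub> act v \<sigma>" if "r \<in> carrier R" "v \<in> carrier V" for r v
    using that h by (auto simp: carrier_V \<pi>_smult[symmetric] act_\<pi>[OF \<sigma>])
qed

lemma act_pure: "\<sigma> permutes {1..d} \<Longrightarrow> x \<in> carrier T \<Longrightarrow> act (pure x) \<sigma> = pure (tuple_act d x \<sigma>)"
  by (simp add: pure_eq act_\<pi> \<delta>_closed relabel_gen)

section \<open>The wreath product is an algebra\<close>

abbreviation W where "W \<equiv> wreath_algebra R A d"
abbreviation wt where "wt \<equiv> wreath_tensor R A d"
abbreviation elt where "elt x \<rho> \<equiv> wreath_tensor R A d (pure_tensor R A d x) \<rho>"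

lemma carrier_W: "carrier W = sym d \<rightarrow>\<^sub>E carrier V"
  and mult_W: "F \<otimes>\<^bsub>W\<^esub> G = (\<lambda>\<omega>\<in>sym d. finsum V (\<lambda>(\<rho>, \<sigma>). F \<rho> \<otimes>\<^bsub>V\<^esub> act (G \<sigma>) (inv\<^bsub>sym_group d\<^esub> \<rho>))
     {(\<rho>, \<sigma>) \<in> sym d \<times> sym d. \<rho> \<circ> \<sigma> = \<omega>})"
  and one_W: "\<one>\<^bsub>W\<^esub> = wt \<one>\<^bsub>V\<^esub> id"
  and zero_W: "\<zero>\<^bsub>W\<^esub> = (\<lambda>\<omega>\<in>sym d. \<zero>\<^bsub>V\<^esub>)"
  and add_W: "F \<oplus>\<^bsub>W\<^esub> G = (\<lambda>\<omega>\<in>sym d. F \<omega> \<oplus>\<^bsub>V\<^esub> G \<omega>)"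
  and smult_W: "r \<odot>\<^bsub>W\<^esub> F = (\<lambda>\<omega>\<in>sym d. r \<odot>\<^bsub>V\<^esub> F \<omega>)"
  by (simp_all add: wreath_algebra_def Let_def carrier_sym_group sym_group_mult sym_group_one)

lemma finite_sym: "finite (sym d)" unfolding sym_def by (rule finite_permutations) simp

lemma W_mem: "F \<in> carrier W \<Longrightarrow> \<rho> \<in> sym d \<Longrightarrow> F \<rho> \<in> carrier V"
  unfolding carrier_W using PiE_mem[of F "sym d" "\<lambda>_. carrier V" \<rho>] by blast

lemma W_eqI: "F \<in> carrier W \<Longrightarrow> G \<in> carrier W \<Longrightarrow> (\<And>\<rho>. \<rho> \<in> sym d \<Longrightarrow> F \<rho> = G \<rho>) \<Longrightarrow> F = G"
  unfolding carrier_W by (rule PiE_ext)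

lemma W_restrict: "(\<And>\<rho>. \<rho> \<in> sym d \<Longrightarrow> f \<rho> \<in> carrier V) \<Longrightarrow> (\<lambda>\<rho>\<in>sym d. f \<rho>) \<in> carrier W"
  unfolding carrier_W by (simp add: restrict_PiE_iff)

lemma add_W_closed: "F \<in> carrier W \<Longrightarrow> G \<in> carrier W \<Longrightarrow> F \<oplus>\<^bsub>W\<^esub> G \<in> carrier W"
  unfolding add_W by (rule W_restrict, rule V.a_closed; erule (1) W_mem)
lemma smult_W_closed: "r \<in> carrier R \<Longrightarrow> F \<in> carrier W \<Longrightarrow> r \<odot>\<^bsub>W\<^esub> F \<in> carrier W"
  unfolding smult_W by (rule W_restrict, rule V.smult_closed, assumption, erule (1) W_mem)
lemma zero_W_closed: "\<zero>\<^bsub>W\<^esub> \<in> carrier W"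
  unfolding zero_W by (rule W_restrict, rule V.zero_closed)

lemma add_W_app: "\<rho> \<in> sym d \<Longrightarrow> (F \<oplus>\<^bsub>W\<^esub> G) \<rho> = F \<rho> \<oplus>\<^bsub>V\<^esub> G \<rho>"
  and smult_W_app: "\<rho> \<in> sym d \<Longrightarrow> (r \<odot>\<^bsub>W\<^esub> F) \<rho> = r \<odot>\<^bsub>V\<^esub> F \<rho>"
  and zero_W_app: "\<rho> \<in> sym d \<Longrightarrow> \<zero>\<^bsub>W\<^esub> \<rho> = \<zero>\<^bsub>V\<^esub>"
  by (simp_all add: add_W smult_W zero_W)

lemmas W_simps = add_W_app smult_W_app zero_W_app W_mem add_W_closed smult_W_closed zero_W_closed

lemma module_W: "module R W"
proof (rule moduleI)
  show "abelian_group W"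
  proof (rule abelian_groupI)
    show "\<exists>G\<in>carrier W. G \<oplus>\<^bsub>W\<^esub> F = \<zero>\<^bsub>W\<^esub>" if F: "F \<in> carrier W" for F
    proof
      show "(\<ominus> \<one>) \<odot>\<^bsub>W\<^esub> F \<in> carrier W" using F by (simp add: smult_W_closed)
      show "(\<ominus> \<one>) \<odot>\<^bsub>W\<^esub> F \<oplus>\<^bsub>W\<^esub> F = \<zero>\<^bsub>W\<^esub>"
        using F by (intro W_eqI) (simp_all add: W_simps V.smult_l_minus V.l_neg)
    qed
    show "F \<oplus>\<^bsub>W\<^esub> G \<oplus>\<^bsub>W\<^esub> H = F \<oplus>\<^bsub>W\<^esub> (G \<oplus>\<^bsub>W\<^esub> H)"
      if "F \<in> carrier W" "G \<in> carrier W" "H \<in> carrier W" for F G H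
      using that by (intro W_eqI) (simp_all add: W_simps V.a_assoc)
    show "F \<oplus>\<^bsub>W\<^esub> G = G \<oplus>\<^bsub>W\<^esub> F" if "F \<in> carrier W" "G \<in> carrier W" for F G
      using that by (intro W_eqI) (simp_all add: W_simps V.a_comm)
    show "\<zero>\<^bsub>W\<^esub> \<oplus>\<^bsub>W\<^esub> F = F" if "F \<in> carrier W" for F
      using that by (intro W_eqI) (simp_all add: W_simps)
  qed (auto intro: add_W_closed zero_W_closed)
  show "cring R" by (rule A.R.is_cring)
next
  fix a b F assume "a \<in> carrier R" "b \<in> carrier R" "F \<in> carrier W"
  then show "(a \<oplus> b) \<odot>\<^bsub>W\<^esub> F = a \<odot>\<^bsub>W\<^esub> F \<oplus>\<^bsub>W\<^esub> b \<odot>\<^bsub>W\<^esub> F" "(a \<otimes> b) \<odot>\<^bsub>W\<^esub> F = a \<odot>\<^bsub>W\<^esub> (b \<odot>\<^bsub>W\<^esub> F)"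
    by (intro W_eqI, simp_all add: W_simps V.smult_l_distr V.smult_assoc1)+
next
  fix a F G assume "a \<in> carrier R" "F \<in> carrier W" "G \<in> carrier W"
  then show "a \<odot>\<^bsub>W\<^esub> (F \<oplus>\<^bsub>W\<^esub> G) = a \<odot>\<^bsub>W\<^esub> F \<oplus>\<^bsub>W\<^esub> a \<odot>\<^bsub>W\<^esub> G"
    by (intro W_eqI) (simp_all add: W_simps V.smult_r_distr)
next
  fix F assume "F \<in> carrier W"
  then show "\<one> \<odot>\<^bsub>W\<^esub> F = F" by (intro W_eqI) (simp_all add: W_simps)
qed (auto intro: smult_W_closed)

lemma wt_hom: "\<rho> \<in> sym d \<Longrightarrow> (\<lambda>v. wt v \<rho>) \<in> module_hom R V W"
  by (intro module_homI W_eqI)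
    (auto simp: wreath_tensor_def carrier_sym_group add_W smult_W carrier_W)

lemma wt_closed: "v \<in> carrier V \<Longrightarrow> wt v \<rho> \<in> carrier W"
  unfolding wreath_tensor_def carrier_sym_group by (rule W_restrict) simp

lemma elt_closed: "x \<in> carrier T \<Longrightarrow> elt x \<rho> \<in> carrier W"
  by (rule wt_closed, rule pure_closed)

lemma W_decomp:
  assumes F: "F \<in> carrier W" shows "F = (\<Oplus>\<^bsub>W\<^esub>\<rho>\<in>sym d. wt (F \<rho>) \<rho>)"
proof -
  interpret W: module R W by (rule module_W)
  have cl: "(\<lambda>\<rho>. wt (F \<rho>) \<rho>) \<in> X \<rightarrow> carrier W" if "X \<subseteq> sym d" for X
    using wt_closed W_mem[OF F] that by blast
  have "finite X \<Longrightarrow> X \<subseteq> sym d \<Longrightarrow> (\<Oplus>\<^bsub>W\<^esub>\<rho>\<in>X. wt (F \<rho>) \<rho>) = (\<lambda>\<rho>\<in>sym d. if \<rho> \<in> X then F \<rho> else \<zero>\<^bsub>V\<^esub>)" for X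
  proof (induction X rule: finite_induct)
    case empty
    then show ?case by (simp add: zero_W)
  next
    case (insert \<rho> X)
    have "(\<Oplus>\<^bsub>W\<^esub>\<rho>\<in>insert \<rho> X. wt (F \<rho>) \<rho>) = wt (F \<rho>) \<rho> \<oplus>\<^bsub>W\<^esub> (\<Oplus>\<^bsub>W\<^esub>\<rho>\<in>X. wt (F \<rho>) \<rho>)"
      using insert cl[of X] wt_closed W_mem[OF F, of \<rho>] by (intro W.M.finsum_insert) auto
    also have "(\<Oplus>\<^bsub>W\<^esub>\<rho>\<in>X. wt (F \<rho>) \<rho>) = (\<lambda>\<rho>\<in>sym d. if \<rho> \<in> X then F \<rho> else \<zero>\<^bsub>V\<^esub>)"
      using insert by blast
    also have "wt (F \<rho>) \<rho> \<oplus>\<^bsub>W\<^esub> \<dots> = (\<lambda>\<sigma>\<in>sym d. if \<sigma> \<in> insert \<rho> X then F \<sigma> else \<zero>\<^bsub>V\<^esub>)"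
      unfolding add_W by (rule restrict_ext)
        (use insert.hyps W_mem[OF F] in \<open>auto simp: wreath_tensor_def carrier_sym_group\<close>)
    finally show ?case .
  qed
  from this[OF finite_sym subset_refl]
  have "(\<Oplus>\<^bsub>W\<^esub>\<rho>\<in>sym d. wt (F \<rho>) \<rho>) = (\<lambda>\<rho>\<in>sym d. F \<rho>)" by (simp cong: restrict_cong)
  also have "\<dots> = F" using F unfolding carrier_W by (rule PiE_restrict)
  finally show ?thesis by simp
qed

lemma W_spans_of_V:
  assumes "spans R V S" shows "spans R W {wt v \<rho> | v \<rho>. v \<in> S \<and> \<rho> \<in> sym d}"
  unfolding spans_def
proof (intro conjI allI impI subsetI)
  interpret W: module R W by (rule module_W)
  show "F \<in> carrier W" if "F \<in> {wt v \<rho> | v \<rho>. v \<in> S \<and> \<rho> \<in> sym d}" for F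
    using that assms wt_closed by (auto simp: spans_def)
  fix H F assume H: "submodule H R W \<and> {wt v \<rho> | v \<rho>. v \<in> S \<and> \<rho> \<in> sym d} \<subseteq> H" and F: "F \<in> carrier W"
  note HE = W.submoduleE[OF conjunct1[OF H]]
  have zH: "\<zero>\<^bsub>W\<^esub> \<in> H" by (rule W.submodule_zero[OF conjunct1[OF H]])
  have wH: "wt v \<rho> \<in> H" if "\<rho> \<in> sym d" "v \<in> carrier V" for v \<rho>
    using V.module_axioms assms that(2)
  proof (rule spans_induct)
    show "wt s \<rho> \<in> H" if "s \<in> S" for s using H that \<open>\<rho> \<in> sym d\<close> by blast
  qed (use that HE zH module_homD[OF wt_hom[OF that(1)]] module_hom_zero[OF V.module_axioms module_W wt_hom[OF that(1)]] in auto)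
  have "(\<Oplus>\<^bsub>W\<^esub>\<rho>\<in>sym d. wt (F \<rho>) \<rho>) \<in> H"
    by (intro W.submodule_finsum[OF conjunct1[OF H]] wH W_mem[OF F])
  then show "F \<in> H" using W_decomp[OF F] by simp
qed

lemma W_spans: "spans R W {elt x \<rho> | x \<rho>. x \<in> carrier T \<and> \<rho> \<in> sym d}"
proof -
  have "{wt v \<rho> | v \<rho>. v \<in> pure ` carrier T \<and> \<rho> \<in> sym d} = {elt x \<rho> | x \<rho>. x \<in> carrier T \<and> \<rho> \<in> sym d}" by blast
  then show ?thesis using W_spans_of_V[OF V_spans] by simp
qed

lemma act_inv_hom: "\<rho> \<in> sym d \<Longrightarrow> (\<lambda>v. act v (inv' \<rho>)) \<in> module_hom R V V"
  by (rule act_hom, drule inv_sym, simp only: mem_sym)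

lemma act_closed: "\<rho> \<in> sym d \<Longrightarrow> v \<in> carrier V \<Longrightarrow> act v (inv' \<rho>) \<in> carrier V"
  by (rule module_homD(1)[OF act_inv_hom])

lemma W_mult_term:
  "F \<in> carrier W \<Longrightarrow> G \<in> carrier W \<Longrightarrow> \<rho> \<in> sym d \<Longrightarrow> \<sigma> \<in> sym d \<Longrightarrow>
    F \<rho> \<otimes>\<^bsub>V\<^esub> act (G \<sigma>) (inv' \<rho>) \<in> carrier V"
  by (intro V.m_closed act_closed W_mem[of F] W_mem[of G])

lemma W_mult_app:
  assumes FG: "F \<in> carrier W" "G \<in> carrier W" and "\<omega> \<in> sym d"
  shows "(F \<otimes>\<^bsub>W\<^esub> G) \<omega> = (\<Oplus>\<^bsub>V\<^esub>p\<in>{p \<in> sym d \<times> sym d. fst p \<circ> snd p = \<omega>}. F (fst p) \<otimes>\<^bsub>V\<^esub> act (G (snd p)) (inv' (fst p)))"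
proof -
  have e: "{(\<rho>, \<sigma>) \<in> sym d \<times> sym d. \<rho> \<circ> \<sigma> = \<omega>} = {p \<in> sym d \<times> sym d. fst p \<circ> snd p = \<omega>}" by auto
  have "finsum V (\<lambda>(\<rho>, \<sigma>). F \<rho> \<otimes>\<^bsub>V\<^esub> act (G \<sigma>) (inv\<^bsub>sym_group d\<^esub> \<rho>)) {p \<in> sym d \<times> sym d. fst p \<circ> snd p = \<omega>}
     = (\<Oplus>\<^bsub>V\<^esub>p\<in>{p \<in> sym d \<times> sym d. fst p \<circ> snd p = \<omega>}. F (fst p) \<otimes>\<^bsub>V\<^esub> act (G (snd p)) (inv' (fst p)))"
    by (rule V.M.finsum_cong') (use W_mult_term[OF FG] in \<open>auto simp: inv_sym_group mem_sym\<close>)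
  moreover have "(F \<otimes>\<^bsub>W\<^esub> G) \<omega> = finsum V (\<lambda>(\<rho>, \<sigma>). F \<rho> \<otimes>\<^bsub>V\<^esub> act (G \<sigma>) (inv\<^bsub>sym_group d\<^esub> \<rho>))
     {(\<rho>, \<sigma>) \<in> sym d \<times> sym d. \<rho> \<circ> \<sigma> = \<omega>}"
    unfolding mult_W using assms(3) by (rule restrict_apply')
  ultimately show ?thesis unfolding e by (rule trans[rotated])
qed

lemma W_mult_closed: "F \<in> carrier W \<Longrightarrow> G \<in> carrier W \<Longrightarrow> F \<otimes>\<^bsub>W\<^esub> G \<in> carrier W"
proof -
  assume FG: "F \<in> carrier W" "G \<in> carrier W"
  have "(F \<otimes>\<^bsub>W\<^esub> G) \<omega> \<in> carrier V" if "\<omega> \<in> sym d" for \<omega>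
    unfolding W_mult_app[OF FG that] by (rule V.M.finsum_closed) (use W_mult_term[OF FG] in auto)
  then have cl: "(\<lambda>\<omega>\<in>sym d. (F \<otimes>\<^bsub>W\<^esub> G) \<omega>) \<in> carrier W" by (rule W_restrict)
  have "(\<lambda>\<omega>\<in>sym d. (F \<otimes>\<^bsub>W\<^esub> G) \<omega>) = F \<otimes>\<^bsub>W\<^esub> G" by (simp add: mult_W cong: restrict_cong)
  from cl[unfolded this] show ?thesis .
qed

lemma W_mult_left_hom:
  assumes G: "G \<in> carrier W" shows "(\<lambda>F. F \<otimes>\<^bsub>W\<^esub> G) \<in> module_hom R W W"
proof (rule module_homI)
  have aG: "act (G \<sigma>) (inv' \<rho>) \<in> carrier V" if "\<rho> \<in> sym d" "\<sigma> \<in> sym d" for \<rho> \<sigma>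
    by (rule act_closed[OF that(1) W_mem[OF G that(2)]])
  note t = W_mult_term[OF _ G]
  show "F \<otimes>\<^bsub>W\<^esub> G \<in> carrier W" if "F \<in> carrier W" for F using W_mult_closed that G by blast
  show "(F \<oplus>\<^bsub>W\<^esub> H) \<otimes>\<^bsub>W\<^esub> G = F \<otimes>\<^bsub>W\<^esub> G \<oplus>\<^bsub>W\<^esub> H \<otimes>\<^bsub>W\<^esub> G" if FH: "F \<in> carrier W" "H \<in> carrier W" for F H
  proof (rule W_eqI)
    fix \<omega> assume \<omega>: "\<omega> \<in> sym d"
    let ?S = "{p \<in> sym d \<times> sym d. fst p \<circ> snd p = \<omega>}"
    have "((F \<oplus>\<^bsub>W\<^esub> H) \<otimes>\<^bsub>W\<^esub> G) \<omega> = (\<Oplus>\<^bsub>V\<^esub>p\<in>?S. F (fst p) \<otimes>\<^bsub>V\<^esub> act (G (snd p)) (inv' (fst p)) \<oplus>\<^bsub>V\<^esub> H (fst p) \<otimes>\<^bsub>V\<^esub> act (G (snd p)) (inv' (fst p)))"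
      unfolding W_mult_app[OF add_W_closed[OF FH] G \<omega>]
      by (rule V.M.finsum_cong') (use t FH aG in \<open>auto simp: W_simps V.l_distr\<close>)
    also have "\<dots> = (F \<otimes>\<^bsub>W\<^esub> G) \<omega> \<oplus>\<^bsub>V\<^esub> (H \<otimes>\<^bsub>W\<^esub> G) \<omega>"
      unfolding W_mult_app[OF FH(1) G \<omega>] W_mult_app[OF FH(2) G \<omega>]
      by (rule V.M.finsum_addf) (use t FH in auto)
    finally show "((F \<oplus>\<^bsub>W\<^esub> H) \<otimes>\<^bsub>W\<^esub> G) \<omega> = (F \<otimes>\<^bsub>W\<^esub> G \<oplus>\<^bsub>W\<^esub> H \<otimes>\<^bsub>W\<^esub> G) \<omega>" by (simp add: add_W_app[OF \<omega>])
  qed (use FH G in \<open>auto intro!: W_mult_closed add_W_closed\<close>)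
  show "(r \<odot>\<^bsub>W\<^esub> F) \<otimes>\<^bsub>W\<^esub> G = r \<odot>\<^bsub>W\<^esub> (F \<otimes>\<^bsub>W\<^esub> G)" if rF: "r \<in> carrier R" "F \<in> carrier W" for r F
  proof (rule W_eqI)
    fix \<omega> assume \<omega>: "\<omega> \<in> sym d"
    let ?S = "{p \<in> sym d \<times> sym d. fst p \<circ> snd p = \<omega>}"
    have "((r \<odot>\<^bsub>W\<^esub> F) \<otimes>\<^bsub>W\<^esub> G) \<omega> = (\<Oplus>\<^bsub>V\<^esub>p\<in>?S. r \<odot>\<^bsub>V\<^esub> (F (fst p) \<otimes>\<^bsub>V\<^esub> act (G (snd p)) (inv' (fst p))))"
      unfolding W_mult_app[OF smult_W_closed[OF rF] G \<omega>]
      by (rule V.M.finsum_cong') (use t rF aG in \<open>auto simp: W_simps V.smult_mult_left\<close>)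
    also have "\<dots> = r \<odot>\<^bsub>V\<^esub> (F \<otimes>\<^bsub>W\<^esub> G) \<omega>"
      unfolding W_mult_app[OF rF(2) G \<omega>]
      by (rule V.finsum_smult_ldistr[symmetric]) (use t rF finite_sym in \<open>auto intro: finite_subset[of _ "sym d \<times> sym d"]\<close>)
    finally show "((r \<odot>\<^bsub>W\<^esub> F) \<otimes>\<^bsub>W\<^esub> G) \<omega> = (r \<odot>\<^bsub>W\<^esub> (F \<otimes>\<^bsub>W\<^esub> G)) \<omega>" by (simp add: smult_W_app[OF \<omega>])
  qed (use rF G in \<open>auto intro!: W_mult_closed smult_W_closed\<close>)
qed

lemma W_mult_right_hom:
  assumes F: "F \<in> carrier W" shows "(\<lambda>G. F \<otimes>\<^bsub>W\<^esub> G) \<in> module_hom R W W"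
proof (rule module_homI)
  have aG: "act (G \<sigma>) (inv' \<rho>) \<in> carrier V" if "G \<in> carrier W" "\<rho> \<in> sym d" "\<sigma> \<in> sym d" for \<rho> \<sigma> G
    by (rule act_closed[OF that(2) W_mem[OF that(1,3)]])
  have ah: "(\<lambda>v. act v (inv' \<rho>)) \<in> module_hom R V V" if "\<rho> \<in> sym d" for \<rho>
    by (rule act_inv_hom[OF that])
  note t = W_mult_term[OF F]
  show "F \<otimes>\<^bsub>W\<^esub> G \<in> carrier W" if "G \<in> carrier W" for G using W_mult_closed that F by blast
  show "F \<otimes>\<^bsub>W\<^esub> (G \<oplus>\<^bsub>W\<^esub> H) = F \<otimes>\<^bsub>W\<^esub> G \<oplus>\<^bsub>W\<^esub> F \<otimes>\<^bsub>W\<^esub> H" if GH: "G \<in> carrier W" "H \<in> carrier W" for G H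
  proof (rule W_eqI)
    fix \<omega> assume \<omega>: "\<omega> \<in> sym d"
    let ?S = "{p \<in> sym d \<times> sym d. fst p \<circ> snd p = \<omega>}"
    have "(F \<otimes>\<^bsub>W\<^esub> (G \<oplus>\<^bsub>W\<^esub> H)) \<omega> = (\<Oplus>\<^bsub>V\<^esub>p\<in>?S. F (fst p) \<otimes>\<^bsub>V\<^esub> act (G (snd p)) (inv' (fst p)) \<oplus>\<^bsub>V\<^esub> F (fst p) \<otimes>\<^bsub>V\<^esub> act (H (snd p)) (inv' (fst p)))"
      unfolding W_mult_app[OF F add_W_closed[OF GH] \<omega>]
      by (rule V.M.finsum_cong') (use t F GH aG in \<open>auto simp: W_simps V.r_distr module_homD(2)[OF ah]\<close>)
    also have "\<dots> = (F \<otimes>\<^bsub>W\<^esub> G) \<omega> \<oplus>\<^bsub>V\<^esub> (F \<otimes>\<^bsub>W\<^esub> H) \<omega>"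
      unfolding W_mult_app[OF F GH(1) \<omega>] W_mult_app[OF F GH(2) \<omega>]
      by (rule V.M.finsum_addf) (use t GH in auto)
    finally show "(F \<otimes>\<^bsub>W\<^esub> (G \<oplus>\<^bsub>W\<^esub> H)) \<omega> = (F \<otimes>\<^bsub>W\<^esub> G \<oplus>\<^bsub>W\<^esub> F \<otimes>\<^bsub>W\<^esub> H) \<omega>" by (simp add: add_W_app[OF \<omega>])
  qed (use F GH in \<open>auto intro!: W_mult_closed add_W_closed\<close>)
  show "F \<otimes>\<^bsub>W\<^esub> (r \<odot>\<^bsub>W\<^esub> G) = r \<odot>\<^bsub>W\<^esub> (F \<otimes>\<^bsub>W\<^esub> G)" if rG: "r \<in> carrier R" "G \<in> carrier W" for r G
  proof (rule W_eqI)
    fix \<omega> assume \<omega>: "\<omega> \<in> sym d"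
    let ?S = "{p \<in> sym d \<times> sym d. fst p \<circ> snd p = \<omega>}"
    have "(F \<otimes>\<^bsub>W\<^esub> (r \<odot>\<^bsub>W\<^esub> G)) \<omega> = (\<Oplus>\<^bsub>V\<^esub>p\<in>?S. r \<odot>\<^bsub>V\<^esub> (F (fst p) \<otimes>\<^bsub>V\<^esub> act (G (snd p)) (inv' (fst p))))"
      unfolding W_mult_app[OF F smult_W_closed[OF rG] \<omega>]
      by (rule V.M.finsum_cong') (use t F rG aG in \<open>auto simp: W_simps V.smult_mult_right module_homD(3)[OF ah]\<close>)
    also have "\<dots> = r \<odot>\<^bsub>V\<^esub> (F \<otimes>\<^bsub>W\<^esub> G) \<omega>"
      unfolding W_mult_app[OF F rG(2) \<omega>]
      by (rule V.finsum_smult_ldistr[symmetric]) (use t rG finite_sym in \<open>auto intro: finite_subset[of _ "sym d \<times> sym d"]\<close>)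
    finally show "(F \<otimes>\<^bsub>W\<^esub> (r \<odot>\<^bsub>W\<^esub> G)) \<omega> = (r \<odot>\<^bsub>W\<^esub> (F \<otimes>\<^bsub>W\<^esub> G)) \<omega>" by (simp add: smult_W_app[OF \<omega>])
  qed (use rG F in \<open>auto intro!: W_mult_closed smult_W_closed\<close>)
qed

text \<open>
  On elements \<open>x \<otimes> \<rho>\<close> with pure \<open>x\<close>, the convolution in the multiplication reduces to a single
  term. As these elements span, this formula determines all products.
\<close>

lemma elt_mult:
  assumes x: "x \<in> carrier T" and y: "y \<in> carrier T" and \<rho>: "\<rho> \<in> sym d" and \<sigma>: "\<sigma> \<in> sym d"
  shows "elt x \<rho> \<otimes>\<^bsub>W\<^esub> elt y \<sigma> = elt (x \<otimes>\<^bsub>T\<^esub> tuple_act d y (inv' \<rho>)) (\<rho> \<circ> \<sigma>)"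
proof (rule W_eqI)
  have \<rho>': "inv' \<rho> permutes {1..d}" using inv_sym[OF \<rho>] by (simp add: mem_sym)
  let ?z = "x \<otimes>\<^bsub>T\<^esub> tuple_act d y (inv' \<rho>)"
  have z: "?z \<in> carrier T" by (intro mult_T_closed x tuple_act_closed[OF \<rho>' y])
  show "elt x \<rho> \<otimes>\<^bsub>W\<^esub> elt y \<sigma> \<in> carrier W" by (intro W_mult_closed elt_closed x y)
  show "elt ?z (\<rho> \<circ> \<sigma>) \<in> carrier W" by (rule elt_closed[OF z])
  fix \<omega> assume \<omega>: "\<omega> \<in> sym d"
  let ?S = "{p \<in> sym d \<times> sym d. fst p \<circ> snd p = \<omega>}"
  let ?f = "\<lambda>p. elt x \<rho> (fst p) \<otimes>\<^bsub>V\<^esub> act (elt y \<sigma> (snd p)) (inv' (fst p))"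
  have act0: "act \<zero>\<^bsub>V\<^esub> (inv' \<tau>) = \<zero>\<^bsub>V\<^esub>" if "\<tau> \<in> sym d" for \<tau>
    by (rule module_hom_zero[OF V.module_axioms V.module_axioms act_inv_hom[OF that]])
  have actc: "act v (inv' \<tau>) \<in> carrier V" if "\<tau> \<in> sym d" "v \<in> carrier V" for v \<tau>
    by (rule act_closed[OF that])
  have ev: "?f p = (if p = (\<rho>, \<sigma>) then pure ?z else \<zero>\<^bsub>V\<^esub>)" if p: "p \<in> sym d \<times> sym d" for p
  proof -
    have px: "pure x \<in> carrier V" "pure y \<in> carrier V" by (intro pure_closed x y)+
    have "pure x \<otimes>\<^bsub>V\<^esub> act (pure y) (inv' \<rho>) = pure ?z"
      using act_pure[OF \<rho>' y] pure_mult[OF x tuple_act_closed[OF \<rho>' y]] by simp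
    moreover obtain \<alpha> \<beta> where ab: "p = (\<alpha>, \<beta>)" "\<alpha> \<in> sym d" "\<beta> \<in> sym d" using p by auto
    moreover have "elt x \<rho> \<alpha> = (if \<alpha> = \<rho> then pure x else \<zero>\<^bsub>V\<^esub>)" "elt y \<sigma> \<beta> = (if \<beta> = \<sigma> then pure y else \<zero>\<^bsub>V\<^esub>)"
      using ab by (simp_all only: wreath_tensor_def carrier_sym_group restrict_apply')
    ultimately show ?thesis
      using px act0[OF ab(2)] act0[OF \<rho>] actc[OF ab(2) px(1)] actc[OF ab(2) px(2)] by simp
  qed
  have "(elt x \<rho> \<otimes>\<^bsub>W\<^esub> elt y \<sigma>) \<omega> = (\<Oplus>\<^bsub>V\<^esub>p\<in>?S. ?f p)"
    by (rule W_mult_app[OF elt_closed[OF x] elt_closed[OF y] \<omega>])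
  also have "\<dots> = (\<Oplus>\<^bsub>V\<^esub>p\<in>?S. if p = (\<rho>, \<sigma>) then pure ?z else \<zero>\<^bsub>V\<^esub>)"
    by (rule V.M.finsum_cong') (use ev pure_closed[OF z] in auto)
  also have "\<dots> = elt ?z (\<rho> \<circ> \<sigma>) \<omega>"
  proof (cases "\<rho> \<circ> \<sigma> = \<omega>")
    case True
    have "(\<Oplus>\<^bsub>V\<^esub>p\<in>?S. if p = (\<rho>, \<sigma>) then pure ?z else \<zero>\<^bsub>V\<^esub>) = pure ?z"
      by (rule V.M.add.finprod_singleton_swap)
        (use True \<rho> \<sigma> finite_sym finite_subset[of ?S "sym d \<times> sym d"] pure_closed[OF z] in auto)
    then show ?thesis using True \<omega> by (simp add: wreath_tensor_def carrier_sym_group)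
  next
    case False
    then have "(\<Oplus>\<^bsub>V\<^esub>p\<in>?S. if p = (\<rho>, \<sigma>) then pure ?z else \<zero>\<^bsub>V\<^esub>) = \<zero>\<^bsub>V\<^esub>"
      by (intro V.M.add.finprod_one_eqI) auto
    then show ?thesis using False \<omega> by (auto simp: wreath_tensor_def carrier_sym_group)
  qed
  finally show "(elt x \<rho> \<otimes>\<^bsub>W\<^esub> elt y \<sigma>) \<omega> = elt ?z (\<rho> \<circ> \<sigma>) \<omega>" .
qed

lemma one_elt: "\<one>\<^bsub>W\<^esub> = elt \<one>\<^bsub>T\<^esub> id"
  unfolding one_W pure_one ..

theorem assoc_algebra_W: "assoc_algebra R W"
proof (rule assoc_algebraI_span[OF module_W W_spans W_mult_closed W_mult_left_hom W_mult_right_hom])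
  note id = id_sym[of d]
  show "\<one>\<^bsub>W\<^esub> \<in> carrier W" unfolding one_elt by (rule elt_closed[OF one_T_closed])
  show "\<one>\<^bsub>W\<^esub> \<otimes>\<^bsub>W\<^esub> X = X" if "X \<in> {elt x \<rho> | x \<rho>. x \<in> carrier T \<and> \<rho> \<in> sym d}" for X
    using that id by (auto simp: one_elt elt_mult tuple_act_id)
  show "X \<otimes>\<^bsub>W\<^esub> \<one>\<^bsub>W\<^esub> = X" if "X \<in> {elt x \<rho> | x \<rho>. x \<in> carrier T \<and> \<rho> \<in> sym d}" for X
  proof -
    from that obtain x \<rho> where X: "X = elt x \<rho>" "x \<in> carrier T" "\<rho> \<in> sym d" by blast
    have "tuple_act d \<one>\<^bsub>T\<^esub> (inv' \<rho>) = \<one>\<^bsub>T\<^esub>"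
      using permutes_mem[OF permutes_inv, of \<rho> d] X(3) unfolding mem_sym by (auto simp: tuple_act_def one_T fun_eq_iff)
    then show ?thesis using X id by (simp add: one_elt elt_mult)
  qed
  show "(X \<otimes>\<^bsub>W\<^esub> Y) \<otimes>\<^bsub>W\<^esub> Z = X \<otimes>\<^bsub>W\<^esub> (Y \<otimes>\<^bsub>W\<^esub> Z)"
    if "X \<in> {elt x \<rho> | x \<rho>. x \<in> carrier T \<and> \<rho> \<in> sym d}" "Y \<in> {elt x \<rho> | x \<rho>. x \<in> carrier T \<and> \<rho> \<in> sym d}"
      "Z \<in> {elt x \<rho> | x \<rho>. x \<in> carrier T \<and> \<rho> \<in> sym d}" for X Y Z
  proof -
    from that obtain x y z \<rho> \<sigma> \<tau> where
      X: "X = elt x \<rho>" "x \<in> carrier T" "\<rho> \<in> sym d" and Y: "Y = elt y \<sigma>" "y \<in> carrier T" "\<sigma> \<in> sym d"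
      and Z: "Z = elt z \<tau>" "z \<in> carrier T" "\<tau> \<in> sym d" by blast
    have inv: "inv' \<rho> permutes {1..d}" "inv' \<sigma> permutes {1..d}" "inv' (\<rho> \<circ> \<sigma>) permutes {1..d}"
      using inv_sym[OF X(3)] inv_sym[OF Y(3)] inv_sym[OF comp_sym[OF X(3) Y(3)]] by (simp_all only: mem_sym)
    have c: "\<rho> \<circ> \<sigma> \<in> sym d" "\<sigma> \<circ> \<tau> \<in> sym d" using X Y Z by (auto intro: comp_sym)
    have io: "inv' (\<rho> \<circ> \<sigma>) = inv' \<sigma> \<circ> inv' \<rho>"
      using X Y by (simp add: mem_sym o_inv_distrib permutes_bij)
    show ?thesis
      using X Y Z inv c
      by (simp add: elt_mult tuple_act_closed mult_T_closed tuple_act_mult tuple_act_compose io MA.G.m_assoc o_assoc)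
  qed
qed

sublocale W: assoc_algebra R W by (rule assoc_algebra_W)

section \<open>Induced anti-involutions\<close>

definition tuple_map :: "('a \<Rightarrow> 'a) \<Rightarrow> (nat \<Rightarrow> 'a) \<Rightarrow> nat \<Rightarrow> 'a" where
  "tuple_map \<tau> x = (\<lambda>i\<in>{1..d}. \<tau> (x i))"

text \<open>
  Apply \<open>\<tau>\<close> to every strand and turn the permutation upside down; on pure tensors this is
  \<open>x \<otimes> \<rho> \<mapsto> \<tau>(x) \<rho> \<otimes> inv \<rho>\<close>. All identities are checked on these elements.
\<close>

lemma W_anti_involution:
  assumes \<tau>: "\<tau> \<in> module_hom R A A"
    and anti: "\<And>x y. x \<in> carrier A \<Longrightarrow> y \<in> carrier A \<Longrightarrow> \<tau> (x \<otimes>\<^bsub>A\<^esub> y) = \<tau> y \<otimes>\<^bsub>A\<^esub> \<tau> x"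
    and one: "\<tau> \<one>\<^bsub>A\<^esub> = \<one>\<^bsub>A\<^esub>" and invol: "\<And>x. x \<in> carrier A \<Longrightarrow> \<tau> (\<tau> x) = x"
  obtains \<Theta> where "\<Theta> \<in> module_hom R W W"
    "\<And>X Y. X \<in> carrier W \<Longrightarrow> Y \<in> carrier W \<Longrightarrow> \<Theta> (X \<otimes>\<^bsub>W\<^esub> Y) = \<Theta> Y \<otimes>\<^bsub>W\<^esub> \<Theta> X"
    "\<Theta> \<one>\<^bsub>W\<^esub> = \<one>\<^bsub>W\<^esub>" "\<And>X. X \<in> carrier W \<Longrightarrow> \<Theta> (\<Theta> X) = X"
    "\<And>x \<rho>. x \<in> carrier T \<Longrightarrow> \<rho> \<in> sym d \<Longrightarrow> \<Theta> (elt x \<rho>) = elt (\<lambda>i\<in>{1..d}. \<tau> (x (\<rho> i))) (inv' \<rho>)"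
proof -
  note t = module_homD[OF \<tau>]
  have tm: "tuple_map \<tau> x \<in> carrier T" if "x \<in> carrier T" for x
    unfolding tuple_map_def by (intro T_restrict t(1) T_mem[OF that])
  have "multilinear R A d V (\<lambda>x. pure (tuple_map \<tau> x))"
    unfolding multilinear_def
  proof (intro conjI ballI funcsetI)
    show "pure (tuple_map \<tau> x) \<in> carrier V" if "x \<in> {1..d} \<rightarrow>\<^sub>E carrier A" for x
      using that by (intro pure_closed tm) (simp add: carrier_T)
    fix x i assume "x \<in> {1..d} \<rightarrow>\<^sub>E carrier A" and i: "i \<in> {1..d}"
    then have x: "x \<in> carrier T" by (simp add: carrier_T)
    have "(\<lambda>a. pure ((tuple_map \<tau> x)(i := a))) \<in> module_hom R A V"
      using pure_multilinear tm[OF x] i unfolding multilinear_def carrier_T by blast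
    from module_hom_compose[OF \<tau> this] have "(\<lambda>a. pure ((tuple_map \<tau> x)(i := \<tau> a))) \<in> module_hom R A V" .
    moreover have "tuple_map \<tau> (x(i := a)) = (tuple_map \<tau> x)(i := \<tau> a)" for a
      using i by (auto simp: tuple_map_def)
    ultimately show "(\<lambda>a. pure (tuple_map \<tau> (x(i := a)))) \<in> module_hom R A V" by simp
  qed
  from tensor_universal[OF V.module_axioms this] obtain h where
    h: "h \<in> module_hom R V V" and hp: "\<And>x. x \<in> carrier T \<Longrightarrow> h (pure x) = pure (tuple_map \<tau> x)" by blast
  define \<Theta> where "\<Theta> F = (\<lambda>\<omega>\<in>sym d. act (h (F (inv' \<omega>))) (inv' \<omega>))" for F
  note inv = inv_sym[of _ d]
  have ah: "(\<lambda>v. act (h v) \<omega>) \<in> module_hom R V V" if "\<omega> \<in> sym d" for \<omega>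
    using module_hom_compose[OF h act_hom[of \<omega>]] that by (simp add: mem_sym)
  note ahD = module_homD[OF ah]
  have \<Theta>: "\<Theta> \<in> module_hom R W W"
  proof (rule module_homI)
    show cl: "\<Theta> F \<in> carrier W" if F: "F \<in> carrier W" for F
      unfolding \<Theta>_def by (rule W_restrict, rule ahD(1), erule inv, rule W_mem[OF F], erule inv)
    show "\<Theta> (F \<oplus>\<^bsub>W\<^esub> G) = \<Theta> F \<oplus>\<^bsub>W\<^esub> \<Theta> G" if FG: "F \<in> carrier W" "G \<in> carrier W" for F G
    proof (rule W_eqI)
      fix \<omega> assume w: "\<omega> \<in> sym d"
      show "\<Theta> (F \<oplus>\<^bsub>W\<^esub> G) \<omega> = (\<Theta> F \<oplus>\<^bsub>W\<^esub> \<Theta> G) \<omega>"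
        unfolding add_W_app[OF w] unfolding \<Theta>_def
        using w by (simp add: add_W_app[OF inv[OF w]] ahD(2)[OF inv[OF w] W_mem[OF FG(1) inv[OF w]] W_mem[OF FG(2) inv[OF w]]])
    qed (use FG cl add_W_closed in auto)
    show "\<Theta> (r \<odot>\<^bsub>W\<^esub> F) = r \<odot>\<^bsub>W\<^esub> \<Theta> F" if rF: "r \<in> carrier R" "F \<in> carrier W" for r F
    proof (rule W_eqI)
      fix \<omega> assume w: "\<omega> \<in> sym d"
      show "\<Theta> (r \<odot>\<^bsub>W\<^esub> F) \<omega> = (r \<odot>\<^bsub>W\<^esub> \<Theta> F) \<omega>"
        unfolding smult_W_app[OF w] unfolding \<Theta>_def
        using w by (simp add: smult_W_app[OF inv[OF w]] ahD(3)[OF inv[OF w] rF(1) W_mem[OF rF(2) inv[OF w]]])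
    qed (use rF cl smult_W_closed in auto)
  qed
  note \<Theta>D = module_homD[OF \<Theta>]
  have tc: "(\<lambda>i\<in>{1..d}. \<tau> (x (\<rho> i))) \<in> carrier T" if x: "x \<in> carrier T" and \<rho>: "\<rho> \<in> sym d" for x \<rho>
    using permutes_mem[of \<rho> d] \<rho> by (intro T_restrict t(1) T_mem[OF x]) (simp add: mem_sym)
  have \<Theta>e: "\<Theta> (elt x \<rho>) = elt (\<lambda>i\<in>{1..d}. \<tau> (x (\<rho> i))) (inv' \<rho>)" if x: "x \<in> carrier T" and \<rho>: "\<rho> \<in> sym d" for x \<rho>
  proof (rule W_eqI)
    have \<rho>p: "\<rho> permutes {1..d}" using \<rho> by (simp add: mem_sym)
    show "\<Theta> (elt x \<rho>) \<in> carrier W" by (rule \<Theta>D(1)[OF elt_closed[OF x]])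
    show "elt (\<lambda>i\<in>{1..d}. \<tau> (x (\<rho> i))) (inv' \<rho>) \<in> carrier W" by (rule elt_closed[OF tc[OF x \<rho>]])
    fix \<omega> assume w: "\<omega> \<in> sym d"
    have 0: "act (h \<zero>\<^bsub>V\<^esub>) (inv' \<omega>) = \<zero>\<^bsub>V\<^esub>"
      by (rule module_hom_zero[OF V.module_axioms V.module_axioms ah[OF inv[OF w]]])
    have iff: "inv' \<omega> = \<rho> \<longleftrightarrow> \<omega> = inv' \<rho>"
      using w inv_inv_sym \<rho> by metis
    have 1: "act (h (pure x)) \<rho> = pure (\<lambda>i\<in>{1..d}. \<tau> (x (\<rho> i)))"
    proof -
      have "tuple_act d (tuple_map \<tau> x) \<rho> = (\<lambda>i\<in>{1..d}. \<tau> (x (\<rho> i)))"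
        using permutes_mem[OF \<rho>p] by (auto simp: tuple_act_def tuple_map_def fun_eq_iff)
      then show ?thesis using act_pure[OF \<rho>p tm[OF x]] hp[OF x] by simp
    qed
    have "\<Theta> (elt x \<rho>) \<omega> = act (h (elt x \<rho> (inv' \<omega>))) (inv' \<omega>)" using w by (simp add: \<Theta>_def)
    also have "elt x \<rho> (inv' \<omega>) = (if inv' \<omega> = \<rho> then pure x else \<zero>\<^bsub>V\<^esub>)"
      using inv[OF w] by (simp add: wreath_tensor_def carrier_sym_group)
    also have "act (h (if inv' \<omega> = \<rho> then pure x else \<zero>\<^bsub>V\<^esub>)) (inv' \<omega>) = elt (\<lambda>i\<in>{1..d}. \<tau> (x (\<rho> i))) (inv' \<rho>) \<omega>"
      using 0 1 w iff by (auto simp: wreath_tensor_def carrier_sym_group)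
    finally show "\<Theta> (elt x \<rho>) \<omega> = elt (\<lambda>i\<in>{1..d}. \<tau> (x (\<rho> i))) (inv' \<rho>) \<omega>" .
  qed
  have anti_gen: "\<Theta> (elt x \<rho> \<otimes>\<^bsub>W\<^esub> elt y \<sigma>) = \<Theta> (elt y \<sigma>) \<otimes>\<^bsub>W\<^esub> \<Theta> (elt x \<rho>)"
    if x: "x \<in> carrier T" "\<rho> \<in> sym d" and y: "y \<in> carrier T" "\<sigma> \<in> sym d" for x y \<rho> \<sigma>
  proof -
    have p: "\<rho> permutes {1..d}" "\<sigma> permutes {1..d}" using x y by (auto simp: mem_sym)
    have c: "\<rho> \<circ> \<sigma> \<in> sym d" using x y by (simp add: comp_sym)
    let ?z = "x \<otimes>\<^bsub>T\<^esub> tuple_act d y (inv' \<rho>)"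
    have z: "?z \<in> carrier T" by (intro mult_T_closed x tuple_act_closed permutes_inv p y)
    have "\<Theta> (elt x \<rho> \<otimes>\<^bsub>W\<^esub> elt y \<sigma>) = elt (\<lambda>i\<in>{1..d}. \<tau> (?z ((\<rho> \<circ> \<sigma>) i))) (inv' (\<rho> \<circ> \<sigma>))"
      using elt_mult[OF x(1) y(1) x(2) y(2)] \<Theta>e[OF z c] by simp
    also have "inv' (\<rho> \<circ> \<sigma>) = inv' \<sigma> \<circ> inv' \<rho>"
      using p by (simp add: o_inv_distrib permutes_bij)
    also have "(\<lambda>i\<in>{1..d}. \<tau> (?z ((\<rho> \<circ> \<sigma>) i)))
        = (\<lambda>i\<in>{1..d}. \<tau> (y (\<sigma> i))) \<otimes>\<^bsub>T\<^esub> tuple_act d (\<lambda>i\<in>{1..d}. \<tau> (x (\<rho> i))) (inv' (inv' \<sigma>))"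
    proof -
      have "\<tau> (?z (\<rho> (\<sigma> i))) = \<tau> (y (\<sigma> i)) \<otimes>\<^bsub>A\<^esub> \<tau> (x (\<rho> (\<sigma> i)))" if i: "i \<in> {1..d}" for i
      proof -
        have m: "\<sigma> i \<in> {1..d}" "\<rho> (\<sigma> i) \<in> {1..d}" using permutes_mem[OF p(2) i] permutes_mem[OF p(1)] by auto
        have "?z (\<rho> (\<sigma> i)) = x (\<rho> (\<sigma> i)) \<otimes>\<^bsub>A\<^esub> y (\<sigma> i)"
          using m p by (simp add: mult_T tuple_act_def permutes_inverses)
        then show ?thesis using anti T_mem[OF x(1) m(2)] T_mem[OF y(1) m(1)] by simp
      qed
      then show ?thesis
        using permutes_mem[OF p(2)] by (auto simp: mult_T tuple_act_def permutes_inv_inv[OF p(2)] fun_eq_iff)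
    qed
    also have "elt \<dots> (inv' \<sigma> \<circ> inv' \<rho>) = elt (\<lambda>i\<in>{1..d}. \<tau> (y (\<sigma> i))) (inv' \<sigma>) \<otimes>\<^bsub>W\<^esub> elt (\<lambda>i\<in>{1..d}. \<tau> (x (\<rho> i))) (inv' \<rho>)"
      by (rule elt_mult[symmetric]) (use tc x y inv in auto)
    also have "\<dots> = \<Theta> (elt y \<sigma>) \<otimes>\<^bsub>W\<^esub> \<Theta> (elt x \<rho>)" using \<Theta>e x y by simp
    finally show ?thesis .
  qed
  let ?G = "{elt x \<rho> | x \<rho>. x \<in> carrier T \<and> \<rho> \<in> sym d}"
  have GW: "X \<in> carrier W" if "X \<in> ?G" for X using that elt_closed by blast
  note eqI = module_hom_eq_on_span[OF module_W module_W W_spans]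
  have a1: "\<Theta> (X \<otimes>\<^bsub>W\<^esub> Y) = \<Theta> Y \<otimes>\<^bsub>W\<^esub> \<Theta> X" if X: "X \<in> ?G" and Y: "Y \<in> carrier W" for X Y
    by (rule eqI[OF module_hom_compose[OF W_mult_right_hom[OF GW[OF X]] \<Theta>]
          module_hom_compose[OF \<Theta> W_mult_left_hom[OF \<Theta>D(1)[OF GW[OF X]]]] _ Y])
      (use anti_gen X in blast)
  have a2: "\<Theta> (X \<otimes>\<^bsub>W\<^esub> Y) = \<Theta> Y \<otimes>\<^bsub>W\<^esub> \<Theta> X" if X: "X \<in> carrier W" and Y: "Y \<in> carrier W" for X Y
    by (rule eqI[OF module_hom_compose[OF W_mult_left_hom[OF Y] \<Theta>]
          module_hom_compose[OF \<Theta> W_mult_right_hom[OF \<Theta>D(1)[OF Y]]] a1[OF _ Y] X])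
  have i: "\<Theta> (\<Theta> X) = X" if X: "X \<in> carrier W" for X
  proof (rule eqI[OF module_hom_compose[OF \<Theta> \<Theta>] _ _ X])
    show "(\<lambda>X. X) \<in> module_hom R W W" by (simp add: module_hom_def)
    fix Y assume "Y \<in> ?G"
    then obtain x \<rho> where Y: "Y = elt x \<rho>" "x \<in> carrier T" "\<rho> \<in> sym d" by blast
    then have p: "\<rho> permutes {1..d}" "inv' \<rho> permutes {1..d}" by (auto simp: mem_sym intro: permutes_inv)
    have "(\<lambda>i\<in>{1..d}. \<tau> ((\<lambda>i\<in>{1..d}. \<tau> (x (\<rho> i))) (inv' \<rho> i))) = x"
    proof (rule T_eqI)
      show "(\<lambda>i\<in>{1..d}. \<tau> ((\<lambda>i\<in>{1..d}. \<tau> (x (\<rho> i))) (inv' \<rho> i))) \<in> carrier T"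
        using tc[OF tc[OF Y(2,3)] inv[OF Y(3)]] .
      show "(\<lambda>i\<in>{1..d}. \<tau> ((\<lambda>i\<in>{1..d}. \<tau> (x (\<rho> i))) (inv' \<rho> i))) i = x i" if "i \<in> {1..d}" for i
        using that permutes_mem[OF p(2) that] p(1) invol T_mem[OF Y(2) that] by (simp add: permutes_inverses)
    qed (rule Y(2))
    then show "\<Theta> (\<Theta> Y) = Y"
      using Y \<Theta>e tc inv[OF Y(3)] permutes_inv_inv[OF p(1)] by simp
  qed
  have o: "\<Theta> \<one>\<^bsub>W\<^esub> = \<one>\<^bsub>W\<^esub>"
  proof -
    have "(\<lambda>i\<in>{1..d}. \<tau> (\<one>\<^bsub>T\<^esub> (id i))) = \<one>\<^bsub>T\<^esub>" using one by (auto simp: one_T fun_eq_iff)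
    then show ?thesis unfolding one_elt using \<Theta>e[OF one_T_closed id_sym] by simp
  qed
  show thesis by (rule that[OF \<Theta> a2 o i \<Theta>e])
qed

section \<open>A basis of the wreath product\<close>

context
  fixes B :: "'b set" and b :: "'b \<Rightarrow> 'a"
  assumes basis: "finite_basis R A B b"
begin

definition letters :: "(nat \<Rightarrow> 'b) set" where "letters = {1..d} \<rightarrow>\<^sub>E B"

definition monom :: "(nat \<Rightarrow> 'b) \<Rightarrow> nat \<Rightarrow> 'a" where "monom w = (\<lambda>i\<in>{1..d}. b (w i))"

lemma finite_letters: "finite letters"
  unfolding letters_def using basis by (intro finite_PiE) (auto simp: finite_basis_def)

lemma monom_closed: "w \<in> letters \<Longrightarrow> monom w \<in> carrier T"
  unfolding monom_def letters_def using basis by (intro T_restrict) (auto simp: finite_basis_def dest: PiE_mem)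

text \<open>
  The tensor factors are expanded in the basis one at a time: in the induction, the positions
  outside \<open>J\<close> already hold basis elements.
\<close>

lemma multilinear_span:
  assumes "module R M" and f: "multilinear R A d M f" and H: "submodule H R M"
    and bas: "\<And>w. w \<in> letters \<Longrightarrow> f (monom w) \<in> H" and x: "x \<in> carrier T"
  shows "f x \<in> H"
proof -
  interpret M: module R M by fact
  note HE = M.submoduleE[OF H]
  have zH: "\<zero>\<^bsub>M\<^esub> \<in> H" by (rule M.submodule_zero[OF H])
  have "finite J \<Longrightarrow> J \<subseteq> {1..d} \<Longrightarrow> x \<in> carrier T \<Longrightarrow> (\<And>i. i \<in> {1..d} \<Longrightarrow> i \<notin> J \<Longrightarrow> x i \<in> b ` B) \<Longrightarrow> f x \<in> H" for J x
  proof (induction J arbitrary: x rule: finite_induct)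
    case empty
    then have "\<forall>i\<in>{1..d}. \<exists>\<beta>. \<beta> \<in> B \<and> x i = b \<beta>" by blast
    from bchoice[OF this] obtain w where w: "\<forall>i\<in>{1..d}. w i \<in> B \<and> x i = b (w i)" by blast
    have "restrict w {1..d} \<in> letters" using w by (auto simp: letters_def)
    moreover have "monom (restrict w {1..d}) = x"
      by (rule T_eqI[OF monom_closed[OF calculation] empty.prems(2)]) (use w in \<open>simp add: monom_def\<close>)
    ultimately show ?case using bas by metis
  next
    case (insert j J)
    have j: "j \<in> {1..d}" using insert by auto
    have h: "(\<lambda>a. f (x(j := a))) \<in> module_hom R A M"
      using f insert.prems(2) j unfolding multilinear_def carrier_T by blast
    have "f (x(j := a)) \<in> H" if a: "a \<in> carrier A" for a
      using A.module_axioms finite_basis_spans[OF A.module_axioms basis] a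
    proof (rule spans_induct)
      fix s assume s: "s \<in> b ` B"
      then have sA: "s \<in> carrier A" using finite_basis_spans[OF A.module_axioms basis] by (auto simp: spans_def)
      show "f (x(j := s)) \<in> H"
      proof (rule insert.IH)
        show "x(j := s) \<in> carrier T" by (rule T_upd[OF insert.prems(2) j sA])
        show "(x(j := s)) i \<in> b ` B" if "i \<in> {1..d}" "i \<notin> J" for i
          using insert.prems(3)[OF that(1)] that(2) s by auto
      qed (use insert.prems in auto)
    next
      show "f (x(j := \<zero>\<^bsub>A\<^esub>)) \<in> H" using module_hom_zero[OF A.module_axioms assms(1) h] zH by simp
    next
      fix y z assume "y \<in> carrier A" "z \<in> carrier A" "f (x(j := y)) \<in> H" "f (x(j := z)) \<in> H"
      then show "f (x(j := y \<oplus>\<^bsub>A\<^esub> z)) \<in> H" unfolding module_homD(2)[OF h \<open>y \<in> carrier A\<close> \<open>z \<in> carrier A\<close>] by (intro HE(5))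
    next
      fix r y assume "r \<in> carrier R" "y \<in> carrier A" "f (x(j := y)) \<in> H"
      then show "f (x(j := r \<odot>\<^bsub>A\<^esub> y)) \<in> H" unfolding module_homD(3)[OF h \<open>r \<in> carrier R\<close> \<open>y \<in> carrier A\<close>] by (intro HE(4))
    qed
    from this[OF T_mem[OF insert.prems(2) j]] show ?case by simp
  qed
  from this[of "{1..d}" x] x show ?thesis by simp
qed

lemma V_spans_monom: "spans R V ((\<lambda>w. pure (monom w)) ` letters)"
  unfolding spans_def
proof (intro conjI allI impI)
  show "(\<lambda>w. pure (monom w)) ` letters \<subseteq> carrier V" using pure_closed monom_closed by blast
  fix H assume H: "submodule H R V \<and> (\<lambda>w. pure (monom w)) ` letters \<subseteq> H"
  then have "pure x \<in> H" if "x \<in> carrier T" for x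
    using H by (intro multilinear_span[OF V.module_axioms pure_multilinear _ _ that]) blast+
  then show "carrier V \<subseteq> H" using V_spans H unfolding spans_def by blast
qed

text \<open>
  The monomials \<open>b (w 1) \<otimes> \<dots> \<otimes> b (w d) \<otimes> \<rho>\<close> span by multilinearity. The product of the
  coordinates of the factors is multilinear, so it induces a linear map from the tensor power
  that sends monomials to the standard generators.
\<close>

lemma wreath_basis:
  assumes coord: "coord \<in> module_hom R A (free_module R B)" "\<And>\<beta>. \<beta> \<in> B \<Longrightarrow> coord (b \<beta>) = free_gen R B \<beta>"
  shows "finite_basis R W (letters \<times> sym d) (\<lambda>(w, \<rho>). elt (monom w) \<rho>)"
    and "\<And>x \<rho>. x \<in> carrier T \<Longrightarrow> \<rho> \<in> sym d \<Longrightarrow>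
      elt x \<rho> = (\<Oplus>\<^bsub>W\<^esub>w\<in>letters. (\<Otimes>i\<in>{1..d}. coord (x i) (w i)) \<odot>\<^bsub>W\<^esub> elt (monom w) \<rho>)"
proof -
  interpret FB: fun_module R B "free_module R B" by (rule fun_module_free[OF A.R.is_cring])
  interpret FL: fun_module R letters "free_module R letters" by (rule fun_module_free[OF A.R.is_cring])
  let ?F = "free_module R letters"
  note cD = module_homD[OF coord(1)]
  have lm: "w i \<in> B" if "w \<in> letters" "i \<in> {1..d}" for w i
    using that PiE_mem[of w "{1..d}" "\<lambda>_. B" i] unfolding letters_def by blast
  have cc: "coord a \<beta> \<in> carrier R" if "a \<in> carrier A" "\<beta> \<in> B" for a \<beta>
    by (rule FB.F_mem[OF cD(1)[OF that(1)] that(2)])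
  have bA: "b \<beta> \<in> carrier A" if "\<beta> \<in> B" for \<beta> using basis that by (auto simp: finite_basis_def)
  define m where "m x = (\<lambda>w\<in>letters. \<Otimes>i\<in>{1..d}. coord (x i) (w i))" for x
  have mF: "m x \<in> carrier ?F" if x: "x \<in> carrier T" for x
    unfolding m_def
    by (rule FL.F_I[of _ letters]) (use finite_letters in \<open>auto intro!: A.R.finprod_closed cc T_mem[OF x] lm simp del: atLeastAtMost_iff\<close>)
  have mul: "multilinear R A d ?F m"
    unfolding multilinear_def
  proof (intro conjI ballI funcsetI)
    show "m x \<in> carrier ?F" if "x \<in> {1..d} \<rightarrow>\<^sub>E carrier A" for x using that mF by (simp add: carrier_T)
    fix x i assume "x \<in> {1..d} \<rightarrow>\<^sub>E carrier A" and i: "i \<in> {1..d}"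
    then have x: "x \<in> carrier T" by (simp add: carrier_T)
    define q where "q w = (\<Otimes>j\<in>{1..d} - {i}. coord (x j) (w j))" for w
    have q: "q w \<in> carrier R" if "w \<in> letters" for w
      unfolding q_def by (rule A.R.finprod_closed) (use cc T_mem[OF x] lm[OF that] in auto)
    have split: "m (x(i := a)) w = coord a (w i) \<otimes> q w" if a: "a \<in> carrier A" and w: "w \<in> letters" for a w
    proof -
      have "m (x(i := a)) w = (\<Otimes>j\<in>insert i ({1..d} - {i}). coord ((x(i := a)) j) (w j))"
        using w i by (simp add: m_def insert_absorb)
      also have "\<dots> = coord ((x(i := a)) i) (w i) \<otimes> (\<Otimes>j\<in>{1..d} - {i}. coord ((x(i := a)) j) (w j))"
        by (rule A.R.finprod_insert) (use cc a T_mem[OF x] lm[OF w] i in \<open>auto simp del: atLeastAtMost_iff\<close>)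
      also have "(\<Otimes>j\<in>{1..d} - {i}. coord ((x(i := a)) j) (w j)) = q w"
        unfolding q_def by (rule A.R.finprod_cong') (use cc T_mem[OF x] lm[OF w] in \<open>auto simp del: atLeastAtMost_iff\<close>)
      finally show ?thesis by (simp only: fun_upd_same)
    qed
    show "(\<lambda>a. m (x(i := a))) \<in> module_hom R A ?F"
    proof (rule module_homI)
      note c = mF[OF T_upd[OF x i]]
      show "m (x(i := a)) \<in> carrier ?F" if "a \<in> carrier A" for a using c that .
      show "m (x(i := a \<oplus>\<^bsub>A\<^esub> a')) = m (x(i := a)) \<oplus>\<^bsub>?F\<^esub> m (x(i := a'))" if a: "a \<in> carrier A" "a' \<in> carrier A" for a a'
        using a c q cc lm[OF _ i]
        by (intro FL.F_eqI) (simp_all add: FL.add_F_closed FL.add_F_app split cD(2) FB.add_F_app A.R.l_distr)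
      show "m (x(i := r \<odot>\<^bsub>A\<^esub> a)) = r \<odot>\<^bsub>?F\<^esub> m (x(i := a))" if ra: "r \<in> carrier R" "a \<in> carrier A" for r a
        using ra c q cc lm[OF _ i]
        by (intro FL.F_eqI) (simp_all add: FL.smult_F_closed FL.smult_F_app split cD(3) FB.smult_F_app A.R.m_assoc)
    qed
  qed
  from tensor_universal[OF FL.module_F mul] obtain h where
    h: "h \<in> module_hom R V ?F" and hp: "\<And>x. x \<in> carrier T \<Longrightarrow> h (pure x) = m x" by blast
  have hm: "h (pure (monom w)) = free_gen R letters w" if w: "w \<in> letters" for w
  proof (rule FL.F_eqI)
    show "h (pure (monom w)) \<in> carrier ?F" using hp mF monom_closed[OF w] by simp
    show "free_gen R letters w \<in> carrier ?F" by (rule FL.gen_closed[OF w])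
    fix v assume v: "v \<in> letters"
    have "h (pure (monom w)) v = (\<Otimes>i\<in>{1..d}. coord (b (w i)) (v i))"
      unfolding hp[OF monom_closed[OF w]] m_def using v
      by (simp, intro A.R.finprod_cong') (use cc[OF bA[OF lm[OF w]] lm[OF v]] in \<open>auto simp: monom_def\<close>)
    also have "\<dots> = (\<Otimes>i\<in>{1..d}. if v i = w i then \<one> else \<zero>)"
      by (rule A.R.finprod_cong') (use coord(2) lm[OF v] lm[OF w] in \<open>auto simp: free_gen_def simp del: atLeastAtMost_iff\<close>)
    also have "\<dots> = free_gen R letters w v"
    proof (cases "v = w")
      case True
      then show ?thesis using v by (simp add: free_gen_def)
    next
      case False
      have "v = w" if "\<forall>i\<in>{1..d}. v i = w i"
        using v w that unfolding letters_def by (intro PiE_ext) auto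
      with False obtain i where i: "i \<in> {1..d}" "v i \<noteq> w i" by blast
      have "(\<Otimes>j\<in>insert i ({1..d} - {i}). if v j = w j then \<one> else \<zero>) = (if v i = w i then \<one> else \<zero>) \<otimes> (\<Otimes>j\<in>{1..d} - {i}. if v j = w j then \<one> else \<zero>)"
        by (rule A.R.finprod_insert) auto
      also have "\<dots> = \<zero>" using i by (simp add: A.R.finprod_closed Pi_iff)
      finally show ?thesis using i False v by (simp add: free_gen_def insert_absorb)
    qed
    finally show "h (pure (monom w)) v = free_gen R letters w v" .
  qed
  have D: "(\<lambda>w. pure (monom w)) \<in> letters \<rightarrow> carrier V" using pure_closed monom_closed by blast
  have V_expand: "v = (\<Oplus>\<^bsub>V\<^esub>w\<in>letters. h v w \<odot>\<^bsub>V\<^esub> pure (monom w))" if "v \<in> carrier V" for v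
    by (rule finite_basisI(2)[OF V.module_axioms finite_letters D V_spans_monom h _ that]) (rule hm)
  let ?I = "letters \<times> sym d"
  interpret FI: fun_module R ?I "free_module R ?I" by (rule fun_module_free[OF A.R.is_cring])
  define k where "k F = (\<lambda>p\<in>?I. h (F (snd p)) (fst p))" for F
  have finI: "finite ?I" using finite_letters finite_sym by blast
  have k: "k \<in> module_hom R W (free_module R ?I)"
  proof (rule module_homI)
    have hc: "h (F \<rho>) w \<in> carrier R" if "F \<in> carrier W" "w \<in> letters" "\<rho> \<in> sym d" for F w \<rho>
      using FL.F_mem[OF module_homD(1)[OF h W_mem[OF that(1,3)]] that(2)] .
    show kc: "k F \<in> carrier (free_module R ?I)" if "F \<in> carrier W" for F
      unfolding k_def by (rule FI.F_I[of _ ?I]) (use finI hc[OF that] in auto)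
    show "k (F \<oplus>\<^bsub>W\<^esub> G) = k F \<oplus>\<^bsub>free_module R ?I\<^esub> k G" if "F \<in> carrier W" "G \<in> carrier W" for F G
      using that by (intro FI.F_eqI kc FI.add_F_closed add_W_closed)
        (auto simp: FI.add_F_app k_def add_W_app module_homD(2)[OF h] W_mem[of F] W_mem[of G] FL.add_F_app)
    show "k (r \<odot>\<^bsub>W\<^esub> F) = r \<odot>\<^bsub>free_module R ?I\<^esub> k F" if "r \<in> carrier R" "F \<in> carrier W" for r F
      using that by (intro FI.F_eqI kc FI.smult_F_closed smult_W_closed)
        (auto simp: FI.smult_F_app k_def smult_W_app module_homD(3)[OF h] W_mem[of F] W_mem[of G] FL.smult_F_app)
  qed
  have h0: "h \<zero>\<^bsub>V\<^esub> = \<zero>\<^bsub>?F\<^esub>" by (rule module_hom_zero[OF V.module_axioms FL.module_F h])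
  show "finite_basis R W ?I (\<lambda>(w, \<rho>). elt (monom w) \<rho>)"
  proof (rule finite_basisI(1)[OF module_W finI _ _ k])
    show "(\<lambda>(w, \<rho>). elt (monom w) \<rho>) \<in> ?I \<rightarrow> carrier W" using elt_closed monom_closed by auto
    have "{wt v \<rho> | v \<rho>. v \<in> (\<lambda>w. pure (monom w)) ` letters \<and> \<rho> \<in> sym d} = (\<lambda>(w, \<rho>). elt (monom w) \<rho>) ` ?I" by auto
    then show "spans R W ((\<lambda>(w, \<rho>). elt (monom w) \<rho>) ` ?I)" using W_spans_of_V[OF V_spans_monom] by simp
    fix p assume p: "p \<in> ?I"
    obtain w \<rho> where wr: "p = (w, \<rho>)" "w \<in> letters" "\<rho> \<in> sym d" using p by auto
    have "k (elt (monom w) \<rho>) = free_gen R ?I (w, \<rho>)"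
      using wr hm[OF wr(2)] h0 unfolding k_def free_gen_def wreath_tensor_def
      by (auto simp: carrier_sym_group fun_eq_iff free_gen_def FL.zero_F)
    then show "k (case p of (w, \<rho>) \<Rightarrow> elt (monom w) \<rho>) = free_gen R ?I p" using wr by simp
  qed
  show "elt x \<rho> = (\<Oplus>\<^bsub>W\<^esub>w\<in>letters. (\<Otimes>i\<in>{1..d}. coord (x i) (w i)) \<odot>\<^bsub>W\<^esub> elt (monom w) \<rho>)"
    if x: "x \<in> carrier T" and \<rho>: "\<rho> \<in> sym d" for x \<rho>
  proof -
    have cl: "(\<Otimes>i\<in>{1..d}. coord (x i) (w i)) \<in> carrier R" if "w \<in> letters" for w
      by (rule A.R.finprod_closed) (use cc T_mem[OF x] lm[OF that] in auto)
    have "pure x = (\<Oplus>\<^bsub>V\<^esub>w\<in>letters. h (pure x) w \<odot>\<^bsub>V\<^esub> pure (monom w))"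
      by (rule V_expand[OF pure_closed[OF x]])
    also have "\<dots> = (\<Oplus>\<^bsub>V\<^esub>w\<in>letters. (\<Otimes>i\<in>{1..d}. coord (x i) (w i)) \<odot>\<^bsub>V\<^esub> pure (monom w))"
      by (rule V.M.finsum_cong') (use cl pure_closed monom_closed in \<open>auto simp: hp[OF x] m_def\<close>)
    finally have "elt x \<rho> = wt \<dots> \<rho>" by simp
    also have "\<dots> = (\<Oplus>\<^bsub>W\<^esub>w\<in>letters. wt ((\<Otimes>i\<in>{1..d}. coord (x i) (w i)) \<odot>\<^bsub>V\<^esub> pure (monom w)) \<rho>)"
      by (rule module_hom_finsum[OF V.module_axioms module_W wt_hom[OF \<rho>]]) (use cl pure_closed monom_closed in auto)
    also have "\<dots> = (\<Oplus>\<^bsub>W\<^esub>w\<in>letters. (\<Otimes>i\<in>{1..d}. coord (x i) (w i)) \<odot>\<^bsub>W\<^esub> elt (monom w) \<rho>)"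
      by (rule W.M.finsum_cong') (use cl pure_closed monom_closed elt_closed module_homD(3)[OF wt_hom[OF \<rho>]] in auto)
    finally show ?thesis .
  qed
qed

end

end

section \<open>Integer coefficients and linear combinations\<close>

text \<open>
  Straightening takes place over the integers; this ring homomorphism transports its
  coefficients to \<open>R\<close>.
\<close>

definition (in cring) of_integer :: "int \<Rightarrow> 'a" where "of_integer n = [n] \<cdot> \<one>"

context cring begin

lemma of_integer_closed [simp]: "of_integer n \<in> carrier R"
  unfolding of_integer_def by simp

lemma of_integer_0 [simp]: "of_integer 0 = \<zero>" and of_integer_1 [simp]: "of_integer 1 = \<one>"
  unfolding of_integer_def by (simp_all add: add_pow_def int_pow_def nat_pow_def)

lemma of_integer_add: "of_integer (m + n) = of_integer m \<oplus> of_integer n"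
  unfolding of_integer_def by (rule add.int_pow_mult) simp

lemma of_integer_mult: "of_integer (m * n) = of_integer m \<otimes> of_integer n"
proof -
  have "[(m * n)] \<cdot> \<one> = [n] \<cdot> ([m] \<cdot> \<one>)" using add.int_pow_pow[of \<one> n m] by (simp add: mult.commute)
  also have "\<dots> = [n] \<cdot> (\<one> \<otimes> ([m] \<cdot> \<one>))" by simp
  also have "\<dots> = ([n] \<cdot> \<one>) \<otimes> ([m] \<cdot> \<one>)" by (rule add_pow_ldistr_int[symmetric]) auto
  finally show ?thesis unfolding of_integer_def by (simp add: m_comm)
qed

lemma of_integer_sum: "of_integer (\<Sum>x\<in>X. f x) = (\<Oplus>x\<in>X. of_integer (f x))"
  by (induction X rule: infinite_finite_induct) (auto simp: of_integer_add)

end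

lemma (in abelian_monoid) finsum_Times:
  assumes "finite B" "finite J" "\<And>i j. i \<in> B \<Longrightarrow> j \<in> J \<Longrightarrow> f i j \<in> carrier G"
  shows "(\<Oplus>p\<in>B \<times> J. f (fst p) (snd p)) = (\<Oplus>i\<in>B. \<Oplus>j\<in>J. f i j)"
  using assms(1,3)
proof (induction B rule: finite_induct)
  case empty then show ?case by simp
next
  case (insert x B)
  have 1: "(\<Oplus>p\<in>Pair x ` J. f (fst p) (snd p)) = (\<Oplus>j\<in>J. f x j)"
    using insert.prems by (subst finsum_reindex) (auto simp: inj_on_def)
  have "insert x B \<times> J = Pair x ` J \<union> B \<times> J" by auto
  then have "(\<Oplus>p\<in>insert x B \<times> J. f (fst p) (snd p))
      = (\<Oplus>p\<in>Pair x ` J. f (fst p) (snd p)) \<oplus> (\<Oplus>p\<in>B \<times> J. f (fst p) (snd p))"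
    using insert.hyps insert.prems assms(2) by (simp only:, intro finsum_Un_disjoint) auto
  also have "\<dots> = (\<Oplus>j\<in>J. f x j) \<oplus> (\<Oplus>i\<in>B. \<Oplus>j\<in>J. f i j)" using 1 insert by simp
  also have "\<dots> = (\<Oplus>i\<in>insert x B. \<Oplus>j\<in>J. f i j)"
    using insert.hyps insert.prems by (intro finsum_insert[symmetric]) (auto intro!: finsum_closed)
  finally show ?case .
qed

lemma (in abelian_monoid) finsum_swap:
  assumes "finite B" "finite J" "\<And>i j. i \<in> B \<Longrightarrow> j \<in> J \<Longrightarrow> f i j \<in> carrier G"
  shows "(\<Oplus>i\<in>B. \<Oplus>j\<in>J. f i j) = (\<Oplus>j\<in>J. \<Oplus>i\<in>B. f i j)"
proof -
  have "(\<Oplus>p\<in>prod.swap ` (B \<times> J). f (snd p) (fst p)) = (\<Oplus>p\<in>B \<times> J. f (fst p) (snd p))"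
    using assms by (subst finsum_reindex) auto
  moreover have "prod.swap ` (B \<times> J) = J \<times> B" by auto
  ultimately have "(\<Oplus>p\<in>J \<times> B. f (snd p) (fst p)) = (\<Oplus>p\<in>B \<times> J. f (fst p) (snd p))" by simp
  moreover have "(\<Oplus>p\<in>B \<times> J. f (fst p) (snd p)) = (\<Oplus>i\<in>B. \<Oplus>j\<in>J. f i j)"
    using assms by (rule finsum_Times)
  moreover have "(\<Oplus>p\<in>J \<times> B. f (snd p) (fst p)) = (\<Oplus>j\<in>J. \<Oplus>i\<in>B. f i j)"
    using assms(2,1) by (rule finsum_Times[of J B "\<lambda>j i. f i j"]) (rule assms(3))
  ultimately show ?thesis by simp
qed

text \<open>
  The linear span of a finite family, in the form in which axiom (C3) states it.
\<close>

definition lincombs ::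
  "('k, 'r) ring_scheme \<Rightarrow> ('k, 'a, 'm) module_scheme \<Rightarrow> 'y set \<Rightarrow> ('y \<Rightarrow> 'a) \<Rightarrow> 'a set" where
  "lincombs R M J c = {\<Oplus>\<^bsub>M\<^esub>y\<in>J. e y \<odot>\<^bsub>M\<^esub> c y | e. e \<in> J \<rightarrow> carrier R}"

lemma (in module) lincombs_submodule:
  assumes "finite J" "c \<in> J \<rightarrow> carrier M"
  shows "submodule (lincombs R M J c) R M"
proof (rule submodule_if_closed)
  have cl: "(\<lambda>y. e y \<odot>\<^bsub>M\<^esub> c y) \<in> J \<rightarrow> carrier M" if "e \<in> J \<rightarrow> carrier R" for e
    using that assms(2) by auto
  show "lincombs R M J c \<subseteq> carrier M"
    unfolding lincombs_def using cl by (auto intro!: M.finsum_closed)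
  have "(\<Oplus>\<^bsub>M\<^esub>y\<in>J. \<zero> \<odot>\<^bsub>M\<^esub> c y) = \<zero>\<^bsub>M\<^esub>"
    using assms(2) by (intro M.add.finprod_one_eqI smult_l_null) auto
  then show "\<zero>\<^bsub>M\<^esub> \<in> lincombs R M J c"
    unfolding lincombs_def by (auto intro!: exI[of _ "\<lambda>_. \<zero>"])
  show "a \<oplus>\<^bsub>M\<^esub> b \<in> lincombs R M J c" if "a \<in> lincombs R M J c" "b \<in> lincombs R M J c" for a b
  proof -
    from that obtain e f where e: "e \<in> J \<rightarrow> carrier R" "a = (\<Oplus>\<^bsub>M\<^esub>y\<in>J. e y \<odot>\<^bsub>M\<^esub> c y)"
      and f: "f \<in> J \<rightarrow> carrier R" "b = (\<Oplus>\<^bsub>M\<^esub>y\<in>J. f y \<odot>\<^bsub>M\<^esub> c y)" unfolding lincombs_def by blast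
    have "a \<oplus>\<^bsub>M\<^esub> b = (\<Oplus>\<^bsub>M\<^esub>y\<in>J. e y \<odot>\<^bsub>M\<^esub> c y \<oplus>\<^bsub>M\<^esub> f y \<odot>\<^bsub>M\<^esub> c y)"
      unfolding e(2) f(2) using cl[OF e(1)] cl[OF f(1)] by (rule M.finsum_addf[symmetric])
    also have "\<dots> = (\<Oplus>\<^bsub>M\<^esub>y\<in>J. (e y \<oplus> f y) \<odot>\<^bsub>M\<^esub> c y)"
      by (rule M.finsum_cong') (use e(1) f(1) assms(2) in \<open>auto simp: smult_l_distr Pi_iff\<close>)
    finally show ?thesis unfolding lincombs_def using e(1) f(1) by (auto intro!: exI[of _ "\<lambda>y. e y \<oplus> f y"])
  qed
  show "r \<odot>\<^bsub>M\<^esub> a \<in> lincombs R M J c" if r: "r \<in> carrier R" and "a \<in> lincombs R M J c" for r a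
  proof -
    from that obtain e where e: "e \<in> J \<rightarrow> carrier R" "a = (\<Oplus>\<^bsub>M\<^esub>y\<in>J. e y \<odot>\<^bsub>M\<^esub> c y)"
      unfolding lincombs_def by blast
    have "r \<odot>\<^bsub>M\<^esub> a = (\<Oplus>\<^bsub>M\<^esub>y\<in>J. r \<odot>\<^bsub>M\<^esub> (e y \<odot>\<^bsub>M\<^esub> c y))"
      unfolding e(2) using assms(1) r cl[OF e(1)] by (rule finsum_smult_ldistr)
    also have "\<dots> = (\<Oplus>\<^bsub>M\<^esub>y\<in>J. (r \<otimes> e y) \<odot>\<^bsub>M\<^esub> c y)"
      by (rule M.finsum_cong') (use e(1) r assms(2) in \<open>auto simp: smult_assoc1 Pi_iff\<close>)
    finally show ?thesis unfolding lincombs_def using e(1) r by (auto intro!: exI[of _ "\<lambda>y. r \<otimes> e y"])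
  qed
qed

lemma (in module) lincombs_base:
  assumes "finite J" "c \<in> J \<rightarrow> carrier M" "y \<in> J" shows "c y \<in> lincombs R M J c"
proof -
  have "(\<Oplus>\<^bsub>M\<^esub>z\<in>J. (if z = y then \<one> else \<zero>) \<odot>\<^bsub>M\<^esub> c z) = (\<Oplus>\<^bsub>M\<^esub>z\<in>J. if z = y then c z else \<zero>\<^bsub>M\<^esub>)"
    by (rule M.finsum_cong') (use assms in \<open>auto simp: Pi_iff\<close>)
  also have "\<dots> = c y" by (rule M.add.finprod_singleton_swap[OF assms(3,1,2)])
  finally show ?thesis unfolding lincombs_def
    by (auto intro!: exI[of _ "\<lambda>z. if z = y then \<one> else \<zero>"])
qed

definition eqmod :: "('k, 'a, 'm) module_scheme \<Rightarrow> 'a set \<Rightarrow> 'a \<Rightarrow> 'a \<Rightarrow> bool" where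
  "eqmod M H x y \<longleftrightarrow> x \<in> carrier M \<and> y \<in> carrier M \<and> (\<exists>z\<in>H. x = y \<oplus>\<^bsub>M\<^esub> z)"

context module begin

context
  fixes H assumes H: "submodule H R M"
begin

lemma eqmod_refl: "x \<in> carrier M \<Longrightarrow> eqmod M H x x"
  unfolding eqmod_def using submodule_zero[OF H] by force

lemma eqmod_trans: "eqmod M H x y \<Longrightarrow> eqmod M H y z \<Longrightarrow> eqmod M H x z"
proof -
  assume a: "eqmod M H x y" "eqmod M H y z"
  then obtain p q where "p \<in> H" "x = y \<oplus>\<^bsub>M\<^esub> p" "q \<in> H" "y = z \<oplus>\<^bsub>M\<^esub> q" unfolding eqmod_def by blast
  moreover from this have "p \<in> carrier M" "q \<in> carrier M" using submoduleE(1)[OF H] by auto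
  moreover have "z \<in> carrier M" using a by (simp add: eqmod_def)
  ultimately have "x = z \<oplus>\<^bsub>M\<^esub> (q \<oplus>\<^bsub>M\<^esub> p)" by (simp add: M.a_assoc)
  then show ?thesis using a submoduleE(5)[OF H \<open>q \<in> H\<close> \<open>p \<in> H\<close>] unfolding eqmod_def by blast
qed

lemma eqmod_add: "eqmod M H x y \<Longrightarrow> eqmod M H x' y' \<Longrightarrow> eqmod M H (x \<oplus>\<^bsub>M\<^esub> x') (y \<oplus>\<^bsub>M\<^esub> y')"
proof -
  assume a: "eqmod M H x y" "eqmod M H x' y'"
  then obtain p q where pq: "p \<in> H" "x = y \<oplus>\<^bsub>M\<^esub> p" "q \<in> H" "x' = y' \<oplus>\<^bsub>M\<^esub> q" unfolding eqmod_def by blast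
  moreover from this have "p \<in> carrier M" "q \<in> carrier M" using submoduleE(1)[OF H] by auto
  moreover have "y \<in> carrier M" "y' \<in> carrier M" using a by (auto simp: eqmod_def)
  ultimately have "x \<oplus>\<^bsub>M\<^esub> x' = (y \<oplus>\<^bsub>M\<^esub> y') \<oplus>\<^bsub>M\<^esub> (p \<oplus>\<^bsub>M\<^esub> q)" by (simp add: M.a_ac)
  then show ?thesis using a submoduleE(5)[OF H pq(1,3)] unfolding eqmod_def by blast
qed

lemma eqmod_smult: "r \<in> carrier R \<Longrightarrow> eqmod M H x y \<Longrightarrow> eqmod M H (r \<odot>\<^bsub>M\<^esub> x) (r \<odot>\<^bsub>M\<^esub> y)"
proof -
  assume r: "r \<in> carrier R" and a: "eqmod M H x y"
  then obtain p where p: "p \<in> H" "x = y \<oplus>\<^bsub>M\<^esub> p" unfolding eqmod_def by blast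
  moreover from this have "p \<in> carrier M" using submoduleE(1)[OF H] by auto
  moreover have "y \<in> carrier M" using a by (simp add: eqmod_def)
  ultimately have "r \<odot>\<^bsub>M\<^esub> x = r \<odot>\<^bsub>M\<^esub> y \<oplus>\<^bsub>M\<^esub> r \<odot>\<^bsub>M\<^esub> p" using r by (simp add: smult_r_distr)
  then show ?thesis using a r submoduleE(4)[OF H r p(1)] unfolding eqmod_def by blast
qed

lemma eqmod_finsum: "(\<And>i. i \<in> B \<Longrightarrow> eqmod M H (f i) (g i)) \<Longrightarrow> eqmod M H (\<Oplus>\<^bsub>M\<^esub>i\<in>B. f i) (\<Oplus>\<^bsub>M\<^esub>i\<in>B. g i)"
proof (induction B rule: infinite_finite_induct)
  case (insert x B)
  then have "f x \<in> carrier M" "g x \<in> carrier M" "f \<in> B \<rightarrow> carrier M" "g \<in> B \<rightarrow> carrier M"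
    by (auto simp: eqmod_def)
  then show ?case using insert by (simp add: eqmod_add)
qed (use eqmod_refl in auto)

lemma eqmod_drop: "x \<in> carrier M \<Longrightarrow> z \<in> H \<Longrightarrow> eqmod M H (x \<oplus>\<^bsub>M\<^esub> z) x"
  unfolding eqmod_def using submoduleE(1)[OF H] by auto

end

end

text \<open>
  Transition matrices \<open>p\<close> and \<open>q\<close> between a basis \<open>D\<close> and a family \<open>c\<close>: the second expansion
  makes \<open>c\<close> span, and the relation \<open>p q = 1\<close> makes it independent.
\<close>

lemma finite_basis_change:
  assumes mod: "module R M" and basis: "finite_basis R M X D" and fin: "finite Y" and C: "c \<in> Y \<rightarrow> carrier M"
    and p: "\<And>x y. x \<in> X \<Longrightarrow> y \<in> Y \<Longrightarrow> p y x \<in> carrier R" and q: "\<And>x y. x \<in> X \<Longrightarrow> y \<in> Y \<Longrightarrow> q x y \<in> carrier R"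
    and cD: "\<And>y. y \<in> Y \<Longrightarrow> c y = (\<Oplus>\<^bsub>M\<^esub>x\<in>X. p y x \<odot>\<^bsub>M\<^esub> D x)"
    and Dc: "\<And>x. x \<in> X \<Longrightarrow> D x = (\<Oplus>\<^bsub>M\<^esub>y\<in>Y. q x y \<odot>\<^bsub>M\<^esub> c y)"
    and pq: "\<And>y y'. y \<in> Y \<Longrightarrow> y' \<in> Y \<Longrightarrow> (\<Oplus>\<^bsub>R\<^esub>x\<in>X. p y x \<otimes>\<^bsub>R\<^esub> q x y') = (if y = y' then \<one>\<^bsub>R\<^esub> else \<zero>\<^bsub>R\<^esub>)"
  shows "finite_basis R M Y c"
proof -
  interpret M: module R M by fact
  interpret FX: fun_module R X "free_module R X" by (rule fun_module_free[OF M.R.is_cring])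
  interpret FY: fun_module R Y "free_module R Y" by (rule fun_module_free[OF M.R.is_cring])
  have finX: "finite X" and D: "D \<in> X \<rightarrow> carrier M" using basis by (auto simp: finite_basis_def)
  obtain h where h: "h \<in> module_hom R M (free_module R X)"
    and hu: "\<And>x e. e \<in> carrier (free_module R X) \<Longrightarrow> x = (\<Oplus>\<^bsub>M\<^esub>\<beta>\<in>X. e \<beta> \<odot>\<^bsub>M\<^esub> D \<beta>) \<Longrightarrow> h x = e"
    by (rule finite_basis_coord[OF mod basis]) blast
  have hc: "h x i \<in> carrier R" if "x \<in> carrier M" "i \<in> X" for x i
    using FX.F_mem[OF module_homD(1)[OF h that(1)] that(2)] .
  define k where "k v = (\<lambda>y\<in>Y. \<Oplus>\<^bsub>R\<^esub>x\<in>X. h v x \<otimes>\<^bsub>R\<^esub> q x y)" for v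
  have kapp: "k v y = (\<Oplus>\<^bsub>R\<^esub>x\<in>X. h v x \<otimes>\<^bsub>R\<^esub> q x y)" if "y \<in> Y" for v y
    using that by (simp add: k_def)
  have kc: "k v \<in> carrier (free_module R Y)" if "v \<in> carrier M" for v
    unfolding k_def by (rule FY.F_I[of _ Y]) (use fin hc[OF that] q in \<open>auto intro!: M.R.finsum_closed\<close>)
  show ?thesis
  proof (rule finite_basisI(1)[OF mod fin C])
    show "spans R M (c ` Y)"
      unfolding spans_def
    proof (intro conjI allI impI)
      show "c ` Y \<subseteq> carrier M" using C by auto
      fix H assume H: "submodule H R M \<and> c ` Y \<subseteq> H"
      have "D x \<in> H" if x: "x \<in> X" for x
        unfolding Dc[OF x] using H q[OF x] M.submoduleE(4)[OF conjunct1[OF H]] by (intro M.submodule_finsum) auto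
      then have "D ` X \<subseteq> H" by blast
      then show "carrier M \<subseteq> H" using finite_basis_spans[OF mod basis] H unfolding spans_def by blast
    qed
    show "k \<in> module_hom R M (free_module R Y)"
    proof (rule module_homI)
      show "k v \<in> carrier (free_module R Y)" if "v \<in> carrier M" for v using kc that .
      show "k (v \<oplus>\<^bsub>M\<^esub> w) = k v \<oplus>\<^bsub>free_module R Y\<^esub> k w" if vw: "v \<in> carrier M" "w \<in> carrier M" for v w
      proof (rule FY.F_eqI)
        fix y assume y: "y \<in> Y"
        have "k (v \<oplus>\<^bsub>M\<^esub> w) y = (\<Oplus>\<^bsub>R\<^esub>x\<in>X. h v x \<otimes>\<^bsub>R\<^esub> q x y \<oplus>\<^bsub>R\<^esub> h w x \<otimes>\<^bsub>R\<^esub> q x y)"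
          unfolding kapp[OF y] by (rule M.R.finsum_cong')
            (use y vw hc q in \<open>auto simp: module_homD(2)[OF h] FX.add_F_app M.R.l_distr\<close>)
        also have "\<dots> = (k v \<oplus>\<^bsub>free_module R Y\<^esub> k w) y"
          unfolding FY.add_F_app[OF y] kapp[OF y] by (rule M.R.finsum_addf) (use y vw hc q in auto)
        finally show "k (v \<oplus>\<^bsub>M\<^esub> w) y = (k v \<oplus>\<^bsub>free_module R Y\<^esub> k w) y" .
      qed (use kc vw FY.add_F_closed in auto)
      show "k (r \<odot>\<^bsub>M\<^esub> v) = r \<odot>\<^bsub>free_module R Y\<^esub> k v" if rv: "r \<in> carrier R" "v \<in> carrier M" for r v
      proof (rule FY.F_eqI)
        fix y assume y: "y \<in> Y"
        have "k (r \<odot>\<^bsub>M\<^esub> v) y = (\<Oplus>\<^bsub>R\<^esub>x\<in>X. r \<otimes>\<^bsub>R\<^esub> (h v x \<otimes>\<^bsub>R\<^esub> q x y))"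
          unfolding kapp[OF y] by (rule M.R.finsum_cong')
            (use y rv hc q in \<open>auto simp: module_homD(3)[OF h] FX.smult_F_app M.R.m_assoc\<close>)
        also have "\<dots> = (r \<odot>\<^bsub>free_module R Y\<^esub> k v) y"
          unfolding FY.smult_F_app[OF y] kapp[OF y] by (rule M.R.finsum_rdistr[symmetric]) (use y rv hc q finX in auto)
        finally show "k (r \<odot>\<^bsub>M\<^esub> v) y = (r \<odot>\<^bsub>free_module R Y\<^esub> k v) y" .
      qed (use kc rv FY.smult_F_closed in auto)
    qed
    fix y assume y: "y \<in> Y"
    have cy: "c y \<in> carrier M" using C y by auto
    define e where "e = (\<lambda>x\<in>X. p y x)"
    have e: "e \<in> carrier (free_module R X)" unfolding e_def by (rule FX.F_I[of _ X]) (use finX p y in auto)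
    have "h (c y) = e"
    proof (rule hu[OF e])
      show "c y = (\<Oplus>\<^bsub>M\<^esub>x\<in>X. e x \<odot>\<^bsub>M\<^esub> D x)"
        unfolding cD[OF y] by (rule M.M.finsum_cong') (use p y D in \<open>auto simp: e_def Pi_iff\<close>)
    qed
    show "k (c y) = free_gen R Y y"
    proof (rule FY.F_eqI[OF kc[OF cy] FY.gen_closed[OF y]])
      fix y' assume y': "y' \<in> Y"
      have "k (c y) y' = (\<Oplus>\<^bsub>R\<^esub>x\<in>X. p y x \<otimes>\<^bsub>R\<^esub> q x y')"
        unfolding kapp[OF y'] \<open>h (c y) = e\<close> by (rule M.R.finsum_cong') (use p y q y' in \<open>auto simp: e_def\<close>)
      also have "\<dots> = free_gen R Y y y'" unfolding pq[OF y y'] using y' by (auto simp: free_gen_def)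
      finally show "k (c y) y' = free_gen R Y y y'" .
    qed
  qed
qed

section \<open>The cell basis of the wreath product\<close>

locale wreath_cell = cell_datum R A I ord M C \<tau>
  for R :: "('k, 'r) ring_scheme" (structure) and A :: "('k, 'a, 'm) module_scheme" (structure)
    and I :: "'i set" and ord and M :: "'i \<Rightarrow> 's set" and C \<tau> +
  fixes d :: nat
begin

lemma assoc_algebra_A: "assoc_algebra R A"
  using fgp_algebra_axioms by (simp add: fgp_algebra_iff)

sublocale TA: tensor_algebra R A d
  by (rule tensor_algebra.intro[OF assoc_algebra_A])

sublocale RW: row_words I d
  by (rule row_words.intro[OF C1_order(1)])

abbreviation W where "W \<equiv> wreath_algebra R A d"
abbreviation elt where "elt x \<rho> \<equiv> wreath_tensor R A d (pure_tensor R A d x) \<rho>"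
abbreviation \<iota> :: "int \<Rightarrow> 'k" where "\<iota> \<equiv> cring.of_integer R"
abbreviation lperms where "lperms \<equiv> RW.lperms"
abbreviation match where "match \<equiv> RW.match"
abbreviation kword where "kword \<equiv> RW.kword"

text \<open>
  Labels for the ends of \<open>d\<close> strands, in the cells of \<open>A\<close> that their colours prescribe.
\<close>

definition labels :: "(nat \<Rightarrow> 'i) \<Rightarrow> (nat \<Rightarrow> 's) set" where "labels k = (\<Pi>\<^sub>E i\<in>{1..d}. M (k i))"

text \<open>
  A diagram: a permutation \<open>\<rho> = fst x\<close> with, on the strand that ends at \<open>i\<close>, the basis element
  of \<open>A\<close> in the cell \<open>snd x i\<close> whose left label is \<open>u i\<close> and whose right label \<open>v (inv \<rho> i)\<close>
  is indexed by the start of the strand.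
\<close>

definition diag :: "(nat \<Rightarrow> nat) \<times> (nat \<Rightarrow> 'i) \<Rightarrow> (nat \<Rightarrow> 's) \<Rightarrow> (nat \<Rightarrow> 's) \<Rightarrow> (nat \<Rightarrow> nat) \<Rightarrow> ((nat \<Rightarrow> 'a) \<Rightarrow> 'k) set" where
  "diag x u v = elt (\<lambda>i\<in>{1..d}. C (snd x i) (u i) (v (inv' (fst x) i))) (fst x)"

text \<open>
  The coloured permutations whose colours fit the labels at both ends. The colours at the
  starting points are those of the flipped permutation.
\<close>

definition valid :: "(nat \<Rightarrow> 's) \<Rightarrow> (nat \<Rightarrow> 's) \<Rightarrow> ((nat \<Rightarrow> nat) \<times> (nat \<Rightarrow> 'i)) set" where
  "valid u v = {x \<in> lperms. u \<in> labels (snd x) \<and> v \<in> labels (snd (RW.flip x))}"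

text \<open>
  An integral function on coloured permutations, read as a combination of diagrams with fixed
  labels at both ends.
\<close>

definition emb :: "(nat \<Rightarrow> 's) \<Rightarrow> (nat \<Rightarrow> 's) \<Rightarrow> ((nat \<Rightarrow> nat) \<times> (nat \<Rightarrow> 'i) \<Rightarrow> int) \<Rightarrow> (nat \<Rightarrow> nat) \<Rightarrow> ((nat \<Rightarrow> 'a) \<Rightarrow> 'k) set" where
  "emb u v g = (\<Oplus>\<^bsub>W\<^esub>x\<in>valid u v. \<iota> (g x) \<odot>\<^bsub>W\<^esub> diag x u v)"

lemma finite_valid: "finite (valid u v)"
  unfolding valid_def using RW.finite_lperms by auto

lemma C_closed: "\<kappa> \<in> I \<Longrightarrow> S \<in> M \<kappa> \<Longrightarrow> T \<in> M \<kappa> \<Longrightarrow> C \<kappa> S T \<in> carrier A"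
proof -
  assume "\<kappa> \<in> I" "S \<in> M \<kappa>" "T \<in> M \<kappa>"
  then have "(\<kappa>, S, T) \<in> cell_indices I M" by (simp add: cell_indices_def)
  moreover have "(\<lambda>(\<kappa>, S, T). C \<kappa> S T) \<in> cell_indices I M \<rightarrow> carrier A"
    using C1_basis by (simp add: finite_basis_def)
  ultimately show ?thesis by (auto dest: funcset_mem)
qed

lemma labels_mem: "u \<in> labels k \<Longrightarrow> i \<in> {1..d} \<Longrightarrow> u i \<in> M (k i)"
  unfolding labels_def using PiE_mem[of u "{1..d}" "\<lambda>i. M (k i)" i] by blast

lemma finite_labels: "k \<in> {1..d} \<rightarrow>\<^sub>E I \<Longrightarrow> finite (labels k)"
  unfolding labels_def using C1_finite PiE_mem[of k "{1..d}" "\<lambda>_. I"] by (intro finite_PiE) auto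

lemma validD:
  assumes "x \<in> valid u v"
  shows "x \<in> lperms" "fst x \<in> sym d" "snd x \<in> {1..d} \<rightarrow>\<^sub>E I"
    "\<And>i. i \<in> {1..d} \<Longrightarrow> snd x i \<in> I" "\<And>i. i \<in> {1..d} \<Longrightarrow> u i \<in> M (snd x i)"
    "\<And>i. i \<in> {1..d} \<Longrightarrow> v (inv' (fst x) i) \<in> M (snd x i)"
proof -
  show x: "x \<in> lperms" using assms by (simp add: valid_def)
  note xx = RW.lpermsD[OF x]
  show "fst x \<in> sym d" using xx by (simp add: mem_sym)
  show "snd x \<in> {1..d} \<rightarrow>\<^sub>E I" using xx by simp
  show "snd x i \<in> I" if "i \<in> {1..d}" for i using PiE_mem[OF xx(2) that] .
  show "u i \<in> M (snd x i)" if "i \<in> {1..d}" for i using assms labels_mem that by (auto simp: valid_def simp del: atLeastAtMost_iff)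
  show "v (inv' (fst x) i) \<in> M (snd x i)" if i: "i \<in> {1..d}" for i
  proof -
    have j: "inv' (fst x) i \<in> {1..d}" by (rule permutes_mem[OF permutes_inv[OF xx(1)] i])
    have "v \<in> labels (snd (RW.flip x))" using assms by (simp add: valid_def)
    from labels_mem[OF this j] show ?thesis
      using j i by (simp add: RW.flip_def permutes_inverses[OF xx(1)] del: atLeastAtMost_iff)
  qed
qed

lemma diag_tuple: "x \<in> valid u v \<Longrightarrow> (\<lambda>i\<in>{1..d}. C (snd x i) (u i) (v (inv' (fst x) i))) \<in> carrier (tuples A d)"
  by (rule TA.T_restrict) (intro C_closed validD; assumption)

lemma diag_closed: "x \<in> valid u v \<Longrightarrow> diag x u v \<in> carrier W"
  unfolding diag_def by (intro TA.elt_closed diag_tuple)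

lemma emb_term: "x \<in> valid u v \<Longrightarrow> \<iota> n \<odot>\<^bsub>W\<^esub> diag x u v \<in> carrier W"
  using diag_closed by (simp add: R.of_integer_closed)

lemma emb_closed: "emb u v g \<in> carrier W"
  unfolding emb_def using emb_term by (intro TA.W.M.finsum_closed) auto

lemma emb_cong: "(\<And>x. x \<in> lperms \<Longrightarrow> g x = h x) \<Longrightarrow> emb u v g = emb u v h"
  unfolding emb_def using emb_term by (intro TA.W.M.finsum_cong') (auto simp: valid_def)

lemma emb_sum:
  assumes "finite Y"
  shows "emb u v (\<lambda>x. \<Sum>y\<in>Y. c y * g y x) = (\<Oplus>\<^bsub>W\<^esub>y\<in>Y. \<iota> (c y) \<odot>\<^bsub>W\<^esub> emb u v (g y))"
  using assms
proof (induction Y rule: finite_induct)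
  case empty
  show ?case unfolding emb_def using diag_closed by (simp, intro TA.W.M.add.finprod_one_eqI) simp
next
  case (insert y Y)
  have "emb u v (\<lambda>x. \<Sum>y\<in>insert y Y. c y * g y x)
      = (\<Oplus>\<^bsub>W\<^esub>x\<in>valid u v. \<iota> (c y) \<odot>\<^bsub>W\<^esub> (\<iota> (g y x) \<odot>\<^bsub>W\<^esub> diag x u v) \<oplus>\<^bsub>W\<^esub> \<iota> (\<Sum>y\<in>Y. c y * g y x) \<odot>\<^bsub>W\<^esub> diag x u v)"
    unfolding emb_def
  proof (rule TA.W.M.finsum_cong'[OF refl])
    fix x assume "x \<in> valid u v"
    then show "\<iota> (\<Sum>y\<in>insert y Y. c y * g y x) \<odot>\<^bsub>W\<^esub> diag x u v
      = \<iota> (c y) \<odot>\<^bsub>W\<^esub> (\<iota> (g y x) \<odot>\<^bsub>W\<^esub> diag x u v) \<oplus>\<^bsub>W\<^esub> \<iota> (\<Sum>y\<in>Y. c y * g y x) \<odot>\<^bsub>W\<^esub> diag x u v"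
      using insert.hyps diag_closed by (simp add: R.of_integer_add R.of_integer_mult TA.W.smult_l_distr TA.W.smult_assoc1)
  qed (use diag_closed in auto)
  also have "\<dots> = (\<Oplus>\<^bsub>W\<^esub>x\<in>valid u v. \<iota> (c y) \<odot>\<^bsub>W\<^esub> (\<iota> (g y x) \<odot>\<^bsub>W\<^esub> diag x u v)) \<oplus>\<^bsub>W\<^esub> emb u v (\<lambda>x. \<Sum>y\<in>Y. c y * g y x)"
    unfolding emb_def by (rule TA.W.M.finsum_addf) (use diag_closed in auto)
  also have "(\<Oplus>\<^bsub>W\<^esub>x\<in>valid u v. \<iota> (c y) \<odot>\<^bsub>W\<^esub> (\<iota> (g y x) \<odot>\<^bsub>W\<^esub> diag x u v)) = \<iota> (c y) \<odot>\<^bsub>W\<^esub> emb u v (g y)"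
    unfolding emb_def by (rule TA.W.finsum_smult_ldistr[symmetric]) (use diag_closed finite_valid in auto)
  finally show ?case using insert emb_closed by simp
qed

lemma emb_delta:
  assumes "x \<in> valid u v" "\<And>x'. x' \<in> lperms \<Longrightarrow> g x' = (if x = x' then 1 else 0)"
  shows "emb u v g = diag x u v"
proof -
  have "emb u v g = (\<Oplus>\<^bsub>W\<^esub>x'\<in>valid u v. if x = x' then diag x' u v else \<zero>\<^bsub>W\<^esub>)"
    unfolding emb_def by (rule TA.W.M.finsum_cong') (use assms(2) validD(1) diag_closed in auto)
  also have "\<dots> = diag x u v"
    by (rule TA.W.M.finsum_singleton) (use assms(1) finite_valid diag_closed in auto)
  finally show ?thesis .
qed

abbreviation B where "B \<equiv> cell_indices I M"
abbreviation b where "b \<equiv> (\<lambda>(\<kappa>, S, T). C \<kappa> S T)"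

lemma coord_exists: "\<exists>h. h \<in> module_hom R A (free_module R B) \<and> (\<forall>\<beta>\<in>B. h (b \<beta>) = free_gen R B \<beta>) \<and>
   (\<forall>x e. e \<in> carrier (free_module R B) \<longrightarrow> x = (\<Oplus>\<^bsub>A\<^esub>\<beta>\<in>B. e \<beta> \<odot>\<^bsub>A\<^esub> b \<beta>) \<longrightarrow> h x = e)"
  by (rule finite_basis_coord[OF module_axioms C1_basis]) blast

text \<open>
  The basis of \<open>A\<close> has only one coordinate map; it is fixed once so that coordinates in
  different strands can be multiplied.
\<close>

definition coord where
  "coord = (SOME h. h \<in> module_hom R A (free_module R B) \<and> (\<forall>\<beta>\<in>B. h (b \<beta>) = free_gen R B \<beta>) \<and>
   (\<forall>x e. e \<in> carrier (free_module R B) \<longrightarrow> x = (\<Oplus>\<^bsub>A\<^esub>\<beta>\<in>B. e \<beta> \<odot>\<^bsub>A\<^esub> b \<beta>) \<longrightarrow> h x = e))"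

lemma coord_hom: "coord \<in> module_hom R A (free_module R B)"
  and coord_gen: "\<And>\<beta>. \<beta> \<in> B \<Longrightarrow> coord (b \<beta>) = free_gen R B \<beta>"
  and coord_unique: "\<And>x e. e \<in> carrier (free_module R B) \<Longrightarrow> x = (\<Oplus>\<^bsub>A\<^esub>\<beta>\<in>B. e \<beta> \<odot>\<^bsub>A\<^esub> b \<beta>) \<Longrightarrow> coord x = e"
  using someI_ex[OF coord_exists, folded coord_def] by blast+

lemma finite_B: "finite B" using C1_basis by (simp add: finite_basis_def)

lemma b_closed: "\<beta> \<in> B \<Longrightarrow> b \<beta> \<in> carrier A"
  using C1_basis by (auto simp: finite_basis_def)

lemma coord_closed: "x \<in> carrier A \<Longrightarrow> \<beta> \<in> B \<Longrightarrow> coord x \<beta> \<in> carrier R"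
  using fun_module.F_mem[OF fun_module_free[OF R.is_cring] module_homD(1)[OF coord_hom]] by blast

abbreviation letters where "letters \<equiv> TA.letters B"

lemma letters_mem: "w \<in> letters \<Longrightarrow> i \<in> {1..d} \<Longrightarrow> w i \<in> B"
  unfolding TA.letters_def[OF C1_basis] using PiE_mem[of w "{1..d}" "\<lambda>_. B" i] by blast

definition diags :: "(((nat \<Rightarrow> nat) \<times> (nat \<Rightarrow> 'i)) \<times> (nat \<Rightarrow> 's) \<times> (nat \<Rightarrow> 's)) set" where
  "diags = {(x, u, v). x \<in> valid u v}"

text \<open>
  A diagram with labels at both ends is the same as a permutation with a basis element of \<open>A\<close>
  for each strand; this map and the next one translate between the two descriptions.
\<close>

definition diag_word where
  "diag_word = (\<lambda>(x, u, v). (\<lambda>i\<in>{1..d}. (snd x i, u i, v (inv' (fst x) i)), fst x))"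

definition word_diag where
  "word_diag = (\<lambda>(w, \<rho>). ((\<rho>, \<lambda>i\<in>{1..d}. fst (w i)), \<lambda>i\<in>{1..d}. fst (snd (w i)), \<lambda>i\<in>{1..d}. snd (snd (w (\<rho> i)))))"

lemma diag_word_mem: "x \<in> valid u v \<Longrightarrow> diag_word (x, u, v) \<in> letters \<times> sym d"
  using validD[of x u v] unfolding diag_word_def TA.letters_def[OF C1_basis]
  by (auto simp: restrict_PiE_iff cell_indices_def)

lemma word_diag_diag_word: "x \<in> valid u v \<Longrightarrow> word_diag (diag_word (x, u, v)) = (x, u, v)"
proof -
  assume x: "x \<in> valid u v"
  note xx = validD[OF x]
  have p: "fst x permutes {1..d}" using xx(2) by (simp add: mem_sym)
  have "(\<lambda>i\<in>{1..d}. snd x i) = snd x" using PiE_restrict[OF xx(3)] .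
  moreover have "(\<lambda>i\<in>{1..d}. u i) = u" using x PiE_restrict[of u "{1..d}"] by (auto simp: valid_def labels_def)
  moreover have "(\<lambda>i\<in>{1..d}. v i) = v" using x PiE_restrict[of v "{1..d}"] by (auto simp: valid_def labels_def)
  moreover have "(\<lambda>i\<in>{1..d}. v (inv' (fst x) (fst x i))) = (\<lambda>i\<in>{1..d}. v i)"
    using permutes_inverses(2)[OF p] by simp
  moreover have "fst x i \<in> {1..d}" if "i \<in> {1..d}" for i using permutes_mem[OF p that] .
  ultimately show ?thesis unfolding word_diag_def diag_word_def
    by (simp add: prod_eq_iff cong: restrict_cong)
qed

lemma word_diag_valid:
  assumes w: "w \<in> letters" and \<rho>: "\<rho> \<in> sym d" and e: "word_diag (w, \<rho>) = (x, u, v)"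
  shows "x \<in> valid u v" "diag_word (x, u, v) = (w, \<rho>)"
proof -
  have p: "\<rho> permutes {1..d}" using \<rho> by (simp add: mem_sym)
  have x: "x = (\<rho>, \<lambda>i\<in>{1..d}. fst (w i))" and u: "u = (\<lambda>i\<in>{1..d}. fst (snd (w i)))"
    and v: "v = (\<lambda>i\<in>{1..d}. snd (snd (w (\<rho> i))))" using e by (auto simp: word_diag_def)
  have wm: "fst (w i) \<in> I" "fst (snd (w i)) \<in> M (fst (w i))" "snd (snd (w i)) \<in> M (fst (w i))" if "i \<in> {1..d}" for i
    using letters_mem[OF w that] by (auto simp: cell_indices_def)
  have \<rho>m: "\<rho> i \<in> {1..d}" if "i \<in> {1..d}" for i using permutes_mem[OF p that] .
  show "x \<in> valid u v"
    unfolding valid_def x u v RW.lperms_def RW.flip_def labels_def using p wm \<rho>m by (auto simp: restrict_PiE_iff simp del: atLeastAtMost_iff)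
  have im: "inv' \<rho> i \<in> {1..d}" if "i \<in> {1..d}" for i using permutes_mem[OF permutes_inv[OF p] that] .
  have "(\<lambda>i\<in>{1..d}. (snd x i, u i, v (inv' \<rho> i))) = w"
  proof
    fix i show "(\<lambda>i\<in>{1..d}. (snd x i, u i, v (inv' \<rho> i))) i = w i"
    proof (cases "i \<in> {1..d}")
      case True
      then show ?thesis using im[OF True] permutes_inverses(1)[OF p] unfolding x u v by simp
    next
      case False
      have "w \<in> {1..d} \<rightarrow>\<^sub>E B" using w unfolding TA.letters_def[OF C1_basis] .
      then show ?thesis using False PiE_arb by fastforce
    qed
  qed
  then show "diag_word (x, u, v) = (w, \<rho>)" unfolding diag_word_def x by simp
qed

lemma diag_word_bij: "bij_betw diag_word diags (letters \<times> sym d)"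
proof (rule bij_betw_byWitness[where f' = word_diag])
  show "\<forall>a\<in>diags. word_diag (diag_word a) = a" using word_diag_diag_word by (auto simp: diags_def)
  show "\<forall>a\<in>letters \<times> sym d. diag_word (word_diag a) = a"
  proof
    fix a assume "a \<in> letters \<times> sym d"
    then obtain w \<rho> where a: "a = (w, \<rho>)" "w \<in> letters" "\<rho> \<in> sym d" by auto
    obtain x u v where "word_diag (w, \<rho>) = (x, u, v)" by (cases "word_diag (w, \<rho>)")
    then show "diag_word (word_diag a) = a" using word_diag_valid(2)[OF a(2,3)] a(1) by simp
  qed
  show "diag_word ` diags \<subseteq> letters \<times> sym d"
  proof
    fix y assume "y \<in> diag_word ` diags"
    then obtain x u v where "y = diag_word (x, u, v)" "x \<in> valid u v" by (auto simp: diags_def)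
    then show "y \<in> letters \<times> sym d" using diag_word_mem[of x u v] by simp
  qed
  show "word_diag ` (letters \<times> sym d) \<subseteq> diags"
  proof
    fix y assume "y \<in> word_diag ` (letters \<times> sym d)"
    then obtain w \<rho> where a: "y = word_diag (w, \<rho>)" "w \<in> letters" "\<rho> \<in> sym d" by auto
    obtain x u v where "word_diag (w, \<rho>) = (x, u, v)" by (cases "word_diag (w, \<rho>)")
    then show "y \<in> diags" using word_diag_valid(1)[OF a(2,3)] a(1) by (simp add: diags_def)
  qed
qed

lemma elt_diag_word: "x \<in> valid u v \<Longrightarrow> diag_word (x, u, v) = (w, \<rho>) \<Longrightarrow> elt (TA.monom b w) \<rho> = diag x u v"
proof -
  assume "x \<in> valid u v" and "diag_word (x, u, v) = (w, \<rho>)"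
  then have w: "w = (\<lambda>i\<in>{1..d}. (snd x i, u i, v (inv' (fst x) i)))" "\<rho> = fst x" by (auto simp: diag_word_def)
  have "TA.monom b w = (\<lambda>i\<in>{1..d}. C (snd x i) (u i) (v (inv' (fst x) i)))"
    unfolding TA.monom_def[OF C1_basis] w by (simp cong: restrict_cong)
  then show ?thesis unfolding diag_def w(2) by simp
qed

lemma diag_basis: "finite_basis R W diags (\<lambda>(x, u, v). diag x u v)"
proof (rule finite_basis_reindex[OF TA.module_W TA.wreath_basis(1)[OF C1_basis coord_hom coord_gen] diag_word_bij])
  fix i assume "i \<in> diags"
  then obtain x u v where i: "i = (x, u, v)" "x \<in> valid u v" by (auto simp: diags_def)
  obtain w \<rho> where "diag_word (x, u, v) = (w, \<rho>)" by (cases "diag_word (x, u, v)")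
  then show "(case i of (x, u, v) \<Rightarrow> diag x u v) = (case diag_word i of (w, \<rho>) \<Rightarrow> elt (TA.monom b w) \<rho>)"
    using elt_diag_word[OF i(2)] i(1) by simp
qed

lemma finite_diags: "finite diags" using diag_basis by (simp add: finite_basis_def)

lemma match_nonzero:
  assumes x: "x \<in> lperms" and nz: "match r s x \<noteq> 0"
  shows "kword r = snd x" "kword s = snd (RW.flip x)" "\<And>i. i \<in> {1..d} \<Longrightarrow> r (fst x i) = s i"
proof -
  show k: "kword r = snd x" and m: "\<And>i. i \<in> {1..d} \<Longrightarrow> r (fst x i) = s i"
    using nz unfolding RW.match_def by (auto split: if_splits)
  have "fst (s i) = snd x (fst x i)" if i: "i \<in> {1..d}" for i
  proof -
    have "snd x (fst x i) = fst (r (fst x i))"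
      using k[symmetric] RW.perm_mem[OF RW.lpermsD(1)[OF x] i] by (simp add: RW.kword_def)
    then show ?thesis using m[OF i] by simp
  qed
  then show "kword s = snd (RW.flip x)" by (simp add: RW.kword_def RW.flip_def cong: restrict_cong)
qed

text \<open>
  A matching function with colours that fit the labels is supported on valid coloured
  permutations, so \<open>emb\<close> loses nothing of it.
\<close>

lemma match_valid:
  assumes "x \<in> lperms" "match r s x \<noteq> 0" "u \<in> labels (kword r)" "v \<in> labels (kword s)"
  shows "x \<in> valid u v"
  using match_nonzero[OF assms(1,2)] assms by (simp add: valid_def)

lemma flip_flip: assumes "x \<in> lperms" shows "RW.flip (RW.flip x) = x"
proof -
  note x = RW.lpermsD[OF assms]
  have "(\<lambda>i\<in>{1..d}. (\<lambda>i\<in>{1..d}. snd x (fst x i)) (inv' (fst x) i)) = (\<lambda>i\<in>{1..d}. snd x i)"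
    using RW.perm_mem[OF permutes_inv[OF x(1)]] permutes_inverses(1)[OF x(1)] by (intro restrict_ext) simp
  also have "\<dots> = snd x" using x(2) by (rule PiE_restrict)
  finally show ?thesis unfolding RW.flip_def using permutes_inv_inv[OF x(1)] by (simp add: prod_eq_iff)
qed

lemma flip_valid: "x \<in> valid u v \<Longrightarrow> RW.flip x \<in> valid v u"
  unfolding valid_def using RW.flip_lperms flip_flip by auto

section \<open>The order on the cells\<close>

text \<open>
  A strictly monotone function from the poset of \<open>A\<close> to the natural numbers. Left
  multiplication can change the colours of many strands at once, and the total height compares
  the results.
\<close>

definition height :: "'i \<Rightarrow> nat" where "height \<kappa> = card {\<mu> \<in> I. (\<mu>, \<kappa>) \<in> ord \<and> \<mu> \<noteq> \<kappa>}"

definition total_height :: "('i \<times> nat \<Rightarrow> nat) \<Rightarrow> int" where "total_height \<Lambda> = (\<Sum>p\<in>RW.rows. int (height (fst p)) * int (\<Lambda> p))"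
definition row_weight :: "('i \<times> nat \<Rightarrow> nat) \<Rightarrow> nat" where "row_weight \<Lambda> = (\<Sum>p\<in>RW.rows. 3 ^ \<Lambda> p)"

text \<open>
  Height comes first: left multiplication in the strands either keeps all colours or increases
  the total height, and the exchange relation preserves all colours and increases the weight.
\<close>

definition wless :: "('i \<times> nat \<Rightarrow> nat) \<Rightarrow> ('i \<times> nat \<Rightarrow> nat) \<Rightarrow> bool" where
  "wless \<Lambda> \<Gamma> \<longleftrightarrow> total_height \<Lambda> < total_height \<Gamma> \<or> total_height \<Lambda> = total_height \<Gamma> \<and> row_weight \<Lambda> < row_weight \<Gamma>"

text \<open>
  The cells are the multipartitions of \<open>d\<close>, in the form of contents of standard words.
\<close>

definition Iw :: "('i \<times> nat \<Rightarrow> nat) set" where "Iw = wcont d ` {r \<in> RW.words. RW.std r}"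

definition ordw :: "('i \<times> nat \<Rightarrow> nat) rel" where "ordw = {(\<Lambda>, \<Gamma>). \<Lambda> \<in> Iw \<and> \<Gamma> \<in> Iw \<and> (\<Lambda> = \<Gamma> \<or> wless \<Lambda> \<Gamma>)}"

text \<open>
  Standard multitableaux of shape \<open>\<Lambda>\<close>, with a label from the cell \<open>\<kappa>\<close> of \<open>A\<close> at each position
  of colour \<open>\<kappa>\<close>.
\<close>

definition Mw :: "('i \<times> nat \<Rightarrow> nat) \<Rightarrow> ((nat \<Rightarrow> 'i \<times> nat) \<times> (nat \<Rightarrow> 's)) set" where
  "Mw \<Lambda> = {(r, u). r \<in> RW.words \<and> RW.std r \<and> wcont d r = \<Lambda> \<and> u \<in> labels (kword r)}"

definition Cw where "Cw \<Lambda> S T = emb (snd S) (snd T) (match (fst S) (fst T))"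

abbreviation Bw where "Bw \<equiv> cell_indices Iw Mw"
abbreviation bw where "bw \<equiv> (\<lambda>(\<Lambda>, S, T). Cw \<Lambda> S T)"

lemma height_mono:
  assumes "(\<kappa>, \<mu>) \<in> ord" "\<kappa> \<noteq> \<mu>" shows "height \<kappa> < height \<mu>"
  unfolding height_def
proof (rule psubset_card_mono)
  have o: "trans ord" "antisym ord" "ord \<subseteq> I \<times> I" using C1_order(2) by (auto dest: partial_order_onD)
  have \<kappa>: "\<kappa> \<in> I" using o(3) assms(1) by auto
  have "{\<nu> \<in> I. (\<nu>, \<kappa>) \<in> ord \<and> \<nu> \<noteq> \<kappa>} \<subseteq> {\<nu> \<in> I. (\<nu>, \<mu>) \<in> ord \<and> \<nu> \<noteq> \<mu>}"
    using assms transD[OF o(1)] antisymD[OF o(2)] by blast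
  moreover have "\<kappa> \<in> {\<nu> \<in> I. (\<nu>, \<mu>) \<in> ord \<and> \<nu> \<noteq> \<mu>}" using \<kappa> assms by blast
  ultimately show "{\<nu> \<in> I. (\<nu>, \<kappa>) \<in> ord \<and> \<nu> \<noteq> \<kappa>} \<subset> {\<nu> \<in> I. (\<nu>, \<mu>) \<in> ord \<and> \<nu> \<noteq> \<mu>}" by blast
  show "finite {\<nu> \<in> I. (\<nu>, \<mu>) \<in> ord \<and> \<nu> \<noteq> \<mu>}" using C1_order(1) by simp
qed

lemma total_height_wcont: "r \<in> RW.words \<Longrightarrow> total_height (wcont d r) = (\<Sum>i\<in>{1..d}. int (height (kword r i)))"
  unfolding total_height_def using RW.sum_cont[of r "\<lambda>p. int (height (fst p))"] by (simp add: RW.kword_def)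

lemma row_weight_wcont: "row_weight (wcont d r) = RW.weight r"
  by (simp add: row_weight_def RW.weight_def)

lemma kword_I: "r \<in> RW.words \<Longrightarrow> kword r \<in> {1..d} \<rightarrow>\<^sub>E I"
  unfolding RW.kword_def using RW.words_fst[of r] by (simp add: restrict_PiE_iff)

lemma finite_Iw: "finite Iw" unfolding Iw_def using RW.finite_words by auto

lemma finite_Mw: "finite (Mw \<Lambda>)"
proof (rule finite_subset)
  show "Mw \<Lambda> \<subseteq> (SIGMA r:RW.words. labels (kword r))" by (auto simp: Mw_def)
  show "finite (SIGMA r:RW.words. labels (kword r))" using RW.finite_words finite_labels[OF kword_I] by (intro finite_SigmaI)
qed

lemma finite_Bw: "finite (cell_indices J Mw)" if "J \<subseteq> Iw"
  unfolding cell_indices_def using finite_Mw finite_subset[OF that finite_Iw] by auto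

lemma Cw_closed: "Cw \<Lambda> S T \<in> carrier W" unfolding Cw_def by (rule emb_closed)

lemma bw_closed: "bw \<in> J \<rightarrow> carrier W" using Cw_closed by auto

text \<open>
  Comparing first heights and then weights is irreflexive and transitive, hence its reflexive
  closure is a partial order.
\<close>

lemma order_Iw: "partial_order_on Iw ordw"
  unfolding partial_order_on_def preorder_on_def
proof (intro conjI)
  show "refl_on Iw ordw" by (auto simp: ordw_def refl_on_def)
  show "ordw \<subseteq> Iw \<times> Iw" by (auto simp: ordw_def)
  show "trans ordw" by (rule transI) (auto simp: ordw_def wless_def)
  show "antisym ordw" by (rule antisymI) (auto simp: ordw_def wless_def)
qed

lemma BwE:
  assumes "y \<in> Bw"
  obtains r u s v where "y = (wcont d r, (r, u), (s, v))" "(r, s) \<in> RW.spairs" "u \<in> labels (kword r)" "v \<in> labels (kword s)"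
  using assms unfolding cell_indices_def Mw_def RW.spairs_def by auto

lemma BwI: "(r, s) \<in> RW.spairs \<Longrightarrow> u \<in> labels (kword r) \<Longrightarrow> v \<in> labels (kword s) \<Longrightarrow> (wcont d r, (r, u), (s, v)) \<in> Bw"
  unfolding cell_indices_def Mw_def Iw_def RW.spairs_def by auto

lemma W_smult_iota: "X \<in> carrier W \<Longrightarrow> \<iota> n \<odot>\<^bsub>W\<^esub> X \<in> carrier W"
  by (simp add: R.of_integer_closed)

text \<open>The matrix that expresses diagrams in terms of the cell basis.\<close>

definition Q where
  "Q = (SOME Q. (\<forall>x\<in>lperms. \<forall>x'\<in>lperms. (\<Sum>y\<in>RW.spairs. Q x y * match (fst y) (snd y) x') = (if x = x' then 1 else 0)) \<and>
    (\<forall>y\<in>RW.spairs. \<forall>y'\<in>RW.spairs. (\<Sum>x\<in>lperms. match (fst y) (snd y) x * Q x y') = (if y = y' then 1 else 0)) \<and>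
    (\<forall>x y. Q x y \<noteq> 0 \<longrightarrow> kword (fst y) = snd x \<and> kword (snd y) = (\<lambda>i\<in>{1..d}. snd x (fst x i))))"

lemma Q_exists: "\<exists>Q. (\<forall>x\<in>lperms. \<forall>x'\<in>lperms. (\<Sum>y\<in>RW.spairs. Q x y * match (fst y) (snd y) x') = (if x = x' then 1 else 0)) \<and>
    (\<forall>y\<in>RW.spairs. \<forall>y'\<in>RW.spairs. (\<Sum>x\<in>lperms. match (fst y) (snd y) x * Q x y') = (if y = y' then 1 else 0)) \<and>
    (\<forall>x y. Q x y \<noteq> 0 \<longrightarrow> kword (fst y) = snd x \<and> kword (snd y) = (\<lambda>i\<in>{1..d}. snd x (fst x i)))"
  by (rule RW.std_pairs_invertible) blast

lemma Q1: "x \<in> lperms \<Longrightarrow> x' \<in> lperms \<Longrightarrow> (\<Sum>y\<in>RW.spairs. Q x y * match (fst y) (snd y) x') = (if x = x' then 1 else 0)"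
  and Q2: "y \<in> RW.spairs \<Longrightarrow> y' \<in> RW.spairs \<Longrightarrow> (\<Sum>x\<in>lperms. match (fst y) (snd y) x * Q x y') = (if y = y' then 1 else 0)"
  and Q3: "Q x y \<noteq> 0 \<Longrightarrow> kword (fst y) = snd x" and Q4: "Q x y \<noteq> 0 \<Longrightarrow> kword (snd y) = snd (RW.flip x)"
  using someI_ex[OF Q_exists, folded Q_def] by (auto simp: RW.flip_def simp del: split_paired_All)

lemma diag_expand:
  assumes x: "x \<in> valid u v"
  shows "diag x u v = (\<Oplus>\<^bsub>W\<^esub>y\<in>{y \<in> RW.spairs. Q x y \<noteq> 0}. \<iota> (Q x y) \<odot>\<^bsub>W\<^esub> emb u v (match (fst y) (snd y)))"
proof -
  have "diag x u v = emb u v (\<lambda>x'. \<Sum>y\<in>RW.spairs. Q x y * match (fst y) (snd y) x')"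
    using Q1[OF validD(1)[OF x]] by (intro emb_delta[OF x, symmetric]) auto
  also have "\<dots> = (\<Oplus>\<^bsub>W\<^esub>y\<in>RW.spairs. \<iota> (Q x y) \<odot>\<^bsub>W\<^esub> emb u v (match (fst y) (snd y)))"
    by (rule emb_sum[OF RW.finite_spairs])
  also have "\<dots> = (\<Oplus>\<^bsub>W\<^esub>y\<in>{y \<in> RW.spairs. Q x y \<noteq> 0}. \<iota> (Q x y) \<odot>\<^bsub>W\<^esub> emb u v (match (fst y) (snd y)))"
    by (rule TA.W.M.add.finprod_mono_neutral_cong_right)
      (use RW.finite_spairs W_smult_iota[OF emb_closed] emb_closed in auto)
  finally show ?thesis .
qed

text \<open>
  Straightening preserves the colours at both ends, so the labels of a diagram fit all cell
  elements in its expansion.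
\<close>

lemma valid_std:
  assumes "x \<in> valid u v" "y \<in> RW.spairs" "Q x y \<noteq> 0"
  shows "(wcont d (fst y), (fst y, u), (snd y, v)) \<in> Bw"
  using assms Q3[OF assms(3)] Q4[OF assms(3)] by (intro BwI) (auto simp: valid_def)

text \<open>
  The transition matrices between diagrams and cell elements. They are block diagonal: one
  block for each pair of labellings \<open>u\<close>, \<open>v\<close>, cut out of the integral matrices \<open>match\<close> and
  \<open>Q\<close>.
\<close>

definition cell_coeff where "cell_coeff = (\<lambda>(\<Lambda>, S, T) (x, u, v). if snd S = u \<and> snd T = v then \<iota> (match (fst S) (fst T) x) else \<zero>)"
definition diag_coeff where "diag_coeff = (\<lambda>(x, u, v) (\<Lambda>, S, T). if snd S = u \<and> snd T = v then \<iota> (Q x (fst S, fst T)) else \<zero>)"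

lemma Cw_diags:
  assumes "y \<in> Bw" shows "bw y = (\<Oplus>\<^bsub>W\<^esub>a\<in>diags. cell_coeff y a \<odot>\<^bsub>W\<^esub> (\<lambda>(x, u, v). diag x u v) a)"
proof -
  obtain r u s v where y: "y = (wcont d r, (r, u), (s, v))" using assms by (rule BwE)
  let ?f = "\<lambda>x. (x, u, v)"
  have dc: "(\<lambda>(x, u, v). diag x u v) a \<in> carrier W" if "a \<in> diags" for a
    using that diag_closed by (auto simp: diags_def)
  have pc: "cell_coeff y a \<in> carrier R" for a by (simp add: cell_coeff_def split_def R.of_integer_closed)
  have "bw y = (\<Oplus>\<^bsub>W\<^esub>x\<in>valid u v. \<iota> (match r s x) \<odot>\<^bsub>W\<^esub> diag x u v)" by (simp add: y Cw_def emb_def)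
  also have "\<dots> = (\<Oplus>\<^bsub>W\<^esub>a\<in>?f ` valid u v. cell_coeff y a \<odot>\<^bsub>W\<^esub> (\<lambda>(x, u, v). diag x u v) a)"
    by (subst TA.W.M.finsum_reindex) (auto simp: inj_on_def cell_coeff_def y diag_closed R.of_integer_closed)
  also have "\<dots> = (\<Oplus>\<^bsub>W\<^esub>a\<in>diags. cell_coeff y a \<odot>\<^bsub>W\<^esub> (\<lambda>(x, u, v). diag x u v) a)"
  proof (rule TA.W.M.add.finprod_mono_neutral_cong_left[OF finite_diags])
    show "?f ` valid u v \<subseteq> diags" by (auto simp: diags_def)
    show "cell_coeff y a \<odot>\<^bsub>W\<^esub> (\<lambda>(x, u, v). diag x u v) a = \<zero>\<^bsub>W\<^esub>" if a: "a \<in> diags - ?f ` valid u v" for a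
    proof -
      have "cell_coeff y a = \<zero>" using a by (auto simp: cell_coeff_def y diags_def)
      then show ?thesis using dc[of a] a by simp
    qed
    show "(\<lambda>a. cell_coeff y a \<odot>\<^bsub>W\<^esub> (\<lambda>(x, u, v). diag x u v) a) \<in> diags \<rightarrow> carrier W"
      using dc pc by (intro funcsetI TA.W.smult_closed)
  qed simp
  finally show ?thesis .
qed

lemma diags_Cw:
  assumes "a \<in> diags" shows "(\<lambda>(x, u, v). diag x u v) a = (\<Oplus>\<^bsub>W\<^esub>y\<in>Bw. diag_coeff a y \<odot>\<^bsub>W\<^esub> bw y)"
proof -
  obtain x u v where a: "a = (x, u, v)" and x: "x \<in> valid u v" using assms by (auto simp: diags_def)
  let ?S = "{y \<in> RW.spairs. Q x y \<noteq> 0}" and ?f = "\<lambda>y. (wcont d (fst y), (fst y, u), (snd y, v))"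
  have qc: "diag_coeff a y \<in> carrier R" for y by (simp add: diag_coeff_def split_def R.of_integer_closed)
  have "(\<lambda>(x, u, v). diag x u v) a = (\<Oplus>\<^bsub>W\<^esub>y\<in>?S. \<iota> (Q x y) \<odot>\<^bsub>W\<^esub> emb u v (match (fst y) (snd y)))"
    using diag_expand[OF x] by (simp add: a)
  also have "\<dots> = (\<Oplus>\<^bsub>W\<^esub>y\<in>?f ` ?S. diag_coeff a y \<odot>\<^bsub>W\<^esub> bw y)"
    by (subst TA.W.M.finsum_reindex) (auto simp: inj_on_def diag_coeff_def a Cw_def emb_closed R.of_integer_closed prod_eq_iff)
  also have "\<dots> = (\<Oplus>\<^bsub>W\<^esub>y\<in>Bw. diag_coeff a y \<odot>\<^bsub>W\<^esub> bw y)"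
  proof (rule TA.W.M.add.finprod_mono_neutral_cong_left[OF finite_Bw[OF subset_refl]])
    show "?f ` ?S \<subseteq> Bw" using valid_std[OF x] by auto
    show "diag_coeff a y \<odot>\<^bsub>W\<^esub> bw y = \<zero>\<^bsub>W\<^esub>" if y: "y \<in> Bw - ?f ` ?S" for y
    proof -
      obtain r u' s v' where e: "y = (wcont d r, (r, u'), (s, v'))" and sp: "(r, s) \<in> RW.spairs" using y by (blast elim: BwE)
      have "diag_coeff a y = \<zero>"
      proof (rule ccontr)
        assume nz: "diag_coeff a y \<noteq> \<zero>"
        then have "u' = u" "v' = v" by (auto simp: diag_coeff_def a e split: if_splits)
        moreover from this nz have "Q x (r, s) \<noteq> 0" by (auto simp: diag_coeff_def a e)
        ultimately have "y \<in> ?f ` ?S" using sp e by (auto intro: image_eqI[where x = "(r, s)"])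
        then show False using y by blast
      qed
      then have "diag_coeff a y \<odot>\<^bsub>W\<^esub> bw y = \<zero> \<odot>\<^bsub>W\<^esub> Cw (wcont d r) (r, u') (s, v')" by (simp add: e)
      then show ?thesis using TA.W.smult_l_null[OF Cw_closed] by simp
    qed
    show "(\<lambda>y. diag_coeff a y \<odot>\<^bsub>W\<^esub> bw y) \<in> Bw \<rightarrow> carrier W"
      using qc Cw_closed by (intro funcsetI TA.W.smult_closed) (auto simp: split_def)
  qed simp
  finally show ?thesis .
qed

lemma cell_diag_coeff:
  assumes y: "y \<in> Bw" and y': "y' \<in> Bw"
  shows "(\<Oplus>a\<in>diags. cell_coeff y a \<otimes> diag_coeff a y') = (if y = y' then \<one> else \<zero>)"
proof -
  obtain r u s v where e: "y = (wcont d r, (r, u), (s, v))" "(r, s) \<in> RW.spairs" "u \<in> labels (kword r)" "v \<in> labels (kword s)"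
    using y by (rule BwE)
  obtain r' u' s' v' where e': "y' = (wcont d r', (r', u'), (s', v'))" "(r', s') \<in> RW.spairs" using y' by (rule BwE)
  show ?thesis
  proof (cases "u = u' \<and> v = v'")
    case False
    then have "cell_coeff y a \<otimes> diag_coeff a y' = \<zero>" for a
      by (auto simp: cell_coeff_def diag_coeff_def e e' split_def R.of_integer_closed)
    moreover have "y \<noteq> y'" using False e e' by auto
    ultimately show ?thesis by (simp add: R.add.finprod_one_eqI)
  next
    case True
    let ?f = "\<lambda>x. (x, u, v)"
    have "(\<Oplus>a\<in>diags. cell_coeff y a \<otimes> diag_coeff a y') = (\<Oplus>a\<in>?f ` valid u v. cell_coeff y a \<otimes> diag_coeff a y')"
      by (rule R.add.finprod_mono_neutral_cong_right[OF finite_diags])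
        (auto simp: diags_def cell_coeff_def diag_coeff_def e e' split_def R.of_integer_closed image_iff)
    also have "\<dots> = (\<Oplus>x\<in>valid u v. \<iota> (match r s x * Q x (r', s')))"
      using True by (subst R.finsum_reindex) (auto simp: inj_on_def cell_coeff_def diag_coeff_def e e' R.of_integer_closed R.of_integer_mult)
    also have "\<dots> = \<iota> (\<Sum>x\<in>valid u v. match r s x * Q x (r', s'))" by (simp add: R.of_integer_sum)
    also have "(\<Sum>x\<in>valid u v. match r s x * Q x (r', s')) = (\<Sum>x\<in>lperms. match r s x * Q x (r', s'))"
      by (rule sum.mono_neutral_left) (use RW.finite_lperms match_valid[OF _ _ e(3,4)] in \<open>auto simp: valid_def\<close>)
    also have "\<dots> = (if (r, s) = (r', s') then 1 else 0)" using Q2[OF e(2) e'(2)] by simp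
    also have "\<iota> \<dots> = (if y = y' then \<one> else \<zero>)" using True e e' by (simp add: R.of_integer_0 R.of_integer_1)
    finally show ?thesis .
  qed
qed

text \<open>
  By \<open>std_pairs_invertible\<close> the transition matrix is invertible over the integers, hence over
  every ring.
\<close>

theorem cell_basis: "finite_basis R W Bw bw"
proof (rule finite_basis_change[OF TA.module_W diag_basis finite_Bw[OF subset_refl] bw_closed])
  show "cell_coeff y x \<in> carrier R" "diag_coeff x y \<in> carrier R" for x y
    by (simp_all add: cell_coeff_def diag_coeff_def split_def R.of_integer_closed)
qed (rule Cw_diags diags_Cw cell_diag_coeff; assumption)+

text \<open>
  The anti-involution flips diagrams, and flipping exchanges the two words of a matching
  function.
\<close>

lemma involution_Cw:
  assumes \<Theta>: "\<Theta> \<in> module_hom R W W"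
    and elt: "\<And>x \<rho>. x \<in> carrier (tuples A d) \<Longrightarrow> \<rho> \<in> sym d \<Longrightarrow> \<Theta> (elt x \<rho>) = elt (\<lambda>i\<in>{1..d}. \<tau> (x (\<rho> i))) (inv' \<rho>)"
    and ST: "S \<in> Mw \<Lambda>" "T \<in> Mw \<Lambda>"
  shows "\<Theta> (Cw \<Lambda> S T) = Cw \<Lambda> T S"
proof -
  obtain r u s v where S: "S = (r, u)" and T: "T = (s, v)" by (cases S, cases T)
  have w: "r \<in> RW.words" "s \<in> RW.words" using ST by (auto simp: S T Mw_def)
  have td: "\<Theta> (diag x u v) = diag (RW.flip x) v u" if x: "x \<in> valid u v" for x
  proof -
    note xx = validD[OF x]
    have p: "fst x permutes {1..d}" using xx(2) by (simp add: mem_sym)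
    have "\<tau> ((\<lambda>i\<in>{1..d}. C (snd x i) (u i) (v (inv' (fst x) i))) (fst x i)) = C (snd x (fst x i)) (v i) (u (fst x i))"
      if i: "i \<in> {1..d}" for i
    proof -
      have j: "fst x i \<in> {1..d}" using permutes_mem[OF p i] .
      show ?thesis using j C2_basis[OF xx(4)[OF j] xx(5)[OF j] xx(6)[OF j]] permutes_inverses(2)[OF p] by simp
    qed
    then show ?thesis
      unfolding diag_def elt[OF diag_tuple[OF x] xx(2)] RW.flip_def
      using permutes_inv_inv[OF p] by (simp cong: restrict_cong)
  qed
  have bij: "bij_betw RW.flip (valid v u) (valid u v)"
    by (rule bij_betw_byWitness[where f' = RW.flip]) (auto simp: flip_valid flip_flip validD(1))
  have "\<Theta> (Cw \<Lambda> S T) = (\<Oplus>\<^bsub>W\<^esub>x\<in>valid u v. \<Theta> (\<iota> (match r s x) \<odot>\<^bsub>W\<^esub> diag x u v))"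
    unfolding Cw_def emb_def S T fst_conv snd_conv
    by (rule module_hom_finsum[OF TA.module_W TA.module_W \<Theta>]) (use emb_term in auto)
  also have "\<dots> = (\<Oplus>\<^bsub>W\<^esub>x\<in>valid u v. \<iota> (match r s x) \<odot>\<^bsub>W\<^esub> diag (RW.flip x) v u)"
    by (rule TA.W.M.finsum_cong') (use td module_homD(3)[OF \<Theta>] diag_closed flip_valid in \<open>auto simp: R.of_integer_closed\<close>)
  also have "\<dots> = (\<Oplus>\<^bsub>W\<^esub>x\<in>RW.flip ` valid v u. \<iota> (match r s x) \<odot>\<^bsub>W\<^esub> diag (RW.flip x) v u)"
    using bij by (simp add: bij_betw_def)
  also have "\<dots> = (\<Oplus>\<^bsub>W\<^esub>x\<in>valid v u. \<iota> (match r s (RW.flip x)) \<odot>\<^bsub>W\<^esub> diag (RW.flip (RW.flip x)) v u)"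
    by (rule TA.W.M.finsum_reindex) (use bij diag_closed flip_valid in \<open>auto simp: bij_betw_def R.of_integer_closed\<close>)
  also have "\<dots> = (\<Oplus>\<^bsub>W\<^esub>x\<in>valid v u. \<iota> (match s r x) \<odot>\<^bsub>W\<^esub> diag x v u)"
    by (rule TA.W.M.finsum_cong') (use diag_closed RW.match_flip[OF w] flip_flip validD(1) in \<open>auto simp: R.of_integer_closed\<close>)
  also have "\<dots> = Cw \<Lambda> T S" unfolding Cw_def emb_def S T by simp
  finally show ?thesis .
qed

section \<open>Left multiplication and the cell datum\<close>

definition above where "above \<Lambda> = {\<Gamma> \<in> Iw. (\<Lambda>, \<Gamma>) \<in> ordw \<and> \<Gamma> \<noteq> \<Lambda>}"

text \<open>
  The span of all higher cells, i.e. the remainder terms that axiom (C3) allows.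
\<close>

definition Higher where "Higher \<Lambda> = lincombs R W (cell_indices (above \<Lambda>) Mw) bw"

lemma finite_above: "finite (cell_indices (above \<Lambda>) Mw)"
  by (rule finite_Bw) (auto simp: above_def)

lemma Higher_submodule: "submodule (Higher \<Lambda>) R W"
  unfolding Higher_def by (rule TA.W.lincombs_submodule[OF finite_above bw_closed])

lemmas Higher_closed = TA.W.submoduleE[OF Higher_submodule]

lemma Cw_Higher:
  assumes "(r, s) \<in> RW.spairs" "u \<in> labels (kword r)" "v \<in> labels (kword s)" "\<Lambda> \<in> Iw" "wless \<Lambda> (wcont d r)"
  shows "emb u v (match r s) \<in> Higher \<Lambda>"
proof -
  have "wcont d r \<noteq> \<Lambda>" using assms(5) by (auto simp: wless_def)
  then have "(wcont d r, (r, u), (s, v)) \<in> cell_indices (above \<Lambda>) Mw"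
    using BwI[OF assms(1-3)] assms(4,5) by (auto simp: above_def cell_indices_def ordw_def)
  from TA.W.lincombs_base[OF finite_above bw_closed this] show ?thesis by (simp add: Higher_def Cw_def)
qed

text \<open>
  A diagram expands into cell elements with the same colours, hence the same total height.
\<close>

lemma diag_Higher:
  assumes x: "x \<in> valid u v" and "\<Lambda> \<in> Iw" and lt: "total_height \<Lambda> < (\<Sum>i\<in>{1..d}. int (height (snd x i)))"
  shows "diag x u v \<in> Higher \<Lambda>"
  unfolding diag_expand[OF x]
proof (rule TA.W.submodule_finsum[OF Higher_submodule])
  fix y assume y: "y \<in> {y \<in> RW.spairs. Q x y \<noteq> 0}"
  obtain r s where rs: "y = (r, s)" by (cases y)
  have sp: "(r, s) \<in> RW.spairs" and nz: "Q x (r, s) \<noteq> 0" using y rs by auto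
  have k: "kword r = snd x" "kword s = snd (RW.flip x)" using Q3[OF nz] Q4[OF nz] by auto
  have "r \<in> RW.words" using sp by (auto simp: RW.spairs_def)
  then have "wless \<Lambda> (wcont d r)" using lt by (simp add: wless_def total_height_wcont k)
  then have "emb u v (match r s) \<in> Higher \<Lambda>" using x by (intro Cw_Higher[OF sp _ _ assms(2)]) (auto simp: k valid_def)
  then show "\<iota> (Q x y) \<odot>\<^bsub>W\<^esub> emb u v (match (fst y) (snd y)) \<in> Higher \<Lambda>"
    using Higher_closed(4) rs by (simp add: R.of_integer_closed)
qed

lemma Iw_part: "\<Lambda> \<in> Iw \<Longrightarrow> part \<Lambda>"
  unfolding Iw_def using RW.std_part by auto

text \<open>
  The transport of \<open>straighten_left\<close> to the wreath product. The heavier standard pairs have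
  the same colours as \<open>r\<close> and \<open>s\<close>, so their cells have the same total height and are higher.
\<close>

lemma emb_straighten:
  assumes r: "r \<in> RW.words" and \<Lambda>: "wcont d r \<in> Iw"
  shows "\<exists>q. \<forall>s u v. s \<in> RW.words \<longrightarrow> wcont d s = wcont d r \<longrightarrow> u \<in> labels (kword r) \<longrightarrow> v \<in> labels (kword s) \<longrightarrow>
     eqmod W (Higher (wcont d r)) (emb u v (match r s)) (\<Oplus>\<^bsub>W\<^esub>t\<in>RW.std_like r. \<iota> (q t) \<odot>\<^bsub>W\<^esub> emb u v (match t s))"
proof -
  obtain q where q: "\<And>s. s \<in> RW.words \<Longrightarrow> wcont d s = wcont d r \<Longrightarrow>
      RW.inspan (RW.spairs_ge (Suc (RW.weight r)) (kword r) (kword s))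
        (\<lambda>x. match r s x - (\<Sum>t\<in>RW.std_like r. q t * match t s x))"
    using RW.straighten_left[OF r Iw_part[OF \<Lambda>]] by blast
  show ?thesis
  proof (intro exI allI impI)
    fix s u v assume s: "s \<in> RW.words" "wcont d s = wcont d r" and u: "u \<in> labels (kword r)" and v: "v \<in> labels (kword s)"
    let ?Y = "RW.spairs_ge (Suc (RW.weight r)) (kword r) (kword s)"
    let ?t = "\<Oplus>\<^bsub>W\<^esub>t\<in>RW.std_like r. \<iota> (q t) \<odot>\<^bsub>W\<^esub> emb u v (match t s)"
    obtain c where c: "\<And>x. x \<in> lperms \<Longrightarrow>
        match r s x - (\<Sum>t\<in>RW.std_like r. q t * match t s x) = (\<Sum>y\<in>?Y. c y * match (fst y) (snd y) x)"
      using q[OF s] unfolding RW.inspan_def by blast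
    let ?z = "\<Oplus>\<^bsub>W\<^esub>y\<in>?Y. \<iota> (c y) \<odot>\<^bsub>W\<^esub> emb u v (match (fst y) (snd y))"
    have z: "?z \<in> Higher (wcont d r)"
    proof (rule TA.W.submodule_finsum[OF Higher_submodule])
      fix y assume y: "y \<in> ?Y"
      obtain p p' where pp: "y = (p, p')" by (cases y)
      have sp: "(p, p') \<in> RW.spairs" and k: "kword p = kword r" "kword p' = kword s" and w: "Suc (RW.weight r) \<le> RW.weight p"
        using y pp by (auto simp: RW.spairs_ge_def)
      have pw: "p \<in> RW.words" using sp by (auto simp: RW.spairs_def)
      have "wless (wcont d r) (wcont d p)"
        using w total_height_wcont[OF pw] total_height_wcont[OF r] by (simp add: wless_def row_weight_wcont k)
      then have "emb u v (match p p') \<in> Higher (wcont d r)" using u v by (intro Cw_Higher[OF sp _ _ \<Lambda>]) (auto simp: k)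
      then show "\<iota> (c y) \<odot>\<^bsub>W\<^esub> emb u v (match (fst y) (snd y)) \<in> Higher (wcont d r)"
        using Higher_closed(4) pp by (simp add: R.of_integer_closed)
    qed
    have tc: "?t \<in> carrier W" using W_smult_iota[OF emb_closed] by (intro TA.W.M.finsum_closed) auto
    have e1: "emb u v (\<lambda>x. \<Sum>y\<in>?Y. c y * match (fst y) (snd y) x) = ?z" by (rule emb_sum[OF RW.finite_spairs_ge])
    have e2: "emb u v (\<lambda>x. \<Sum>t\<in>RW.std_like r. q t * match t s x) = ?t" by (rule emb_sum[OF RW.finite_std_like])
    (* A sum over two indices, so that linearity over finite sums also covers the sum of the two
       parts. *)
    have "emb u v (match r s) = emb u v (\<lambda>x. \<Sum>i\<in>{True, False}. 1 *
       (if i then \<Sum>t\<in>RW.std_like r. q t * match t s x else \<Sum>y\<in>?Y. c y * match (fst y) (snd y) x))"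
    proof (rule emb_cong)
      fix x assume "x \<in> lperms"
      from c[OF this] show "match r s x = (\<Sum>i\<in>{True, False}. 1 *
       (if i then \<Sum>t\<in>RW.std_like r. q t * match t s x else \<Sum>y\<in>?Y. c y * match (fst y) (snd y) x))" by simp
    qed
    also have "\<dots> = (\<Oplus>\<^bsub>W\<^esub>i\<in>{True, False}. \<iota> 1 \<odot>\<^bsub>W\<^esub> emb u v (\<lambda>x. if i then \<Sum>t\<in>RW.std_like r. q t * match t s x else \<Sum>y\<in>?Y. c y * match (fst y) (snd y) x))"
      by (rule emb_sum) simp
    also have "\<dots> = ?t \<oplus>\<^bsub>W\<^esub> ?z"
      using emb_closed by (simp add: R.of_integer_1 e1 e2 tc)
    finally show "eqmod W (Higher (wcont d r)) (emb u v (match r s)) ?t"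
      using TA.W.eqmod_drop[OF Higher_submodule tc z] by simp
  qed
qed

lemma emb_match:
  assumes r: "r \<in> RW.words" and s: "s \<in> RW.words" and u: "u \<in> labels (kword r)" and v: "v \<in> labels (kword s)"
  defines "S \<equiv> {\<rho> \<in> sym d. \<forall>i\<in>{1..d}. r (\<rho> i) = s i}"
  shows "emb u v (match r s) = (\<Oplus>\<^bsub>W\<^esub>\<rho>\<in>S. diag (\<rho>, kword r) u v)"
    and "\<And>\<rho>. \<rho> \<in> S \<Longrightarrow> (\<rho>, kword r) \<in> valid u v"
proof -
  have m1: "match r s (\<rho>, kword r) = 1" if "\<rho> \<in> S" for \<rho> using that by (simp add: RW.match_def S_def)
  have lp: "(\<rho>, kword r) \<in> lperms" if "\<rho> \<in> S" for \<rho>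
    using that kword_I[OF r] by (simp add: RW.lperms_def S_def mem_sym)
  show val: "(\<rho>, kword r) \<in> valid u v" if "\<rho> \<in> S" for \<rho>
    using match_valid[OF lp[OF that] _ u v] m1[OF that] by simp
  have "emb u v (match r s) = (\<Oplus>\<^bsub>W\<^esub>x\<in>(\<lambda>\<rho>. (\<rho>, kword r)) ` S. diag x u v)"
    unfolding emb_def
  proof (rule TA.W.M.add.finprod_mono_neutral_cong_right[OF finite_valid])
    show "(\<lambda>\<rho>. (\<rho>, kword r)) ` S \<subseteq> valid u v" using val by auto
    show "\<iota> (match r s x) \<odot>\<^bsub>W\<^esub> diag x u v = \<zero>\<^bsub>W\<^esub>" if x: "x \<in> valid u v - (\<lambda>\<rho>. (\<rho>, kword r)) ` S" for x
    proof -
      have "match r s x = 0"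
      proof (rule ccontr)
        assume nz: "match r s x \<noteq> 0"
        have xl: "x \<in> lperms" "fst x \<in> sym d" using x validD(1,2) by blast+
        have "fst x \<in> S" "x = (fst x, kword r)" using match_nonzero[OF xl(1) nz] xl(2) by (auto simp: S_def prod_eq_iff)
        then show False using x by blast
      qed
      then show ?thesis using x diag_closed by (simp add: R.of_integer_0)
    qed
  qed (use m1 diag_closed in \<open>auto simp: R.of_integer_1 R.of_integer_closed val\<close>)
  also have "\<dots> = (\<Oplus>\<^bsub>W\<^esub>\<rho>\<in>S. diag (\<rho>, kword r) u v)"
    using diag_closed[OF val] by (subst TA.W.M.finsum_reindex) (auto simp: inj_on_def)
  finally show "emb u v (match r s) = (\<Oplus>\<^bsub>W\<^esub>\<rho>\<in>S. diag (\<rho>, kword r) u v)" .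
qed

text \<open>
  Axiom (C3) in coordinates: left multiplication keeps the right label within the cell, with
  coefficients that do not depend on it, and otherwise leads to higher cells.
\<close>

lemma coord_C3:
  assumes \<kappa>: "\<kappa> \<in> I" and a: "a \<in> carrier A"
  shows "\<exists>rr \<in> M \<kappa> \<rightarrow> M \<kappa> \<rightarrow> carrier R. \<forall>S\<in>M \<kappa>. \<forall>T\<in>M \<kappa>. \<forall>\<mu> U V. (\<mu>, U, V) \<in> B \<longrightarrow>
     (\<mu> = \<kappa> \<longrightarrow> coord (a \<otimes>\<^bsub>A\<^esub> C \<kappa> S T) (\<mu>, U, V) = (if V = T then rr U S else \<zero>)) \<and>
     (\<mu> \<noteq> \<kappa> \<longrightarrow> coord (a \<otimes>\<^bsub>A\<^esub> C \<kappa> S T) (\<mu>, U, V) \<noteq> \<zero> \<longrightarrow> (\<kappa>, \<mu>) \<in> ord)"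
proof -
  let ?J = "cell_indices {\<mu> \<in> I. (\<kappa>, \<mu>) \<in> ord \<and> \<mu> \<noteq> \<kappa>} M"
  interpret FB: fun_module R B "free_module R B" by (rule fun_module_free[OF R.is_cring])
  obtain r where r: "r \<in> M \<kappa> \<rightarrow> M \<kappa> \<rightarrow> carrier R" and
    C3': "\<And>S T. S \<in> M \<kappa> \<Longrightarrow> T \<in> M \<kappa> \<Longrightarrow> \<exists>c \<in> ?J \<rightarrow> carrier R.
          a \<otimes>\<^bsub>A\<^esub> C \<kappa> S T = (\<Oplus>\<^bsub>A\<^esub>U\<in>M \<kappa>. r U S \<odot>\<^bsub>A\<^esub> C \<kappa> U T) \<oplus>\<^bsub>A\<^esub>
            finsum A (\<lambda>(\<mu>, U, V). c (\<mu>, U, V) \<odot>\<^bsub>A\<^esub> C \<mu> U V) ?J"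
    using C3[OF assms] by blast
  have rc: "r U S \<in> carrier R" if "U \<in> M \<kappa>" "S \<in> M \<kappa>" for U S using r that by (auto simp: Pi_iff)
  show ?thesis
  proof (intro bexI[OF _ r] ballI allI impI)
    fix S T \<mu> U V assume S: "S \<in> M \<kappa>" and T: "T \<in> M \<kappa>" and B: "(\<mu>, U, V) \<in> B"
    from C3'[OF S T] obtain c where c: "c \<in> ?J \<rightarrow> carrier R" and
      eq: "a \<otimes>\<^bsub>A\<^esub> C \<kappa> S T = (\<Oplus>\<^bsub>A\<^esub>U\<in>M \<kappa>. r U S \<odot>\<^bsub>A\<^esub> C \<kappa> U T) \<oplus>\<^bsub>A\<^esub>
            finsum A (\<lambda>(\<mu>, U, V). c (\<mu>, U, V) \<odot>\<^bsub>A\<^esub> C \<mu> U V) ?J" by blast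
    define e where "e = (\<lambda>\<beta>\<in>B. if fst \<beta> = \<kappa> then (if snd (snd \<beta>) = T then r (fst (snd \<beta>)) S else \<zero>)
       else if \<beta> \<in> ?J then c \<beta> else \<zero>)"
    let ?K = "(\<lambda>U. (\<kappa>, U, T)) ` M \<kappa>"
    have KB: "?K \<subseteq> B" "?J \<subseteq> B" using \<kappa> T by (auto simp: cell_indices_def)
    have KJ: "?K \<inter> ?J = {}" by (auto simp: cell_indices_def)
    have ec: "e \<beta> \<in> carrier R" if "\<beta> \<in> B" for \<beta>
      using that rc S c by (auto simp: e_def cell_indices_def Pi_iff)
    have eF: "e \<in> carrier (free_module R B)"
    proof -
      have "(\<lambda>\<beta>\<in>B. e \<beta>) \<in> carrier (free_module R B)"
        by (rule FB.F_I[of _ B]) (use ec finite_B in auto)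
      moreover have "(\<lambda>\<beta>\<in>B. e \<beta>) = e" by (auto simp: e_def)
      ultimately show ?thesis by simp
    qed
    have bc: "(\<lambda>\<beta>. e \<beta> \<odot>\<^bsub>A\<^esub> b \<beta>) \<in> X \<rightarrow> carrier A" if "X \<subseteq> B" for X
      using that ec b_closed by (intro funcsetI smult_closed) auto
    have fin: "finite ?K" "finite ?J" using finite_subset[OF KB(1) finite_B] finite_subset[OF KB(2) finite_B] by auto
    have "(\<Oplus>\<^bsub>A\<^esub>\<beta>\<in>B. e \<beta> \<odot>\<^bsub>A\<^esub> b \<beta>) = (\<Oplus>\<^bsub>A\<^esub>\<beta>\<in>?K \<union> ?J. e \<beta> \<odot>\<^bsub>A\<^esub> b \<beta>)"
    proof (rule M.add.finprod_mono_neutral_cong_right[OF finite_B])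
      show "?K \<union> ?J \<subseteq> B" using KB by blast
      show "e \<beta> \<odot>\<^bsub>A\<^esub> b \<beta> = \<zero>\<^bsub>A\<^esub>" if "\<beta> \<in> B - (?K \<union> ?J)" for \<beta>
      proof -
        have "e \<beta> = \<zero>" using that by (auto simp: e_def cell_indices_def)
        then show ?thesis using b_closed[of \<beta>] that by simp
      qed
    qed (use bc in auto)
    also have "\<dots> = (\<Oplus>\<^bsub>A\<^esub>\<beta>\<in>?K. e \<beta> \<odot>\<^bsub>A\<^esub> b \<beta>) \<oplus>\<^bsub>A\<^esub> (\<Oplus>\<^bsub>A\<^esub>\<beta>\<in>?J. e \<beta> \<odot>\<^bsub>A\<^esub> b \<beta>)"
      using fin KJ bc KB by (intro M.finsum_Un_disjoint) auto
    also have "(\<Oplus>\<^bsub>A\<^esub>\<beta>\<in>?K. e \<beta> \<odot>\<^bsub>A\<^esub> b \<beta>) = (\<Oplus>\<^bsub>A\<^esub>U\<in>M \<kappa>. e (\<kappa>, U, T) \<odot>\<^bsub>A\<^esub> b (\<kappa>, U, T))"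
      using bc[OF KB(1)] by (intro M.finsum_reindex) (auto simp: inj_on_def)
    also have "\<dots> = (\<Oplus>\<^bsub>A\<^esub>U\<in>M \<kappa>. r U S \<odot>\<^bsub>A\<^esub> C \<kappa> U T)"
      by (rule M.finsum_cong') (use rc S T \<kappa> C_closed KB(1) in \<open>auto simp: e_def\<close>)
    also have "(\<Oplus>\<^bsub>A\<^esub>\<beta>\<in>?J. e \<beta> \<odot>\<^bsub>A\<^esub> b \<beta>) = finsum A (\<lambda>(\<mu>, U, V). c (\<mu>, U, V) \<odot>\<^bsub>A\<^esub> C \<mu> U V) ?J"
      by (rule M.finsum_cong') (use c C_closed KB(2) in \<open>auto simp: e_def cell_indices_def Pi_iff\<close>)
    finally have "a \<otimes>\<^bsub>A\<^esub> C \<kappa> S T = (\<Oplus>\<^bsub>A\<^esub>\<beta>\<in>B. e \<beta> \<odot>\<^bsub>A\<^esub> b \<beta>)" using eq by simp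
    from coord_unique[OF eF this] have co: "coord (a \<otimes>\<^bsub>A\<^esub> C \<kappa> S T) = e" .
    show "(\<mu> = \<kappa> \<longrightarrow> coord (a \<otimes>\<^bsub>A\<^esub> C \<kappa> S T) (\<mu>, U, V) = (if V = T then r U S else \<zero>)) \<and>
       (\<mu> \<noteq> \<kappa> \<longrightarrow> coord (a \<otimes>\<^bsub>A\<^esub> C \<kappa> S T) (\<mu>, U, V) \<noteq> \<zero> \<longrightarrow> (\<kappa>, \<mu>) \<in> ord)"
      unfolding co e_def using B by (auto simp: cell_indices_def)
  qed
qed

lemma finprod_zero_factor:
  assumes "finite J" "\<And>i. i \<in> J \<Longrightarrow> f i \<in> carrier R" "j \<in> J" "f j = \<zero>"
  shows "(\<Otimes>i\<in>J. f i) = \<zero>"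
proof -
  have "(\<Otimes>i\<in>insert j (J - {j}). f i) = f j \<otimes> (\<Otimes>i\<in>J - {j}. f i)"
    by (rule R.finprod_insert) (use assms in auto)
  also have "\<dots> = \<zero>" using assms by (simp add: R.finprod_closed Pi_iff)
  finally show ?thesis using assms(3) by (simp add: insert_absorb)
qed

text \<open>
  Expand the product in every strand by (C3). The words in which all strands stay in their
  cell keep the right labels and give the diagrams on the right-hand side. If some strand
  changes its cell, then none goes down and this one goes up, so the diagram has a larger
  total height and is a remainder term.
\<close>

lemma elt_expand:
  assumes a: "a \<in> carrier (tuples A d)" and k: "k \<in> {1..d} \<rightarrow>\<^sub>E I" and u: "\<And>i. i \<in> {1..d} \<Longrightarrow> u i \<in> M (k i)"
    and \<rho>: "\<rho> \<in> sym d" and T: "\<And>i. i \<in> {1..d} \<Longrightarrow> v (inv' \<rho> i) \<in> M (k i)" and vE: "\<And>U. U \<in> labels k \<Longrightarrow> (\<rho>, k) \<in> valid U v"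
    and \<Lambda>: "\<Lambda> \<in> Iw" "total_height \<Lambda> = (\<Sum>i\<in>{1..d}. int (height (k i)))"
    and rrc: "\<And>i U. i \<in> {1..d} \<Longrightarrow> U \<in> M (k i) \<Longrightarrow> rr i U (u i) \<in> carrier R"
    and rr: "\<And>i T \<mu> U V. i \<in> {1..d} \<Longrightarrow> T \<in> M (k i) \<Longrightarrow> (\<mu>, U, V) \<in> B \<Longrightarrow>
     (\<mu> = k i \<longrightarrow> coord (a i \<otimes>\<^bsub>A\<^esub> C (k i) (u i) T) (\<mu>, U, V) = (if V = T then rr i U (u i) else \<zero>)) \<and>
     (\<mu> \<noteq> k i \<longrightarrow> coord (a i \<otimes>\<^bsub>A\<^esub> C (k i) (u i) T) (\<mu>, U, V) \<noteq> \<zero> \<longrightarrow> (k i, \<mu>) \<in> ord)"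
  shows "eqmod W (Higher \<Lambda>) (elt (\<lambda>i\<in>{1..d}. a i \<otimes>\<^bsub>A\<^esub> C (k i) (u i) (v (inv' \<rho> i))) \<rho>)
     (\<Oplus>\<^bsub>W\<^esub>U\<in>labels k. (\<Otimes>i\<in>{1..d}. rr i (U i) (u i)) \<odot>\<^bsub>W\<^esub> diag (\<rho>, k) U v)"
proof -
  have kI: "k i \<in> I" if "i \<in> {1..d}" for i using PiE_mem[OF k that] .
  let ?z = "\<lambda>i\<in>{1..d}. a i \<otimes>\<^bsub>A\<^esub> C (k i) (u i) (v (inv' \<rho> i))"
  have zi: "a i \<otimes>\<^bsub>A\<^esub> C (k i) (u i) (v (inv' \<rho> i)) \<in> carrier A" if "i \<in> {1..d}" for i
    using TA.T_mem[OF a that] C_closed[OF kI[OF that] u[OF that] T[OF that]] by simp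
  have z: "?z \<in> carrier (tuples A d)" by (rule TA.T_restrict) (rule zi)
  define cf where "cf w = (\<Otimes>i\<in>{1..d}. coord (?z i) (w i))" for w
  have cfi: "coord (?z i) (w i) \<in> carrier R" if "w \<in> letters" "i \<in> {1..d}" for w i
    by (rule coord_closed[OF TA.T_mem[OF z that(2)] letters_mem[OF that]])
  have cfc: "cf w \<in> carrier R" if "w \<in> letters" for w
    unfolding cf_def by (rule R.finprod_closed) (use cfi[OF that] in auto)
  have mc: "elt (TA.monom b w) \<rho> \<in> carrier W" if "w \<in> letters" for w
    by (rule TA.elt_closed[OF TA.monom_closed[OF C1_basis that]])
  (* The word of the diagram with left labels U, and therefore with the colours and right labels
     of the given one. *)
  define g where "g U = (\<lambda>i\<in>{1..d}. (k i, U i, v (inv' \<rho> i)))" for U :: "nat \<Rightarrow> 's"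
  have g: "g U \<in> letters" "elt (TA.monom b (g U)) \<rho> = diag (\<rho>, k) U v" if U: "U \<in> labels k" for U
  proof -
    have dw: "diag_word ((\<rho>, k), U, v) = (g U, \<rho>)" by (simp add: diag_word_def g_def)
    show "g U \<in> letters" using diag_word_mem[OF vE[OF U]] dw by simp
    show "elt (TA.monom b (g U)) \<rho> = diag (\<rho>, k) U v" by (rule elt_diag_word[OF vE[OF U] dw])
  qed
  have cg: "cf (g U) = (\<Otimes>i\<in>{1..d}. rr i (U i) (u i))" if U: "U \<in> labels k" for U
    unfolding cf_def
  proof (rule R.finprod_cong'[OF refl])
    show "(\<lambda>i. rr i (U i) (u i)) \<in> {1..d} \<rightarrow> carrier R" using rrc labels_mem[OF U] by blast
    fix i assume i: "i \<in> {1..d}"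
    have "(k i, U i, v (inv' \<rho> i)) \<in> B" using letters_mem[OF g(1)[OF U] i] i by (simp add: g_def)
    from rr[OF i T[OF i] this] show "coord (?z i) (g U i) = rr i (U i) (u i)" using i by (simp add: g_def)
  qed
  have gi: "inj_on g (labels k)"
  proof (rule inj_onI)
    fix U U' assume U: "U \<in> labels k" "U' \<in> labels k" and eq: "g U = g U'"
    have "U i = U' i" if "i \<in> {1..d}" for i using fun_cong[OF eq, of i] that by (simp add: g_def)
    then show "U = U'" using U unfolding labels_def by (intro PiE_ext[of U _ "\<lambda>i. M (k i)" U'])
  qed
  let ?L0 = "g ` labels k"
  have L0: "?L0 \<subseteq> letters" using g by blast
  have finL: "finite letters" by (rule TA.finite_letters[OF C1_basis])
  have fin0: "finite ?L0" "finite (letters - ?L0)" using finite_subset[OF L0 finL] finL by auto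
  have tc: "(\<lambda>w. cf w \<odot>\<^bsub>W\<^esub> elt (TA.monom b w) \<rho>) \<in> X \<rightarrow> carrier W" if "X \<subseteq> letters" for X
    using that cfc mc by (intro funcsetI TA.W.smult_closed) auto
  have high: "cf w \<odot>\<^bsub>W\<^esub> elt (TA.monom b w) \<rho> \<in> Higher \<Lambda>" if w: "w \<in> letters" "w \<notin> ?L0" for w
  proof (cases "cf w = \<zero>")
    case True
    then show ?thesis using mc[OF w(1)] TA.W.submodule_zero[OF Higher_submodule] by simp
  next
    case False
    have nz: "coord (?z i) (w i) \<noteq> \<zero>" if "i \<in> {1..d}" for i
      using False finprod_zero_factor[of "{1..d}" "\<lambda>i. coord (?z i) (w i)" i] cfi[OF w(1)] that unfolding cf_def by blast
    have alt: "(fst (w i) = k i \<and> snd (snd (w i)) = v (inv' \<rho> i)) \<or> (fst (w i) \<noteq> k i \<and> (k i, fst (w i)) \<in> ord)"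
      if i: "i \<in> {1..d}" for i
    proof -
      obtain \<mu> U V where wi: "w i = (\<mu>, U, V)" by (cases "w i")
      have "(\<mu>, U, V) \<in> B" using letters_mem[OF w(1) i] wi by simp
      from rr[OF i T[OF i] this] nz[OF i] i show ?thesis by (auto simp: wi split: if_splits)
    qed
    have wB: "fst (snd (w i)) \<in> M (fst (w i))" if "i \<in> {1..d}" for i
      using letters_mem[OF w(1) that] by (auto simp: cell_indices_def)
    have "\<exists>i\<in>{1..d}. fst (w i) \<noteq> k i"
    proof (rule ccontr)
      assume "\<not> (\<exists>i\<in>{1..d}. fst (w i) \<noteq> k i)"
      then have eq: "fst (w i) = k i" "snd (snd (w i)) = v (inv' \<rho> i)" if "i \<in> {1..d}" for i using alt that by auto
      define U where "U = (\<lambda>i\<in>{1..d}. fst (snd (w i)))"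
      have U: "U \<in> labels k" using wB eq by (simp add: U_def labels_def restrict_PiE_iff)
      have "g U = w"
      proof
        fix i show "g U i = w i"
        proof (cases "i \<in> {1..d}")
          case True then show ?thesis using eq[OF True] by (auto simp: g_def U_def prod_eq_iff)
        next
          case False
          have "w \<in> {1..d} \<rightarrow>\<^sub>E B" using w(1) unfolding TA.letters_def[OF C1_basis] .
          then show ?thesis using False PiE_arb[of w "{1..d}" "\<lambda>_. B" i] by (auto simp: g_def)
        qed
      qed
      then show False using U w(2) by blast
    qed
    then obtain j where j: "j \<in> {1..d}" "fst (w j) \<noteq> k j" by blast
    have le: "height (k i) \<le> height (fst (w i))" if "i \<in> {1..d}" for i
      using alt[OF that] height_mono[of "k i" "fst (w i)"] by auto
    have lt: "height (k j) < height (fst (w j))" using alt[OF j(1)] j(2) height_mono[of "k j" "fst (w j)"] by auto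
    obtain x U V where xUV: "word_diag (w, \<rho>) = (x, U, V)" by (cases "word_diag (w, \<rho>)")
    note wv = word_diag_valid[OF w(1) \<rho> xUV]
    have sx: "snd x = (\<lambda>i\<in>{1..d}. fst (w i))" using xUV by (auto simp: word_diag_def)
    have "(\<Sum>i\<in>{1..d}. int (height (k i))) < (\<Sum>i\<in>{1..d}. int (height (snd x i)))"
      by (rule sum_strict_mono_ex1) (use le lt j(1) in \<open>auto simp: sx simp del: atLeastAtMost_iff\<close>)
    then have "diag x U V \<in> Higher \<Lambda>" using \<Lambda> by (intro diag_Higher[OF wv(1)]) auto
    moreover have "elt (TA.monom b w) \<rho> = diag x U V" by (rule elt_diag_word[OF wv])
    ultimately show ?thesis using Higher_closed(4)[OF cfc[OF w(1)]] by simp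
  qed
  have "elt ?z \<rho> = (\<Oplus>\<^bsub>W\<^esub>w\<in>letters. cf w \<odot>\<^bsub>W\<^esub> elt (TA.monom b w) \<rho>)"
    unfolding cf_def by (rule TA.wreath_basis(2)[OF C1_basis coord_hom coord_gen z \<rho>])
  also have "\<dots> = (\<Oplus>\<^bsub>W\<^esub>w\<in>?L0 \<union> (letters - ?L0). cf w \<odot>\<^bsub>W\<^esub> elt (TA.monom b w) \<rho>)"
    using L0 by (simp add: Un_absorb1)
  also have "\<dots> = (\<Oplus>\<^bsub>W\<^esub>w\<in>?L0. cf w \<odot>\<^bsub>W\<^esub> elt (TA.monom b w) \<rho>) \<oplus>\<^bsub>W\<^esub> (\<Oplus>\<^bsub>W\<^esub>w\<in>letters - ?L0. cf w \<odot>\<^bsub>W\<^esub> elt (TA.monom b w) \<rho>)"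
    using fin0 tc[OF L0] tc[of "letters - ?L0"] by (intro TA.W.M.finsum_Un_disjoint) auto
  also have "(\<Oplus>\<^bsub>W\<^esub>w\<in>?L0. cf w \<odot>\<^bsub>W\<^esub> elt (TA.monom b w) \<rho>) = (\<Oplus>\<^bsub>W\<^esub>U\<in>labels k. cf (g U) \<odot>\<^bsub>W\<^esub> elt (TA.monom b (g U)) \<rho>)"
    using tc[OF L0] gi by (intro TA.W.M.finsum_reindex)
  also have "\<dots> = (\<Oplus>\<^bsub>W\<^esub>U\<in>labels k. (\<Otimes>i\<in>{1..d}. rr i (U i) (u i)) \<odot>\<^bsub>W\<^esub> diag (\<rho>, k) U v)"
  proof (rule TA.W.M.finsum_cong'[OF refl])
    have "(\<Otimes>i\<in>{1..d}. rr i (U i) (u i)) \<in> carrier R" if "U \<in> labels k" for U using cfc[OF g(1)[OF that]] cg[OF that] by simp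
    then show "(\<lambda>U. (\<Otimes>i\<in>{1..d}. rr i (U i) (u i)) \<odot>\<^bsub>W\<^esub> diag (\<rho>, k) U v) \<in> labels k \<rightarrow> carrier W"
      using diag_closed[OF vE] by (intro funcsetI TA.W.smult_closed)
  qed (simp add: cg g)
  finally have eq: "elt ?z \<rho> = (\<Oplus>\<^bsub>W\<^esub>U\<in>labels k. (\<Otimes>i\<in>{1..d}. rr i (U i) (u i)) \<odot>\<^bsub>W\<^esub> diag (\<rho>, k) U v)
      \<oplus>\<^bsub>W\<^esub> (\<Oplus>\<^bsub>W\<^esub>w\<in>letters - ?L0. cf w \<odot>\<^bsub>W\<^esub> elt (TA.monom b w) \<rho>)" .
  show ?thesis
    unfolding eq
  proof (rule TA.W.eqmod_drop[OF Higher_submodule])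
    have "(\<Otimes>i\<in>{1..d}. rr i (U i) (u i)) \<in> carrier R" if "U \<in> labels k" for U using cfc[OF g(1)[OF that]] cg[OF that] by simp
    then show "(\<Oplus>\<^bsub>W\<^esub>U\<in>labels k. (\<Otimes>i\<in>{1..d}. rr i (U i) (u i)) \<odot>\<^bsub>W\<^esub> diag (\<rho>, k) U v) \<in> carrier W"
      using diag_closed[OF vE] by (intro TA.W.M.finsum_closed funcsetI TA.W.smult_closed)
    show "(\<Oplus>\<^bsub>W\<^esub>w\<in>letters - ?L0. cf w \<odot>\<^bsub>W\<^esub> elt (TA.monom b w) \<rho>) \<in> Higher \<Lambda>"
      by (rule TA.W.submodule_finsum[OF Higher_submodule]) (use high in blast)
  qed
qed

text \<open>
  The condition of (C3) for left multiplication by \<open>X\<close>. The coefficients \<open>q\<close> are chosen before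
  \<open>T\<close>. The condition is linear in \<open>X\<close>, so it is enough to verify it for \<open>x \<otimes> \<rho>\<close> with \<open>x\<close> a
  pure tensor.
\<close>

definition left_expands where
  "left_expands \<Lambda> S X \<longleftrightarrow> (\<exists>q \<in> Mw \<Lambda> \<rightarrow> carrier R. \<forall>T\<in>Mw \<Lambda>.
     eqmod W (Higher \<Lambda>) (X \<otimes>\<^bsub>W\<^esub> Cw \<Lambda> S T) (\<Oplus>\<^bsub>W\<^esub>U\<in>Mw \<Lambda>. q U \<odot>\<^bsub>W\<^esub> Cw \<Lambda> U T))"

text \<open>
  Multiplying a cell element by \<open>a \<otimes> \<sigma>\<close> first permutes the letters and labels at the left ends
  by \<open>\<sigma>\<close>, which gives the matching function of a word \<open>r'\<close> that need not be standard. Then \<open>a\<close>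
  acts on the strands as in \<open>elt_expand\<close>, and \<open>emb_straighten\<close> makes \<open>r'\<close> standard. Both steps
  leave the right word and the right labels alone, and their coefficients do not depend on
  them.
\<close>

lemma left_expands_elt:
  assumes a: "a \<in> carrier (tuples A d)" and \<sigma>: "\<sigma> \<in> sym d" and \<Lambda>: "\<Lambda> \<in> Iw" and S: "S \<in> Mw \<Lambda>"
  shows "left_expands \<Lambda> S (elt a \<sigma>)"
proof -
  obtain r u where S': "S = (r, u)" by (cases S)
  have r: "r \<in> RW.words" "wcont d r = \<Lambda>" "RW.std r" and u: "u \<in> labels (kword r)" using S by (auto simp: S' Mw_def)
  have p: "\<sigma> permutes {1..d}" "inv' \<sigma> permutes {1..d}" using \<sigma> permutes_inv by (auto simp: mem_sym)
  have im: "inv' \<sigma> i \<in> {1..d}" if "i \<in> {1..d}" for i using permutes_mem[OF p(2) that] .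
  define r' where "r' = (\<lambda>i\<in>{1..d}. r (inv' \<sigma> i))"
  define u' where "u' = (\<lambda>i\<in>{1..d}. u (inv' \<sigma> i))"
  define k where "k = kword r'"
  have r': "r' \<in> RW.words" "wcont d r' = \<Lambda>"
    unfolding r'_def using RW.words_perm[OF p(2) r(1)] RW.cont_perm[OF p(2)] r(2) by auto
  have k: "k \<in> {1..d} \<rightarrow>\<^sub>E I" unfolding k_def by (rule kword_I[OF r'(1)])
  have ki: "k i = kword r (inv' \<sigma> i)" if "i \<in> {1..d}" for i
    using that im[OF that] by (simp add: k_def RW.kword_def r'_def)
  have kI: "k i \<in> I" if "i \<in> {1..d}" for i using PiE_mem[OF k that] .
  have u'm: "u' i \<in> M (k i)" if "i \<in> {1..d}" for i
    using labels_mem[OF u im[OF that]] that by (simp add: ki u'_def)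
  have "\<forall>i\<in>{1..d}. \<exists>rr. (\<forall>U\<in>M (k i). \<forall>S\<in>M (k i). rr U S \<in> carrier R) \<and> (\<forall>S\<in>M (k i). \<forall>T\<in>M (k i). \<forall>\<mu> U V. (\<mu>, U, V) \<in> B \<longrightarrow>
     (\<mu> = k i \<longrightarrow> coord (a i \<otimes>\<^bsub>A\<^esub> C (k i) S T) (\<mu>, U, V) = (if V = T then rr U S else \<zero>)) \<and>
     (\<mu> \<noteq> k i \<longrightarrow> coord (a i \<otimes>\<^bsub>A\<^esub> C (k i) S T) (\<mu>, U, V) \<noteq> \<zero> \<longrightarrow> (k i, \<mu>) \<in> ord))"
  proof
    fix i assume i: "i \<in> {1..d}"
    from coord_C3[OF kI[OF i] TA.T_mem[OF a i]] obtain rr where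
      rr: "rr \<in> M (k i) \<rightarrow> M (k i) \<rightarrow> carrier R" and
      rr': "\<forall>S\<in>M (k i). \<forall>T\<in>M (k i). \<forall>\<mu> U V. (\<mu>, U, V) \<in> B \<longrightarrow>
     (\<mu> = k i \<longrightarrow> coord (a i \<otimes>\<^bsub>A\<^esub> C (k i) S T) (\<mu>, U, V) = (if V = T then rr U S else \<zero>)) \<and>
     (\<mu> \<noteq> k i \<longrightarrow> coord (a i \<otimes>\<^bsub>A\<^esub> C (k i) S T) (\<mu>, U, V) \<noteq> \<zero> \<longrightarrow> (k i, \<mu>) \<in> ord)" by blast
    have "\<forall>U\<in>M (k i). \<forall>S\<in>M (k i). rr U S \<in> carrier R" using rr by (auto simp: Pi_iff)
    with rr' show "\<exists>rr. (\<forall>U\<in>M (k i). \<forall>S\<in>M (k i). rr U S \<in> carrier R) \<and> (\<forall>S\<in>M (k i). \<forall>T\<in>M (k i). \<forall>\<mu> U V. (\<mu>, U, V) \<in> B \<longrightarrow>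
     (\<mu> = k i \<longrightarrow> coord (a i \<otimes>\<^bsub>A\<^esub> C (k i) S T) (\<mu>, U, V) = (if V = T then rr U S else \<zero>)) \<and>
     (\<mu> \<noteq> k i \<longrightarrow> coord (a i \<otimes>\<^bsub>A\<^esub> C (k i) S T) (\<mu>, U, V) \<noteq> \<zero> \<longrightarrow> (k i, \<mu>) \<in> ord))" by blast
  qed
  from bchoice[OF this] obtain rr where
    rrc: "\<And>i U S. i \<in> {1..d} \<Longrightarrow> U \<in> M (k i) \<Longrightarrow> S \<in> M (k i) \<Longrightarrow> rr i U S \<in> carrier R" and
    rr: "\<And>i S T \<mu> U V. i \<in> {1..d} \<Longrightarrow> S \<in> M (k i) \<Longrightarrow> T \<in> M (k i) \<Longrightarrow> (\<mu>, U, V) \<in> B \<Longrightarrow>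
     (\<mu> = k i \<longrightarrow> coord (a i \<otimes>\<^bsub>A\<^esub> C (k i) S T) (\<mu>, U, V) = (if V = T then rr i U S else \<zero>)) \<and>
     (\<mu> \<noteq> k i \<longrightarrow> coord (a i \<otimes>\<^bsub>A\<^esub> C (k i) S T) (\<mu>, U, V) \<noteq> \<zero> \<longrightarrow> (k i, \<mu>) \<in> ord)" by blast
  define cf where "cf U = (\<Otimes>i\<in>{1..d}. rr i (U i) (u' i))" for U
  have cfc: "cf U \<in> carrier R" if "U \<in> labels k" for U
    unfolding cf_def using rrc[OF _ labels_mem[OF that] u'm] by (intro R.finprod_closed funcsetI)
  have "wcont d r' \<in> Iw" using \<Lambda> r'(2) by simp
  from emb_straighten[OF r'(1) this, unfolded r'(2) k_def[symmetric]] obtain q where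
    q: "\<And>s u v. s \<in> RW.words \<Longrightarrow> wcont d s = \<Lambda> \<Longrightarrow> u \<in> labels k \<Longrightarrow> v \<in> labels (kword s) \<Longrightarrow>
     eqmod W (Higher \<Lambda>) (emb u v (match r' s)) (\<Oplus>\<^bsub>W\<^esub>t\<in>RW.std_like r'. \<iota> (q t) \<odot>\<^bsub>W\<^esub> emb u v (match t s))"
    by blast
  (* The product of the coefficients of both steps; words whose colours differ from those of r'
     do not occur. *)
  define qq where "qq U = (if kword (fst U) = k then cf (snd U) \<otimes> \<iota> (q (fst U)) else \<zero>)" for U
  have qqc: "qq U \<in> carrier R" if "U \<in> Mw \<Lambda>" for U
    using that cfc by (auto simp: qq_def Mw_def R.of_integer_closed)
  note finL = finite_labels[OF k]
  show ?thesis
    unfolding left_expands_def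
  proof (intro bexI[of _ qq] ballI)
    show "qq \<in> Mw \<Lambda> \<rightarrow> carrier R" using qqc by blast
    fix T assume T: "T \<in> Mw \<Lambda>"
    obtain s v where T': "T = (s, v)" by (cases T)
    have s: "s \<in> RW.words" "wcont d s = \<Lambda>" "RW.std s" and v: "v \<in> labels (kword s)" using T by (auto simp: T' Mw_def)
    let ?S = "{\<rho> \<in> sym d. \<forall>i\<in>{1..d}. r (\<rho> i) = s i}"
    let ?S' = "{\<rho> \<in> sym d. \<forall>i\<in>{1..d}. r' (\<rho> i) = s i}"
    let ?z = "\<lambda>\<rho>. \<lambda>i\<in>{1..d}. a i \<otimes>\<^bsub>A\<^esub> C (k i) (u' i) (v (inv' \<rho> i))"
    note em = emb_match[OF r(1) s(1) u v]
    have em': "emb U v (match r' s) = (\<Oplus>\<^bsub>W\<^esub>\<rho>\<in>?S'. diag (\<rho>, k) U v)" "\<And>\<rho>. \<rho> \<in> ?S' \<Longrightarrow> (\<rho>, k) \<in> valid U v"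
      if "U \<in> labels k" for U
      using emb_match[OF r'(1) s(1) _ v, of U] that unfolding k_def by blast+
    have u'L: "u' \<in> labels k" using u'm by (simp add: labels_def u'_def restrict_PiE_iff)
    have vm: "v (inv' \<rho> i) \<in> M (k i)" if "\<rho> \<in> ?S'" "i \<in> {1..d}" for \<rho> i
      using validD(6)[OF em'(2)[OF u'L that(1)] that(2)] by simp
    have finS: "finite ?S" "finite ?S'" using TA.finite_sym by auto
    have ae: "elt a \<sigma> \<in> carrier W" by (rule TA.elt_closed[OF a])
    have shift: "\<sigma> \<circ> \<rho> \<in> ?S'" if \<rho>: "\<rho> \<in> ?S" for \<rho>
    proof -
      have "r' (\<sigma> (\<rho> i)) = s i" if i: "i \<in> {1..d}" for i
      proof -
        have "\<rho> i \<in> {1..d}" using \<rho> permutes_mem[of \<rho> d i] i by (simp add: mem_sym)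
        then have "\<sigma> (\<rho> i) \<in> {1..d}" using permutes_mem[OF p(1)] by blast
        then have "r' (\<sigma> (\<rho> i)) = r (\<rho> i)" using permutes_inverses(2)[OF p(1)] by (simp add: r'_def)
        then show ?thesis using \<rho> i by simp
      qed
      then show ?thesis using \<rho> comp_sym[OF \<sigma>] by simp
    qed
    have bij: "bij_betw (\<lambda>\<rho>. \<sigma> \<circ> \<rho>) ?S ?S'"
    proof (rule bij_betw_byWitness[where f' = "\<lambda>\<rho>. inv' \<sigma> \<circ> \<rho>"])
      show "\<forall>\<rho>\<in>?S. inv' \<sigma> \<circ> (\<sigma> \<circ> \<rho>) = \<rho>" using permutes_inv_o(2)[OF p(1)] by (simp add: o_assoc)
      show "\<forall>\<rho>\<in>?S'. \<sigma> \<circ> (inv' \<sigma> \<circ> \<rho>) = \<rho>" using permutes_inv_o(1)[OF p(1)] by (simp add: o_assoc)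
      show "(\<lambda>\<rho>. \<sigma> \<circ> \<rho>) ` ?S \<subseteq> ?S'" using shift by blast
      show "(\<lambda>\<rho>. inv' \<sigma> \<circ> \<rho>) ` ?S' \<subseteq> ?S"
      proof (rule image_subsetI)
        fix \<rho> assume \<rho>: "\<rho> \<in> ?S'"
        have "r (inv' \<sigma> (\<rho> i)) = s i" if i: "i \<in> {1..d}" for i
        proof -
          have "\<rho> i \<in> {1..d}" using \<rho> permutes_mem[of \<rho> d i] i by (simp add: mem_sym)
          then have "r' (\<rho> i) = r (inv' \<sigma> (\<rho> i))" by (simp add: r'_def)
          then show ?thesis using \<rho> i by simp
        qed
        then show "inv' \<sigma> \<circ> \<rho> \<in> ?S" using \<rho> comp_sym[OF inv_sym[OF \<sigma>]] by simp
      qed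
    qed
    have zc: "elt (?z \<rho>) \<rho> \<in> carrier W" if "\<rho> \<in> ?S'" for \<rho>
    proof (rule TA.elt_closed, rule TA.T_restrict)
      fix i assume i: "i \<in> {1..d}"
      show "a i \<otimes>\<^bsub>A\<^esub> C (k i) (u' i) (v (inv' \<rho> i)) \<in> carrier A"
        using TA.T_mem[OF a i] C_closed[OF kI[OF i] u'm[OF i] vm[OF that i]] by simp
    qed
    have step: "elt a \<sigma> \<otimes>\<^bsub>W\<^esub> diag (\<rho>, kword r) u v = elt (?z (\<sigma> \<circ> \<rho>)) (\<sigma> \<circ> \<rho>)" if \<rho>: "\<rho> \<in> ?S" for \<rho>
    proof -
      have \<rho>s: "\<rho> \<in> sym d" using \<rho> by simp
      have pr: "\<rho> permutes {1..d}" using \<rho>s by (simp add: mem_sym)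
      let ?y = "\<lambda>i\<in>{1..d}. C (snd (\<rho>, kword r) i) (u i) (v (inv' (fst (\<rho>, kword r)) i))"
      have y: "?y \<in> carrier (tuples A d)" by (rule diag_tuple[OF em(2)[OF \<rho>]])
      have io: "inv' (\<sigma> \<circ> \<rho>) = inv' \<rho> \<circ> inv' \<sigma>" using p(1) pr by (simp add: o_inv_distrib permutes_bij)
      have "a \<otimes>\<^bsub>tuples A d\<^esub> tuple_act d ?y (inv' \<sigma>) = ?z (\<sigma> \<circ> \<rho>)"
        unfolding TA.mult_T
      proof (rule restrict_ext)
        fix i assume i: "i \<in> {1..d}"
        show "a i \<otimes>\<^bsub>A\<^esub> tuple_act d ?y (inv' \<sigma>) i = a i \<otimes>\<^bsub>A\<^esub> C (k i) (u' i) (v (inv' (\<sigma> \<circ> \<rho>) i))"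
          using i im[OF i] ki[OF i] by (simp add: tuple_act_def u'_def io)
      qed
      then show ?thesis unfolding diag_def fst_conv using TA.elt_mult[OF a y \<sigma> \<rho>s] by simp
    qed
    have "elt a \<sigma> \<otimes>\<^bsub>W\<^esub> Cw \<Lambda> S T = elt a \<sigma> \<otimes>\<^bsub>W\<^esub> (\<Oplus>\<^bsub>W\<^esub>\<rho>\<in>?S. diag (\<rho>, kword r) u v)"
      unfolding Cw_def S' T' fst_conv snd_conv em(1) ..
    also have "\<dots> = (\<Oplus>\<^bsub>W\<^esub>\<rho>\<in>?S. elt a \<sigma> \<otimes>\<^bsub>W\<^esub> diag (\<rho>, kword r) u v)"
      by (rule module_hom_finsum[OF TA.module_W TA.module_W TA.W_mult_right_hom[OF ae]]) (use diag_closed em(2) in blast)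
    also have "\<dots> = (\<Oplus>\<^bsub>W\<^esub>\<rho>\<in>?S. elt (?z (\<sigma> \<circ> \<rho>)) (\<sigma> \<circ> \<rho>))"
      by (rule TA.W.M.finsum_cong'[OF refl]) (use zc[OF shift] step in \<open>blast+\<close>)
    also have "\<dots> = (\<Oplus>\<^bsub>W\<^esub>\<rho>\<in>(\<lambda>\<rho>. \<sigma> \<circ> \<rho>) ` ?S. elt (?z \<rho>) \<rho>)"
    proof (rule TA.W.M.finsum_reindex[symmetric])
      show "(\<lambda>\<rho>. elt (?z \<rho>) \<rho>) \<in> (\<lambda>\<rho>. \<sigma> \<circ> \<rho>) ` ?S \<rightarrow> carrier W" using zc shift by blast
      show "inj_on (\<lambda>\<rho>. \<sigma> \<circ> \<rho>) ?S" by (rule bij_betw_imp_inj_on[OF bij])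
    qed
    also have "(\<lambda>\<rho>. \<sigma> \<circ> \<rho>) ` ?S = ?S'" using bij by (simp add: bij_betw_def)
    finally have prod: "elt a \<sigma> \<otimes>\<^bsub>W\<^esub> Cw \<Lambda> S T = (\<Oplus>\<^bsub>W\<^esub>\<rho>\<in>?S'. elt (?z \<rho>) \<rho>)" .
    have wt: "total_height \<Lambda> = (\<Sum>i\<in>{1..d}. int (height (k i)))" using total_height_wcont[OF r'(1)] r'(2) by (simp add: k_def)
    have "eqmod W (Higher \<Lambda>) (\<Oplus>\<^bsub>W\<^esub>\<rho>\<in>?S'. elt (?z \<rho>) \<rho>) (\<Oplus>\<^bsub>W\<^esub>\<rho>\<in>?S'. \<Oplus>\<^bsub>W\<^esub>U\<in>labels k. cf U \<odot>\<^bsub>W\<^esub> diag (\<rho>, k) U v)"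
    proof (rule TA.W.eqmod_finsum[OF Higher_submodule])
      fix \<rho> assume \<rho>: "\<rho> \<in> ?S'"
      show "eqmod W (Higher \<Lambda>) (elt (?z \<rho>) \<rho>) (\<Oplus>\<^bsub>W\<^esub>U\<in>labels k. cf U \<odot>\<^bsub>W\<^esub> diag (\<rho>, k) U v)"
        unfolding cf_def
      proof (rule elt_expand[OF a k u'm _ vm[OF \<rho>] em'(2)[OF _ \<rho>] \<Lambda> wt])
        show "\<rho> \<in> sym d" using \<rho> by simp
        show "rr i U (u' i) \<in> carrier R" if "i \<in> {1..d}" "U \<in> M (k i)" for i U using rrc[OF that u'm[OF that(1)]] .
        show "(\<mu> = k i \<longrightarrow> coord (a i \<otimes>\<^bsub>A\<^esub> C (k i) (u' i) T) (\<mu>, U, V) = (if V = T then rr i U (u' i) else \<zero>)) \<and>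
          (\<mu> \<noteq> k i \<longrightarrow> coord (a i \<otimes>\<^bsub>A\<^esub> C (k i) (u' i) T) (\<mu>, U, V) \<noteq> \<zero> \<longrightarrow> (k i, \<mu>) \<in> ord)"
          if "i \<in> {1..d}" "T \<in> M (k i)" "(\<mu>, U, V) \<in> B" for i T \<mu> U V using rr[OF that(1) u'm[OF that(1)] that(2,3)] .
      qed
    qed
    also have "(\<Oplus>\<^bsub>W\<^esub>\<rho>\<in>?S'. \<Oplus>\<^bsub>W\<^esub>U\<in>labels k. cf U \<odot>\<^bsub>W\<^esub> diag (\<rho>, k) U v) = (\<Oplus>\<^bsub>W\<^esub>U\<in>labels k. \<Oplus>\<^bsub>W\<^esub>\<rho>\<in>?S'. cf U \<odot>\<^bsub>W\<^esub> diag (\<rho>, k) U v)"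
      by (rule TA.W.M.finsum_swap[OF finS(2) finL]) (use cfc diag_closed[OF em'(2)] in \<open>intro TA.W.smult_closed\<close>)
    also have "\<dots> = (\<Oplus>\<^bsub>W\<^esub>U\<in>labels k. cf U \<odot>\<^bsub>W\<^esub> emb U v (match r' s))"
    proof (rule TA.W.M.finsum_cong'[OF refl])
      show "(\<lambda>U. cf U \<odot>\<^bsub>W\<^esub> emb U v (match r' s)) \<in> labels k \<rightarrow> carrier W"
        using cfc emb_closed by (intro funcsetI TA.W.smult_closed)
      fix U assume U: "U \<in> labels k"
      show "(\<Oplus>\<^bsub>W\<^esub>\<rho>\<in>?S'. cf U \<odot>\<^bsub>W\<^esub> diag (\<rho>, k) U v) = cf U \<odot>\<^bsub>W\<^esub> emb U v (match r' s)"
        unfolding em'(1)[OF U]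
        by (rule TA.W.finsum_smult_ldistr[symmetric, OF finS(2) cfc[OF U]]) (use diag_closed[OF em'(2)[OF U]] in blast)
    qed
    finally have 1: "eqmod W (Higher \<Lambda>) (elt a \<sigma> \<otimes>\<^bsub>W\<^esub> Cw \<Lambda> S T) (\<Oplus>\<^bsub>W\<^esub>U\<in>labels k. cf U \<odot>\<^bsub>W\<^esub> emb U v (match r' s))"
      unfolding prod .
    have 2: "eqmod W (Higher \<Lambda>) (\<Oplus>\<^bsub>W\<^esub>U\<in>labels k. cf U \<odot>\<^bsub>W\<^esub> emb U v (match r' s))
       (\<Oplus>\<^bsub>W\<^esub>U\<in>labels k. cf U \<odot>\<^bsub>W\<^esub> (\<Oplus>\<^bsub>W\<^esub>t\<in>RW.std_like r'. \<iota> (q t) \<odot>\<^bsub>W\<^esub> emb U v (match t s)))"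
      by (intro TA.W.eqmod_finsum[OF Higher_submodule] TA.W.eqmod_smult[OF Higher_submodule] cfc q s v)
    have "(\<Oplus>\<^bsub>W\<^esub>U\<in>labels k. cf U \<odot>\<^bsub>W\<^esub> (\<Oplus>\<^bsub>W\<^esub>t\<in>RW.std_like r'. \<iota> (q t) \<odot>\<^bsub>W\<^esub> emb U v (match t s)))
       = (\<Oplus>\<^bsub>W\<^esub>U\<in>labels k. \<Oplus>\<^bsub>W\<^esub>t\<in>RW.std_like r'. (cf U \<otimes> \<iota> (q t)) \<odot>\<^bsub>W\<^esub> emb U v (match t s))"
    proof (rule TA.W.M.finsum_cong'[OF refl])
      show "(\<lambda>U. \<Oplus>\<^bsub>W\<^esub>t\<in>RW.std_like r'. (cf U \<otimes> \<iota> (q t)) \<odot>\<^bsub>W\<^esub> emb U v (match t s)) \<in> labels k \<rightarrow> carrier W"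
        by (intro funcsetI TA.W.M.finsum_closed TA.W.smult_closed R.m_closed cfc R.of_integer_closed emb_closed)
      fix U assume U: "U \<in> labels k"
      have "cf U \<odot>\<^bsub>W\<^esub> (\<Oplus>\<^bsub>W\<^esub>t\<in>RW.std_like r'. \<iota> (q t) \<odot>\<^bsub>W\<^esub> emb U v (match t s))
          = (\<Oplus>\<^bsub>W\<^esub>t\<in>RW.std_like r'. cf U \<odot>\<^bsub>W\<^esub> (\<iota> (q t) \<odot>\<^bsub>W\<^esub> emb U v (match t s)))"
        using W_smult_iota[OF emb_closed] by (intro TA.W.finsum_smult_ldistr RW.finite_std_like cfc[OF U]) blast
      also have "\<dots> = (\<Oplus>\<^bsub>W\<^esub>t\<in>RW.std_like r'. (cf U \<otimes> \<iota> (q t)) \<odot>\<^bsub>W\<^esub> emb U v (match t s))"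
        by (rule TA.W.M.finsum_cong') (use cfc[OF U] emb_closed in \<open>auto simp: TA.W.smult_assoc1 R.of_integer_closed\<close>)
      finally show "cf U \<odot>\<^bsub>W\<^esub> (\<Oplus>\<^bsub>W\<^esub>t\<in>RW.std_like r'. \<iota> (q t) \<odot>\<^bsub>W\<^esub> emb U v (match t s))
        = (\<Oplus>\<^bsub>W\<^esub>t\<in>RW.std_like r'. (cf U \<otimes> \<iota> (q t)) \<odot>\<^bsub>W\<^esub> emb U v (match t s))" .
    qed
    also have "\<dots> = (\<Oplus>\<^bsub>W\<^esub>t\<in>RW.std_like r'. \<Oplus>\<^bsub>W\<^esub>U\<in>labels k. (cf U \<otimes> \<iota> (q t)) \<odot>\<^bsub>W\<^esub> emb U v (match t s))"
      by (rule TA.W.M.finsum_swap[OF finL RW.finite_std_like])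
        (intro TA.W.smult_closed R.m_closed cfc R.of_integer_closed emb_closed)
    also have "\<dots> = (\<Oplus>\<^bsub>W\<^esub>p\<in>RW.std_like r' \<times> labels k. (cf (snd p) \<otimes> \<iota> (q (fst p))) \<odot>\<^bsub>W\<^esub> emb (snd p) v (match (fst p) s))"
      by (rule TA.W.M.finsum_Times[symmetric, OF RW.finite_std_like finL])
        (intro TA.W.smult_closed R.m_closed cfc R.of_integer_closed emb_closed)
    also have "\<dots> = (\<Oplus>\<^bsub>W\<^esub>U\<in>Mw \<Lambda>. qq U \<odot>\<^bsub>W\<^esub> Cw \<Lambda> U T)"
    proof (rule TA.W.M.add.finprod_mono_neutral_cong_left[OF finite_Mw])
      show "RW.std_like r' \<times> labels k \<subseteq> Mw \<Lambda>" using r'(2) by (auto simp: RW.std_like_def Mw_def k_def)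
      show "qq U \<odot>\<^bsub>W\<^esub> Cw \<Lambda> U T = \<zero>\<^bsub>W\<^esub>" if U: "U \<in> Mw \<Lambda> - RW.std_like r' \<times> labels k" for U
      proof -
        have "kword (fst U) \<noteq> k" using U r'(2) by (auto simp: RW.std_like_def Mw_def k_def)
        then have "qq U = \<zero>" by (simp add: qq_def)
        then show ?thesis using TA.W.smult_l_null[OF Cw_closed] by simp
      qed
      show "(cf (snd p) \<otimes> \<iota> (q (fst p))) \<odot>\<^bsub>W\<^esub> emb (snd p) v (match (fst p) s) = qq p \<odot>\<^bsub>W\<^esub> Cw \<Lambda> p T"
        if "p \<in> RW.std_like r' \<times> labels k" for p
        using that by (auto simp: qq_def Cw_def T' RW.std_like_def k_def)
      show "(\<lambda>U. qq U \<odot>\<^bsub>W\<^esub> Cw \<Lambda> U T) \<in> Mw \<Lambda> \<rightarrow> carrier W"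
        by (intro funcsetI TA.W.smult_closed qqc Cw_closed)
    qed
    finally have 3: "(\<Oplus>\<^bsub>W\<^esub>U\<in>labels k. cf U \<odot>\<^bsub>W\<^esub> (\<Oplus>\<^bsub>W\<^esub>t\<in>RW.std_like r'. \<iota> (q t) \<odot>\<^bsub>W\<^esub> emb U v (match t s)))
       = (\<Oplus>\<^bsub>W\<^esub>U\<in>Mw \<Lambda>. qq U \<odot>\<^bsub>W\<^esub> Cw \<Lambda> U T)" .
    from TA.W.eqmod_trans[OF Higher_submodule 1 2]
    show "eqmod W (Higher \<Lambda>) (elt a \<sigma> \<otimes>\<^bsub>W\<^esub> Cw \<Lambda> S T) (\<Oplus>\<^bsub>W\<^esub>U\<in>Mw \<Lambda>. qq U \<odot>\<^bsub>W\<^esub> Cw \<Lambda> U T)"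
      unfolding 3 .
  qed
qed

lemma left_expands_all:
  assumes X: "X \<in> carrier W" and \<Lambda>: "\<Lambda> \<in> Iw" and S: "S \<in> Mw \<Lambda>" shows "left_expands \<Lambda> S X"
  using TA.module_W TA.W_spans X
proof (rule spans_induct)
  show "left_expands \<Lambda> S Y" if "Y \<in> {elt x \<rho> | x \<rho>. x \<in> carrier (tuples A d) \<and> \<rho> \<in> sym d}" for Y
    using that left_expands_elt[OF _ _ \<Lambda> S] by blast
  show "left_expands \<Lambda> S \<zero>\<^bsub>W\<^esub>"
    unfolding left_expands_def
  proof (intro bexI[of _ "\<lambda>_. \<zero>"] ballI)
    fix T
    have "(\<Oplus>\<^bsub>W\<^esub>U\<in>Mw \<Lambda>. \<zero> \<odot>\<^bsub>W\<^esub> Cw \<Lambda> U T) = \<zero>\<^bsub>W\<^esub>"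
      by (intro TA.W.M.add.finprod_one_eqI TA.W.smult_l_null Cw_closed)
    moreover have "\<zero>\<^bsub>W\<^esub> \<otimes>\<^bsub>W\<^esub> Cw \<Lambda> S T = \<zero>\<^bsub>W\<^esub>"
      by (rule module_hom_zero[OF TA.module_W TA.module_W TA.W_mult_left_hom[OF Cw_closed]])
    ultimately show "eqmod W (Higher \<Lambda>) (\<zero>\<^bsub>W\<^esub> \<otimes>\<^bsub>W\<^esub> Cw \<Lambda> S T) (\<Oplus>\<^bsub>W\<^esub>U\<in>Mw \<Lambda>. \<zero> \<odot>\<^bsub>W\<^esub> Cw \<Lambda> U T)"
      using TA.W.eqmod_refl[OF Higher_submodule TA.W.M.zero_closed] by metis
  qed auto
next
  fix X Y assume XY: "X \<in> carrier W" "Y \<in> carrier W" "left_expands \<Lambda> S X" "left_expands \<Lambda> S Y"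
  then obtain p q where p: "p \<in> Mw \<Lambda> \<rightarrow> carrier R" "\<And>T. T \<in> Mw \<Lambda> \<Longrightarrow> eqmod W (Higher \<Lambda>) (X \<otimes>\<^bsub>W\<^esub> Cw \<Lambda> S T) (\<Oplus>\<^bsub>W\<^esub>U\<in>Mw \<Lambda>. p U \<odot>\<^bsub>W\<^esub> Cw \<Lambda> U T)"
    and q: "q \<in> Mw \<Lambda> \<rightarrow> carrier R" "\<And>T. T \<in> Mw \<Lambda> \<Longrightarrow> eqmod W (Higher \<Lambda>) (Y \<otimes>\<^bsub>W\<^esub> Cw \<Lambda> S T) (\<Oplus>\<^bsub>W\<^esub>U\<in>Mw \<Lambda>. q U \<odot>\<^bsub>W\<^esub> Cw \<Lambda> U T)"
    unfolding left_expands_def by blast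
  have cl: "(\<lambda>U. q U \<odot>\<^bsub>W\<^esub> Cw \<Lambda> U T) \<in> Mw \<Lambda> \<rightarrow> carrier W" if "q \<in> Mw \<Lambda> \<rightarrow> carrier R" for q T
    using that by (intro funcsetI TA.W.smult_closed Cw_closed) auto
  show "left_expands \<Lambda> S (X \<oplus>\<^bsub>W\<^esub> Y)"
    unfolding left_expands_def
  proof (intro bexI[of _ "\<lambda>U. p U \<oplus> q U"] ballI)
    show "(\<lambda>U. p U \<oplus> q U) \<in> Mw \<Lambda> \<rightarrow> carrier R" using p(1) q(1) by auto
    fix T assume T: "T \<in> Mw \<Lambda>"
    have "(\<Oplus>\<^bsub>W\<^esub>U\<in>Mw \<Lambda>. (p U \<oplus> q U) \<odot>\<^bsub>W\<^esub> Cw \<Lambda> U T) = (\<Oplus>\<^bsub>W\<^esub>U\<in>Mw \<Lambda>. p U \<odot>\<^bsub>W\<^esub> Cw \<Lambda> U T \<oplus>\<^bsub>W\<^esub> q U \<odot>\<^bsub>W\<^esub> Cw \<Lambda> U T)"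
      by (rule TA.W.M.finsum_cong') (use p(1) q(1) in \<open>auto simp: TA.W.smult_l_distr Pi_iff Cw_closed simp del: split_paired_All\<close>)
    also have "\<dots> = (\<Oplus>\<^bsub>W\<^esub>U\<in>Mw \<Lambda>. p U \<odot>\<^bsub>W\<^esub> Cw \<Lambda> U T) \<oplus>\<^bsub>W\<^esub> (\<Oplus>\<^bsub>W\<^esub>U\<in>Mw \<Lambda>. q U \<odot>\<^bsub>W\<^esub> Cw \<Lambda> U T)"
      by (rule TA.W.M.finsum_addf[OF cl[OF p(1)] cl[OF q(1)]])
    finally show "eqmod W (Higher \<Lambda>) ((X \<oplus>\<^bsub>W\<^esub> Y) \<otimes>\<^bsub>W\<^esub> Cw \<Lambda> S T) (\<Oplus>\<^bsub>W\<^esub>U\<in>Mw \<Lambda>. (p U \<oplus> q U) \<odot>\<^bsub>W\<^esub> Cw \<Lambda> U T)"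
      using TA.W.eqmod_add[OF Higher_submodule p(2)[OF T] q(2)[OF T]] module_homD(2)[OF TA.W_mult_left_hom[OF Cw_closed[of \<Lambda> S T]] XY(1,2)] by simp
  qed
next
  fix c X assume c: "c \<in> carrier R" and X: "X \<in> carrier W" "left_expands \<Lambda> S X"
  then obtain p where p: "p \<in> Mw \<Lambda> \<rightarrow> carrier R" "\<And>T. T \<in> Mw \<Lambda> \<Longrightarrow> eqmod W (Higher \<Lambda>) (X \<otimes>\<^bsub>W\<^esub> Cw \<Lambda> S T) (\<Oplus>\<^bsub>W\<^esub>U\<in>Mw \<Lambda>. p U \<odot>\<^bsub>W\<^esub> Cw \<Lambda> U T)"
    unfolding left_expands_def by blast
  have cl: "(\<lambda>U. p U \<odot>\<^bsub>W\<^esub> Cw \<Lambda> U T) \<in> Mw \<Lambda> \<rightarrow> carrier W" for T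
    using p(1) by (intro funcsetI TA.W.smult_closed Cw_closed) auto
  show "left_expands \<Lambda> S (c \<odot>\<^bsub>W\<^esub> X)"
    unfolding left_expands_def
  proof (intro bexI[of _ "\<lambda>U. c \<otimes> p U"] ballI)
    show "(\<lambda>U. c \<otimes> p U) \<in> Mw \<Lambda> \<rightarrow> carrier R" using p(1) c by auto
    fix T assume T: "T \<in> Mw \<Lambda>"
    have "(\<Oplus>\<^bsub>W\<^esub>U\<in>Mw \<Lambda>. (c \<otimes> p U) \<odot>\<^bsub>W\<^esub> Cw \<Lambda> U T) = (\<Oplus>\<^bsub>W\<^esub>U\<in>Mw \<Lambda>. c \<odot>\<^bsub>W\<^esub> (p U \<odot>\<^bsub>W\<^esub> Cw \<Lambda> U T))"
      by (rule TA.W.M.finsum_cong') (use p(1) c in \<open>auto simp: TA.W.smult_assoc1 Pi_iff Cw_closed simp del: split_paired_All\<close>)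
    also have "\<dots> = c \<odot>\<^bsub>W\<^esub> (\<Oplus>\<^bsub>W\<^esub>U\<in>Mw \<Lambda>. p U \<odot>\<^bsub>W\<^esub> Cw \<Lambda> U T)"
      by (rule TA.W.finsum_smult_ldistr[symmetric, OF finite_Mw c cl])
    finally show "eqmod W (Higher \<Lambda>) ((c \<odot>\<^bsub>W\<^esub> X) \<otimes>\<^bsub>W\<^esub> Cw \<Lambda> S T) (\<Oplus>\<^bsub>W\<^esub>U\<in>Mw \<Lambda>. (c \<otimes> p U) \<odot>\<^bsub>W\<^esub> Cw \<Lambda> U T)"
      using TA.W.eqmod_smult[OF Higher_submodule c p(2)[OF T]] module_homD(3)[OF TA.W_mult_left_hom[OF Cw_closed[of \<Lambda> S T]] c X(1)] by simp
  qed
qed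

theorem wreath_cellular: "cellular_algebra R W"
proof -
  obtain \<Theta> where \<Theta>: "\<Theta> \<in> module_hom R W W"
    "\<And>X Y. X \<in> carrier W \<Longrightarrow> Y \<in> carrier W \<Longrightarrow> \<Theta> (X \<otimes>\<^bsub>W\<^esub> Y) = \<Theta> Y \<otimes>\<^bsub>W\<^esub> \<Theta> X"
    "\<Theta> \<one>\<^bsub>W\<^esub> = \<one>\<^bsub>W\<^esub>" "\<And>X. X \<in> carrier W \<Longrightarrow> \<Theta> (\<Theta> X) = X"
    "\<And>x \<rho>. x \<in> carrier (tuples A d) \<Longrightarrow> \<rho> \<in> sym d \<Longrightarrow> \<Theta> (elt x \<rho>) = elt (\<lambda>i\<in>{1..d}. \<tau> (x (\<rho> i))) (inv' \<rho>)"
    by (rule TA.W_anti_involution[OF C2_linear C2_anti C2_one C2_involution]) (blast intro: that)+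
  have fgp: "fgp_algebra R W"
    unfolding fgp_algebra_iff using TA.assoc_algebra_W finite_basis_fg_projective[OF TA.module_W cell_basis] by blast
  have "cell_datum R W Iw ordw Mw Cw \<Theta>"
  proof (intro cell_datum.intro[OF fgp] cell_datum_axioms.intro)
    show "finite Iw" by (rule finite_Iw)
    show "partial_order_on Iw ordw" by (rule order_Iw)
    show "finite (Mw \<Lambda>)" for \<Lambda> by (rule finite_Mw)
    show "finite_basis R W Bw bw" by (rule cell_basis)
    show "\<Theta> (Cw \<Lambda> S T) = Cw \<Lambda> T S" if "S \<in> Mw \<Lambda>" "T \<in> Mw \<Lambda>" for \<Lambda> S T
      by (rule involution_Cw[OF \<Theta>(1,5) that])
  next
    fix \<Lambda> X assume \<Lambda>: "\<Lambda> \<in> Iw" and X: "X \<in> carrier W"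
    have "\<forall>S\<in>Mw \<Lambda>. \<exists>q. q \<in> Mw \<Lambda> \<rightarrow> carrier R \<and> (\<forall>T\<in>Mw \<Lambda>.
        eqmod W (Higher \<Lambda>) (X \<otimes>\<^bsub>W\<^esub> Cw \<Lambda> S T) (\<Oplus>\<^bsub>W\<^esub>U\<in>Mw \<Lambda>. q U \<odot>\<^bsub>W\<^esub> Cw \<Lambda> U T))"
      using left_expands_all[OF X \<Lambda>] unfolding left_expands_def by blast
    from bchoice[OF this] obtain q where
      qc: "\<And>S. S \<in> Mw \<Lambda> \<Longrightarrow> q S \<in> Mw \<Lambda> \<rightarrow> carrier R" and
      q: "\<And>S T. S \<in> Mw \<Lambda> \<Longrightarrow> T \<in> Mw \<Lambda> \<Longrightarrow>
        eqmod W (Higher \<Lambda>) (X \<otimes>\<^bsub>W\<^esub> Cw \<Lambda> S T) (\<Oplus>\<^bsub>W\<^esub>U\<in>Mw \<Lambda>. q S U \<odot>\<^bsub>W\<^esub> Cw \<Lambda> U T)" by blast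
    let ?J = "cell_indices {\<Gamma> \<in> Iw. (\<Lambda>, \<Gamma>) \<in> ordw \<and> \<Gamma> \<noteq> \<Lambda>} Mw"
    show "\<exists>r \<in> Mw \<Lambda> \<rightarrow> Mw \<Lambda> \<rightarrow> carrier R. \<forall>S\<in>Mw \<Lambda>. \<forall>T\<in>Mw \<Lambda>. \<exists>c \<in> ?J \<rightarrow> carrier R.
        X \<otimes>\<^bsub>W\<^esub> Cw \<Lambda> S T = (\<Oplus>\<^bsub>W\<^esub>U\<in>Mw \<Lambda>. r U S \<odot>\<^bsub>W\<^esub> Cw \<Lambda> U T) \<oplus>\<^bsub>W\<^esub>
            finsum W (\<lambda>(\<mu>, U, V). c (\<mu>, U, V) \<odot>\<^bsub>W\<^esub> Cw \<mu> U V) ?J"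
    proof (intro bexI[of _ "\<lambda>U S. q S U"] ballI)
      show "(\<lambda>U S. q S U) \<in> Mw \<Lambda> \<rightarrow> Mw \<Lambda> \<rightarrow> carrier R" using qc by (intro funcsetI) (rule funcset_mem)
      fix S T assume "S \<in> Mw \<Lambda>" "T \<in> Mw \<Lambda>"
      from q[OF this] obtain z where z: "z \<in> Higher \<Lambda>"
        "X \<otimes>\<^bsub>W\<^esub> Cw \<Lambda> S T = (\<Oplus>\<^bsub>W\<^esub>U\<in>Mw \<Lambda>. q S U \<odot>\<^bsub>W\<^esub> Cw \<Lambda> U T) \<oplus>\<^bsub>W\<^esub> z" unfolding eqmod_def by blast
      from z(1) obtain e where e: "e \<in> ?J \<rightarrow> carrier R" "z = (\<Oplus>\<^bsub>W\<^esub>y\<in>?J. e y \<odot>\<^bsub>W\<^esub> bw y)"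
        unfolding Higher_def lincombs_def above_def by blast
      have "(\<lambda>y. e y \<odot>\<^bsub>W\<^esub> bw y) = (\<lambda>(\<mu>, U, V). e (\<mu>, U, V) \<odot>\<^bsub>W\<^esub> Cw \<mu> U V)" by (auto simp: fun_eq_iff)
      then show "\<exists>c \<in> ?J \<rightarrow> carrier R.
        X \<otimes>\<^bsub>W\<^esub> Cw \<Lambda> S T = (\<Oplus>\<^bsub>W\<^esub>U\<in>Mw \<Lambda>. q S U \<odot>\<^bsub>W\<^esub> Cw \<Lambda> U T) \<oplus>\<^bsub>W\<^esub>
            finsum W (\<lambda>(\<mu>, U, V). c (\<mu>, U, V) \<odot>\<^bsub>W\<^esub> Cw \<mu> U V) ?J"
        using z(2) e by (intro bexI[of _ e]) simp_all
    qed
  qed (use \<Theta> in auto)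
  then show ?thesis by (rule cellular_algebraI)
qed

end

theorem corollary6p8:
  fixes R :: "('k, 'r) ring_scheme" and A :: "('k, 'a, 'm) module_scheme" and d :: nat
  assumes "noetherian_domain R"
    and "cellular_algebra R A"
  shows "cellular_algebra R (wreath_algebra R A d)"
proof -
  obtain I :: "nat set" and ord and M :: "nat \<Rightarrow> nat set" and C \<tau> where "cell_datum R A I ord M C \<tau>"
    using assms(2) unfolding cellular_algebra_def by blast
  then interpret wreath_cell R A I ord M C \<tau> d by (rule wreath_cell.intro)
  show ?thesis by (rule wreath_cellular)
qed

end
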